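(* Let $q\ge 1$ be an integer and let $p\in\mathbb{R}$ with $p>2q-1$. For $(r,a),(s,b)\in\Pi_q\times\mathbb{R}$ define a measure $\delta_{(r,a)}*_{p,q}\delta_{(s,b)}$ on $\Pi_q\times\mathbb{R}$ by $$(\delta_{(r,a)}*_{p,q}\delta_{(s,b)})(f)=\kappa_{p,q}\int_{B_q} f\Bigl(\sqrt{r^2+s^2+rws+(rws)^*},\;a+b-\operatorname{Im}\operatorname{tr}(rws)\Bigr)\,\Delta(I_q-w^*w)^{p-2q}\,dw$$ for $f\in C_b(\Pi_q\times\mathbb{R})$. Then this formula establishes, by unique bilinear, weakly continuous extension, an associative convolution $*_{p,q}$ on $M_b(\Pi_q\times\mathbb{R})$. More precisely, $(\Pi_q\times\mathbb{R},*_{p,q})$ is a hypergroup in the sense of Jewett with identity $(0,0)$ and with involution $\overline{(r,a)}:=(r,-a)$. Moreover, $$\omega_{p,q}(f)=\int_{\Pi_q\times\mathbb{R}} f(\sqrt r,a)\,\Delta(r)^{p-q}\,dr\,da\qquad (f\in C_c(\Pi_q\times\mathbb{R}))$$ defines a left and right Haar measure of this hypergroup.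
   Context: $M_{q,q}$ is the space of complex $q\times q$ matrices; $\Pi_q\subset M_{q,q}$ is the closed cone of Hermitian positive semidefinite matrices; $\sqrt{\cdot}$ is the positive semidefinite square root; $\Delta$ is the determinant and $\operatorname{tr}$ the trace of a $q\times q$ matrix; $B_q:=\{w\in M_{q,q}: I_q-w^*w\text{ is positive definite}\}$; $dw$ is Lebesgue measure on $M_{q,q}$; $\kappa_{p,q}:=\bigl(\int_{B_q}\Delta(I_q-w^*w)^{p-2q}dw\bigr)^{-1}>0$; $dr$ is the restriction to $\Pi_q$ of Lebesgue measure on the real vector space of Hermitian $q\times q$ matrices. $M_b(X)$ denotes the bounded regular Borel measures on a locally compact Hausdorff space $X$; $C_b(X)$ and $C_c(X)$ are the bounded continuous functions and the continuous functions with compact support; $\mu(f):=\int f\,d\mu$. The weak topology is the one induced by $C_b(X)$; weak continuity of a convolution on measures is understood, as usual for hypergroups, on positive measures. A hypergroup (in the sense of Jewett) is a locally compact Hausdorff space $X$ with a bilinear, associative, weakly continuous convolution $*$ on $M_b(X)$ such that: (i) $\delta_x*\delta_y$ is a probability measure with compact support for all $x,y\in X$; (ii) $(x,y)\mapsto\operatorname{supp}(\delta_x*\delta_y)$ is continuous into the space of nonempty compact subsets of $X$ with the Michael topology (generated by the sets $\{C: C\cap U\neq\emptyset,\,C\subset V\}$, $U,V$ open); (iii) there is an identity $e\in X$ with $\delta_e*\delta_x=\delta_x*\delta_e=\delta_x$ for all $x$; (iv) there is an involutive homeomorphism $x\mapsto\bar x$ (the involution) such that the image of $\delta_x*\delta_y$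 under it is $\delta_{\bar y}*\delta_{\bar x}$, and $e\in\operatorname{supp}(\delta_x*\delta_y)$ iff $y=\bar x$. A left (right) Haar measure is a nonzero positive Radon measure $\omega$ on $X$ with $\int_X(\delta_x*\delta_y)(f)\,d\omega(y)=\int_X f\,d\omega$ (respectively $\int_X(\delta_y*\delta_x)(f)\,d\omega(y)=\int_X f\,d\omega$) for all $x\in X$, $f\in C_c(X)$. *)

theory Defs
  imports "HOL-Analysis.Analysis"
begin

section \<open>Bounded regular Borel measures on a topological space\<close>

definition borel_of :: "'a topology \<Rightarrow> 'a measure" where
  "borel_of X = sigma (topspace X) {U. openin X U}"

text \<open>A complex measure is a countably additive complex-valued function on the Borel sets. It takes
  finite values only, hence is bounded. Being a total function on \<^typ>\<open>'a set\<close>, it is normalised to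
  be zero on non-Borel sets, so that equality of functions is equality of measures.\<close>

definition complex_measure :: "'a topology \<Rightarrow> ('a set \<Rightarrow> complex) \<Rightarrow> bool" where
  "complex_measure X \<mu> \<longleftrightarrow>
     (\<forall>A. A \<notin> sets (borel_of X) \<longrightarrow> \<mu> A = 0) \<and>
     (\<forall>F :: nat \<Rightarrow> 'a set. range F \<subseteq> sets (borel_of X) \<and> disjoint_family F \<longrightarrow>
        (\<lambda>n. \<mu> (F n)) sums \<mu> (\<Union>n. F n))"

definition total_variation :: "'a topology \<Rightarrow> ('a set \<Rightarrow> complex) \<Rightarrow> 'a set \<Rightarrow> ennreal" where
  "total_variation X \<mu> A =
     (SUP F \<in> {F :: nat \<Rightarrow> 'a set. range F \<subseteq> sets (borel_of X) \<and> disjoint_family F \<and> (\<Union>n. F n) = A}.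
        \<Sum>n. ennreal (norm (\<mu> (F n))))"

definition regular_measure :: "'a topology \<Rightarrow> ('a set \<Rightarrow> complex) \<Rightarrow> bool" where
  "regular_measure X \<mu> \<longleftrightarrow> (\<forall>A \<in> sets (borel_of X).
     total_variation X \<mu> A = (INF U \<in> {U. openin X U \<and> A \<subseteq> U}. total_variation X \<mu> U) \<and>
     total_variation X \<mu> A = (SUP K \<in> {K. compactin X K \<and> K \<subseteq> A}. total_variation X \<mu> K))"

definition Mb :: "'a topology \<Rightarrow> ('a set \<Rightarrow> complex) set" where
  "Mb X = {\<mu>. complex_measure X \<mu> \<and> regular_measure X \<mu>}"

definition Mb_pos :: "'a topology \<Rightarrow> ('a set \<Rightarrow> complex) set" where
  "Mb_pos X = {\<mu> \<in> Mb X. \<forall>A. Im (\<mu> A) = 0 \<and> 0 \<le> Re (\<mu> A)}"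

definition dirac :: "'a topology \<Rightarrow> 'a \<Rightarrow> 'a set \<Rightarrow> complex" where
  "dirac X x = (\<lambda>A. if A \<in> sets (borel_of X) \<and> x \<in> A then 1 else 0)"

definition image_measure :: "'a topology \<Rightarrow> ('a \<Rightarrow> 'a) \<Rightarrow> ('a set \<Rightarrow> complex) \<Rightarrow> 'a set \<Rightarrow> complex" where
  "image_measure X h \<mu> = (\<lambda>A. if A \<in> sets (borel_of X) then \<mu> (h -` A \<inter> topspace X) else 0)"

definition supp :: "'a topology \<Rightarrow> ('a set \<Rightarrow> complex) \<Rightarrow> 'a set" where
  "supp X \<mu> = {x \<in> topspace X. \<forall>U. openin X U \<and> x \<in> U \<longrightarrow> total_variation X \<mu> U > 0}"

text \<open>The positive part of the Jordan decomposition of a finite signed measure. The function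
  \<^const>\<open>ennreal\<close> truncates negative values to \<open>0\<close>, the value at the empty set \<open>B\<close>.\<close>

definition pos_part :: "'a topology \<Rightarrow> ('a set \<Rightarrow> real) \<Rightarrow> 'a measure" where
  "pos_part X \<nu> = measure_of (topspace X) (sets (borel_of X))
     (\<lambda>A. SUP B \<in> {B \<in> sets (borel_of X). B \<subseteq> A}. ennreal (\<nu> B))"

definition integ :: "'a topology \<Rightarrow> ('a set \<Rightarrow> complex) \<Rightarrow> ('a \<Rightarrow> complex) \<Rightarrow> complex" where
  "integ X \<mu> f =
     (\<integral>x. f x \<partial>pos_part X (\<lambda>A. Re (\<mu> A))) - (\<integral>x. f x \<partial>pos_part X (\<lambda>A. - Re (\<mu> A)))
     + \<i> * ((\<integral>x. f x \<partial>pos_part X (\<lambda>A. Im (\<mu> A))) - (\<integral>x. f x \<partial>pos_part X (\<lambda>A. - Im (\<mu> A))))"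

definition Cb :: "'a topology \<Rightarrow> ('a \<Rightarrow> complex) set" where
  "Cb X = {f. continuous_map X euclidean f \<and> bounded (f ` topspace X)}"

definition Cc :: "'a topology \<Rightarrow> ('a \<Rightarrow> complex) set" where
  "Cc X = {f. continuous_map X euclidean f \<and> compactin X (X closure_of {x \<in> topspace X. f x \<noteq> 0})}"

definition weak_topology :: "'a topology \<Rightarrow> ('a set \<Rightarrow> complex) topology" where
  "weak_topology X =
     topology_generated_by {{\<mu> \<in> Mb X. integ X \<mu> f \<in> W} | f W. f \<in> Cb X \<and> open W}"

section \<open>Hypergroups and Haar measures\<close>

definition bilinear_convolution ::
    "'a topology \<Rightarrow> (('a set \<Rightarrow> complex) \<Rightarrow> ('a set \<Rightarrow> complex) \<Rightarrow> 'a set \<Rightarrow> complex) \<Rightarrow> bool" where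
  "bilinear_convolution X cv \<longleftrightarrow>
     (\<forall>\<mu> \<in> Mb X. \<forall>\<nu> \<in> Mb X. cv \<mu> \<nu> \<in> Mb X) \<and>
     (\<forall>\<mu> \<in> Mb X. \<forall>\<mu>' \<in> Mb X. \<forall>\<nu> \<in> Mb X. \<forall>c d.
        cv (\<lambda>A. c * \<mu> A + d * \<mu>' A) \<nu> = (\<lambda>A. c * cv \<mu> \<nu> A + d * cv \<mu>' \<nu> A) \<and>
        cv \<nu> (\<lambda>A. c * \<mu> A + d * \<mu>' A) = (\<lambda>A. c * cv \<nu> \<mu> A + d * cv \<nu> \<mu>' A))"

definition weakly_continuous ::
    "'a topology \<Rightarrow> (('a set \<Rightarrow> complex) \<Rightarrow> ('a set \<Rightarrow> complex) \<Rightarrow> 'a set \<Rightarrow> complex) \<Rightarrow> bool" where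
  "weakly_continuous X cv \<longleftrightarrow>
     continuous_map
       (prod_topology (subtopology (weak_topology X) (Mb_pos X)) (subtopology (weak_topology X) (Mb_pos X)))
       (weak_topology X) (\<lambda>(\<mu>, \<nu>). cv \<mu> \<nu>)"

definition michael_topology :: "'a topology \<Rightarrow> 'a set topology" where
  "michael_topology X = topology_generated_by
     {{C. compactin X C \<and> C \<noteq> {} \<and> C \<inter> U \<noteq> {} \<and> C \<subseteq> V} | U V. openin X U \<and> openin X V}"

locale hypergroup =
  fixes X :: "'a topology"
    and cv :: "('a set \<Rightarrow> complex) \<Rightarrow> ('a set \<Rightarrow> complex) \<Rightarrow> 'a set \<Rightarrow> complex"
    and e :: 'a
    and bar :: "'a \<Rightarrow> 'a"
  assumes locally_compact: "locally_compact_space X"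
    and Hausdorff: "Hausdorff_space X"
    and bilinear: "bilinear_convolution X cv"
    and associative: "\<And>\<mu> \<nu> \<rho>. \<lbrakk>\<mu> \<in> Mb X; \<nu> \<in> Mb X; \<rho> \<in> Mb X\<rbrakk> \<Longrightarrow> cv (cv \<mu> \<nu>) \<rho> = cv \<mu> (cv \<nu> \<rho>)"
    and weakly_continuous: "weakly_continuous X cv"
    and probability: "\<And>x y. \<lbrakk>x \<in> topspace X; y \<in> topspace X\<rbrakk> \<Longrightarrow>
          cv (dirac X x) (dirac X y) \<in> Mb_pos X \<and> cv (dirac X x) (dirac X y) (topspace X) = 1"
    and compact_supp: "\<And>x y. \<lbrakk>x \<in> topspace X; y \<in> topspace X\<rbrakk> \<Longrightarrow>
          compactin X (supp X (cv (dirac X x) (dirac X y)))"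
    and continuous_supp: "continuous_map (prod_topology X X) (michael_topology X)
          (\<lambda>(x, y). supp X (cv (dirac X x) (dirac X y)))"
    and identity_closed: "e \<in> topspace X"
    and identity: "\<And>x. x \<in> topspace X \<Longrightarrow>
          cv (dirac X e) (dirac X x) = dirac X x \<and> cv (dirac X x) (dirac X e) = dirac X x"
    and involution: "homeomorphic_maps X X bar bar"
    and involution_conv: "\<And>x y. \<lbrakk>x \<in> topspace X; y \<in> topspace X\<rbrakk> \<Longrightarrow>
          image_measure X bar (cv (dirac X x) (dirac X y)) = cv (dirac X (bar y)) (dirac X (bar x))"
    and identity_in_supp: "\<And>x y. \<lbrakk>x \<in> topspace X; y \<in> topspace X\<rbrakk> \<Longrightarrow>
          e \<in> supp X (cv (dirac X x) (dirac X y)) \<longleftrightarrow> y = bar x"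

definition radon_measure :: "'a topology \<Rightarrow> 'a measure \<Rightarrow> bool" where
  "radon_measure X \<omega> \<longleftrightarrow>
     sets \<omega> = sets (borel_of X) \<and>
     (\<forall>K. compactin X K \<longrightarrow> emeasure \<omega> K < \<infinity>) \<and>
     (\<forall>A \<in> sets \<omega>. emeasure \<omega> A = (INF U \<in> {U. openin X U \<and> A \<subseteq> U}. emeasure \<omega> U)) \<and>
     (\<forall>U. openin X U \<longrightarrow> emeasure \<omega> U = (SUP K \<in> {K. compactin X K \<and> K \<subseteq> U}. emeasure \<omega> K))"

text \<open>In the next two definitions \<^const>\<open>has_bochner_integral\<close> demands that the left-hand integrand
  is integrable, since the Bochner integral of a non-integrable function is \<open>0\<close> by convention.\<close>

definition left_haar_measure ::
    "'a topology \<Rightarrow> (('a set \<Rightarrow> complex) \<Rightarrow> ('a set \<Rightarrow> complex) \<Rightarrow> 'a set \<Rightarrow> complex) \<Rightarrow> 'a measure \<Rightarrow> bool" where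
  "left_haar_measure X cv \<omega> \<longleftrightarrow> radon_measure X \<omega> \<and> emeasure \<omega> (topspace X) \<noteq> 0 \<and>
     (\<forall>x \<in> topspace X. \<forall>f \<in> Cc X.
        has_bochner_integral \<omega> (\<lambda>y. integ X (cv (dirac X x) (dirac X y)) f) (\<integral>y. f y \<partial>\<omega>))"

definition right_haar_measure ::
    "'a topology \<Rightarrow> (('a set \<Rightarrow> complex) \<Rightarrow> ('a set \<Rightarrow> complex) \<Rightarrow> 'a set \<Rightarrow> complex) \<Rightarrow> 'a measure \<Rightarrow> bool" where
  "right_haar_measure X cv \<omega> \<longleftrightarrow> radon_measure X \<omega> \<and> emeasure \<omega> (topspace X) \<noteq> 0 \<and>
     (\<forall>x \<in> topspace X. \<forall>f \<in> Cc X.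
        has_bochner_integral \<omega> (\<lambda>y. integ X (cv (dirac X y) (dirac X x)) f) (\<integral>y. f y \<partial>\<omega>))"

section \<open>Matrix cones\<close>

definition ctranspose :: "complex ^ 'n ^ 'm \<Rightarrow> complex ^ 'm ^ 'n" where
  "ctranspose A = (\<chi> i j. cnj (A $ j $ i))"

text \<open>On \<^typ>\<open>complex ^ 'n\<close> the inner product \<open>x \<bullet> y\<close> is the real part of the Hermitian form
  \<open>\<Sum>i. cnj (x $ i) * y $ i\<close>, and this form is real at \<open>(x, A *v x)\<close> if \<open>A\<close> is Hermitian.\<close>

definition psd :: "(complex ^ 'n ^ 'n) set" where
  "psd = {A. ctranspose A = A \<and> (\<forall>x. 0 \<le> x \<bullet> (A *v x))}"

definition pos_def :: "(complex ^ 'n ^ 'n) set" where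
  "pos_def = {A. ctranspose A = A \<and> (\<forall>x. x \<noteq> 0 \<longrightarrow> 0 < x \<bullet> (A *v x))}"

definition psd_sqrt :: "complex ^ 'n ^ 'n \<Rightarrow> complex ^ 'n ^ 'n" where
  "psd_sqrt A = (THE B. B \<in> psd \<and> B ** B = A)"

definition matrix_ball :: "(complex ^ 'n ^ 'n) set" where
  "matrix_ball = {w. mat 1 - ctranspose w ** w \<in> pos_def}"

definition ball_weight :: "real \<Rightarrow> complex ^ 'n ^ 'n \<Rightarrow> real" where
  "ball_weight p w = Re (det (mat 1 - ctranspose w ** w)) powr (p - 2 * real CARD('n))"

definition kappa :: "real \<Rightarrow> 'n::finite itself \<Rightarrow> real" where
  "kappa p _ = inverse (LINT w : (matrix_ball :: (complex ^ 'n ^ 'n) set) | lborel. ball_weight p w)"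

text \<open>The map \<open>hermitian_of\<close> is a linear isometry of \<^typ>\<open>real ^ 'n ^ 'n\<close> onto the real vector
  space of Hermitian matrices, with respect to the inner products \<open>tr (A\<^sup>T B)\<close> and \<open>tr (A B)\<close>;
  it transports Lebesgue measure to Lebesgue measure of this Euclidean space.\<close>

definition hermitian_of :: "real ^ 'n ^ 'n \<Rightarrow> complex ^ 'n ^ 'n" where
  "hermitian_of A = (\<chi> i j. Complex ((A $ i $ j + A $ j $ i) / 2) ((A $ i $ j - A $ j $ i) / 2))"

definition hermitian_lebesgue :: "(complex ^ 'n ^ 'n) measure" where
  "hermitian_lebesgue = distr lborel borel hermitian_of"

section \<open>The space \<open>\<Pi>\<^sub>q \<times> \<real>\<close>\<close>

definition cone_space :: "((complex ^ 'n ^ 'n) \<times> real) topology" where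
  "cone_space = top_of_set (psd \<times> UNIV)"

definition point_arg ::
    "(complex ^ 'n ^ 'n) \<times> real \<Rightarrow> (complex ^ 'n ^ 'n) \<times> real \<Rightarrow> complex ^ 'n ^ 'n \<Rightarrow> (complex ^ 'n ^ 'n) \<times> real" where
  "point_arg x y w = (case (x, y) of ((r, a), (s, b)) \<Rightarrow>
     (psd_sqrt (r ** r + s ** s + r ** w ** s + ctranspose (r ** w ** s)),
      a + b - Im (trace (r ** w ** s))))"

definition extends_point_convolution ::
    "real \<Rightarrow> ((((complex ^ 'n ^ 'n) \<times> real) set \<Rightarrow> complex) \<Rightarrow> (((complex ^ 'n ^ 'n) \<times> real) set \<Rightarrow> complex)
       \<Rightarrow> ((complex ^ 'n ^ 'n) \<times> real) set \<Rightarrow> complex) \<Rightarrow> bool" where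
  "extends_point_convolution p cv \<longleftrightarrow>
     (\<forall>x \<in> topspace cone_space. \<forall>y \<in> topspace cone_space. \<forall>f \<in> Cb cone_space.
        integ cone_space (cv (dirac cone_space x) (dirac cone_space y)) f =
        kappa p TYPE('n) *\<^sub>R
          (LINT w : matrix_ball | lborel. ball_weight p w *\<^sub>R f (point_arg x y w)))"

end

theory Submission
 imports Defs "HOL-Computational_Algebra.Polynomial"
begin

text \<open>
 Let \<open>q\<close> be the size of the matrices and \<open>e = p - 2 q\<close>, so that \<open>e > -1\<close>.

 The point convolutions are the images of one probability measure on the compact set
 of contractions, with density proportional to \<open>det (1 - w\<^sup>* w) ^ e\<close>, under the continuous maps
 \<open>point_arg x y\<close>. For such a kernel on a closed subset of Euclidean space, the convolution of two
 finite measures is the image of their product with the parameter measure, and the Jordan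
 decomposition extends it to complex measures. The density is positive inside the matrix ball, so the
 support of a product of points is the image of all contractions. Compactness of the parameter space
 then gives compact supports that depend continuously on the points (\<open>continuous_range\<close>). Weak
 continuity holds because the integrated kernel is, up to a small error, a finite sum of products
 (\<open>product_approximation\<close>). It forces uniqueness, since discrete measures are weakly dense
 (\<open>discrete_dense\<close>).

 Both ways to multiply three points \<open>(r, a)\<close>, \<open>(s, b)\<close>, \<open>(t, c)\<close> give the image, under
 one and the same map, of the law of a random matrix: of \<open>r w s + \<surd>(r\<^sup>2 + s\<^sup>2 + r w s + (r w s)\<^sup>* ) v t\<close> in
 one case, of \<open>r v \<surd>(s\<^sup>2 + t\<^sup>2 + s w t + (s w t)\<^sup>* ) + s w t\<close> in the other. That these laws agree is
 \<open>nn_integral_associativity_all\<close>. For large exponents the ball density is a marginal of a density on pairs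
 of matrices that is invariant under unitary block matrices. Completing a block row to a unitary matrix
 replaces the square roots by sums with an independent third matrix (\<open>nn_integral_root_mixture\<close>),
 after which both laws are given by the same integral over three matrices. For fixed test functions,
 the exponent enters only as the power of one bounded variable, whose law is determined by its moments;
 hence large exponents imply all exponents.

 With \<open>s = y\<^sup>* y + t\<close>, the weight on the ball and the weight \<open>det s ^ (e + q)\<close> on the
 cone turn into Lebesgue measure in \<open>y\<close> times \<open>det t ^ e\<close> in \<open>t\<close> (\<open>nn_integral_polar_shift\<close>), and the
 product with \<open>r\<close> into the translation of \<open>y\<close> by \<open>r\<close>. The central coordinate only contributes a
 translation of the real line, and \<open>w\<close> and \<open>w\<^sup>*\<close> have the same law, which exchanges left and right. The
 Jacobian in this substitution is computed in \<open>nn_integral_mult_pos_def\<close>, and integrability of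
 \<open>det (1 - w\<^sup>* w) ^ e\<close> for every \<open>e > -1\<close> in \<open>ball_mass_finite\<close>.
\<close>

section \<open>Hermitian matrices and the cone of positive semidefinite matrices\<close>

lemma ctranspose_nth [simp]: "ctranspose A $ i $ j = cnj (A $ j $ i)"
 by (simp add: ctranspose_def)

lemma ctranspose_add: "ctranspose (A + B) = ctranspose A + ctranspose B"
 by (simp add: ctranspose_def vec_eq_iff)

lemma ctranspose_diff: "ctranspose (A - B) = ctranspose A - ctranspose B"
 by (simp add: ctranspose_def vec_eq_iff)

lemma ctranspose_uminus: "ctranspose (- A) = - ctranspose A"
 by (simp add: ctranspose_def vec_eq_iff)

lemma ctranspose_scaleR: "ctranspose (c *\<^sub>R A) = c *\<^sub>R ctranspose A"
 by (simp add: ctranspose_def vec_eq_iff)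

lemma ctranspose_zero [simp]: "ctranspose 0 = 0"
 by (simp add: ctranspose_def vec_eq_iff)

lemma ctranspose_mat_1 [simp]: "ctranspose (mat 1) = mat 1"
 by (simp add: ctranspose_def vec_eq_iff mat_def)

lemma ctranspose_ctranspose [simp]: "ctranspose (ctranspose A) = A"
 by (simp add: ctranspose_def vec_eq_iff)

lemma ctranspose_mult: "ctranspose (A ** B) = ctranspose B ** ctranspose A"
 by (simp add: ctranspose_def vec_eq_iff matrix_matrix_mult_def mult.commute)

lemma norm_ctranspose [simp]: "norm (ctranspose A) = norm A"
proof -
 have "(norm (ctranspose A))\<^sup>2 = (norm A)\<^sup>2"
  unfolding norm_vec_def L2_set_def
  by (simp add: real_sqrt_pow2 sum_nonneg) (rule sum.swap)
 then show ?thesis by (simp add: power2_eq_iff_nonneg)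
qed

lemma linear_ctranspose: "linear (ctranspose :: complex^'n^'m => complex^'m^'n)"
 by (rule linearI) (simp_all add: ctranspose_add ctranspose_scaleR)

lemma continuous_on_ctranspose [continuous_intros]:
 fixes f :: "'a::topological_space => complex^'n^'m"
 shows "continuous_on S f ==> continuous_on S (%x. ctranspose (f x))"
 by (rule bounded_linear.continuous_on[OF linear_ctranspose[THEN linear_conv_bounded_linear[THEN iffD1]]])

lemma inner_complex_vec: "(x :: complex^'n) \<bullet> y = Re (\<Sum>i\<in>UNIV. cnj (x $ i) * y $ i)"
 by (simp add: inner_vec_def inner_complex_def)

lemma inner_matrix_vector: "(x :: complex^'n) \<bullet> (A *v y) = (ctranspose A *v x) \<bullet> y"
proof -
 have "(\<Sum>i\<in>UNIV. cnj (x $ i) * (A *v y) $ i) = (\<Sum>i\<in>UNIV. \<Sum>j\<in>UNIV. cnj (x $ i) * (A $ i $ j * y $ j))"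
  by (simp add: matrix_vector_mult_def sum_distrib_left)
 also have "\<dots> = (\<Sum>j\<in>UNIV. \<Sum>i\<in>UNIV. cnj (x $ i) * (A $ i $ j * y $ j))"
  by (rule sum.swap)
 also have "\<dots> = (\<Sum>j\<in>UNIV. cnj ((ctranspose A *v x) $ j) * y $ j)"
  by (simp add: matrix_vector_mult_def sum_distrib_right sum_distrib_left mult_ac)
 finally show ?thesis by (simp only: inner_complex_vec)
qed

lemma norm_matrix_vector_le: "norm ((A :: complex^'n^'m) *v x) <= norm A * norm x"
proof -
 have c: "norm ((A *v x) $ i) <= norm (A $ i) * norm x" for i
 proof -
  have "norm ((A *v x) $ i) <= (\<Sum>j\<in>UNIV. \<bar>norm (A $ i $ j)\<bar> * \<bar>norm (x $ j)\<bar>)"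
   unfolding matrix_vector_mult_def by (simp add: sum_norm_le norm_mult)
  also have "\<dots> <= norm (A $ i) * norm x"
   unfolding norm_vec_def by (rule L2_set_mult_ineq)
  finally show ?thesis .
 qed
 have "norm (A *v x) <= L2_set (%i. norm (A $ i) * norm x) UNIV"
  unfolding norm_vec_def[of "A *v x"] by (rule L2_set_mono) (use c in auto)
 also have "\<dots> = norm A * norm x"
  by (simp add: norm_vec_def[of A] L2_set_left_distrib)
 finally show ?thesis .
qed

lemma column_mult: "(A ** B) *v x = A *v (B *v x)"
 by (simp add: matrix_vector_mul_assoc)

lemma matrix_vector_axis [simp]: "((A :: complex^'n^'m) *v axis j 1) $ i = A $ i $ j"
 by (simp add: matrix_vector_mult_def axis_def if_distrib cong: if_cong)

lemma norm_matrix_columns: "(norm (A :: complex^'n^'m))\<^sup>2 = (\<Sum>j\<in>UNIV. (norm (A *v axis j 1))\<^sup>2)"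
proof -
 have "(norm A)\<^sup>2 = (norm (ctranspose A))\<^sup>2" by simp
 also have "\<dots> = (\<Sum>j\<in>UNIV. (norm (ctranspose A $ j))\<^sup>2)"
  unfolding norm_vec_def[of "ctranspose A"] L2_set_def by (simp add: sum_nonneg)
 also have "\<dots> = (\<Sum>j\<in>UNIV. (norm (A *v axis j 1))\<^sup>2)"
  by (simp add: norm_vec_def L2_set_def)
 finally show ?thesis .
qed

lemma norm_matrix_mult_le: "norm ((A :: complex^'n^'m) ** (B :: complex^'k^'n)) <= norm A * norm B"
proof -
 have "(norm (A ** B))\<^sup>2 = (\<Sum>j\<in>UNIV. (norm (A *v (B *v axis j 1)))\<^sup>2)"
  by (simp add: norm_matrix_columns matrix_vector_mul_assoc)
 also have "\<dots> <= (\<Sum>j\<in>UNIV. (norm A * norm (B *v axis j 1))\<^sup>2)"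
  by (intro sum_mono power_mono norm_matrix_vector_le) auto
 also have "\<dots> = (norm A * norm B)\<^sup>2"
  by (simp add: power_mult_distrib norm_matrix_columns sum_distrib_left)
 finally show ?thesis by (rule power2_le_imp_le) simp
qed

lemma bounded_bilinear_matrix_mult:
 "bounded_bilinear ((**) :: complex^'n^'m => complex^'k^'n => complex^'k^'m)"
proof
 show "\<exists>K. \<forall>a b. norm ((a :: complex^'n^'m) ** (b :: complex^'k^'n)) <= norm a * norm b * K"
  by (rule exI[of _ 1]) (simp add: norm_matrix_mult_le)
qed (simp_all add: vec_eq_iff matrix_matrix_mult_def sum.distrib algebra_simps scaleR_right.sum sum_distrib_left)

lemmas matrix_mult_simps =
 bounded_bilinear.add_left[OF bounded_bilinear_matrix_mult]
 bounded_bilinear.add_right[OF bounded_bilinear_matrix_mult]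
 bounded_bilinear.diff_left[OF bounded_bilinear_matrix_mult]
 bounded_bilinear.diff_right[OF bounded_bilinear_matrix_mult]
 bounded_bilinear.minus_left[OF bounded_bilinear_matrix_mult]
 bounded_bilinear.minus_right[OF bounded_bilinear_matrix_mult]
 bounded_bilinear.zero_left[OF bounded_bilinear_matrix_mult]
 bounded_bilinear.zero_right[OF bounded_bilinear_matrix_mult]
 bounded_bilinear.scaleR_left[OF bounded_bilinear_matrix_mult]
 bounded_bilinear.scaleR_right[OF bounded_bilinear_matrix_mult]

lemmas ctranspose_simps = ctranspose_add ctranspose_diff ctranspose_uminus ctranspose_scaleR ctranspose_mult

lemmas continuous_on_matrix_mult [continuous_intros] =
 bounded_bilinear.continuous_on[OF bounded_bilinear_matrix_mult]

lemmas tendsto_matrix_mult [tendsto_intros] =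
 bounded_bilinear.tendsto[OF bounded_bilinear_matrix_mult]

lemma continuous_on_trace [continuous_intros]:
 fixes f :: "'a::topological_space => complex^'n^'n"
 shows "continuous_on S f ==> continuous_on S (%x. trace (f x))"
 unfolding trace_def by (intro continuous_intros)

lemma continuous_on_det [continuous_intros]:
 fixes f :: "'a::topological_space => complex^'n^'n"
 shows "continuous_on S f ==> continuous_on S (%x. det (f x))"
 unfolding det_def by (intro continuous_intros)

lemma continuous_on_matrix_vector [continuous_intros]:
 fixes f :: "'a::topological_space => complex^'n^'m"
 shows "continuous_on S f ==> continuous_on S (%x. f x *v v)"
 unfolding matrix_vector_mult_def by (intro continuous_intros)

lemma det_ctranspose: "det (ctranspose A) = cnj (det (A :: complex^'n^'n))"
proof -
 have "det (ctranspose A) = det (transpose (ctranspose A))" by simp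
 also have "\<dots> = cnj (det A)"
  unfolding det_def cnj_sum complex_cnj_mult complex_cnj_of_int cnj_prod
  by (simp only: transpose_def vec_lambda_beta ctranspose_nth)
 finally show ?thesis .
qed

lemma trace_ctranspose: "trace (ctranspose A) = cnj (trace (A :: complex^'n^'n))"
 by (simp add: trace_def)

lemma trace_mult_commute: "trace (A ** B) = trace (B ** (A :: complex^'n^'n))"
 by (rule trace_mul_sym)

lemma Re_trace: "Re (trace (A :: complex^'n^'n)) = (\<Sum>i\<in>UNIV. axis i 1 \<bullet> (A *v axis i 1))"
 by (simp add: trace_def inner_axis' inner_complex_def)

lemma Re_trace_gram: "Re (trace (ctranspose A ** A)) = (norm (A :: complex^'n^'n))\<^sup>2"
 by (simp add: Re_trace norm_matrix_columns column_mult inner_matrix_vector dot_square_norm)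

definition hermitian :: "(complex^'n^'n) set" where
 "hermitian = {A. ctranspose A = A}"

lemma subspace_hermitian: "subspace hermitian"
 by (auto simp: hermitian_def subspace_def ctranspose_simps)

lemma closed_hermitian: "closed hermitian"
 unfolding hermitian_def by (intro closed_Collect_eq continuous_intros)

lemma psdI: "ctranspose A = A ==> (!!x. 0 <= x \<bullet> (A *v x)) ==> A \<in> psd"
 by (simp add: psd_def)

lemma psd_hermitian: "A \<in> psd ==> ctranspose A = A"
 and psd_nonneg: "A \<in> psd ==> 0 <= x \<bullet> (A *v x)"
 and pos_def_hermitian: "A \<in> pos_def ==> ctranspose A = A"
 and pos_def_pos: "A \<in> pos_def ==> x ~= 0 ==> 0 < x \<bullet> (A *v x)"
 by (auto simp: psd_def pos_def_def)

lemma pos_def_psd: "A \<in> pos_def ==> A \<in> psd"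
proof (rule psdI)
 assume A: "A \<in> pos_def"
 show "ctranspose A = A" using A by (rule pos_def_hermitian)
 show "0 <= x \<bullet> (A *v x)" for x
  by (cases "x = 0") (use pos_def_pos[OF A, of x] in \<open>auto intro: less_imp_le\<close>)
qed

lemma closed_psd: "closed (psd :: (complex^'n^'n) set)"
proof -
 have eq: "psd = hermitian \<inter> (\<Inter>x. {A :: complex^'n^'n. 0 <= x \<bullet> (A *v x)})"
  by (auto simp: psd_def hermitian_def)
 have "closed {A :: complex^'n^'n. 0 <= x \<bullet> (A *v x)}" for x
  by (intro closed_Collect_le continuous_on_const continuous_on_inner continuous_on_matrix_vector continuous_on_id)
 then have "closed (\<Inter>x. {A :: complex^'n^'n. 0 <= x \<bullet> (A *v x)})"
  by (intro closed_INT ballI)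
 with closed_hermitian show ?thesis unfolding eq by (rule closed_Int)
qed

lemma zero_psd: "0 \<in> psd"
 by (simp add: psd_def)

lemma psd_add: "A \<in> psd ==> B \<in> psd ==> A + B \<in> psd"
 by (simp add: psd_def ctranspose_add matrix_vector_mult_add_rdistrib inner_add_right)

lemma pos_def_add_psd: "A \<in> pos_def ==> B \<in> psd ==> A + B \<in> pos_def"
 by (simp add: psd_def pos_def_def ctranspose_add matrix_vector_mult_add_rdistrib inner_add_right add_pos_nonneg)

lemma matrix_vector_scaleR: "A *v (c *\<^sub>R x) = c *\<^sub>R ((A :: complex^'n^'m) *v x)"
 by (simp add: vec_eq_iff matrix_vector_mult_def scaleR_right.sum)

lemma scaleR_matrix_vector: "(c *\<^sub>R A) *v x = c *\<^sub>R ((A :: complex^'n^'m) *v x)"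
 by (simp add: vec_eq_iff matrix_vector_mult_def scaleR_right.sum)

lemma psd_scaleR: "0 <= c ==> A \<in> psd ==> c *\<^sub>R A \<in> psd"
 by (simp add: psd_def ctranspose_scaleR scaleR_matrix_vector)

lemma pos_def_scaleR: "0 < c ==> A \<in> pos_def ==> c *\<^sub>R A \<in> pos_def"
 by (simp add: pos_def_def ctranspose_scaleR scaleR_matrix_vector)

lemma mat_1_pos_def: "mat 1 \<in> pos_def"
 by (simp add: pos_def_def)

lemma inner_congruence:
 "x \<bullet> ((ctranspose C ** A ** C) *v x) = (C *v x) \<bullet> (A *v (C *v (x :: complex^'n)))"
 by (simp add: inner_matrix_vector[of x "ctranspose C"] flip: matrix_vector_mul_assoc)

lemma psd_congruence:
 assumes A: "A \<in> psd" shows "ctranspose C ** A ** C \<in> psd"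
proof (rule psdI)
 show "ctranspose (ctranspose C ** A ** C) = ctranspose C ** A ** C"
  by (simp add: ctranspose_mult psd_hermitian[OF A] matrix_mul_assoc)
 show "0 <= x \<bullet> ((ctranspose C ** A ** C) *v x)" for x
  unfolding inner_congruence by (rule psd_nonneg[OF A])
qed

lemma psd_gram: "ctranspose C ** C \<in> psd"
 using psd_congruence[OF pos_def_psd[OF mat_1_pos_def], of C] by simp

lemma psd_gram': "C ** ctranspose C \<in> psd"
 using psd_gram[of "ctranspose C"] by simp

lemma invertible_iff_ker: "invertible (A :: complex^'n^'n) \<longleftrightarrow> (\<forall>x. A *v x = 0 --> x = 0)"
 by (simp add: invertible_left_inverse matrix_left_invertible_ker)

lemma pos_def_congruence:
 assumes "A \<in> pos_def" "invertible (C :: complex^'n^'n)" shows "ctranspose C ** A ** C \<in> pos_def"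
proof -
 have "ctranspose C ** A ** C \<in> psd" using assms(1) by (intro psd_congruence pos_def_psd)
 moreover have "0 < x \<bullet> ((ctranspose C ** A ** C) *v x)" if "x ~= 0" for x
  unfolding inner_congruence using assms that by (intro pos_def_pos) (auto simp: invertible_iff_ker)
 ultimately show ?thesis by (auto simp: pos_def_def psd_hermitian)
qed

lemma pos_def_invertible: "A \<in> pos_def ==> invertible A"
 unfolding invertible_iff_ker using pos_def_pos by fastforce

text \<open>Cauchy--Schwarz for the semidefinite form of \<open>A\<close>, in its degenerate case.\<close>
lemma psd_null_vector:
 assumes A: "A \<in> psd" and 0: "x \<bullet> (A *v x) = 0" shows "A *v x = 0"
proof -
 define z where "z = A *v x"
 define k where "k = z \<bullet> (A *v z)"
 have k: "0 <= k" unfolding k_def by (rule psd_nonneg[OF A])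
 have xz: "x \<bullet> (A *v z) = z \<bullet> z"
  unfolding z_def by (subst inner_matrix_vector) (simp add: psd_hermitian[OF A])
 have q: "0 <= - 2 * \<tau> * (z \<bullet> z) + \<tau>\<^sup>2 * k" for \<tau>
 proof -
  have "0 <= (x - \<tau> *\<^sub>R z) \<bullet> (A *v (x - \<tau> *\<^sub>R z))" by (rule psd_nonneg[OF A])
  also have "\<dots> = - 2 * \<tau> * (z \<bullet> z) + \<tau>\<^sup>2 * k"
   using 0 xz by (simp add: matrix_vector_mult_diff_distrib matrix_vector_scaleR inner_diff_left
     inner_diff_right z_def[symmetric] k_def power2_eq_square algebra_simps)
  finally show ?thesis .
 qed
 have "z \<bullet> z <= 0"
 proof (rule ccontr)
  assume "\<not> z \<bullet> z <= 0" then have p: "z \<bullet> z > 0" by linarith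
  define \<tau> where "\<tau> = (z \<bullet> z) / (k + 1)"
  have t: "\<tau> > 0" using p k by (simp add: \<tau>_def)
  have "\<tau> * k <= z \<bullet> z" using p k by (simp add: \<tau>_def field_simps)
  then have "\<tau>\<^sup>2 * k <= \<tau> * (z \<bullet> z)"
   using t by (simp add: power2_eq_square mult.assoc mult_left_mono)
  with q[of \<tau>] show False using mult_pos_pos[OF t p] by linarith
 qed
 then show ?thesis unfolding z_def[symmetric] using inner_ge_zero[of z] by auto
qed

lemma psd_invertible_pos_def: "A \<in> psd ==> invertible A ==> A \<in> pos_def"
 using psd_null_vector[of A] psd_nonneg[of A]
 by (force simp: pos_def_def psd_hermitian invertible_iff_ker less_le)

lemma matrix_eq_zero_iff: "(A :: complex^'n^'n) = 0 \<longleftrightarrow> (\<forall>i. A *v axis i 1 = 0)"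
 using norm_matrix_columns[of A] by auto

text \<open>With \<open>D = B - C\<close> and \<open>S = B + C\<close>, the equation \<open>B\<^sup>2 = C\<^sup>2\<close> reads \<open>D S = - S D\<close>; so the psd
 matrix \<open>D S D\<close> has trace zero, hence \<open>B D = C D = 0\<close> and \<open>D\<^sup>2 = 0\<close>.\<close>
lemma psd_square_inject:
 assumes B: "B \<in> psd" and C: "C \<in> psd" and eq: "B ** B = C ** C" shows "B = C"
proof -
 define D where "D = B - C"
 have DH: "ctranspose D = D"
  by (simp add: D_def ctranspose_simps psd_hermitian B C)
 have anti: "D ** (B + C) = - ((B + C) ** D)"
  by (simp add: D_def matrix_mult_simps eq)
 have "trace (D ** (B + C) ** D) = - trace ((B + C) ** D ** D)"
  unfolding anti by (simp add: matrix_mult_simps trace_def sum.distrib sum_negf sum_subtractf)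
 also have "trace ((B + C) ** D ** D) = trace (D ** (B + C) ** D)"
  by (metis matrix_mul_assoc trace_mult_commute)
 finally have tr: "trace (D ** (B + C) ** D) = 0" by simp
 have sum0: "(\<Sum>i\<in>UNIV. (D *v axis i 1) \<bullet> ((B + C) *v (D *v axis i 1))) = 0"
  using tr Re_trace[of "ctranspose D ** (B + C) ** D"] by (simp add: DH inner_congruence[of _ D, unfolded DH])
 have BC: "B + C \<in> psd" using B C by (rule psd_add)
 have s: "(D *v axis i 1) \<bullet> ((B + C) *v (D *v axis i 1)) = 0" for i
  using sum0 by (subst (asm) sum_nonneg_eq_0_iff) (auto intro: psd_nonneg[OF BC])
 have "(D *v axis i 1) \<bullet> (B *v (D *v axis i 1)) = 0 \<and> (D *v axis i 1) \<bullet> (C *v (D *v axis i 1)) = 0" for i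
  using s[of i] psd_nonneg[OF B, of "D *v axis i 1"] psd_nonneg[OF C, of "D *v axis i 1"]
  unfolding matrix_vector_mult_add_rdistrib inner_add_right by linarith
 then have "B *v (D *v axis i 1) = 0 \<and> C *v (D *v axis i 1) = 0" for i
  using psd_null_vector B C by blast
 then have "D *v (D *v axis i 1) = 0" for i
  unfolding D_def by (metis D_def diff_self matrix_vector_mult_diff_rdistrib)
 then have "(D *v axis i 1) \<bullet> (D *v axis i 1) = 0" for i
  using inner_matrix_vector[of "D *v axis i 1" D "axis i 1"] by (simp add: DH)
 then have "D = 0" by (simp add: matrix_eq_zero_iff)
 then show ?thesis by (simp add: D_def)
qed

lemma norm_psd_square: "B \<in> psd ==> (norm B)\<^sup>2 = Re (trace (B ** B))"
 using Re_trace_gram[of B] by (simp add: psd_hermitian)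

lemma closed_psd_squares: "closed ((%B. B ** B) ` (psd :: (complex^'n^'n) set))"
 unfolding closed_sequential_limits
proof (intro allI impI, elim conjE)
 fix A :: "nat => complex^'n^'n" and l
 assume "\<forall>n. A n \<in> (%B. B ** B) ` psd" and lim: "A \<longlonglongrightarrow> l"
 then have "\<forall>n. \<exists>B. B \<in> psd \<and> A n = B ** B" by auto
 then obtain B where B: "!!n. B n \<in> psd" "!!n. A n = B n ** B n" by metis
 have "continuous_on UNIV (%A :: complex^'n^'n. Re (trace A))" by (intro continuous_intros)
 then have "(%n. Re (trace (A n))) \<longlonglongrightarrow> Re (trace l)"
  using lim by (auto simp: continuous_on_def intro: tendsto_compose[unfolded o_def])
 then obtain R where R: "!!n. norm (Re (trace (A n))) <= R"
  using convergent_imp_Bseq[of "%n. Re (trace (A n))"] by (auto simp: convergent_def Bseq_def)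
 have "(norm (B n))\<^sup>2 <= R" for n
  using R[of n] norm_psd_square[OF B(1)[of n]] by (simp add: B(2))
 then have "norm (B n) <= sqrt R" for n by (metis real_le_rsqrt)
 then have "\<forall>n. B n \<in> psd \<inter> cball 0 (sqrt R)" using B(1) by auto
 moreover have "compact (psd \<inter> cball 0 (sqrt R) :: (complex^'n^'n) set)"
  by (intro closed_Int_compact closed_psd compact_cball)
 ultimately obtain l' r where l': "l' \<in> psd" and r: "strict_mono r" and limB: "(B \<circ> r) \<longlonglongrightarrow> l'"
  unfolding compact_def by blast
 have "(%n. B (r n) ** B (r n)) \<longlonglongrightarrow> l' ** l'"
  using limB by (auto intro!: tendsto_intros simp: o_def)
 moreover have "(%n. A (r n)) \<longlonglongrightarrow> l"
  using LIMSEQ_subseq_LIMSEQ[OF lim r] by (simp add: o_def)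
 ultimately have "l = l' ** l'" unfolding B(2)[symmetric] by (metis LIMSEQ_unique)
 then show "l \<in> (%B. B ** B) ` psd" using l' by auto
qed

lemma pos_def_iff_sphere:
 "A \<in> pos_def \<longleftrightarrow> ctranspose A = A \<and> (\<forall>x\<in>sphere 0 1. 0 < x \<bullet> (A *v x))"
proof (intro iffI conjI ballI; (elim conjE)?)
 show "ctranspose A = A" if "A \<in> pos_def" using that by (rule pos_def_hermitian)
 show "0 < x \<bullet> (A *v x)" if "A \<in> pos_def" "x \<in> sphere 0 1" for x
  using that(2) by (intro pos_def_pos[OF that(1)]) auto
next
 assume H: "ctranspose A = A" and s: "\<forall>x\<in>sphere 0 1. 0 < x \<bullet> (A *v x)"
 have "0 < x \<bullet> (A *v x)" if "x ~= 0" for x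
 proof -
  have "x /\<^sub>R norm x \<in> sphere 0 1" using that by simp
  with s have "0 < (x /\<^sub>R norm x) \<bullet> (A *v (x /\<^sub>R norm x))" by blast
  then show ?thesis using that
   unfolding matrix_vector_scaleR inner_scaleR_left inner_scaleR_right by (simp add: zero_less_mult_iff)
 qed
 with H show "A \<in> pos_def" by (simp add: pos_def_def)
qed

lemma openin_pos_def: "openin (top_of_set hermitian) (pos_def :: (complex^'n^'n) set)"
 unfolding openin_euclidean_subtopology_iff
proof (intro conjI ballI)
 show "pos_def \<subseteq> (hermitian :: (complex^'n^'n) set)" by (auto simp: pos_def_def hermitian_def)
 fix A :: "complex^'n^'n" assume A: "A \<in> pos_def"
 let ?S = "sphere 0 1 :: (complex^'n) set"
 have "axis undefined 1 \<in> ?S" by (simp add: norm_axis_1)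
 then have "?S ~= {}" by blast
 moreover have "continuous_on ?S (%x. x \<bullet> (A *v x))" by (intro continuous_intros)
 ultimately obtain x0 where x0: "x0 \<in> ?S" "!!x. x \<in> ?S ==> x0 \<bullet> (A *v x0) <= x \<bullet> (A *v x)"
  using continuous_attains_inf[of ?S] compact_sphere by blast
 define m where "m = x0 \<bullet> (A *v x0)"
 have m: "m > 0" using A x0(1) by (auto simp: m_def pos_def_iff_sphere)
 have "A' \<in> pos_def" if A': "A' \<in> hermitian" "dist A' A < m" for A'
  unfolding pos_def_iff_sphere
 proof (intro conjI ballI)
  show "ctranspose A' = A'" using A' by (simp add: hermitian_def)
  fix x assume x: "x \<in> ?S"
  have "\<bar>x \<bullet> ((A' - A) *v x)\<bar> <= norm x * norm ((A' - A) *v x)" by (rule Cauchy_Schwarz_ineq2)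
  also have "\<dots> <= norm x * (norm (A' - A) * norm x)" by (intro mult_left_mono norm_matrix_vector_le) auto
  also have "\<dots> < m" using x A'(2) by (simp add: dist_norm)
  finally have "\<bar>x \<bullet> ((A' - A) *v x)\<bar> < m" .
  moreover have "m <= x \<bullet> (A *v x)" using x0(2)[OF x] by (simp add: m_def)
  ultimately show "0 < x \<bullet> (A' *v x)"
   by (simp add: matrix_vector_mult_diff_rdistrib inner_diff_right)
 qed
 with m show "\<exists>e>0. \<forall>x'\<in>hermitian. dist x' A < e --> x' \<in> pos_def"
  by (intro exI[of _ m]) auto
qed

lemma convex_pos_def: "convex (pos_def :: (complex^'n^'n) set)"
proof (rule convexI)
 fix A B :: "complex^'n^'n" and u v :: real
 assume AB: "A \<in> pos_def" "B \<in> pos_def" and uv: "0 <= u" "0 <= v" "u + v = 1"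
 show "u *\<^sub>R A + v *\<^sub>R B \<in> pos_def"
 proof (cases "u = 0")
  case True then show ?thesis using AB uv by simp
 next
  case False then show ?thesis
   using AB uv by (intro pos_def_add_psd pos_def_scaleR psd_scaleR pos_def_psd) auto
 qed
qed

text \<open>Squaring is injective on the positive definite matrices, so its image there is open in the
 Hermitian matrices by invariance of domain; the image is also relatively closed, and the cone
 of positive definite matrices is connected.\<close>
lemma pos_def_square_root: "(A :: complex^'n^'n) \<in> pos_def ==> \<exists>B\<in>pos_def. A = B ** B"
proof -
 let ?sq = "%B :: complex^'n^'n. B ** B"
 have sub: "?sq ` pos_def \<subseteq> pos_def"
  using pos_def_congruence[OF mat_1_pos_def] pos_def_invertible pos_def_hermitian by fastforce
 have "openin (top_of_set hermitian) (?sq ` pos_def)"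
 proof (rule invariance_of_domain_subspaces[OF openin_pos_def subspace_hermitian subspace_hermitian order_refl])
  show "continuous_on pos_def ?sq" by (intro continuous_intros)
  show "?sq \<in> pos_def \<rightarrow> hermitian" using sub by (auto simp: hermitian_def pos_def_hermitian)
  show "inj_on ?sq pos_def" by (auto intro!: inj_onI psd_square_inject pos_def_psd)
 qed
 then have op: "openin (top_of_set pos_def) (?sq ` pos_def)"
  by (rule openin_subset_trans[OF _ sub]) (auto simp: hermitian_def pos_def_hermitian)
 have eq: "?sq ` pos_def = pos_def \<inter> ?sq ` psd"
 proof safe
  fix B :: "complex^'n^'n" assume B: "B \<in> psd" "B ** B \<in> pos_def"
  have "invertible B"
   using pos_def_invertible[OF B(2)] unfolding invertible_iff_ker
   by (metis matrix_vector_mul_assoc matrix_vector_mult_0_right)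
  then show "B ** B \<in> ?sq ` pos_def" using B(1) by (auto intro: psd_invertible_pos_def)
 qed (use sub pos_def_psd in auto)
 have cl: "closedin (top_of_set pos_def) (?sq ` pos_def)"
  unfolding eq by (rule closedin_closed_Int[OF closed_psd_squares])
 have "mat 1 ** mat 1 \<in> ?sq ` pos_def" using mat_1_pos_def by (rule imageI)
 then have "?sq ` pos_def ~= {}" by (metis empty_iff)
 with op cl have "?sq ` pos_def = pos_def"
  using convex_connected[OF convex_pos_def, THEN connected_clopen[THEN iffD1], rule_format, of "?sq ` pos_def"]
  by simp
 then show "A \<in> pos_def ==> \<exists>B\<in>pos_def. A = B ** B" by auto
qed

lemma psd_square_root:
 assumes A: "A \<in> psd" shows "\<exists>!B. B \<in> psd \<and> B ** B = A"
proof -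
 have lim: "(%n. A + (1 / real (Suc n)) *\<^sub>R mat 1) \<longlonglongrightarrow> A + 0 *\<^sub>R mat 1"
  by (intro tendsto_intros LIMSEQ_inverse_real_of_nat[unfolded inverse_eq_divide])
 have "A + (1 / real (Suc n)) *\<^sub>R mat 1 \<in> pos_def" for n
  using pos_def_add_psd[OF pos_def_scaleR[OF _ mat_1_pos_def] A] by (simp add: add.commute)
 then have "A + (1 / real (Suc n)) *\<^sub>R mat 1 \<in> (%B. B ** B) ` psd" for n
  using pos_def_square_root pos_def_psd by blast
 then have "A + 0 *\<^sub>R mat 1 \<in> (%B. B ** B) ` psd"
  using closed_psd_squares[unfolded closed_sequential_limits, rule_format, OF conjI[OF _ lim]] by blast
 then obtain B where "B \<in> psd" "A = B ** B" by auto
 then show ?thesis using psd_square_inject[of _ B] by (intro ex1I[of _ B]) auto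
qed

lemma psd_sqrt_psd: "A \<in> psd ==> psd_sqrt A \<in> psd"
 and psd_sqrt_square: "A \<in> psd ==> psd_sqrt A ** psd_sqrt A = A"
 using theI'[OF psd_square_root] unfolding psd_sqrt_def by blast+

lemma psd_sqrt_eq: "B \<in> psd ==> B ** B = A ==> psd_sqrt A = B"
 using psd_square_inject psd_sqrt_psd psd_sqrt_square psd_congruence[OF pos_def_psd[OF mat_1_pos_def], of B]
 by (metis matrix_mul_rid psd_hermitian)

lemma psd_sqrt_pos_def: "A \<in> pos_def ==> psd_sqrt A \<in> pos_def"
 using pos_def_square_root psd_sqrt_eq pos_def_psd by metis

lemma norm_psd_sqrt: "A \<in> psd ==> (norm (psd_sqrt A))\<^sup>2 = Re (trace A)"
 using norm_psd_square[OF psd_sqrt_psd] psd_sqrt_square by metis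

lemma Re_trace_nonneg: "A \<in> psd ==> 0 <= Re (trace A)"
 by (metis norm_psd_sqrt zero_le_power2)

lemma norm_le_trace: "A \<in> psd ==> norm A <= Re (trace A)"
 using norm_matrix_mult_le[of "psd_sqrt A" "psd_sqrt A"]
 by (simp add: psd_sqrt_square norm_psd_sqrt flip: power2_eq_square)

text \<open>A map into a compact set is continuous if its graph is closed, and square roots of
 matrices of bounded trace are bounded.\<close>
lemma continuous_on_psd_sqrt: "continuous_on (psd :: (complex^'n^'n) set) psd_sqrt"
proof -
 let ?K = "%R. psd \<inter> {A :: complex^'n^'n. Re (trace A) <= R}"
 have bd: "continuous_on (?K R) psd_sqrt" for R
 proof (rule continuous_from_closed_graph[of "cball 0 (sqrt R)"])
  show "psd_sqrt \<in> ?K R \<rightarrow> cball 0 (sqrt R)"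
   by (auto simp: real_le_rsqrt norm_psd_sqrt)
  have eq: "(%A. (A, psd_sqrt A)) ` (psd \<inter> {A :: complex^'n^'n. Re (trace A) <= R})
   = {p. fst p \<in> psd} \<inter> {p. snd p \<in> psd} \<inter> {p. Re (trace (fst p)) <= R} \<inter> {p. snd p ** snd p = fst p}"
   by (auto simp: psd_sqrt_psd psd_sqrt_square psd_sqrt_eq image_iff)
  moreover have "closed {p :: (complex^'n^'n) \<times> (complex^'n^'n). fst p \<in> psd}"
   "closed {p :: (complex^'n^'n) \<times> (complex^'n^'n). snd p \<in> psd}"
   using closed_vimage_fst[OF closed_psd] closed_vimage_snd[OF closed_psd] by (simp_all add: vimage_def)
  moreover have "closed {p :: (complex^'n^'n) \<times> (complex^'n^'n). Re (trace (fst p)) <= R}"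
   by (intro closed_Collect_le continuous_intros)
  moreover have "closed {p :: (complex^'n^'n) \<times> (complex^'n^'n). snd p ** snd p = fst p}"
   by (intro closed_Collect_eq continuous_intros)
  ultimately show "closed ((%A. (A, psd_sqrt A)) ` ?K R)"
   unfolding eq by (intro closed_Int)
 qed auto
 have "continuous (at A within psd) psd_sqrt" if A: "A \<in> psd" for A :: "complex^'n^'n"
 proof -
  let ?U = "{B :: complex^'n^'n. Re (trace B) < Re (trace A) + 1}"
  have "open ?U" by (intro open_Collect_less continuous_intros)
  have "continuous_on (psd \<inter> ?U) psd_sqrt"
   by (rule continuous_on_subset[OF bd[of "Re (trace A) + 1"]]) auto
  then have "continuous (at A within psd \<inter> ?U) psd_sqrt"
   using A by (simp add: continuous_on_eq_continuous_within)
  moreover have "at A within psd \<inter> ?U = at A within psd"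
   by (rule at_within_nhd[of A ?U]) (use \<open>open ?U\<close> in auto)
  ultimately show ?thesis by simp
 qed
 then show ?thesis by (simp add: continuous_on_eq_continuous_within)
qed

lemma hermitian_det_real: "ctranspose A = A ==> Im (det A) = 0"
 using det_ctranspose[of A] by (metis complex_cnj_cancel_iff Reals_cnj_iff complex_is_Real_iff)

lemma pos_def_det:
 assumes "A \<in> pos_def" shows "0 < Re (det A)" "det A = of_real (Re (det A))"
proof -
 obtain B where B: "B \<in> pos_def" "A = B ** B" using pos_def_square_root[OF assms] by blast
 have r: "det B = of_real (Re (det B))"
  using hermitian_det_real[OF pos_def_hermitian[OF B(1)]] by (simp add: complex_eq_iff)
 have nz: "det B ~= 0" using pos_def_invertible[OF B(1)] by (simp add: invertible_det_nz)
 then have "Re (det B) ~= 0" using r by (metis of_real_0)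
 moreover have "det A = det B * det B" by (simp add: B(2) det_mul)
 ultimately show "0 < Re (det A)" "det A = of_real (Re (det A))"
  using hermitian_det_real[OF pos_def_hermitian[OF B(1)]]
  by (auto simp: complex_eq_iff simp flip: power2_eq_square)
qed

lemma Re_det_psd_mult:
 assumes "A \<in> psd" shows "Re (det (A ** B)) = Re (det A) * Re (det B)"
  and "Re (det (B ** A)) = Re (det A) * Re (det B)"
 using hermitian_det_real[OF psd_hermitian[OF assms]] by (simp_all add: det_mul)

section \<open>The matrix ball\<close>

lemma inner_one_minus_gram:
 "x \<bullet> ((mat 1 - ctranspose w ** w) *v x) = (norm x)\<^sup>2 - (norm (w *v (x :: complex^'n)))\<^sup>2"
 by (simp add: matrix_vector_mult_diff_rdistrib inner_diff_right dot_square_norm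
   inner_matrix_vector[of x "ctranspose w"] flip: matrix_vector_mul_assoc)

lemma mem_matrix_ball: "w \<in> matrix_ball \<longleftrightarrow> (\<forall>x. x ~= 0 --> norm (w *v x) < norm x)"
 by (simp add: matrix_ball_def pos_def_def inner_one_minus_gram ctranspose_simps) (metis norm_ge_zero power2_less_imp_less power_strict_mono zero_less_numeral)

lemma matrix_ball_ctranspose: "(w :: complex^'n^'n) \<in> matrix_ball ==> ctranspose w \<in> matrix_ball"
 unfolding mem_matrix_ball
proof (intro allI impI)
 fix x :: "complex^'n"
 assume w: "\<forall>x. x ~= 0 --> norm (w *v x) < norm x" and x: "x ~= 0"
 let ?y = "ctranspose w *v x"
 show "norm ?y < norm x"
 proof (cases "?y = 0")
  case False
  have "(norm ?y)\<^sup>2 = x \<bullet> (w *v ?y)"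
   by (simp add: inner_matrix_vector dot_square_norm)
  also have "\<dots> <= norm x * norm (w *v ?y)" by (rule norm_cauchy_schwarz)
  also have "\<dots> < norm x * norm ?y" using w False x by simp
  finally show ?thesis using False by (simp add: power2_eq_square)
 qed (use x in simp)
qed

lemma open_matrix_ball: "open (matrix_ball :: (complex^'n^'n) set)"
proof -
 have *: "matrix_ball = (%w. mat 1 - ctranspose w ** w) -` (pos_def :: (complex^'n^'n) set)"
  by (auto simp: matrix_ball_def)
 obtain T where T: "open T" "pos_def = hermitian \<inter> (T :: (complex^'n^'n) set)"
  using openin_pos_def by (auto simp: openin_open)
 have eq: "matrix_ball = (%w. mat 1 - ctranspose w ** w) -` (T :: (complex^'n^'n) set)"
  unfolding * T(2) by (auto simp: hermitian_def ctranspose_simps)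
 show ?thesis
  unfolding eq using T(1) by (rule open_vimage) (intro continuous_intros)
qed

definition matrix_cball :: "(complex^'n^'n) set" where
 "matrix_cball = {w. \<forall>x. norm (w *v x) <= norm x}"

lemma matrix_ball_cball: "matrix_ball \<subseteq> matrix_cball"
 by (auto simp: mem_matrix_ball matrix_cball_def) (metis less_imp_le matrix_vector_mult_0_right order_refl)

lemma compact_matrix_cball: "compact (matrix_cball :: (complex^'n^'n) set)"
proof -
 have eq: "matrix_cball = (\<Inter>x. {w :: complex^'n^'n. norm (w *v x) <= norm x})"
  by (auto simp: matrix_cball_def)
 have "closed {w :: complex^'n^'n. norm (w *v x) <= norm x}" for x
  by (intro closed_Collect_le continuous_on_const continuous_on_norm continuous_on_matrix_vector continuous_on_id)
 then have "closed (matrix_cball :: (complex^'n^'n) set)"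
  unfolding eq by (intro closed_INT ballI)
 moreover have "bounded (matrix_cball :: (complex^'n^'n) set)"
  unfolding bounded_iff
 proof (intro exI ballI)
  fix w :: "complex^'n^'n" assume "w \<in> matrix_cball"
  then have "norm (w *v axis j 1) <= norm (axis j 1 :: complex^'n)" for j
   unfolding matrix_cball_def by blast
  then have le: "norm (w *v axis j 1) <= 1" for j by simp
  have "(norm w)\<^sup>2 <= (\<Sum>j\<in>(UNIV::'n set). 1\<^sup>2)"
   unfolding norm_matrix_columns by (intro sum_mono power_mono le) auto
  then show "norm w <= sqrt (real CARD('n))" by (simp add: real_le_rsqrt)
 qed
 ultimately show ?thesis by (simp add: compact_eq_bounded_closed)
qed

lemma matrix_cball_limit: "(w :: complex^'n^'n) \<in> matrix_cball ==> 0 <= c ==> c < 1 ==> c *\<^sub>R w \<in> matrix_ball"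
 unfolding mem_matrix_ball matrix_cball_def scaleR_matrix_vector
proof (intro allI impI)
 fix x :: "complex^'n"
 assume w: "w \<in> {w. \<forall>x. norm (w *v x) <= norm x}" and c: "0 <= c" "c < 1" and x: "x ~= 0"
 have "c * norm (w *v x) <= c * norm x" using w c by (intro mult_left_mono) auto
 also have "\<dots> < norm x" using c x by simp
 finally show "norm (c *\<^sub>R (w *v x)) < norm x" using c by simp
qed

text \<open>If \<open>w\<close> is invertible, then \<open>1 - w w\<^sup>*\<close> and \<open>1 - w\<^sup>* w\<close> are conjugate by \<open>w\<close>; in general \<open>w\<close>
 is a limit of the invertible matrices among \<open>w + \<epsilon>\<close>.\<close>
lemma det_one_minus_mult_commute:
 "det (mat 1 - A ** B) = det (mat 1 - B ** (A :: complex^'n^'n))"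
proof -
 define P where "P = det (\<chi> i j. [: A $ i $ j, if i = j then 1 else 0 :] :: complex poly^'n^'n)"
 have poly_P: "poly P x = det (A + mat x)" for x
  unfolding P_def det_def by (simp add: poly_sum poly_prod mat_def if_distrib[of "%y. poly y _"] if_distrib[of "%y. x * y"] cong: if_cong)
 have "P ~= 0"
 proof
  assume "P = 0"
  define x where "x = norm A + 1"
  have "det (A + mat (complex_of_real x)) = 0" using poly_P[of "of_real x"] \<open>P = 0\<close> by simp
  then obtain v where v: "(A + mat (complex_of_real x)) *v v = 0" "v ~= 0"
   using invertible_det_nz invertible_iff_ker by metis
  have "mat (complex_of_real x) *v v = x *\<^sub>R v"
   by (simp add: vec_eq_iff matrix_vector_mult_def mat_def if_distrib[of "%a. a * _"] scaleR_conv_of_real[where 'a = complex] cong: if_cong)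
  then have "A *v v = - (x *\<^sub>R v)"
   using v(1) by (simp add: matrix_vector_mult_add_rdistrib eq_neg_iff_add_eq_0)
  then have "x * norm v <= norm A * norm v"
   using norm_matrix_vector_le[of A v] by (simp add: x_def)
  then show False using v(2) by (simp add: x_def mult_le_cancel_right)
 qed
 then have fin: "finite {x. poly P x = 0}" by (rule poly_roots_finite)
 have "eventually (%x. x \<notin> {x. poly P x = 0}) (at 0)"
  using islimpt_finite[OF fin, of 0] by (simp add: islimpt_iff_eventually)
 then have ev: "eventually (%x. det (mat 1 - (A + mat x) ** B) = det (mat 1 - B ** (A + mat x))) (at 0)"
 proof eventually_elim
  case (elim x)
  let ?C = "A + mat x"
  have nz: "det ?C ~= 0" using elim by (simp add: poly_P)
  have "det (mat 1 - ?C ** B) * det ?C = det ?C * det (mat 1 - B ** ?C)"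
   unfolding det_mul[symmetric] by (simp add: matrix_mult_simps matrix_mul_assoc algebra_simps)
  then show ?case using nz by simp
 qed
 have cm: "((%x. mat x :: complex^'n^'n) \<longlongrightarrow> mat 0) (at 0)"
 proof -
  have "((%x. if i = j then x else 0) \<longlongrightarrow> (if i = j then 0 else (0 :: complex))) (at 0)" for i j :: 'n
   by (cases "i = j") auto
  then show ?thesis unfolding mat_def by (intro tendsto_vec_lambda)
 qed
 have dl: "((%x. det (f x)) \<longlongrightarrow> det l) (at (0::complex))" if "(f \<longlongrightarrow> l) (at 0)" for f and l :: "complex^'n^'n"
  using continuous_on_det[OF continuous_on_id, of UNIV] that
  by (auto simp: continuous_on_def intro: tendsto_compose[unfolded o_def])
 have l1: "((%x. det (mat 1 - (A + mat x) ** B)) \<longlongrightarrow> det (mat 1 - (A + mat 0) ** B)) (at 0)"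
  by (intro dl tendsto_intros cm)
 have l2: "((%x. det (mat 1 - B ** (A + mat x))) \<longlongrightarrow> det (mat 1 - B ** (A + mat 0))) (at 0)"
  by (intro dl tendsto_intros cm)
 have "det (mat 1 - (A + mat 0) ** B) = det (mat 1 - B ** (A + mat 0))"
  by (rule tendsto_unique[OF at_neq_bot Lim_transform_eventually[OF l1 ev] l2])
 moreover have "mat 0 = (0 :: complex^'n^'n)" by (simp add: vec_eq_iff mat_def)
 ultimately show ?thesis by simp
qed

section \<open>Lebesgue measure and linear maps\<close>

lemma ennreal_cancel_right: "a * c = b * c ==> c ~= 0 ==> c ~= top ==> a = (b :: ennreal)"
 using ennreal_mult_cancel_left[of c a b] by (simp add: mult.commute)

lemma lborel_open_pos:
 fixes U :: "'a::euclidean_space set"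
 assumes "open U" "U ~= {}" shows "0 < emeasure lborel U"
proof -
 obtain x r where "r > 0" "ball x r \<subseteq> U" using assms open_contains_ball by blast
 then have "0 < emeasure lborel (ball x r)" by (simp add: emeasure_ball)
 also have "\<dots> <= emeasure lborel U" using assms \<open>ball x r \<subseteq> U\<close> by (intro emeasure_mono) auto
 finally show ?thesis .
qed

lemma nn_integral_lborel_translate:
 fixes g :: "'a::euclidean_space => ennreal"
 assumes [measurable]: "g \<in> borel_measurable borel"
 shows "(\<integral>\<^sup>+x. g (c + x) \<partial>lborel) = (\<integral>\<^sup>+x. g x \<partial>lborel)"
 by (subst (2) lborel_distr_plus[of c, symmetric]) (simp add: nn_integral_distr)

text \<open>Weil's argument: integrate \<open>1\<^sub>A(x) 1\<^sub>B(y)\<close> over both measures, translate \<open>x\<close> by \<open>y\<close>, then \<open>y\<close>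
 by \<open>-x\<close>, and exchange the order of integration in between.\<close>
lemma translation_invariant_proportional:
 fixes M :: "'a::euclidean_space measure"
 assumes sets[measurable_cong]: "sets M = sets borel" and sf: "sigma_finite_measure M"
  and inv: "!!c. distr M borel ((+) c) = M"
  and A[measurable]: "A \<in> sets borel" and B[measurable]: "B \<in> sets borel"
 shows "emeasure M A * emeasure lborel B = emeasure lborel A * emeasure M {x. - x \<in> B}"
proof -
 interpret M: sigma_finite_measure M by fact
 interpret P: pair_sigma_finite M lborel ..
 have "uminus -` B \<in> sets borel" by (rule measurable_sets_borel[OF _ B]) simp
 then have Bm[measurable]: "{x. - x \<in> B} \<in> sets borel" by (simp add: vimage_def)
 have tr: "(\<integral>\<^sup>+x. g (c + x) \<partial>M) = (\<integral>\<^sup>+x. g x \<partial>M)" if [measurable]: "g \<in> borel_measurable borel" for g :: "'a => ennreal" and c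
  by (subst (2) inv[of c, symmetric]) (simp add: nn_integral_distr)
 have "emeasure M A * emeasure lborel B = (\<integral>\<^sup>+y. (\<integral>\<^sup>+x. indicator A x * indicator B y \<partial>M) \<partial>lborel)"
  by (simp add: nn_integral_multc nn_integral_cmult)
 also have "\<dots> = (\<integral>\<^sup>+y. (\<integral>\<^sup>+x. indicator A (y + x) * indicator B y \<partial>M) \<partial>lborel)"
  by (intro nn_integral_cong tr[symmetric]) simp
 also have "\<dots> = (\<integral>\<^sup>+x. (\<integral>\<^sup>+y. indicator A (y + x) * indicator B y \<partial>lborel) \<partial>M)"
  by (rule P.Fubini') simp
 also have "\<dots> = (\<integral>\<^sup>+x. (\<integral>\<^sup>+y. indicator A y * indicator B (y - x) \<partial>lborel) \<partial>M)"
 proof (rule nn_integral_cong)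
  fix x
  have "(\<integral>\<^sup>+y. indicator A (y + x) * indicator B y \<partial>lborel)
    = (\<integral>\<^sup>+y. indicator A ((- x + y) + x) * indicator B (- x + y) \<partial>lborel)"
   by (rule nn_integral_lborel_translate[symmetric]) simp
  then show "(\<integral>\<^sup>+y. indicator A (y + x) * indicator B y \<partial>lborel)
    = (\<integral>\<^sup>+y. indicator A y * indicator B (y - x) \<partial>lborel)" by simp
 qed
 also have "\<dots> = (\<integral>\<^sup>+y. (\<integral>\<^sup>+x. indicator A y * indicator B (y - x) \<partial>M) \<partial>lborel)"
  by (rule P.Fubini'[symmetric]) simp
 also have "\<dots> = (\<integral>\<^sup>+y. indicator A y * emeasure M {x. - x \<in> B} \<partial>lborel)"
 proof (rule nn_integral_cong)
  fix y
  have "(\<integral>\<^sup>+x. indicator B (y - x) \<partial>M) = (\<integral>\<^sup>+x. indicator B (y - (y + x)) \<partial>M)"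
   by (rule tr[symmetric]) simp
  also have "\<dots> = (\<integral>\<^sup>+x. indicator {x. - x \<in> B} x \<partial>M)"
   by (intro nn_integral_cong) (simp add: indicator_def)
  also have "\<dots> = emeasure M {x. - x \<in> B}"
   by (intro nn_integral_indicator) (simp add: sets Bm)
  finally show "(\<integral>\<^sup>+x. indicator A y * indicator B (y - x) \<partial>M) = indicator A y * emeasure M {x. - x \<in> B}"
   by (simp add: nn_integral_cmult)
 qed
 also have "\<dots> = emeasure lborel A * emeasure M {x. - x \<in> B}"
  by (simp add: nn_integral_multc)
 finally show ?thesis .
qed

definition lin_scale :: "('a::euclidean_space => 'a) => real" where
 "lin_scale f = measure lborel (f -` ball 0 1) / measure lborel (ball 0 1 :: 'a set)"

lemma linear_inj_bounded_vimage:
 fixes f :: "'a::euclidean_space => 'a"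
 assumes f: "linear f" "inj f" and S: "bounded S" shows "bounded (f -` S)"
proof -
 obtain g where g: "linear g" "g \<circ> f = id"
  using linear_injective_left_inverse[OF f] by blast
 have "g (f x) = x" for x using g(2) by (metis comp_apply id_apply)
 then have "f -` S \<subseteq> g ` S" by (metis image_eqI subsetI vimageE)
 then show ?thesis using bounded_linear_image[OF S linear_conv_bounded_linear[THEN iffD1, OF g(1)]] bounded_subset by blast
qed

lemma linear_borel_measurable: "linear (f :: 'a::euclidean_space => 'b::euclidean_space) ==> f \<in> borel_measurable borel"
 by (intro borel_measurable_continuous_onI linear_continuous_on linear_conv_bounded_linear[THEN iffD1])

lemma
 fixes f :: "'a::euclidean_space => 'a"
 assumes f: "linear f" "inj f"
 shows lin_scale_pos: "0 < lin_scale f"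
  and nn_integral_lin_scale: "!!g. g \<in> borel_measurable borel ==>
   (\<integral>\<^sup>+x. g (f x) \<partial>lborel) = ennreal (lin_scale f) * (\<integral>\<^sup>+x. g x \<partial>lborel)"
proof -
 let ?B = "ball 0 1 :: 'a set"
 let ?M = "distr lborel borel f"
 have [measurable]: "f \<in> borel_measurable borel" using f(1) by (rule linear_borel_measurable)
 have surj: "surj f" by (rule linear_injective_imp_surjective[OF f]) simp
 have fin: "emeasure ?M S < \<infinity>" if "bounded S" "S \<in> sets borel" for S
  using emeasure_bounded_finite[OF linear_inj_bounded_vimage[OF f that(1)]] that(2) by (simp add: emeasure_distr)
 have sf: "sigma_finite_measure ?M"
 proof
  show "\<exists>A. countable A \<and> A \<subseteq> sets ?M \<and> \<Union> A = space ?M \<and> (\<forall>a\<in>A. emeasure ?M a ~= \<infinity>)"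
  proof (intro exI conjI)
   show "\<Union> (range (%n. ball (0::'a) (real n))) = space ?M"
    using reals_Archimedean2 by (auto simp: mem_ball)
   show "\<forall>a\<in>range (%n. ball (0::'a) (real n)). emeasure ?M a ~= \<infinity>"
    using fin[OF bounded_ball] by (auto simp: less_top)
  qed auto
 qed
 have inv: "distr ?M borel ((+) c) = ?M" for c
 proof -
  obtain d where d: "c = f d" using surj by blast
  have "distr ?M borel ((+) c) = distr lborel borel (%x. f (d + x))"
   by (subst distr_distr) (auto simp: o_def d linear_add[OF f(1)])
  also have "\<dots> = distr (distr lborel borel ((+) d)) borel f"
   by (subst distr_distr) (auto simp: o_def)
  finally show ?thesis by (simp add: lborel_distr_plus)
 qed
 have B: "emeasure lborel ?B = ennreal (measure lborel ?B)" "measure lborel ?B > 0"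
  using emeasure_eq_ennreal_measure[of lborel ?B] emeasure_lborel_ball_finite[of "0::'a" 1] lborel_open_pos[of ?B]
  by (auto simp: measure_def enn2real_positive_iff)
 have nz: "ennreal (measure lborel ?B) ~= 0"
  using lborel_open_pos[of ?B] by (subst B(1)[symmetric]) (simp add: zero_less_iff_neq_zero)
 have open_v: "open (f -` ?B)"
  using f(1) by (intro open_vimage linear_continuous_on linear_conv_bounded_linear[THEN iffD1]) auto
 have fB: "emeasure ?M ?B = ennreal (measure lborel (f -` ?B))"
  using emeasure_eq_ennreal_measure[of lborel "f -` ?B"] fin[of ?B] by (simp add: emeasure_distr less_top)
 have "0 \<in> f -` ?B" using linear_0[OF f(1)] by simp
 then have "f -` ?B ~= {}" by blast
 then have "0 < emeasure lborel (f -` ?B)" using open_v by (intro lborel_open_pos)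
 then have pos: "0 < measure lborel (f -` ?B)" using fB by (simp add: emeasure_distr)
 then show "0 < lin_scale f" using B(2) by (simp add: lin_scale_def)
 have sym: "{x. - x \<in> ?B} = ?B" by auto
 have A: "emeasure ?M A = ennreal (lin_scale f) * emeasure lborel A" if [measurable]: "A \<in> sets borel" for A
 proof -
  have "emeasure ?M A * emeasure lborel ?B = emeasure lborel A * emeasure ?M {x. - x \<in> ?B}"
   by (rule translation_invariant_proportional[OF _ sf inv]) auto
  then have "emeasure ?M A * ennreal (measure lborel ?B) = emeasure lborel A * ennreal (measure lborel (f -` ?B))"
   by (simp only: sym B(1) fB)
  also have "ennreal (measure lborel (f -` ?B)) = ennreal (lin_scale f) * ennreal (measure lborel ?B)"
   using B(2) pos by (simp add: lin_scale_def flip: ennreal_mult)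
  also have "emeasure lborel A * (ennreal (lin_scale f) * ennreal (measure lborel ?B))
    = (ennreal (lin_scale f) * emeasure lborel A) * ennreal (measure lborel ?B)"
   by (metis mult.assoc mult.commute)
  finally have "emeasure ?M A * ennreal (measure lborel ?B) = (ennreal (lin_scale f) * emeasure lborel A) * ennreal (measure lborel ?B)" .
  then show ?thesis
   by (rule ennreal_cancel_right) (rule nz, simp)
 qed
 have M: "?M = density lborel (%_. ennreal (lin_scale f))"
  by (rule measure_eqI) (simp_all add: A emeasure_density nn_integral_cmult)
 fix g :: "'a => ennreal" assume [measurable]: "g \<in> borel_measurable borel"
 have "(\<integral>\<^sup>+x. g (f x) \<partial>lborel) = (\<integral>\<^sup>+x. g x \<partial>?M)" by (simp add: nn_integral_distr)
 also have "\<dots> = ennreal (lin_scale f) * (\<integral>\<^sup>+x. g x \<partial>lborel)"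
  unfolding M by (simp add: nn_integral_density nn_integral_cmult)
 finally show "(\<integral>\<^sup>+x. g (f x) \<partial>lborel) = ennreal (lin_scale f) * (\<integral>\<^sup>+x. g x \<partial>lborel)" .
qed

lemma lin_scale_eqI:
 fixes f :: "'a::euclidean_space => 'a"
 assumes f: "linear f" "inj f" and c: "c \<ge> 0"
  and eq: "!!g. g \<in> borel_measurable borel ==> (\<integral>\<^sup>+x. g (f x) \<partial>lborel) = ennreal c * (\<integral>\<^sup>+x. g x \<partial>lborel)"
 shows "lin_scale f = c"
proof -
 let ?g = "indicator (ball 0 1) :: 'a => ennreal"
 have g: "?g \<in> borel_measurable borel" by (intro borel_measurable_indicator) simp
 have "ennreal (lin_scale f) * emeasure lborel (ball 0 1 :: 'a set) = ennreal c * emeasure lborel (ball 0 1 :: 'a set)"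
  using eq[OF g] nn_integral_lin_scale[OF f g] by simp
 moreover have "emeasure lborel (ball 0 1 :: 'a set) ~= 0"
  using lborel_open_pos[of "ball 0 1 :: 'a set"] by (simp add: zero_less_iff_neq_zero)
 moreover have "emeasure lborel (ball 0 1 :: 'a set) ~= top"
  using emeasure_lborel_ball_finite[of "0::'a" 1] by (metis infinity_ennreal_def less_irrefl)
 ultimately have "ennreal (lin_scale f) = ennreal c"
  by (rule ennreal_cancel_right)
 then show ?thesis using c lin_scale_pos[OF f] by simp
qed

lemma nn_integral_isometry:
 fixes f :: "'a::euclidean_space => 'a"
 assumes f: "linear f" and iso: "!!x. norm (f x) = norm x" and g: "g \<in> borel_measurable borel"
 shows "(\<integral>\<^sup>+x. g (f x) \<partial>lborel) = (\<integral>\<^sup>+x. g x \<partial>lborel)"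
proof -
 have inj: "inj f"
  using iso by (intro linear_injective_0[OF f, THEN iffD2]) (metis norm_eq_zero)
 have "f -` ball 0 1 = ball 0 1" using iso by auto
 moreover have "emeasure lborel (ball 0 1 :: 'a set) ~= 0"
  using lborel_open_pos[of "ball 0 1 :: 'a set"] by (simp add: zero_less_iff_neq_zero)
 moreover have "emeasure lborel (ball 0 1 :: 'a set) ~= top"
  using emeasure_lborel_ball_finite[of "0::'a" 1] by (metis infinity_ennreal_def less_irrefl)
 ultimately have "f -` ball 0 1 = ball 0 1" "measure lborel (ball 0 1 :: 'a set) ~= 0"
  by (simp_all add: measure_def enn2real_eq_0_iff)
 then have "lin_scale f = 1" by (simp add: lin_scale_def)
 then show ?thesis using nn_integral_lin_scale[OF f inj g] by simp
qed

section \<open>The Jacobian of right multiplication by a positive definite matrix\<close>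

lemma mult_single_column:
 fixes x :: "complex^'n"
 shows "A ** (\<chi> i j. if j = k then x $ i else 0) = (\<chi> i j. if j = k then (A *v x) $ i else 0)"
 by (simp add: vec_eq_iff matrix_matrix_mult_def matrix_vector_mult_def)

lemma mult_diag_right:
 "(A ** (\<chi> i j. if i = j then d i else 0)) $ i $ j = A $ i $ j * (d j :: complex)"
 by (simp add: matrix_matrix_mult_def if_distrib cong: if_cong)

lemma mult_diag_left:
 "((\<chi> i j. if i = j then d i else 0) ** A) $ i $ j = d i * (A $ i $ j :: complex)"
 by (simp add: matrix_matrix_mult_def if_distrib[of "%a. a * _"] cong: if_cong)

lemma invertible_diag:
 assumes "!!i. d i ~= (0::complex)" shows "invertible (\<chi> i j. if i = j then d i else 0 :: complex^'n^'n)"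
 unfolding invertible_right_inverse
 by (rule exI[of _ "\<chi> i j. if i = j then inverse (d i) else 0"])
  (use assms in \<open>simp add: vec_eq_iff mult_diag_right mat_def\<close>)

text \<open>A multiplicative functional is trivial on a shear \<open>L\<close>, because \<open>L\<close> is conjugate to a square root
 of itself; pivoting with shears turns a positive definite matrix into a diagonal one.\<close>
lemma multiplicative_trivial_on_pos_def:
 fixes \<psi> :: "complex^'n^'n => real"
 assumes mult: "!!A B. invertible A ==> invertible B ==> \<psi> (A ** B) = \<psi> A * \<psi> B"
  and pos: "!!A. invertible A ==> \<psi> A > 0"
  and diag: "!!d. (!!i. d i > 0) ==> \<psi> (\<chi> i j. if i = j then complex_of_real (d i) else 0) = 1"
  and A: "A \<in> pos_def"
 shows "\<psi> A = 1"
proof -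
 define N where "N k x = (\<chi> i j. if j = k then x $ i else (0::complex) :: complex^'n^'n)" for k and x :: "complex^'n"
 have NN: "N k x ** N k x = 0" if "x $ k = 0" for k x
  using that unfolding N_def mult_single_column
  by (simp add: vec_eq_iff matrix_vector_mult_def if_distrib[of "%a. a * _"] cong: if_cong)
 have Ninv: "invertible (mat 1 + c *\<^sub>R N k x)" "(mat 1 + c *\<^sub>R N k x) ** (mat 1 - c *\<^sub>R N k x) = mat 1" if "x $ k = 0" for c k x
 proof -
  show "(mat 1 + c *\<^sub>R N k x) ** (mat 1 - c *\<^sub>R N k x) = mat 1"
   by (simp add: matrix_mult_simps NN[OF that])
  then show "invertible (mat 1 + c *\<^sub>R N k x)" unfolding invertible_right_inverse by blast
 qed
 have shear: "\<psi> (mat 1 + N k x) = 1" if x: "x $ k = 0" for k x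
 proof -
  let ?L = "mat 1 + N k x" and ?L' = "mat 1 + (1/2) *\<^sub>R N k x"
  define D where "D = (\<chi> i j. if i = j then (if i = k then 2 else 1) else 0 :: complex^'n^'n)"
  have D: "invertible D" unfolding D_def by (rule invertible_diag) simp
  have L: "invertible ?L" "invertible ?L'" using Ninv(1)[OF x, of 1] Ninv(1)[OF x, of "1/2"] by simp_all
  have sq: "?L' ** ?L' = ?L"
   using NN[OF x] by (simp add: matrix_mult_simps add.assoc flip: scaleR_left_distrib)
  have "D ** ?L = ?L' ** D"
   using x unfolding D_def vec_eq_iff mult_diag_left mult_diag_right
   by (auto simp: N_def mat_def scaleR_conv_of_real[where 'a = complex])
  then have "\<psi> D * \<psi> ?L = \<psi> ?L' * \<psi> D" by (simp only: mult[OF D L(1), symmetric] mult[OF L(2) D])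
  then have "\<psi> ?L = \<psi> ?L'" using pos[OF D] by simp
  moreover have "\<psi> ?L = \<psi> ?L' * \<psi> ?L'" using mult[OF L(2) L(2)] sq by simp
  ultimately show ?thesis using pos[OF L(2)] by auto
 qed
 have transp: "\<psi> (ctranspose (mat 1 + N k x)) = 1" if x: "x $ k = 0" for k x
 proof -
  let ?L = "ctranspose (mat 1 + N k x)" and ?L' = "ctranspose (mat 1 + (1/2) *\<^sub>R N k x)"
  define D where "D = (\<chi> i j. if i = j then (if i = k then 2 else 1) else 0 :: complex^'n^'n)"
  have D: "invertible D" unfolding D_def by (rule invertible_diag) simp
  have ic: "invertible (ctranspose B)" if "invertible B" for B :: "complex^'n^'n"
   using that by (simp add: invertible_det_nz det_ctranspose)
  have L: "invertible ?L" "invertible ?L'"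
   using ic[OF Ninv(1)[OF x, of 1]] ic[OF Ninv(1)[OF x, of "1/2"]] by simp_all
  have "(mat 1 + (1/2) *\<^sub>R N k x) ** (mat 1 + (1/2) *\<^sub>R N k x) = mat 1 + N k x"
   using NN[OF x] by (simp add: matrix_mult_simps add.assoc flip: scaleR_left_distrib)
  then have sq: "?L' ** ?L' = ?L" by (metis ctranspose_mult)
  have "?L ** D = D ** ?L'"
   using x unfolding D_def vec_eq_iff mult_diag_left mult_diag_right
   by (auto simp: N_def mat_def scaleR_conv_of_real[where 'a = complex])
  then have "\<psi> ?L * \<psi> D = \<psi> D * \<psi> ?L'" by (simp only: mult[OF D L(2)] mult[OF L(1) D, symmetric])
  then have "\<psi> ?L = \<psi> ?L'" using pos[OF D] by simp
  moreover have "\<psi> ?L = \<psi> ?L' * \<psi> ?L'" using mult[OF L(2) L(2)] sq by simp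
  ultimately show ?thesis using pos[OF L(2)] by auto
 qed
 have main: "\<psi> A = 1" if "finite K" "A \<in> pos_def" "!!i j. i ~= j ==> i \<notin> K ==> A $ i $ j = 0" for A and K :: "'n set"
  using that
 proof (induction K arbitrary: A rule: finite_induct)
  case empty
  have herm: "A $ i $ j = cnj (A $ j $ i)" for i j
   using arg_cong[OF pos_def_hermitian[OF empty.prems(1)], of "%B. B $ i $ j"] by simp
  have d: "Re (A $ i $ i) > 0" for i
   using pos_def_pos[OF empty.prems(1), of "axis i 1"] by (simp add: inner_axis' inner_complex_def)
  have "Im (A $ i $ i) = 0" for i using arg_cong[OF herm[of i i], of Im] by simp
  then have eq: "A = (\<chi> i j. if i = j then complex_of_real (Re (A $ i $ i)) else 0)"
   using empty.prems(2) by (auto simp: vec_eq_iff complex_eq_iff)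
  show ?case by (subst eq) (rule diag[OF d])
 next
  case (insert k K)
  have herm: "A $ i $ j = cnj (A $ j $ i)" for i j
   using arg_cong[OF pos_def_hermitian[OF insert.prems(1)], of "%B. B $ i $ j"] by simp
  define x where "x = (\<chi> i. if i = k then 0 else A $ i $ k / A $ k $ k)"
  have nz: "A $ k $ k ~= 0"
   using pos_def_pos[OF insert.prems(1), of "axis k 1"] by (auto simp: inner_axis' inner_complex_def)
  have x: "x $ k = 0" by (simp add: x_def)
  define L where "L = mat 1 + N k x"
  define G where "G = mat 1 - N k x"
  have LG: "L ** G = mat 1" using Ninv(2)[OF x, of 1] by (simp add: L_def G_def)
  then have GL: "G ** L = mat 1" by (simp add: matrix_left_right_inverse)
  have inv: "invertible L" "invertible G" using LG GL by (auto simp: invertible_right_inverse)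
  have invc: "invertible (ctranspose L)" "invertible (ctranspose G)"
   using inv by (simp_all add: invertible_det_nz det_ctranspose)
  define A' where "A' = G ** A ** ctranspose G"
  have A': "A' \<in> pos_def"
   using pos_def_congruence[OF insert.prems(1) invc(2)] by (simp add: A'_def)
  have "L ** A' ** ctranspose L = (L ** G) ** A ** ctranspose (L ** G)"
   by (simp add: A'_def ctranspose_mult matrix_mul_assoc)
  then have AL: "A = L ** A' ** ctranspose L" by (simp add: LG)
  have GA: "(G ** A) $ i $ j = A $ i $ j - x $ i * A $ k $ j" for i j
   unfolding G_def matrix_mult_simps matrix_mul_lid
   by (simp add: N_def matrix_matrix_mult_def if_distrib[of "%a. a * _"] cong: if_cong)
  have A'e: "A' $ i $ j = (G ** A) $ i $ j - (G ** A) $ i $ k * cnj (x $ j)" for i j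
  proof -
   define B where "B = G ** A"
   have "(B ** ctranspose G) $ i $ j = B $ i $ j - (B ** ctranspose (N k x)) $ i $ j"
    by (simp add: G_def ctranspose_diff matrix_mult_simps)
   also have "(B ** ctranspose (N k x)) $ i $ j = B $ i $ k * cnj (x $ j)"
    by (simp add: matrix_matrix_mult_def N_def if_distrib[of "%a. _ * a"] if_distrib[of cnj] cong: if_cong)
   finally show ?thesis by (simp add: A'_def B_def)
  qed
  have Gk: "(G ** A) $ i $ k = 0" if "i ~= k" for i
   using that nz by (simp add: GA x_def)
  have herm': "A' $ i $ j = cnj (A' $ j $ i)" for i j
   using arg_cong[OF pos_def_hermitian[OF A'], of "%B. B $ i $ j"] by simp
  have zero: "A' $ i $ m = 0" if im: "i ~= m" "m \<notin> K" for i m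
  proof (cases "m = k")
   case True
   then show ?thesis using im Gk[of i] by (simp add: A'e x)
  next
   case False
   then have "A $ i' $ m = 0" if "i' ~= m" for i'
    using insert.prems(2)[of m i'] that im(2) herm[of i' m] by auto
   moreover have "x $ m = 0" using insert.prems(2)[of m k] False im(2) by (auto simp: x_def)
   ultimately show ?thesis using im False by (auto simp: A'e GA)
  qed
  have "\<psi> A' = 1"
  proof (rule insert.IH[OF A'])
   show "A' $ i $ j = 0" if "i ~= j" "i \<notin> K" for i j
    using zero[of j i] that herm'[of i j] by auto
  qed
  moreover have "\<psi> A = \<psi> L * \<psi> A' * \<psi> (ctranspose L)"
   by (subst AL) (simp add: mult[OF invertible_mult[OF inv(1) pos_def_invertible[OF A']] invc(1)]
     mult[OF inv(1) pos_def_invertible[OF A']])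
  ultimately show ?case using shear[OF x] transp[OF x] by (simp add: L_def)
 qed
 show ?thesis by (rule main[of UNIV, OF _ A]) auto
qed

lemma linear_mult_right: "linear (%w :: complex^'n^'n. w ** c)"
 by (rule linearI) (simp_all add: matrix_mult_simps)

lemma inj_mult_right:
 assumes "invertible (c :: complex^'n^'n)" shows "inj (%w :: complex^'n^'n. w ** c)"
proof (rule injI)
 fix w w' :: "complex^'n^'n" assume eq: "w ** c = w' ** c"
 obtain c' where c': "c ** c' = mat 1" using assms by (auto simp: invertible_right_inverse)
 have "w ** (c ** c') = w' ** (c ** c')" using eq by (simp add: matrix_mul_assoc)
 then show "w = w'" by (simp add: c')
qed

lemma prod_Basis_matrix:
 fixes h :: "complex^'n^'n => real"
 shows "(\<Prod>b\<in>Basis. h b) = (\<Prod>i\<in>UNIV. \<Prod>k\<in>UNIV. h (axis i (axis k 1)) * h (axis i (axis k \<i>)))"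
proof -
 have B: "(Basis :: (complex^'n^'n) set) = (%(i, k, u). axis i (axis k u)) ` (UNIV \<times> UNIV \<times> {1, \<i>})"
  unfolding Basis_vec_def Basis_complex_def by (auto simp: image_iff) blast+
 have key: "i = i' \<and> k = k' \<and> u = u'"
  if u: "u \<in> {1, \<i>}" "u' \<in> {1, \<i>}" and eq: "(axis i (axis k u) :: complex^'n^'n) = axis i' (axis k' u')"
  for i k u i' k' u'
 proof -
  have "axis k u ~= (0 :: complex^'n)" using u by (auto simp: axis_eq_0_iff)
  with eq have "i = i'" "(axis k u :: complex^'n) = axis k' u'" by (auto simp: axis_eq_axis)
  moreover have "u ~= 0" using u by auto
  ultimately show ?thesis by (auto simp: axis_eq_axis)
 qed
 let ?f = "(%(i, k, u). axis i (axis k u)) :: 'n \<times> 'n \<times> complex => complex^'n^'n"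
 have inj: "inj_on ?f (UNIV \<times> UNIV \<times> {1, \<i>})"
 proof (rule inj_onI)
  fix p q :: "'n \<times> 'n \<times> complex"
  assume p: "p \<in> UNIV \<times> UNIV \<times> {1, \<i>}" and q: "q \<in> UNIV \<times> UNIV \<times> {1, \<i>}"
   and eq: "?f p = ?f q"
  obtain i k u i' k' u' where pq: "p = (i, k, u)" "q = (i', k', u')" by (cases p, cases q)
  then have "i = i' \<and> k = k' \<and> u = u'" using p q eq by (intro key) auto
  then show "p = q" by (simp add: pq)
 qed
 show ?thesis
  unfolding B prod.reindex[OF inj] by (simp add: prod.cartesian_product' o_def)
qed

lemma nn_integral_mult_diag:
 fixes d :: "'n::finite => real" and g :: "complex^'n^'n => ennreal"
 assumes d: "!!i. d i > 0" and [measurable]: "g \<in> borel_measurable borel"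
 defines "D \<equiv> (\<chi> i j. if i = j then complex_of_real (d i) else 0) :: complex^'n^'n"
 shows "(\<integral>\<^sup>+w. g w \<partial>lborel) = ennreal ((\<Prod>i\<in>UNIV. d i) ^ (2 * CARD('n))) * (\<integral>\<^sup>+w. g (w ** D) \<partial>lborel)"
proof -
 define c where "c b = (\<Sum>i\<in>UNIV. \<Sum>k\<in>UNIV. d k * norm (b $ i $ k))" for b :: "complex^'n^'n"
 have c: "c (axis i (axis k u)) = d k * norm u" for i k u
 proof -
  have col: "(\<Sum>k'\<in>UNIV. d k' * norm (axis k u $ k')) = d k * norm u"
   by (simp add: axis_def if_distrib[of norm] if_distrib[of "%a. _ * a"] cong: if_cong)
  have "c (axis i (axis k u)) = (\<Sum>i'\<in>UNIV. if i' = i then (\<Sum>k'\<in>UNIV. d k' * norm (axis k u $ k')) else 0)"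
   unfolding c_def by (intro sum.cong refl) (simp add: axis_def[of i])
  then show ?thesis by (simp add: col)
 qed
 define T where "T w = 0 + (\<Sum>j\<in>Basis. (c j * (w \<bullet> j)) *\<^sub>R j)" for w :: "complex^'n^'n"
 have Bas: "b \<in> Basis ==> \<exists>i k u. b = axis i (axis k u) \<and> (u = 1 \<or> u = \<i>)" for b :: "complex^'n^'n"
  by (auto simp: Basis_vec_def Basis_complex_def)
 have T: "T w = w ** D" for w
 proof (rule euclidean_eqI)
  fix b :: "complex^'n^'n" assume b: "b \<in> Basis"
  obtain i k u where u: "b = axis i (axis k u)" "u = 1 \<or> u = \<i>" using Bas[OF b] by blast
  have "T w \<bullet> b = c b * (w \<bullet> b)"
   using b by (simp add: T_def inner_sum_left inner_Basis if_distrib cong: if_cong)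
  also have "\<dots> = (w ** D) \<bullet> b"
   using u(2) unfolding u(1) c inner_axis D_def mult_diag_right by (auto simp: inner_complex_def)
  finally show "T w \<bullet> b = (w ** D) \<bullet> b" .
 qed
 have cnz: "c b ~= 0" if "b \<in> Basis" for b using Bas[OF that] d by (auto simp: c less_imp_neq[symmetric])
 have [measurable]: "T \<in> borel_measurable borel" unfolding T by (rule linear_borel_measurable) (rule linear_mult_right)
 have "(\<Prod>j\<in>Basis. \<bar>c j\<bar>) = (\<Prod>i\<in>(UNIV::'n set). \<Prod>k\<in>(UNIV::'n set). d k * d k)"
  unfolding prod_Basis_matrix by (simp add: c d less_imp_le)
 also have "\<dots> = (\<Prod>i\<in>UNIV. d i) ^ (2 * CARD('n))"
  by (simp add: prod.distrib power_mult power2_eq_square)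
 finally have pr: "(\<Prod>j\<in>Basis. \<bar>c j\<bar>) = (\<Prod>i\<in>UNIV. d i) ^ (2 * CARD('n))" .
 have "(lborel :: (complex^'n^'n) measure) = density (distr lborel borel T) (%_. ennreal (\<Prod>j\<in>Basis. \<bar>c j\<bar>))"
  using lborel_affine_euclidean[of c 0] cnz unfolding T_def by simp
 then have "(\<integral>\<^sup>+w. g w \<partial>lborel) = (\<integral>\<^sup>+w. g w \<partial>density (distr lborel borel T) (%_. ennreal (\<Prod>j\<in>Basis. \<bar>c j\<bar>)))"
  by metis
 also have "\<dots> = ennreal (\<Prod>j\<in>Basis. \<bar>c j\<bar>) * (\<integral>\<^sup>+w. g (T w) \<partial>lborel)"
  by (simp add: nn_integral_density nn_integral_distr nn_integral_cmult)
 finally show ?thesis by (simp add: pr T)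
qed

lemma det_diag: "det (\<chi> i j. if i = j then d i else 0 :: complex^'n^'n) = (\<Prod>i\<in>UNIV. d i)"
 by (subst det_diagonal) auto

text \<open>The Jacobian divided by the expected power of the determinant is multiplicative and equals \<open>1\<close> on
 positive diagonal matrices.\<close>
proposition nn_integral_mult_pos_def:
 fixes g :: "complex^'n^'n => ennreal"
 assumes c: "c \<in> pos_def" and g[measurable]: "g \<in> borel_measurable borel"
 shows "(\<integral>\<^sup>+w. g w \<partial>lborel) = ennreal (Re (det c) ^ (2 * CARD('n))) * (\<integral>\<^sup>+w. g (w ** c) \<partial>lborel)"
proof -
 define R where "R A = (%w :: complex^'n^'n. w ** A)" for A :: "complex^'n^'n"
 define \<psi> where "\<psi> A = lin_scale (R A) * norm (det A) ^ (2 * CARD('n))" for A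
 have lin: "linear (R A)" for A unfolding R_def by (rule linear_mult_right)
 have inj: "inj (R A)" if "invertible A" for A unfolding R_def using that by (rule inj_mult_right)
 have [measurable]: "R A \<in> borel_measurable borel" for A using lin by (rule linear_borel_measurable)
 have "\<psi> c = 1"
 proof (rule multiplicative_trivial_on_pos_def[OF _ _ _ c])
  fix A B :: "complex^'n^'n" assume AB: "invertible A" "invertible B"
  have "lin_scale (R (A ** B)) = lin_scale (R A) * lin_scale (R B)"
  proof (rule lin_scale_eqI[OF lin inj[OF invertible_mult[OF AB]]])
   show "0 <= lin_scale (R A) * lin_scale (R B)"
    using lin_scale_pos[OF lin inj] AB by (simp add: less_imp_le)
   fix g :: "complex^'n^'n => ennreal" assume [measurable]: "g \<in> borel_measurable borel"
   have "(\<integral>\<^sup>+x. g (R (A ** B) x) \<partial>lborel) = (\<integral>\<^sup>+x. g (R B (R A x)) \<partial>lborel)"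
    by (simp add: R_def matrix_mul_assoc)
   also have "\<dots> = ennreal (lin_scale (R A)) * (\<integral>\<^sup>+x. g (R B x) \<partial>lborel)"
    by (rule nn_integral_lin_scale[OF lin inj[OF AB(1)]]) simp
   also have "\<dots> = ennreal (lin_scale (R A)) * (ennreal (lin_scale (R B)) * (\<integral>\<^sup>+x. g x \<partial>lborel))"
    by (simp add: nn_integral_lin_scale[OF lin inj[OF AB(2)]])
   finally show "(\<integral>\<^sup>+x. g (R (A ** B) x) \<partial>lborel) = ennreal (lin_scale (R A) * lin_scale (R B)) * (\<integral>\<^sup>+x. g x \<partial>lborel)"
    using lin_scale_pos[OF lin inj] AB by (simp add: ennreal_mult less_imp_le mult.assoc)
  qed
  then show "\<psi> (A ** B) = \<psi> A * \<psi> B" by (simp add: \<psi>_def det_mul norm_mult power_mult_distrib)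
 next
  fix A :: "complex^'n^'n" assume A: "invertible A"
  then have "norm (det A) > 0" by (simp add: invertible_det_nz)
  then show "\<psi> A > 0" using lin_scale_pos[OF lin inj[OF A]] by (simp add: \<psi>_def)
 next
  fix d :: "'n => real" assume d: "!!i. d i > 0"
  define D where "D = (\<chi> i j. if i = j then complex_of_real (d i) else 0 :: complex^'n^'n)"
  define p where "p = (\<Prod>i\<in>UNIV. d i) ^ (2 * CARD('n))"
  have p: "p > 0" using d by (simp add: p_def prod_pos)
  have D: "invertible D" unfolding D_def by (rule invertible_diag) (metis d less_irrefl of_real_eq_0_iff)
  have "lin_scale (R D) = 1 / p"
  proof (rule lin_scale_eqI[OF lin inj[OF D]])
   fix g :: "complex^'n^'n => ennreal" assume "g \<in> borel_measurable borel"
   then have "(\<integral>\<^sup>+w. g w \<partial>lborel) = ennreal p * (\<integral>\<^sup>+w. g (R D w) \<partial>lborel)"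
    unfolding R_def D_def p_def by (rule nn_integral_mult_diag[OF d])
   then have "ennreal (1 / p) * (\<integral>\<^sup>+w. g w \<partial>lborel) = (ennreal (1 / p) * ennreal p) * (\<integral>\<^sup>+w. g (R D w) \<partial>lborel)"
    by (simp add: mult.assoc)
   also have "ennreal (1 / p) * ennreal p = 1" using p by (simp flip: ennreal_mult)
   finally show "(\<integral>\<^sup>+w. g (R D w) \<partial>lborel) = ennreal (1 / p) * (\<integral>\<^sup>+w. g w \<partial>lborel)" by simp
  qed (use p in simp)
  moreover have "det D = of_real (\<Prod>i\<in>UNIV. d i)" by (simp add: D_def det_diag)
  then have "norm (det D) ^ (2 * CARD('n)) = p"
   using prod_pos[of UNIV d] d by (simp only: norm_of_real abs_of_pos p_def)
  ultimately show "\<psi> (\<chi> i j. if i = j then complex_of_real (d i) else 0) = 1"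
   using p by (simp add: \<psi>_def D_def)
 qed
 moreover have "norm (det c) = Re (det c)"
  using pos_def_det[OF c] by (metis abs_of_pos norm_of_real)
 ultimately have eq: "Re (det c) ^ (2 * CARD('n)) * lin_scale (R c) = 1" by (simp add: \<psi>_def mult.commute)
 have "(\<integral>\<^sup>+w. g (w ** c) \<partial>lborel) = ennreal (lin_scale (R c)) * (\<integral>\<^sup>+w. g w \<partial>lborel)"
  using nn_integral_lin_scale[OF lin[of c] inj[OF pos_def_invertible[OF c]] g] by (simp add: R_def)
 moreover have "ennreal (Re (det c) ^ (2 * CARD('n))) * ennreal (lin_scale (R c)) = 1"
  using pos_def_det(1)[OF c] lin_scale_pos[OF lin[of c] inj[OF pos_def_invertible[OF c]]] eq
  by (simp flip: ennreal_mult)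
 ultimately show ?thesis by (simp flip: mult.assoc)
qed

section \<open>Integration over matrices and over the Hermitian cone\<close>

lemma borel_measurable_ctranspose [measurable (raw)]:
 fixes f :: "'a => complex^'n^'m"
 assumes "f \<in> borel_measurable M" shows "(%x. ctranspose (f x)) \<in> borel_measurable M"
proof -
 have "(ctranspose :: complex^'n^'m => _) \<in> borel_measurable borel"
  by (intro borel_measurable_continuous_onI continuous_on_ctranspose continuous_on_id)
 from measurable_compose[OF assms this] show ?thesis .
qed

lemma borel_measurable_matrix_mult [measurable (raw)]:
 fixes f :: "'a => complex^'n^'m" and g :: "'a => complex^'k^'n"
 assumes "f \<in> borel_measurable M" "g \<in> borel_measurable M" shows "(%x. f x ** g x) \<in> borel_measurable M"
proof (rule borel_measurable_continuous_Pair[OF assms])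
 show "continuous_on UNIV (%x. (fst x :: complex^'n^'m) ** (snd x :: complex^'k^'n))"
  by (intro continuous_on_matrix_mult continuous_on_fst continuous_on_snd continuous_on_id)
qed

lemma borel_measurable_det [measurable (raw)]:
 fixes f :: "'a => complex^'n^'n"
 assumes "f \<in> borel_measurable M" shows "(%x. det (f x)) \<in> borel_measurable M"
proof -
 have "(det :: complex^'n^'n => _) \<in> borel_measurable borel"
  by (intro borel_measurable_continuous_onI continuous_on_det continuous_on_id)
 from measurable_compose[OF assms this] show ?thesis .
qed

lemma borel_measurable_trace [measurable (raw)]:
 fixes f :: "'a => complex^'n^'n"
 assumes "f \<in> borel_measurable M" shows "(%x. trace (f x)) \<in> borel_measurable M"
proof -
 have "(trace :: complex^'n^'n => _) \<in> borel_measurable borel"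
  by (intro borel_measurable_continuous_onI continuous_on_trace continuous_on_id)
 from measurable_compose[OF assms this] show ?thesis .
qed

lemma sets_cball [measurable]: "cball (a :: 'a::euclidean_space) r \<in> sets borel"
 by simp

lemma sets_psd [measurable]: "(psd :: (complex^'n^'n) set) \<in> sets borel"
 by (rule borel_closed[OF closed_psd])

lemma sets_hermitian [measurable]: "(hermitian :: (complex^'n^'n) set) \<in> sets borel"
 by (rule borel_closed[OF closed_hermitian])

lemma sets_matrix_ball [measurable]: "(matrix_ball :: (complex^'n^'n) set) \<in> sets borel"
 by (rule borel_open[OF open_matrix_ball])

lemma sets_pos_def [measurable]: "(pos_def :: (complex^'n^'n) set) \<in> sets borel"
proof -
 obtain T where T: "open T" "pos_def = hermitian \<inter> (T :: (complex^'n^'n) set)"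
  using openin_pos_def by (auto simp: openin_open)
 show ?thesis unfolding T(2) using T(1) by (intro sets.Int sets_hermitian borel_open)
qed

definition matrix_root :: "complex^'n^'n => complex^'n^'n" where
 "matrix_root A = (if A \<in> psd then psd_sqrt A else 0)"

lemma borel_measurable_matrix_root [measurable (raw)]:
 fixes f :: "'a => complex^'n^'n"
 assumes "f \<in> borel_measurable M" shows "(%x. matrix_root (f x)) \<in> borel_measurable M"
proof -
 have "(matrix_root :: complex^'n^'n => _) \<in> borel_measurable borel"
  unfolding matrix_root_def
  by (rule borel_measurable_continuous_on_if[OF sets_psd continuous_on_psd_sqrt continuous_on_const])
 from measurable_compose[OF assms this] show ?thesis .
qed

lemma matrix_root_psd: "matrix_root A \<in> psd"
 by (simp add: matrix_root_def psd_sqrt_psd zero_psd)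

lemma matrix_root_square: "A \<in> psd ==> matrix_root A ** matrix_root A = A"
 by (simp add: matrix_root_def psd_sqrt_square)

lemma matrix_root_pos_def: "A \<in> pos_def ==> matrix_root A \<in> pos_def"
 by (simp add: matrix_root_def psd_sqrt_pos_def pos_def_psd)

definition det_power :: "real => complex^'n^'n => real" where
 "det_power e t = (if t \<in> pos_def then Re (det t) powr e else 0)"

lemma borel_measurable_det_power [measurable (raw)]:
 fixes f :: "'a => complex^'n^'n"
 assumes "f \<in> borel_measurable M" shows "(%x. det_power e (f x)) \<in> borel_measurable M"
proof -
 have "(det_power e :: complex^'n^'n => real) \<in> borel_measurable borel"
  unfolding det_power_def by measurable
 from measurable_compose[OF assms this] show ?thesis .
qed

lemma det_power_nonneg: "0 <= det_power e t"
 by (simp add: det_power_def)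

lemma sets_hermitian_lebesgue [simp, measurable_cong]: "sets hermitian_lebesgue = sets borel"
 by (simp add: hermitian_lebesgue_def)

lemma linear_hermitian_of: "linear (hermitian_of :: real^'n^'n => complex^'n^'n)"
 by (rule linearI) (simp_all add: hermitian_of_def vec_eq_iff complex_eq_iff field_simps)

lemma hermitian_of_hermitian: "hermitian_of A \<in> hermitian"
 by (simp add: hermitian_of_def hermitian_def vec_eq_iff complex_eq_iff field_simps)

lemma hermitian_of_surj:
 assumes "h \<in> hermitian" shows "hermitian_of (\<chi> i j. Re (h $ i $ j) + Im (h $ i $ j)) = h"
proof -
 have h: "ctranspose h = h" using assms by (simp add: hermitian_def)
 have e: "h $ i $ j = cnj (h $ j $ i)" for i j
  by (subst (1) h[symmetric]) simp
 have "hermitian_of (\<chi> i j. Re (h $ i $ j) + Im (h $ i $ j)) $ i $ j = h $ i $ j" for i j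
  using arg_cong[OF e[of i j], of Re] arg_cong[OF e[of i j], of Im]
  by (simp add: hermitian_of_def complex_eq_iff)
 then show ?thesis by (simp add: vec_eq_iff)
qed

lemma norm_hermitian_of: "norm (hermitian_of A) = norm (A :: real^'n^'n)"
proof -
 have n2: "(norm B)\<^sup>2 = (\<Sum>i\<in>UNIV. \<Sum>j\<in>UNIV. (norm (B $ i $ j))\<^sup>2)" for B :: "'a::real_normed_vector^'n^'n"
  unfolding norm_vec_def L2_set_def by (simp add: sum_nonneg)
 have "(norm (hermitian_of A))\<^sup>2 = (\<Sum>i\<in>UNIV. \<Sum>j\<in>UNIV. ((A $ i $ j)\<^sup>2 + (A $ j $ i)\<^sup>2) / 2)"
  unfolding n2 by (intro sum.cong refl)
   (simp add: hermitian_of_def cmod_def real_sqrt_pow2 power2_eq_square field_simps)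
 also have "\<dots> = ((\<Sum>i\<in>UNIV. \<Sum>j\<in>UNIV. (A $ i $ j)\<^sup>2) + (\<Sum>i\<in>UNIV. \<Sum>j\<in>UNIV. (A $ j $ i)\<^sup>2)) / 2"
  by (simp add: sum.distrib sum_divide_distrib[symmetric])
 also have "(\<Sum>i\<in>UNIV. \<Sum>j\<in>UNIV. (A $ j $ i)\<^sup>2) = (\<Sum>i\<in>UNIV. \<Sum>j\<in>UNIV. (A $ i $ j)\<^sup>2)"
  by (rule sum.swap)
 also have "((\<Sum>i\<in>UNIV. \<Sum>j\<in>UNIV. (A $ i $ j)\<^sup>2) + (\<Sum>i\<in>UNIV. \<Sum>j\<in>UNIV. (A $ i $ j)\<^sup>2)) / 2 = (norm A)\<^sup>2"
  unfolding n2 by simp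
 finally show ?thesis by (simp add: power2_eq_iff_nonneg)
qed

lemma measurable_hermitian_of [measurable]: "hermitian_of \<in> borel_measurable borel"
 by (rule linear_borel_measurable[OF linear_hermitian_of])

lemma nn_integral_hermitian_lebesgue:
 "g \<in> borel_measurable borel ==> (\<integral>\<^sup>+t. g t \<partial>hermitian_lebesgue) = (\<integral>\<^sup>+A. g (hermitian_of A) \<partial>lborel)"
 unfolding hermitian_lebesgue_def by (rule nn_integral_distr) simp_all

lemma hermitian_lebesgue_bounded_finite:
 assumes "bounded S" "S \<in> sets borel" shows "emeasure hermitian_lebesgue S < \<infinity>"
proof -
 obtain R where R: "!!x. x \<in> S ==> norm x <= R" using assms(1) by (auto simp: bounded_iff)
 have "bounded (hermitian_of -` S)"
  unfolding bounded_iff using R by (intro exI[of _ R]) (auto simp flip: norm_hermitian_of)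
 from emeasure_bounded_finite[OF this] show ?thesis
  unfolding hermitian_lebesgue_def using assms(2) by (simp add: emeasure_distr)
qed

lemma sigma_finite_hermitian_lebesgue: "sigma_finite_measure hermitian_lebesgue"
proof
 show "\<exists>A. countable A \<and> A \<subseteq> sets (hermitian_lebesgue :: (complex^'n^'n) measure) \<and> \<Union> A = space hermitian_lebesgue
   \<and> (\<forall>a\<in>A. emeasure hermitian_lebesgue a ~= \<infinity>)"
 proof (intro exI conjI)
  show "\<Union> (range (%n. ball (0::complex^'n^'n) (real n))) = space hermitian_lebesgue"
   using reals_Archimedean2 by (auto simp: hermitian_lebesgue_def)
  show "\<forall>a\<in>range (%n. ball (0::complex^'n^'n) (real n)). emeasure hermitian_lebesgue a ~= \<infinity>"
  proof
   fix a :: "(complex^'n^'n) set" assume "a \<in> range (%n. ball 0 (real n))"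
   then obtain n where a: "a = ball 0 (real n)" by blast
   have "emeasure hermitian_lebesgue a < \<infinity>"
    unfolding a by (rule hermitian_lebesgue_bounded_finite) auto
   then show "emeasure hermitian_lebesgue a ~= \<infinity>" by (rule less_imp_neq)
  qed
 qed auto
qed

lemma nn_integral_hermitian_translate:
 fixes g :: "complex^'n^'n => ennreal"
 assumes h: "h \<in> hermitian" and [measurable]: "g \<in> borel_measurable borel"
 shows "(\<integral>\<^sup>+t. g (h + t) \<partial>hermitian_lebesgue) = (\<integral>\<^sup>+t. g t \<partial>hermitian_lebesgue)"
proof -
 define H where "H = (\<chi> i j. Re (h $ i $ j) + Im (h $ i $ j))"
 have H: "h = hermitian_of H" unfolding H_def by (rule hermitian_of_surj[OF h, symmetric])
 have "(\<integral>\<^sup>+t. g (h + t) \<partial>hermitian_lebesgue) = (\<integral>\<^sup>+A. g (hermitian_of (H + A)) \<partial>lborel)"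
  by (simp add: nn_integral_hermitian_lebesgue H linear_add[OF linear_hermitian_of])
 also have "\<dots> = (\<integral>\<^sup>+A. g (hermitian_of A) \<partial>lborel)"
  by (rule nn_integral_lborel_translate[of "%A. g (hermitian_of A)"]) simp
 finally show ?thesis by (simp add: nn_integral_hermitian_lebesgue)
qed

lemma pos_def_congruence_iff:
 "c \<in> pos_def ==> c ** B ** c \<in> pos_def \<longleftrightarrow> (B :: complex^'n^'n) \<in> pos_def"
proof
 assume c: "c \<in> pos_def"
 have H: "ctranspose c = c" using c by (rule pos_def_hermitian)
 show "B \<in> pos_def ==> c ** B ** c \<in> pos_def"
  using pos_def_congruence[OF _ pos_def_invertible[OF c], of B] by (simp add: H)
 obtain c' where c': "c ** c' = mat 1" using pos_def_invertible[OF c] by (auto simp: invertible_right_inverse)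
 then have c'': "c' ** c = mat 1" by (simp add: matrix_left_right_inverse)
 have inv: "invertible c'" using c'' by (auto simp: invertible_right_inverse)
 have "ctranspose c' ** c = mat 1" using arg_cong[OF c', of ctranspose] by (simp add: ctranspose_mult H)
 then have "ctranspose c' ** (c ** B ** c) ** c' = B"
  using c' by (simp add: matrix_mul_assoc) (simp add: c' flip: matrix_mul_assoc)
 then show "c ** B ** c \<in> pos_def ==> B \<in> pos_def"
  using pos_def_congruence[OF _ inv, of "c ** B ** c"] by simp
qed

text \<open>The substitution \<open>y = w \<surd>s\<close>, under which \<open>s - y\<^sup>* y = \<surd>s (1 - w\<^sup>* w) \<surd>s\<close>.\<close>
lemma nn_integral_scaled_ball:
 fixes g :: "complex^'n^'n => ennreal"
 assumes g[measurable]: "g \<in> borel_measurable borel"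
 shows "(\<integral>\<^sup>+y. g y * ennreal (det_power e (s - ctranspose y ** y)) \<partial>lborel)
  = ennreal (det_power (e + real CARD('n)) s)
   * (\<integral>\<^sup>+w. g (w ** matrix_root s) * ennreal (det_power e (mat 1 - ctranspose w ** w)) \<partial>lborel)"
proof (cases "s \<in> pos_def")
 case False
 have "s - ctranspose y ** y \<notin> pos_def" for y :: "complex^'n^'n"
  using pos_def_add_psd[of "s - ctranspose y ** y", OF _ psd_gram[of y]] False by auto
 then show ?thesis using False by (simp add: det_power_def)
next
 case True
 define c where "c = matrix_root s"
 have c: "c \<in> pos_def" "ctranspose c = c" and cc: "c ** c = s"
  using True by (simp_all add: c_def matrix_root_pos_def pos_def_hermitian matrix_root_square pos_def_psd)
 have dc: "Re (det c) > 0" "Re (det s) = (Re (det c))\<^sup>2"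
  using pos_def_det[OF c(1)] Re_det_psd_mult(1)[OF pos_def_psd[OF c(1)], of c] by (simp_all add: cc power2_eq_square)
 have dp: "det_power e (s - ctranspose (w ** c) ** (w ** c)) = Re (det s) powr e * det_power e (mat 1 - ctranspose w ** w)" for w
 proof -
  have eq: "s - ctranspose (w ** c) ** (w ** c) = c ** (mat 1 - ctranspose w ** w) ** c"
   by (simp add: ctranspose_mult c matrix_mult_simps matrix_mul_assoc cc)
  show ?thesis
  proof (cases "mat 1 - ctranspose w ** w \<in> pos_def")
   case True
   have "Re (det (c ** (mat 1 - ctranspose w ** w) ** c)) = Re (det s) * Re (det (mat 1 - ctranspose w ** w))"
    using Re_det_psd_mult[OF pos_def_psd[OF c(1)]] by (simp add: dc(2) power2_eq_square)
   then show ?thesis using True dc pos_def_det(1)[OF True]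
    unfolding eq by (simp add: det_power_def pos_def_congruence_iff[OF c(1)] powr_mult)
  qed (simp add: eq det_power_def pos_def_congruence_iff[OF c(1)])
 qed
 have pw: "Re (det c) ^ (2 * CARD('n)) * Re (det s) powr e = det_power (e + real CARD('n)) s"
 proof -
  have "Re (det c) ^ (2 * CARD('n)) = Re (det s) ^ CARD('n)" by (simp add: dc(2) power_mult)
  then show ?thesis
   using True pos_def_det(1)[OF True] by (simp add: det_power_def powr_add powr_realpow mult.commute)
 qed
 have "(\<integral>\<^sup>+y. g y * ennreal (det_power e (s - ctranspose y ** y)) \<partial>lborel)
   = ennreal (Re (det c) ^ (2 * CARD('n))) *
    (\<integral>\<^sup>+w. g (w ** c) * ennreal (det_power e (s - ctranspose (w ** c) ** (w ** c))) \<partial>lborel)"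
  by (rule nn_integral_mult_pos_def[OF c(1)]) simp
 also have "\<dots> = ennreal (Re (det c) ^ (2 * CARD('n))) *
    (\<integral>\<^sup>+w. ennreal (Re (det s) powr e) * (g (w ** c) * ennreal (det_power e (mat 1 - ctranspose w ** w))) \<partial>lborel)"
  by (simp add: dp ennreal_mult det_power_nonneg mult_ac)
 also have "\<dots> = ennreal (Re (det c) ^ (2 * CARD('n))) * ennreal (Re (det s) powr e) *
    (\<integral>\<^sup>+w. g (w ** c) * ennreal (det_power e (mat 1 - ctranspose w ** w)) \<partial>lborel)"
  by (subst nn_integral_cmult) (simp_all add: mult.assoc)
 also have "ennreal (Re (det c) ^ (2 * CARD('n))) * ennreal (Re (det s) powr e) = ennreal (det_power (e + real CARD('n)) s)"
  using dc(1) by (simp add: pw[symmetric] ennreal_mult)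
 finally show ?thesis by (simp add: c_def)
qed

text \<open>For fixed \<open>s\<close> put \<open>y = w \<surd>s\<close>, exchange the integrals, and translate \<open>s\<close> by \<open>y\<^sup>* y\<close>.\<close>
proposition nn_integral_polar_shift:
 fixes \<Psi> :: "(complex^'n^'n) \<times> (complex^'n^'n) => ennreal"
 assumes [measurable]: "\<Psi> \<in> borel_measurable (borel \<Otimes>\<^sub>M borel)"
 shows "(\<integral>\<^sup>+s. (\<integral>\<^sup>+w. \<Psi> (s, w ** matrix_root s) * ennreal (det_power e (mat 1 - ctranspose w ** w)) \<partial>lborel)
    * ennreal (det_power (e + real CARD('n)) s) \<partial>hermitian_lebesgue)
  = (\<integral>\<^sup>+y. (\<integral>\<^sup>+t. \<Psi> (ctranspose y ** y + t, y) * ennreal (det_power e t) \<partial>hermitian_lebesgue) \<partial>lborel)"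
proof -
 interpret H: sigma_finite_measure "hermitian_lebesgue :: (complex^'n^'n) measure"
  by (rule sigma_finite_hermitian_lebesgue)
 interpret P: pair_sigma_finite "hermitian_lebesgue :: (complex^'n^'n) measure" "lborel :: (complex^'n^'n) measure" ..
 have "(\<integral>\<^sup>+s. (\<integral>\<^sup>+w. \<Psi> (s, w ** matrix_root s) * ennreal (det_power e (mat 1 - ctranspose w ** w)) \<partial>lborel)
    * ennreal (det_power (e + real CARD('n)) s) \<partial>hermitian_lebesgue)
  = (\<integral>\<^sup>+s. (\<integral>\<^sup>+y. \<Psi> (s, y) * ennreal (det_power e (s - ctranspose y ** y)) \<partial>lborel) \<partial>hermitian_lebesgue)"
  by (intro nn_integral_cong, subst nn_integral_scaled_ball) (simp_all add: mult.commute)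
 also have "\<dots> = (\<integral>\<^sup>+y. (\<integral>\<^sup>+s. \<Psi> (s, y) * ennreal (det_power e (s - ctranspose y ** y)) \<partial>hermitian_lebesgue) \<partial>lborel)"
  by (rule P.Fubini'[symmetric]) simp
 also have "\<dots> = (\<integral>\<^sup>+y. (\<integral>\<^sup>+t. \<Psi> (ctranspose y ** y + t, y) * ennreal (det_power e t) \<partial>hermitian_lebesgue) \<partial>lborel)"
 proof (rule nn_integral_cong)
  fix y :: "complex^'n^'n"
  have "ctranspose y ** y \<in> hermitian" using psd_hermitian[OF psd_gram[of y]] by (simp add: hermitian_def)
  from nn_integral_hermitian_translate[OF this, of "%s. \<Psi> (s, y) * ennreal (det_power e (s - ctranspose y ** y))"]
  show "(\<integral>\<^sup>+s. \<Psi> (s, y) * ennreal (det_power e (s - ctranspose y ** y)) \<partial>hermitian_lebesgue)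
   = (\<integral>\<^sup>+t. \<Psi> (ctranspose y ** y + t, y) * ennreal (det_power e t) \<partial>hermitian_lebesgue)"
   by simp
 qed
 finally show ?thesis .
qed

section \<open>Finiteness of the weight of the matrix ball\<close>

lemma nn_integral_powr_affine_le:
 fixes a b e :: real
 assumes b: "b > 0" and e: "-1 < e" "e <= 0"
 shows "(\<integral>\<^sup>+\<tau>. indicator {0..1} \<tau> * ennreal (if a + \<tau> * b > 0 then (a + \<tau> * b) powr e else 0) \<partial>lborel)
  <= ennreal (b powr e / (e + 1))"
proof -
 define \<sigma> where "\<sigma> = max 0 (- a / b)"
 define h where "h x = (if x \<in> {0..1} then x powr e else 0)" for x :: real
 have [measurable]: "h \<in> borel_measurable borel" unfolding h_def by measurable
 have "(h has_integral (1 powr (e + 1) / (e + 1))) UNIV"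
  unfolding h_def has_integral_restrict_UNIV by (rule has_integral_powr_from_0) (use e in auto)
 then have h: "(\<integral>\<^sup>+x. ennreal (h x) \<partial>lborel) = ennreal (1 / (e + 1))"
  using nn_integral_has_integral_lborel[of h] by (simp add: h_def)
 have "(\<integral>\<^sup>+\<tau>. indicator {0..1} \<tau> * ennreal (if a + \<tau> * b > 0 then (a + \<tau> * b) powr e else 0) \<partial>lborel)
   <= (\<integral>\<^sup>+\<tau>. ennreal (b powr e) * ennreal (h (- \<sigma> + \<tau>)) \<partial>lborel)"
 proof (rule nn_integral_mono_AE, rule eventually_mono[OF AE_lborel_singleton[of \<sigma>]])
  fix \<tau> :: real assume ne: "\<tau> ~= \<sigma>"
  show "indicator {0..1} \<tau> * ennreal (if a + \<tau> * b > 0 then (a + \<tau> * b) powr e else 0)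
   <= ennreal (b powr e) * ennreal (h (- \<sigma> + \<tau>))"
  proof (cases "\<tau> \<in> {0..1} \<and> a + \<tau> * b > 0")
   case True
   then have "\<tau> > - a / b" using b by (simp add: field_simps)
   with True ne have r: "0 < \<tau> - \<sigma>" "\<tau> - \<sigma> <= 1" by (auto simp: \<sigma>_def max_def split: if_splits)
   have "- a / b <= \<sigma>" by (simp add: \<sigma>_def)
   then have "b * (\<tau> - \<sigma>) <= a + \<tau> * b" using b by (simp add: field_simps)
   then have "(a + \<tau> * b) powr e <= (b * (\<tau> - \<sigma>)) powr e"
    using r b e by (intro powr_mono2') auto
   also have "\<dots> = b powr e * h (- \<sigma> + \<tau>)" using r b by (simp add: powr_mult h_def)
   finally show ?thesis using True by (simp add: ennreal_leI flip: ennreal_mult')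
  qed auto
 qed
 also have "\<dots> = ennreal (b powr e) * (\<integral>\<^sup>+\<tau>. ennreal (h \<tau>) \<partial>lborel)"
  using nn_integral_lborel_translate[of "%x. ennreal (h x)" "- \<sigma>"] by (simp add: nn_integral_cmult)
 also have "\<dots> = ennreal (b powr e / (e + 1))"
  using e by (simp add: h flip: ennreal_mult')
 finally show ?thesis .
qed


definition coord_proj :: "'n set => complex^'n^'n" where
 "coord_proj K = (\<chi> i j. if i = j then (if i \<in> K then 1 else 0) else 0)"

definition principal_minor :: "'n set => complex^'n^'n => complex^'n^'n" where
 "principal_minor K t = (\<chi> i j. if i \<in> K \<and> j \<in> K then t $ i $ j else if i = j then 1 else 0)"

lemma principal_minor_eq:
 "principal_minor K t = coord_proj K ** t ** coord_proj K + (mat 1 - coord_proj K)"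
 unfolding vec_eq_iff vector_add_component coord_proj_def mult_diag_right mult_diag_left
 by (auto simp: principal_minor_def mat_def)

lemma coord_proj_simps: "ctranspose (coord_proj K) = coord_proj K" "coord_proj K ** coord_proj K = coord_proj K"
 "coord_proj K *v x = (\<chi> i. if i \<in> K then x $ i else 0)"
proof -
 show "ctranspose (coord_proj K) = coord_proj K" by (simp add: vec_eq_iff coord_proj_def)
 show "coord_proj K ** coord_proj K = coord_proj K"
  unfolding vec_eq_iff by (subst (2) coord_proj_def, subst mult_diag_right) (simp add: coord_proj_def)
 show "coord_proj K *v x = (\<chi> i. if i \<in> K then x $ i else 0)"
  by (simp add: vec_eq_iff matrix_vector_mult_def coord_proj_def if_distrib[of "%a. a * _"] cong: if_cong)
qed

lemma principal_minor_pos_def: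
 assumes t: "t \<in> pos_def" shows "principal_minor K t \<in> pos_def"
proof -
 let ?P = "coord_proj K"
 have H: "ctranspose (principal_minor K t) = principal_minor K t"
  by (simp add: principal_minor_eq ctranspose_simps coord_proj_simps(1) pos_def_hermitian[OF t] matrix_mul_assoc)
 have "0 < x \<bullet> (principal_minor K t *v x)" if x: "x ~= 0" for x
 proof -
  have "x \<bullet> ((?P ** t ** ?P) *v x) = (?P *v x) \<bullet> (t *v (?P *v x))"
   using inner_congruence[of x ?P t] by (simp add: coord_proj_simps(1))
  moreover have "x \<bullet> ((mat 1 - ?P) *v x) = (x - ?P *v x) \<bullet> (x - ?P *v x)"
  proof -
   have "x \<bullet> (?P *v x) = (?P *v x) \<bullet> (?P *v x)"
    by (subst (2) inner_matrix_vector) (simp add: coord_proj_simps(1,2) matrix_vector_mul_assoc inner_commute)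
   then show ?thesis
    by (simp add: matrix_vector_mult_diff_rdistrib inner_diff_right inner_diff_left inner_commute)
  qed
  ultimately have eq: "x \<bullet> (principal_minor K t *v x)
    = (?P *v x) \<bullet> (t *v (?P *v x)) + (x - ?P *v x) \<bullet> (x - ?P *v x)"
   by (simp add: principal_minor_eq matrix_vector_mult_add_rdistrib inner_add_right)
  show ?thesis
  proof (cases "?P *v x = 0")
   case True
   then show ?thesis unfolding eq using x by simp
  next
   case False
   from pos_def_pos[OF t False] show ?thesis unfolding eq by (simp add: add_pos_nonneg)
  qed
 qed
 with H show ?thesis by (simp add: pos_def_def)
qed

lemma principal_minor_minor: "K \<subseteq> L ==> principal_minor K (principal_minor L t) = principal_minor K t"
 by (auto simp: principal_minor_def vec_eq_iff)

lemma det_unit_row_cong: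
 fixes A B :: "complex^'n^'n"
 assumes A: "!!j. j ~= k ==> A $ k $ j = 0" and B: "!!j. j ~= k ==> B $ k $ j = 0"
  and kk: "A $ k $ k = B $ k $ k" and eq: "!!i j. i ~= k ==> j ~= k ==> A $ i $ j = B $ i $ j"
 shows "det A = det B"
 unfolding det_def
proof (rule sum.cong[OF refl])
 fix p assume "p \<in> {p. p permutes (UNIV :: 'n set)}"
 then have p: "p permutes UNIV" by simp
 have "(\<Prod>i\<in>UNIV. A $ i $ p i) = (\<Prod>i\<in>UNIV. B $ i $ p i)"
 proof (cases "p k = k")
  case True
  then have "p i ~= k" if "i ~= k" for i using that permutes_inj[OF p] by (metis injD)
  then show ?thesis using True kk eq by (intro prod.cong refl) metis
 next
  case False
  then have "A $ k $ p k = 0" "B $ k $ p k = 0" using A B by auto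
  then have "(\<Prod>i\<in>UNIV. A $ i $ p i) = 0" and "(\<Prod>i\<in>UNIV. B $ i $ p i) = 0"
   by (intro prod_zero; auto)+
  then show ?thesis by (simp only:)
 qed
 then show "of_int (sign p) * (\<Prod>i\<in>UNIV. A $ i $ p i) = of_int (sign p) * (\<Prod>i\<in>UNIV. B $ i $ p i)" by simp
qed

definition diag_unit :: "'n => complex^'n^'n" where
 "diag_unit k = (\<chi> i j. if i = k \<and> j = k then 1 else 0)"

text \<open>Expansion along row \<open>k\<close>.\<close>
lemma det_minor_affine:
 assumes k: "k \<notin> K"
 shows "Re (det (principal_minor (insert k K) (\<tau> *\<^sub>R diag_unit k + t)))
  = Re (det (principal_minor (insert k K) t)) + \<tau> * Re (det (principal_minor K t))"
proof -
 let ?C = "principal_minor (insert k K) t"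
 have "principal_minor (insert k K) (\<tau> *\<^sub>R diag_unit k + t) = (\<chi> i. if i = k then ?C $ i + \<tau> *\<^sub>R axis k 1 else ?C $ i)"
  by (auto simp: vec_eq_iff principal_minor_def diag_unit_def axis_def)
 then have "det (principal_minor (insert k K) (\<tau> *\<^sub>R diag_unit k + t))
   = det (\<chi> i. if i = k then ?C $ i else ?C $ i) + det (\<chi> i. if i = k then \<tau> *\<^sub>R axis k 1 else ?C $ i)"
  by (simp only: det_row_add)
 also have "(\<chi> i. if i = k then ?C $ i else ?C $ i) = ?C" by (simp add: vec_eq_iff)
 also have "(\<chi> i. if i = k then \<tau> *\<^sub>R axis k 1 else ?C $ i) = (\<chi> i. if i = k then of_real \<tau> *s axis k 1 else ?C $ i)"
  by (auto simp: vec_eq_iff axis_def scaleR_conv_of_real[where 'a = complex])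
 also have "det \<dots> = of_real \<tau> * det (\<chi> i. if i = k then axis k 1 else ?C $ i)"
  by (rule det_row_mul)
 also have "det (\<chi> i. if i = k then axis k 1 else ?C $ i) = det (principal_minor K t)"
  by (rule det_unit_row_cong[of k]) (use k in \<open>auto simp: principal_minor_def axis_def\<close>)
 finally show ?thesis by simp
qed

lemma minor_shift: "k \<notin> K ==> principal_minor K (\<tau> *\<^sub>R diag_unit k + t) = principal_minor K t"
 by (auto simp: principal_minor_def diag_unit_def vec_eq_iff)

lemma measurable_principal_minor [measurable (raw)]:
 fixes f :: "'a => complex^'n^'n"
 assumes [measurable]: "f \<in> borel_measurable M" shows "(%x. principal_minor K (f x)) \<in> borel_measurable M"
 unfolding principal_minor_eq by measurable

lemma diag_unit: "diag_unit k \<in> hermitian" "norm (diag_unit k) = 1"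
proof -
 show "diag_unit k \<in> hermitian" by (auto simp: hermitian_def diag_unit_def vec_eq_iff)
 have "diag_unit k = axis k (axis k 1)" by (auto simp: diag_unit_def axis_def vec_eq_iff)
 then show "norm (diag_unit k) = 1" by simp
qed

text \<open>Integrate over one diagonal entry after another: the minor of \<open>K \<union> {k}\<close> is affine in the entry
 \<open>t\<^sub>k\<^sub>k\<close>, and its slope is the minor of \<open>K\<close>.\<close>
lemma nn_integral_minor_finite:
 fixes K :: "'n::finite set"
 assumes e: "-1 < e" "e <= 0" and "finite K"
 shows "(\<integral>\<^sup>+t. indicator (cball 0 R) t * ennreal (det_power e (principal_minor K (t :: complex^'n^'n))) \<partial>hermitian_lebesgue) < \<infinity>"
 using \<open>finite K\<close>
proof (induction K arbitrary: R rule: finite_induct)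
 case empty
 have "principal_minor {} t = mat 1" for t :: "complex^'n^'n" by (auto simp: principal_minor_def mat_def vec_eq_iff)
 then have "(\<integral>\<^sup>+t. indicator (cball 0 R) t * ennreal (det_power e (principal_minor {} (t :: complex^'n^'n))) \<partial>hermitian_lebesgue)
   = emeasure hermitian_lebesgue (cball (0 :: complex^'n^'n) R)"
  by (simp add: det_power_def mat_1_pos_def)
 also have "\<dots> < \<infinity>" by (rule hermitian_lebesgue_bounded_finite) auto
 finally show ?case .
next
 case (insert k K)
 interpret H: sigma_finite_measure "hermitian_lebesgue :: (complex^'n^'n) measure"
  by (rule sigma_finite_hermitian_lebesgue)
 interpret P: pair_sigma_finite "hermitian_lebesgue :: (complex^'n^'n) measure" "lborel :: real measure" ..
 define F where "F t = indicator (cball 0 R) t * ennreal (det_power e (principal_minor (insert k K) t))" for t :: "complex^'n^'n"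
 define G where "G t = indicator (cball 0 (R + 1)) t * ennreal (det_power e (principal_minor K t))" for t :: "complex^'n^'n"
 have [measurable]: "cball (0 :: complex^'n^'n) r \<in> sets borel" for r by simp
 have [measurable]: "F \<in> borel_measurable borel" "G \<in> borel_measurable borel"
  unfolding F_def G_def by measurable
 have pt: "(\<integral>\<^sup>+\<tau>. indicator {0..1} \<tau> * F (\<tau> *\<^sub>R diag_unit k + t) \<partial>lborel) <= ennreal (1 / (e + 1)) * G t" for t
 proof -
  let ?a = "Re (det (principal_minor (insert k K) t))" and ?b = "Re (det (principal_minor K t))"
  have le: "indicator {0..1} \<tau> * F (\<tau> *\<^sub>R diag_unit k + t)
    <= indicator (cball 0 (R + 1)) t * (if principal_minor K t \<in> pos_def then 1 else 0)
     * (indicator {0..1} \<tau> * ennreal (if ?a + \<tau> * ?b > 0 then (?a + \<tau> * ?b) powr e else 0))" for \<tau>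
  proof (cases "\<tau> \<in> {0..1} \<and> \<tau> *\<^sub>R diag_unit k + t \<in> cball 0 R \<and> principal_minor (insert k K) (\<tau> *\<^sub>R diag_unit k + t) \<in> pos_def")
   case True
   then have pd: "principal_minor K t \<in> pos_def"
    using principal_minor_pos_def[of "principal_minor (insert k K) (\<tau> *\<^sub>R diag_unit k + t)" K]
    by (simp add: principal_minor_minor[of K "insert k K"] subset_insertI minor_shift[OF insert.hyps(2)])
   have "norm t <= norm (\<tau> *\<^sub>R diag_unit k + t) + norm (\<tau> *\<^sub>R diag_unit k)"
    by (metis add_diff_cancel_left' norm_triangle_ineq4)
   then have "norm t <= R + 1" using True diag_unit(2)[of k] by auto
   then show ?thesis
    using True pd pos_def_det(1)[of "principal_minor (insert k K) (\<tau> *\<^sub>R diag_unit k + t)"]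
    by (simp add: F_def det_power_def det_minor_affine[OF insert.hyps(2)])
  next
   case False
   then show ?thesis by (auto simp: F_def det_power_def indicator_def split: if_splits)
  qed
  show ?thesis
  proof (cases "principal_minor K t \<in> pos_def")
   case True
   then have b: "?b > 0" by (rule pos_def_det)
   have "(\<integral>\<^sup>+\<tau>. indicator {0..1} \<tau> * F (\<tau> *\<^sub>R diag_unit k + t) \<partial>lborel)
    <= (\<integral>\<^sup>+\<tau>. indicator (cball 0 (R + 1)) t * (indicator {0..1} \<tau> * ennreal (if ?a + \<tau> * ?b > 0 then (?a + \<tau> * ?b) powr e else 0)) \<partial>lborel)"
    using le True by (intro nn_integral_mono) simp
   also have "\<dots> = indicator (cball 0 (R + 1)) t * (\<integral>\<^sup>+\<tau>. indicator {0..1} \<tau> * ennreal (if ?a + \<tau> * ?b > 0 then (?a + \<tau> * ?b) powr e else 0) \<partial>lborel)"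
    by (rule nn_integral_cmult) measurable
   also have "\<dots> <= indicator (cball 0 (R + 1)) t * ennreal (?b powr e / (e + 1))"
    by (intro mult_left_mono nn_integral_powr_affine_le b e) simp
   also have "\<dots> = ennreal (1 / (e + 1)) * G t"
    using True e by (simp add: G_def det_power_def mult.left_commute[of _ "indicator _ _"] flip: ennreal_mult')
   finally show ?thesis .
  next
   case False
   then have z: "indicator {0..1} \<tau> * F (\<tau> *\<^sub>R diag_unit k + t) = 0" for \<tau> :: real using le[of \<tau>] by simp
   show ?thesis unfolding z by simp
  qed
 qed
 have "(\<integral>\<^sup>+t. F t \<partial>hermitian_lebesgue) = (\<integral>\<^sup>+\<tau>. indicator {0..1} \<tau> * (\<integral>\<^sup>+t. F t \<partial>hermitian_lebesgue) \<partial>(lborel :: real measure))"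
  by (subst nn_integral_multc) simp_all
 also have "\<dots> = (\<integral>\<^sup>+\<tau>. (\<integral>\<^sup>+t. indicator {0..1} \<tau> * F (\<tau> *\<^sub>R diag_unit k + t) \<partial>hermitian_lebesgue) \<partial>(lborel :: real measure))"
 proof (rule nn_integral_cong)
  fix \<tau> :: real
  have "\<tau> *\<^sub>R diag_unit k \<in> hermitian" by (rule subspace_scale[OF subspace_hermitian diag_unit(1)])
  then show "indicator {0..1} \<tau> * (\<integral>\<^sup>+t. F t \<partial>hermitian_lebesgue)
   = (\<integral>\<^sup>+t. indicator {0..1} \<tau> * F (\<tau> *\<^sub>R diag_unit k + t) \<partial>hermitian_lebesgue)"
   by (simp add: nn_integral_cmult nn_integral_hermitian_translate)
 qed
 also have "\<dots> = (\<integral>\<^sup>+t. (\<integral>\<^sup>+\<tau>. indicator {0..1} \<tau> * F (\<tau> *\<^sub>R diag_unit k + t) \<partial>lborel) \<partial>hermitian_lebesgue)"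
  by (rule P.Fubini') simp
 also have "\<dots> <= (\<integral>\<^sup>+t. ennreal (1 / (e + 1)) * G t \<partial>hermitian_lebesgue)"
  by (intro nn_integral_mono pt)
 also have "\<dots> = ennreal (1 / (e + 1)) * (\<integral>\<^sup>+t. G t \<partial>hermitian_lebesgue)"
  by (rule nn_integral_cmult) simp
 also have "\<dots> < \<infinity>"
  using insert.IH[of "R + 1"] unfolding G_def by (simp add: ennreal_mult_less_top)
 finally show ?case unfolding F_def .
qed

lemma det_bounded_cball: "\<exists>C>0. \<forall>t\<in>cball 0 R. norm (det (t :: complex^'n^'n)) <= C"
proof -
 have "compact (det ` cball (0 :: complex^'n^'n) R)"
  by (intro compact_continuous_image continuous_on_det continuous_on_id compact_cball)
 then have "bounded (det ` cball (0 :: complex^'n^'n) R)" by (rule compact_imp_bounded)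
 then show ?thesis unfolding bounded_pos by auto
qed

lemma nn_integral_det_power_finite:
 assumes e: "-1 < e"
 shows "(\<integral>\<^sup>+t. indicator (cball 0 R) t * ennreal (det_power e (t :: complex^'n^'n)) \<partial>hermitian_lebesgue) < \<infinity>"
proof -
 have U: "principal_minor UNIV t = t" for t :: "complex^'n^'n" by (simp add: principal_minor_def vec_eq_iff)
 show ?thesis
 proof (cases "e <= 0")
  case True
  show ?thesis using nn_integral_minor_finite[OF e True, of "UNIV :: 'n set" R] by (simp add: U)
 next
  case False
  obtain C where C: "C > 0" "!!t. t \<in> cball 0 R ==> norm (det (t :: complex^'n^'n)) <= C"
   using det_bounded_cball[of R] by blast
  have "(\<integral>\<^sup>+t. indicator (cball 0 R) t * ennreal (det_power e (t :: complex^'n^'n)) \<partial>hermitian_lebesgue)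
   <= (\<integral>\<^sup>+t. ennreal (C powr e) * indicator (cball 0 R) (t :: complex^'n^'n) \<partial>hermitian_lebesgue)"
  proof (rule nn_integral_mono)
   fix t :: "complex^'n^'n"
   have "det_power e t <= C powr e" if "t \<in> cball 0 R"
   proof (cases "t \<in> pos_def")
    case True
    have "Re (det t) <= C" using C(2)[OF that] complex_Re_le_cmod[of "det t"] by linarith
    then show ?thesis using True pos_def_det(1)[OF True] False by (simp add: det_power_def powr_mono2)
   qed (simp add: det_power_def)
   then show "indicator (cball 0 R) t * ennreal (det_power e t) <= ennreal (C powr e) * indicator (cball 0 R) t"
    by (auto simp: indicator_def ennreal_leI)
  qed
  also have "\<dots> = ennreal (C powr e) * emeasure hermitian_lebesgue (cball (0 :: complex^'n^'n) R)"
   by (subst nn_integral_cmult_indicator) simp_all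
  also have "\<dots> < \<infinity>"
   using hermitian_lebesgue_bounded_finite[of "cball (0 :: complex^'n^'n) R"] by (simp add: ennreal_mult_less_top)
  finally show ?thesis .
 qed
qed

definition ball_mass :: "real => 'n::finite itself => ennreal" where
 "ball_mass e _ = (\<integral>\<^sup>+w. ennreal (det_power e (mat 1 - ctranspose w ** (w :: complex^'n^'n))) \<partial>lborel)"

lemma ball_mass_pos: "ball_mass e TYPE('n::finite) ~= 0"
proof
 let ?f = "%w :: complex^'n^'n. ennreal (det_power e (mat 1 - ctranspose w ** w))"
 assume "ball_mass e TYPE('n) = 0"
 then have "AE w in lborel. ?f w = 0" unfolding ball_mass_def by (subst (asm) nn_integral_0_iff_AE) simp_all
 moreover have "?f w ~= 0" if "w \<in> matrix_ball" for w
  using that pos_def_det(1)[of "mat 1 - ctranspose w ** w"] by (simp add: matrix_ball_def det_power_def ennreal_eq_0_iff)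
 ultimately have "AE w in lborel. w \<notin> (matrix_ball :: (complex^'n^'n) set)" by (auto elim: eventually_mono)
 then have "emeasure lborel (matrix_ball :: (complex^'n^'n) set) = 0"
  by (subst (asm) AE_iff_measurable[of "matrix_ball"]) auto
 moreover have "(0 :: complex^'n^'n) \<in> matrix_ball" by (simp add: mem_matrix_ball)
 then have "emeasure lborel (matrix_ball :: (complex^'n^'n) set) > 0"
  by (intro lborel_open_pos open_matrix_ball) blast
 ultimately show False by simp
qed

text \<open>By the substitution \<open>s = y\<^sup>* y + t\<close>, the mass of the ball times that of \<open>{s. tr s <= 1}\<close>
 is at most the volume of the unit ball times the mass of \<open>{t. tr t <= 1}\<close>.\<close>
proposition ball_mass_finite:
 assumes e: "-1 < e" shows "ball_mass e TYPE('n::finite) < \<infinity>"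
proof -
 let ?q = "real CARD('n)"
 define S where "S = {s :: complex^'n^'n. Re (trace s) <= 1}"
 have [measurable]: "S \<in> sets borel" unfolding S_def by measurable
 define I where "I = (\<integral>\<^sup>+s. indicator S s * ennreal (det_power (e + ?q) (s :: complex^'n^'n)) \<partial>hermitian_lebesgue)"
 have "ball_mass e TYPE('n) * I = (\<integral>\<^sup>+s. (\<integral>\<^sup>+w. indicator S s * ennreal (det_power e (mat 1 - ctranspose w ** (w :: complex^'n^'n))) \<partial>lborel)
    * ennreal (det_power (e + ?q) (s :: complex^'n^'n)) \<partial>hermitian_lebesgue)"
  unfolding I_def ball_mass_def by (simp add: nn_integral_cmult mult_ac flip: nn_integral_cmult)
 also have "\<dots> = (\<integral>\<^sup>+y. (\<integral>\<^sup>+t. indicator S (ctranspose y ** y + t) * ennreal (det_power e t) \<partial>hermitian_lebesgue) \<partial>(lborel :: (complex^'n^'n) measure))"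
  using nn_integral_polar_shift[of "%p. indicator S (fst p)" e] by simp
 also have "\<dots> <= (\<integral>\<^sup>+y. (\<integral>\<^sup>+t. indicator (cball 0 1) y * (indicator (cball 0 1) t * ennreal (det_power e (t :: complex^'n^'n))) \<partial>hermitian_lebesgue) \<partial>(lborel :: (complex^'n^'n) measure))"
 proof (intro nn_integral_mono)
  fix y t :: "complex^'n^'n"
  show "indicator S (ctranspose y ** y + t) * ennreal (det_power e t)
    <= indicator (cball 0 1) y * (indicator (cball 0 1) t * ennreal (det_power e t))"
  proof (cases "t \<in> pos_def \<and> ctranspose y ** y + t \<in> S")
   case True
   then have t: "t \<in> psd" and le: "(norm y)\<^sup>2 + Re (trace t) <= 1"
    by (auto simp: pos_def_psd S_def trace_add Re_trace_gram)
   have "(norm y)\<^sup>2 <= 1" using le Re_trace_nonneg[OF t] by linarith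
   then have "norm y <= 1" by (simp add: power_le_one_iff abs_square_le_1)
   moreover have "norm t <= 1" using norm_le_trace[OF t] le zero_le_power2[of "norm y"] by linarith
   ultimately show ?thesis using True by simp
  qed (auto simp: det_power_def)
 qed
 also have "\<dots> = emeasure lborel (cball (0 :: complex^'n^'n) 1) *
   (\<integral>\<^sup>+t. indicator (cball 0 1) t * ennreal (det_power e (t :: complex^'n^'n)) \<partial>hermitian_lebesgue)"
  by (simp add: nn_integral_cmult nn_integral_multc)
 also have "\<dots> < \<infinity>"
  using nn_integral_det_power_finite[OF e, of 1, where 'n = 'n] emeasure_lborel_cball_finite[of "0 :: complex^'n^'n" 1]
  by (simp add: ennreal_mult_less_top)
 finally have fin: "ball_mass e TYPE('n) * I < \<infinity>" .
 have "I ~= 0"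
 proof
  assume "I = 0"
  then have "AE s in hermitian_lebesgue. indicator S s * ennreal (det_power (e + ?q) (s :: complex^'n^'n)) = 0"
   unfolding I_def by (subst (asm) nn_integral_0_iff_AE) simp_all
  then have AE: "AE A in lborel. indicator S (hermitian_of A) * ennreal (det_power (e + ?q) (hermitian_of A :: complex^'n^'n)) = 0"
   unfolding hermitian_lebesgue_def by (subst (asm) AE_distr_iff) simp_all
  obtain T where T: "open T" "pos_def = hermitian \<inter> (T :: (complex^'n^'n) set)"
   using openin_pos_def by (auto simp: openin_open)
  define V where "V = hermitian_of -` (T \<inter> {s :: complex^'n^'n. Re (trace s) < 1})"
  have "open V"
   unfolding V_def
   by (intro open_vimage open_Int T(1) open_Collect_less continuous_on_Re continuous_on_trace continuous_on_id continuous_on_const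
     linear_continuous_on[OF linear_hermitian_of[THEN linear_conv_bounded_linear[THEN iffD1]]])
  have h: "(1 / (2 * ?q)) *\<^sub>R mat 1 \<in> (pos_def :: (complex^'n^'n) set)"
   by (intro pos_def_scaleR mat_1_pos_def) simp
  have tr: "trace ((1 / (2 * ?q)) *\<^sub>R mat 1 :: complex^'n^'n) = 1 / 2"
   by (simp add: trace_def mat_def scaleR_conv_of_real[where 'a = complex])
  obtain A where A: "hermitian_of A = ((1 / (2 * ?q)) *\<^sub>R mat 1 :: complex^'n^'n)"
   using hermitian_of_surj[of "(1 / (2 * ?q)) *\<^sub>R mat 1 :: complex^'n^'n"] h T(2) by blast
  have "A \<in> V" using h T(2) by (auto simp: V_def A tr)
  have "A \<notin> V" if "indicator S (hermitian_of A) * ennreal (det_power (e + ?q) (hermitian_of A :: complex^'n^'n)) = 0" for A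
  proof
   assume "A \<in> V"
   then have "hermitian_of A \<in> pos_def" "hermitian_of A \<in> S"
    using T(2) hermitian_of_hermitian[of A] by (auto simp: V_def S_def)
   then show False using that pos_def_det(1)[of "hermitian_of A"] by (simp add: det_power_def ennreal_eq_0_iff)
  qed
  with AE have "AE A in lborel. A \<notin> V" by (auto elim: eventually_mono)
  then have "emeasure lborel V = 0"
   using \<open>open V\<close> by (subst (asm) AE_iff_measurable[of V]) auto
  then show False using lborel_open_pos[OF \<open>open V\<close>] \<open>A \<in> V\<close> by auto
 qed
 with fin show ?thesis by (auto simp: ennreal_mult_less_top)
qed

section \<open>Rotation invariance and the associativity identity\<close>

definition ball_density :: "real => complex^'n^'n => real" where
 "ball_density e w = det_power e (mat 1 - ctranspose w ** w)"

lemma borel_measurable_ball_density [measurable (raw)]: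
 fixes f :: "'a => complex^'n^'n"
 assumes [measurable]: "f \<in> borel_measurable M" shows "(%x. ball_density e (f x)) \<in> borel_measurable M"
 unfolding ball_density_def by measurable

lemma ball_density_nonneg: "0 <= ball_density e w"
 by (simp add: ball_density_def det_power_nonneg)

lemma ball_density_outside: "w \<notin> matrix_ball ==> ball_density e w = 0"
 by (simp add: ball_density_def det_power_def matrix_ball_def)

lemma ball_density_pos: "w \<in> matrix_ball ==> 0 < ball_density e w"
 using pos_def_det(1)[of "mat 1 - ctranspose w ** w"]
 by (simp add: ball_density_def det_power_def matrix_ball_def)

lemma matrix_ball_ctranspose_iff: "ctranspose w \<in> matrix_ball \<longleftrightarrow> (w :: complex^'n^'n) \<in> matrix_ball"
 using matrix_ball_ctranspose[of w] matrix_ball_ctranspose[of "ctranspose w"] by auto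

lemma ball_density_ctranspose: "ball_density e (ctranspose w) = ball_density e (w :: complex^'n^'n)"
 using matrix_ball_ctranspose_iff[of w]
 by (simp add: ball_density_def det_power_def matrix_ball_def det_one_minus_mult_commute[of w "ctranspose w"])

lemma nn_integral_ball_density: "(\<integral>\<^sup>+w. ennreal (ball_density e (w :: complex^'n^'n)) \<partial>lborel) = ball_mass e TYPE('n::finite)"
 by (simp add: ball_mass_def ball_density_def)

lemma nn_integral_ctranspose:
 fixes g :: "complex^'n^'n => ennreal"
 assumes "g \<in> borel_measurable borel"
 shows "(\<integral>\<^sup>+w. g (ctranspose w) \<partial>lborel) = (\<integral>\<^sup>+w. g w \<partial>lborel)"
 by (rule nn_integral_isometry[OF linear_ctranspose norm_ctranspose assms])

text \<open>With \<open>\<kappa> = \<beta>\<^sup>-\<^sup>1 \<alpha>\<close>, the row \<open>(\<gamma>, \<delta>)\<close> is \<open>(1, - \<kappa>\<^sup>* )\<close>, normalised from the left by the inverse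
 square root of \<open>1 + \<kappa>\<^sup>* \<kappa>\<close>; it is orthogonal to the row \<open>(\<alpha>, \<beta>)\<close>.\<close>
lemma unitary_completion:
 fixes \<alpha> \<beta> :: "complex^'n^'n"
 assumes \<beta>: "invertible \<beta>" and unit: "\<alpha> ** ctranspose \<alpha> + \<beta> ** ctranspose \<beta> = mat 1"
 shows "\<exists>\<gamma> \<delta> :: complex^'n^'n. \<forall>v u. ctranspose (\<alpha> ** v + \<beta> ** u) ** (\<alpha> ** v + \<beta> ** u)
   + ctranspose (\<gamma> ** v + \<delta> ** u) ** (\<gamma> ** v + \<delta> ** (u :: complex^'n^'n)) = ctranspose v ** v + ctranspose u ** u"
proof -
 obtain \<beta>' where \<beta>': "\<beta> ** \<beta>' = mat 1" using \<beta> by (auto simp: invertible_right_inverse)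
 define \<kappa> where "\<kappa> = \<beta>' ** \<alpha>"
 have \<beta>\<kappa>: "\<beta> ** \<kappa> = \<alpha>" by (simp add: \<kappa>_def matrix_mul_assoc \<beta>')
 have pd: "mat 1 + ctranspose \<kappa> ** \<kappa> \<in> pos_def" by (intro pos_def_add_psd mat_1_pos_def psd_gram)
 define S where "S = matrix_root (mat 1 + ctranspose \<kappa> ** \<kappa>)"
 have S: "S \<in> pos_def" "S ** S = mat 1 + ctranspose \<kappa> ** \<kappa>"
  using pd by (simp_all add: S_def matrix_root_pos_def matrix_root_square pos_def_psd)
 obtain \<gamma> where \<gamma>: "S ** \<gamma> = mat 1" using pos_def_invertible[OF S(1)] by (auto simp: invertible_right_inverse)
 have \<gamma>': "\<gamma> ** S = mat 1" using \<gamma> by (simp add: matrix_left_right_inverse)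
 have "ctranspose \<gamma> ** S = mat 1"
  using arg_cong[OF \<gamma>, of ctranspose] by (simp add: ctranspose_mult pos_def_hermitian[OF S(1)])
 then have "ctranspose \<gamma> ** (S ** \<gamma>) = \<gamma>" by (simp add: matrix_mul_assoc)
 then have \<gamma>H: "ctranspose \<gamma> = \<gamma>" by (simp add: \<gamma>)
 define \<delta> where "\<delta> = - (\<gamma> ** ctranspose \<kappa>)"
 have orth: "\<gamma> ** ctranspose \<alpha> + \<delta> ** ctranspose \<beta> = 0"
 proof -
  have "\<delta> ** ctranspose \<beta> = - (\<gamma> ** ctranspose (\<beta> ** \<kappa>))"
   by (simp add: \<delta>_def ctranspose_mult matrix_mult_simps matrix_mul_assoc)
  then show ?thesis by (simp add: \<beta>\<kappa>)
 qed
 have orth': "\<alpha> ** ctranspose \<gamma> + \<beta> ** ctranspose \<delta> = 0"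
  using arg_cong[OF orth, of ctranspose] by (simp add: ctranspose_simps)
 have unit': "\<gamma> ** ctranspose \<gamma> + \<delta> ** ctranspose \<delta> = mat 1"
 proof -
  have "\<gamma> ** ctranspose \<gamma> + \<delta> ** ctranspose \<delta> = \<gamma> ** (S ** S) ** \<gamma>"
   by (simp add: \<delta>_def S(2) ctranspose_simps \<gamma>H matrix_mult_simps matrix_mul_assoc)
  also have "\<dots> = (\<gamma> ** S) ** (S ** \<gamma>)" by (simp add: matrix_mul_assoc)
  finally show ?thesis by (simp add: \<gamma> \<gamma>')
 qed
 define L where "L p = (\<alpha> ** fst p + \<beta> ** snd p, \<gamma> ** fst p + \<delta> ** snd p)" for p :: "(complex^'n^'n) \<times> (complex^'n^'n)"
 define L' where "L' p = (ctranspose \<alpha> ** fst p + ctranspose \<gamma> ** snd p, ctranspose \<beta> ** fst p + ctranspose \<delta> ** snd p)"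
  for p :: "(complex^'n^'n) \<times> (complex^'n^'n)"
 have LL': "L (L' p) = p" for p
 proof -
  have "fst (L (L' p)) = (\<alpha> ** ctranspose \<alpha> + \<beta> ** ctranspose \<beta>) ** fst p + (\<alpha> ** ctranspose \<gamma> + \<beta> ** ctranspose \<delta>) ** snd p"
   by (simp add: L_def L'_def matrix_mult_simps matrix_mul_assoc add_ac)
  moreover have "snd (L (L' p)) = (\<gamma> ** ctranspose \<alpha> + \<delta> ** ctranspose \<beta>) ** fst p + (\<gamma> ** ctranspose \<gamma> + \<delta> ** ctranspose \<delta>) ** snd p"
   by (simp add: L_def L'_def matrix_mult_simps matrix_mul_assoc add_ac)
  ultimately show ?thesis by (simp add: prod_eq_iff unit unit' orth orth' matrix_mult_simps)
 qed
 have "linear L'" by (rule linearI) (simp_all add: L'_def matrix_mult_simps algebra_simps)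
 moreover have "inj L'" by (rule inj_on_inverseI[of _ L]) (rule LL')
 ultimately have surj: "surj L'" by (rule linear_injective_imp_surjective) simp
 have L'L: "L' (L p) = p" for p
 proof -
  obtain z where "p = L' z" using surj by blast
  then show ?thesis by (simp add: LL')
 qed
 show ?thesis
 proof (intro exI allI)
  fix v u :: "complex^'n^'n"
  define y where "y = \<alpha> ** v + \<beta> ** u"
  define x where "x = \<gamma> ** v + \<delta> ** u"
  have "L (v, u) = (y, x)" by (simp add: L_def y_def x_def)
  then have "L' (y, x) = (v, u)" using L'L[of "(v, u)"] by simp
  then have vu: "ctranspose \<alpha> ** y + ctranspose \<gamma> ** x = v" "ctranspose \<beta> ** y + ctranspose \<delta> ** x = u"
   by (simp_all add: L'_def)
  have "ctranspose y ** y + ctranspose x ** x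
    = ctranspose v ** (ctranspose \<alpha> ** y + ctranspose \<gamma> ** x) + ctranspose u ** (ctranspose \<beta> ** y + ctranspose \<delta> ** x)"
  proof -
   have "ctranspose y = ctranspose v ** ctranspose \<alpha> + ctranspose u ** ctranspose \<beta>"
    and "ctranspose x = ctranspose v ** ctranspose \<gamma> + ctranspose u ** ctranspose \<delta>"
    by (simp_all add: y_def x_def ctranspose_simps)
   then show ?thesis by (simp add: matrix_mult_simps matrix_mul_assoc add_ac)
  qed
  then show "ctranspose (\<alpha> ** v + \<beta> ** u) ** (\<alpha> ** v + \<beta> ** u)
   + ctranspose (\<gamma> ** v + \<delta> ** u) ** (\<gamma> ** v + \<delta> ** u) = ctranspose v ** v + ctranspose u ** u"
   by (simp add: vu flip: y_def x_def)
 qed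
qed

text \<open>The completed block matrix acts as an isometry on pairs of matrices and preserves \<open>v\<^sup>* v + u\<^sup>* u\<close>,
 hence both Lebesgue measure and the weight.\<close>
lemma nn_integral_gram_rotation:
 fixes \<alpha> \<beta> :: "complex^'n^'n" and \<Phi> :: "complex^'n^'n => ennreal"
 assumes \<beta>: "invertible \<beta>" and unit: "\<alpha> ** ctranspose \<alpha> + \<beta> ** ctranspose \<beta> = mat 1"
  and \<Phi>[measurable]: "\<Phi> \<in> borel_measurable borel"
 shows "(\<integral>\<^sup>+v. (\<integral>\<^sup>+u. \<Phi> (\<alpha> ** v + \<beta> ** u) * ennreal (det_power n (mat 1 - ctranspose v ** v - ctranspose u ** u)) \<partial>lborel) \<partial>lborel)
  = (\<integral>\<^sup>+y. (\<integral>\<^sup>+x. \<Phi> y * ennreal (det_power n (mat 1 - ctranspose y ** y - ctranspose x ** (x :: complex^'n^'n))) \<partial>lborel) \<partial>lborel)"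
proof -
 obtain \<gamma> \<delta> :: "complex^'n^'n" where G: "!!v u. ctranspose (\<alpha> ** v + \<beta> ** u) ** (\<alpha> ** v + \<beta> ** u)
   + ctranspose (\<gamma> ** v + \<delta> ** u) ** (\<gamma> ** v + \<delta> ** (u :: complex^'n^'n)) = ctranspose v ** v + ctranspose u ** u"
  using unitary_completion[OF \<beta> unit] by blast
 define L where "L p = (\<alpha> ** fst p + \<beta> ** snd p, \<gamma> ** fst p + \<delta> ** snd p)" for p :: "(complex^'n^'n) \<times> (complex^'n^'n)"
 define f where "f p = \<Phi> (fst p) * ennreal (det_power n (mat 1 - (ctranspose (fst p) ** fst p + ctranspose (snd p) ** snd p)))"
  for p :: "(complex^'n^'n) \<times> (complex^'n^'n)"
 have fm[measurable]: "f \<in> borel_measurable (borel \<Otimes>\<^sub>M borel)" unfolding f_def by measurable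
 have fm': "f \<in> borel_measurable borel" using fm by (simp add: borel_prod)
 have lin: "linear L" by (rule linearI) (simp_all add: L_def matrix_mult_simps algebra_simps)
 have n2: "(norm p)\<^sup>2 = Re (trace (ctranspose (fst p) ** fst p + ctranspose (snd p) ** snd p))" for p :: "(complex^'n^'n) \<times> (complex^'n^'n)"
  by (simp add: norm_prod_def trace_add Re_trace_gram)
 have "(norm (L p))\<^sup>2 = (norm p)\<^sup>2" for p
 proof -
  have "(norm (L p))\<^sup>2 = Re (trace (ctranspose (fst (L p)) ** fst (L p) + ctranspose (snd (L p)) ** snd (L p)))"
   by (rule n2)
  also have "\<dots> = Re (trace (ctranspose (fst p) ** fst p + ctranspose (snd p) ** snd p))"
   unfolding L_def fst_conv snd_conv G ..
  also have "\<dots> = (norm p)\<^sup>2" by (rule n2[symmetric])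
  finally show ?thesis .
 qed
 then have iso: "norm (L p) = norm p" for p by (simp add: power2_eq_iff_nonneg)
 have fL: "f (L p) = \<Phi> (\<alpha> ** fst p + \<beta> ** snd p) * ennreal (det_power n (mat 1 - (ctranspose (fst p) ** fst p + ctranspose (snd p) ** snd p)))" for p
  using G[of "fst p" "snd p"] by (simp add: f_def L_def)
 have [measurable]: "(%p. f (L p)) \<in> borel_measurable (borel \<Otimes>\<^sub>M borel)" unfolding fL by measurable
 have "(\<integral>\<^sup>+v. (\<integral>\<^sup>+u. f (L (v, u)) \<partial>lborel) \<partial>lborel) = (\<integral>\<^sup>+p. f (L p) \<partial>(lborel \<Otimes>\<^sub>M lborel))"
  by (rule lborel.nn_integral_fst) simp
 also have "\<dots> = (\<integral>\<^sup>+p. f p \<partial>(lborel \<Otimes>\<^sub>M lborel))"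
  unfolding lborel_prod by (rule nn_integral_isometry[OF lin iso fm'])
 also have "\<dots> = (\<integral>\<^sup>+y. (\<integral>\<^sup>+x. f (y, x) \<partial>lborel) \<partial>lborel)"
  by (rule lborel.nn_integral_fst[symmetric]) simp
 finally show ?thesis unfolding fL by (simp add: f_def diff_diff_eq)
qed

text \<open>Apply the rotation identity to the row \<open>(h\<^sup>-\<^sup>1 a, h\<^sup>-\<^sup>1 b)\<close> and substitute \<open>u = \<theta> \<surd>(1 - v\<^sup>* v)\<close>, which
 raises the exponent of the weight of \<open>v\<close> by \<open>q\<close>.\<close>
proposition nn_integral_root_mixture:
 fixes a b h :: "complex^'n^'n" and \<Phi> :: "complex^'n^'n => ennreal"
 assumes b: "invertible b" and h: "h \<in> pos_def" and hh: "h ** h = a ** ctranspose a + b ** ctranspose b"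
  and \<Phi>[measurable]: "\<Phi> \<in> borel_measurable borel"
 shows "ball_mass n TYPE('n) * (\<integral>\<^sup>+v. \<Phi> (h ** v) * ennreal (ball_density (n + real CARD('n)) v) \<partial>lborel)
  = (\<integral>\<^sup>+v. (\<integral>\<^sup>+\<theta>. \<Phi> (a ** v + b ** \<theta> ** matrix_root (mat 1 - ctranspose v ** v)) * ennreal (ball_density n \<theta>) \<partial>lborel)
    * ennreal (ball_density (n + real CARD('n)) v) \<partial>lborel)"
proof -
 obtain h' where h': "h ** h' = mat 1" using pos_def_invertible[OF h] by (auto simp: invertible_right_inverse)
 have h'': "h' ** h = mat 1" using h' by (simp add: matrix_left_right_inverse)
 have h'H: "h ** ctranspose h' = mat 1"
  using arg_cong[OF h'', of ctranspose] by (simp add: ctranspose_mult pos_def_hermitian[OF h])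
 define \<alpha> where "\<alpha> = h' ** a"
 define \<beta> where "\<beta> = h' ** b"
 have "invertible h'" using h'' h' by (auto simp: invertible_right_inverse)
 then have \<beta>: "invertible \<beta>" unfolding \<beta>_def using b by (rule invertible_mult)
 have "\<alpha> ** ctranspose \<alpha> + \<beta> ** ctranspose \<beta> = h' ** (h ** h) ** ctranspose h'"
  by (simp add: \<alpha>_def \<beta>_def hh ctranspose_mult matrix_mult_simps matrix_mul_assoc)
 also have "\<dots> = (h' ** h) ** (h ** ctranspose h')" by (simp add: matrix_mul_assoc)
 finally have unit: "\<alpha> ** ctranspose \<alpha> + \<beta> ** ctranspose \<beta> = mat 1" by (simp add: h'' h'H)
 have ab: "h ** (\<alpha> ** v + \<beta> ** u) = a ** v + b ** u" for v u :: "complex^'n^'n"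
  by (simp add: \<alpha>_def \<beta>_def matrix_mult_simps matrix_mul_assoc h')
 have dn: "(\<integral>\<^sup>+u. \<Psi> u * ennreal (det_power n (mat 1 - ctranspose v ** v - ctranspose u ** u)) \<partial>lborel)
   = (\<integral>\<^sup>+\<theta>. \<Psi> (\<theta> ** matrix_root (mat 1 - ctranspose v ** v)) * ennreal (ball_density n \<theta>) \<partial>lborel)
    * ennreal (ball_density (n + real CARD('n)) v)"
  if "\<Psi> \<in> borel_measurable borel" for \<Psi> :: "complex^'n^'n => ennreal" and v :: "complex^'n^'n"
  using nn_integral_scaled_ball[OF that, of n "mat 1 - ctranspose v ** v"] by (simp add: ball_density_def mult.commute)
 have "(\<integral>\<^sup>+v. (\<integral>\<^sup>+\<theta>. \<Phi> (a ** v + b ** \<theta> ** matrix_root (mat 1 - ctranspose v ** v)) * ennreal (ball_density n \<theta>) \<partial>lborel)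
    * ennreal (ball_density (n + real CARD('n)) v) \<partial>lborel)
  = (\<integral>\<^sup>+v. (\<integral>\<^sup>+u. \<Phi> (h ** (\<alpha> ** v + \<beta> ** u)) * ennreal (det_power n (mat 1 - ctranspose v ** v - ctranspose u ** u)) \<partial>lborel) \<partial>lborel)"
 proof (rule nn_integral_cong)
  fix v :: "complex^'n^'n"
  have "(%u. \<Phi> (h ** (\<alpha> ** v + \<beta> ** u))) \<in> borel_measurable borel" by measurable
  from dn[OF this, of v]
  show "(\<integral>\<^sup>+\<theta>. \<Phi> (a ** v + b ** \<theta> ** matrix_root (mat 1 - ctranspose v ** v)) * ennreal (ball_density n \<theta>) \<partial>lborel)
    * ennreal (ball_density (n + real CARD('n)) v)
   = (\<integral>\<^sup>+u. \<Phi> (h ** (\<alpha> ** v + \<beta> ** u)) * ennreal (det_power n (mat 1 - ctranspose v ** v - ctranspose u ** u)) \<partial>lborel)"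
   unfolding ab unfolding matrix_mul_assoc by simp
 qed
 also have "\<dots> = (\<integral>\<^sup>+y. (\<integral>\<^sup>+x. \<Phi> (h ** y) * ennreal (det_power n (mat 1 - ctranspose y ** y - ctranspose x ** (x :: complex^'n^'n))) \<partial>lborel) \<partial>lborel)"
  by (rule nn_integral_gram_rotation[OF \<beta> unit, of "%y. \<Phi> (h ** y)"]) simp
 also have "\<dots> = (\<integral>\<^sup>+y. ball_mass n TYPE('n) * (\<Phi> (h ** y) * ennreal (ball_density (n + real CARD('n)) y)) \<partial>lborel)"
 proof (rule nn_integral_cong)
  fix y :: "complex^'n^'n"
  have "(\<integral>\<^sup>+x. \<Phi> (h ** y) * ennreal (det_power n (mat 1 - ctranspose y ** y - ctranspose x ** (x :: complex^'n^'n))) \<partial>lborel)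
   = (\<integral>\<^sup>+\<theta>. \<Phi> (h ** y) * ennreal (ball_density n (\<theta> :: complex^'n^'n)) \<partial>lborel) * ennreal (ball_density (n + real CARD('n)) y)"
   by (rule dn) simp
  also have "(\<integral>\<^sup>+\<theta>. \<Phi> (h ** y) * ennreal (ball_density n (\<theta> :: complex^'n^'n)) \<partial>lborel) = \<Phi> (h ** y) * ball_mass n TYPE('n)"
   by (subst nn_integral_cmult) (simp_all add: nn_integral_ball_density)
  finally show "(\<integral>\<^sup>+x. \<Phi> (h ** y) * ennreal (det_power n (mat 1 - ctranspose y ** y - ctranspose x ** (x :: complex^'n^'n))) \<partial>lborel)
   = ball_mass n TYPE('n) * (\<Phi> (h ** y) * ennreal (ball_density (n + real CARD('n)) y))"
   by (simp only: ac_simps)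
 qed
 also have "\<dots> = ball_mass n TYPE('n) * (\<integral>\<^sup>+v. \<Phi> (h ** v) * ennreal (ball_density (n + real CARD('n)) v) \<partial>lborel)"
  by (rule nn_integral_cmult) simp
 finally show ?thesis by simp
qed

definition sum_square :: "complex^'n^'n => complex^'n^'n => complex^'n^'n => complex^'n^'n" where
 "sum_square r s w = r ** r + s ** s + r ** w ** s + ctranspose (r ** w ** s)"

lemma borel_measurable_sum_square [measurable (raw)]:
 fixes f g h :: "'a => complex^'n^'n"
 assumes [measurable]: "f \<in> borel_measurable M" "g \<in> borel_measurable M" "h \<in> borel_measurable M"
 shows "(%x. sum_square (f x) (g x) (h x)) \<in> borel_measurable M"
 unfolding sum_square_def by measurable

lemma sum_square_eq:
 assumes "r \<in> psd" "s \<in> psd"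
 shows "sum_square r s w = (s + r ** w) ** ctranspose (s + r ** w) + r ** (mat 1 - w ** ctranspose w) ** r"
 using assms by (simp add: sum_square_def ctranspose_simps psd_hermitian matrix_mult_simps matrix_mul_assoc add_ac)

lemma matrix_cball_ctranspose_psd:
 assumes w: "(w :: complex^'n^'n) \<in> matrix_cball" shows "mat 1 - w ** ctranspose w \<in> psd"
proof -
 have "norm (ctranspose w *v x) <= norm x" for x :: "complex^'n"
 proof -
  let ?y = "ctranspose w *v x"
  have "(norm ?y)\<^sup>2 = x \<bullet> (w *v ?y)" by (simp add: inner_matrix_vector dot_square_norm)
  also have "\<dots> <= norm x * norm (w *v ?y)" by (rule norm_cauchy_schwarz)
  also have "\<dots> <= norm x * norm ?y" using w by (intro mult_left_mono) (auto simp: matrix_cball_def)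
  finally show ?thesis by (cases "?y = 0") (auto simp: power2_eq_square)
 qed
 then have "0 <= x \<bullet> ((mat 1 - ctranspose (ctranspose w) ** ctranspose w) *v x)" for x
  unfolding inner_one_minus_gram by (simp add: power_mono)
 then show ?thesis by (intro psdI) (simp_all add: ctranspose_simps)
qed

lemma sum_square_psd:
 assumes "r \<in> psd" "s \<in> psd" "w \<in> matrix_cball" shows "sum_square r s w \<in> psd"
 unfolding sum_square_eq[OF assms(1,2)]
 using psd_congruence[OF matrix_cball_ctranspose_psd[OF assms(3)], of r] psd_hermitian[OF assms(1)]
 by (intro psd_add psd_gram') simp

text \<open>The mixture formula with \<open>a = s + r w\<close> and \<open>b = r \<surd>(1 - w w\<^sup>* )\<close>, for which \<open>a a\<^sup>* + b b\<^sup>*\<close> is the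
 square of the first component of the product of \<open>r\<close> and \<open>s\<close>.\<close>
lemma nn_integral_product_mixture:
 fixes r s w :: "complex^'n^'n" and \<Phi> :: "complex^'n^'n => ennreal"
 assumes r: "r \<in> pos_def" and s: "s \<in> psd" and w: "w \<in> matrix_ball"
  and \<Phi>[measurable]: "\<Phi> \<in> borel_measurable borel"
 shows "ball_mass n TYPE('n) * (\<integral>\<^sup>+v. \<Phi> (matrix_root (sum_square r s w) ** v) * ennreal (ball_density (n + real CARD('n)) v) \<partial>lborel)
  = (\<integral>\<^sup>+v. (\<integral>\<^sup>+\<theta>. \<Phi> ((s + r ** w) ** v + r ** matrix_root (mat 1 - w ** ctranspose w) ** \<theta> ** matrix_root (mat 1 - ctranspose v ** v))
     * ennreal (ball_density n \<theta>) \<partial>lborel) * ennreal (ball_density (n + real CARD('n)) v) \<partial>lborel)"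
proof -
 define c where "c = matrix_root (mat 1 - w ** ctranspose w)"
 have pd: "mat 1 - w ** ctranspose w \<in> pos_def"
  using matrix_ball_ctranspose[OF w] by (simp add: matrix_ball_def)
 have c: "c \<in> pos_def" "c ** c = mat 1 - w ** ctranspose w"
  using pd by (simp_all add: c_def matrix_root_pos_def matrix_root_square pos_def_psd)
 have b: "invertible (r ** c)" using r c by (intro invertible_mult pos_def_invertible)
 have "(r ** c) ** ctranspose (r ** c) = r ** (c ** c) ** r"
  by (simp add: ctranspose_mult pos_def_hermitian[OF c(1)] pos_def_hermitian[OF r] matrix_mul_assoc)
 then have eq: "sum_square r s w = (s + r ** w) ** ctranspose (s + r ** w) + (r ** c) ** ctranspose (r ** c)"
  by (simp add: sum_square_eq[OF pos_def_psd[OF r] s] c(2))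
 have "ctranspose (ctranspose (r ** c)) ** ctranspose (r ** c) \<in> pos_def"
  using pos_def_congruence[OF mat_1_pos_def, of "ctranspose (r ** c)"] b by (simp add: invertible_det_nz det_ctranspose)
 then have pd2: "sum_square r s w \<in> pos_def"
  unfolding eq by (subst add.commute) (intro pos_def_add_psd psd_gram', simp)
 have hh: "matrix_root (sum_square r s w) ** matrix_root (sum_square r s w)
   = (s + r ** w) ** ctranspose (s + r ** w) + (r ** c) ** ctranspose (r ** c)"
  unfolding matrix_root_square[OF pos_def_psd[OF pd2]] by (rule eq)
 show ?thesis
  using nn_integral_root_mixture[OF b matrix_root_pos_def[OF pd2] hh \<Phi>, of n] unfolding c_def .
qed

text \<open>Both sides, times the mass of the ball, are one integral over three independent matrices in the
 ball, \<open>w\<close> and \<open>v\<close> with exponent \<open>n + q\<close> and \<open>\<theta>\<close> with exponent \<open>n\<close>.\<close>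
proposition nn_integral_associativity:
 fixes r s t :: "complex^'n^'n" and \<Phi> :: "complex^'n^'n => ennreal"
 assumes r: "r \<in> pos_def" and s: "s \<in> psd" and t: "t \<in> pos_def" and n: "n > -1"
  and \<Phi>[measurable]: "\<Phi> \<in> borel_measurable borel"
 defines "m \<equiv> n + real CARD('n)"
 shows "(\<integral>\<^sup>+w. (\<integral>\<^sup>+v. \<Phi> (r ** w ** s + matrix_root (sum_square r s w) ** v ** t) * ennreal (ball_density m v) \<partial>lborel)
    * ennreal (ball_density m w) \<partial>lborel)
  = (\<integral>\<^sup>+w. (\<integral>\<^sup>+v. \<Phi> (r ** v ** matrix_root (sum_square s t w) + s ** w ** t) * ennreal (ball_density m v) \<partial>lborel)
    * ennreal (ball_density m w) \<partial>lborel)" (is "?A = ?B")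
proof -
 let ?J = "ball_mass n TYPE('n)"
 define root1 where "root1 w = matrix_root (mat 1 - w ** ctranspose w)" for w :: "complex^'n^'n"
 define root2 where "root2 w = matrix_root (mat 1 - ctranspose w ** w)" for w :: "complex^'n^'n"
 have [measurable]: "root1 \<in> borel_measurable borel" "root2 \<in> borel_measurable borel"
  unfolding root1_def root2_def by measurable
 define \<Theta> where "\<Theta> w v \<theta> = r ** w ** s + s ** v ** t + r ** w ** v ** t + r ** root1 w ** \<theta> ** root2 v ** t"
  for w v \<theta> :: "complex^'n^'n"
 have [measurable]: "(%x. \<Theta> (f x) (g x) (h x)) \<in> borel_measurable M"
  if [measurable]: "f \<in> borel_measurable M" "g \<in> borel_measurable M" "h \<in> borel_measurable M" for f g h and M :: "'b measure"
  unfolding \<Theta>_def by measurable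
 have A: "?J * (\<integral>\<^sup>+v. \<Phi> (r ** w ** s + matrix_root (sum_square r s w) ** v ** t) * ennreal (ball_density m v) \<partial>lborel) * ennreal (ball_density m w)
   = (\<integral>\<^sup>+v. (\<integral>\<^sup>+\<theta>. \<Phi> (\<Theta> w v \<theta>) * ennreal (ball_density n \<theta>) \<partial>lborel) * ennreal (ball_density m v) \<partial>lborel) * ennreal (ball_density m w)" for w
 proof (cases "w \<in> matrix_ball")
  case True
  have "?J * (\<integral>\<^sup>+v. \<Phi> (r ** w ** s + matrix_root (sum_square r s w) ** v ** t) * ennreal (ball_density m v) \<partial>lborel)
   = (\<integral>\<^sup>+v. (\<integral>\<^sup>+\<theta>. \<Phi> (r ** w ** s + ((s + r ** w) ** v + r ** root1 w ** \<theta> ** root2 v) ** t)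
     * ennreal (ball_density n \<theta>) \<partial>lborel) * ennreal (ball_density m v) \<partial>lborel)"
   using nn_integral_product_mixture[OF r s True, of "%N. \<Phi> (r ** w ** s + N ** t)" n]
   by (simp add: m_def root1_def root2_def)
  also have "(%v \<theta>. r ** w ** s + ((s + r ** w) ** v + r ** root1 w ** \<theta> ** root2 v) ** t) = \<Theta> w"
   by (simp add: fun_eq_iff \<Theta>_def matrix_mult_simps matrix_mul_assoc add_ac)
  finally show ?thesis by simp
 qed (simp add: ball_density_outside)
 have B: "?J * (\<integral>\<^sup>+v. \<Phi> (r ** v ** matrix_root (sum_square s t w) + s ** w ** t) * ennreal (ball_density m v) \<partial>lborel) * ennreal (ball_density m w)
   = (\<integral>\<^sup>+v. (\<integral>\<^sup>+\<theta>. \<Phi> (\<Theta> v w \<theta>) * ennreal (ball_density n \<theta>) \<partial>lborel) * ennreal (ball_density m v) \<partial>lborel) * ennreal (ball_density m w)" for w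
 proof (cases "w \<in> matrix_ball")
  case True
  define k where "k = matrix_root (sum_square s t w)"
  have kH: "ctranspose k = k" unfolding k_def by (rule psd_hermitian[OF matrix_root_psd])
  have sq: "sum_square t s (ctranspose w) = sum_square s t w"
   by (simp add: sum_square_def ctranspose_mult psd_hermitian[OF s] pos_def_hermitian[OF t] matrix_mul_assoc add_ac)
  have "(\<integral>\<^sup>+v. \<Phi> (r ** v ** k + s ** w ** t) * ennreal (ball_density m v) \<partial>lborel)
    = (\<integral>\<^sup>+v. \<Phi> (r ** ctranspose v ** k + s ** w ** t) * ennreal (ball_density m (ctranspose v)) \<partial>lborel)"
   by (rule nn_integral_ctranspose[symmetric]) simp
  also have "\<dots> = (\<integral>\<^sup>+v. \<Phi> (r ** ctranspose (k ** v) + s ** w ** t) * ennreal (ball_density m v) \<partial>lborel)"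
   by (simp add: ctranspose_mult kH matrix_mul_assoc ball_density_ctranspose)
  finally have "?J * (\<integral>\<^sup>+v. \<Phi> (r ** v ** k + s ** w ** t) * ennreal (ball_density m v) \<partial>lborel)
    = ?J * (\<integral>\<^sup>+v. \<Phi> (r ** ctranspose (k ** v) + s ** w ** t) * ennreal (ball_density m v) \<partial>lborel)" by simp
  also have "\<dots> = (\<integral>\<^sup>+v. (\<integral>\<^sup>+\<theta>. \<Phi> (r ** ctranspose ((s + t ** ctranspose w) ** v + t ** root2 w ** \<theta> ** root2 v) + s ** w ** t)
     * ennreal (ball_density n \<theta>) \<partial>lborel) * ennreal (ball_density m v) \<partial>lborel)"
   using nn_integral_product_mixture[OF t s matrix_ball_ctranspose[OF True], of "%N. \<Phi> (r ** ctranspose N + s ** w ** t)" n]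
   by (simp add: m_def root2_def sq k_def)
  also have "\<dots> = (\<integral>\<^sup>+v. (\<integral>\<^sup>+\<theta>. \<Phi> (r ** ctranspose ((s + t ** ctranspose w) ** ctranspose v + t ** root2 w ** \<theta> ** root2 (ctranspose v)) + s ** w ** t)
     * ennreal (ball_density n \<theta>) \<partial>lborel) * ennreal (ball_density m (ctranspose v)) \<partial>lborel)"
   by (rule nn_integral_ctranspose[symmetric]) simp
  also have "\<dots> = (\<integral>\<^sup>+v. (\<integral>\<^sup>+\<theta>. \<Phi> (r ** ctranspose ((s + t ** ctranspose w) ** ctranspose v + t ** root2 w ** ctranspose \<theta> ** root2 (ctranspose v)) + s ** w ** t)
     * ennreal (ball_density n (ctranspose \<theta>)) \<partial>lborel) * ennreal (ball_density m (ctranspose v)) \<partial>lborel)"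
   by (intro nn_integral_cong arg_cong2[of _ _ _ _ "(*)"] refl nn_integral_ctranspose[symmetric]) simp
  also have "\<dots> = (\<integral>\<^sup>+v. (\<integral>\<^sup>+\<theta>. \<Phi> (\<Theta> v w \<theta>) * ennreal (ball_density n \<theta>) \<partial>lborel) * ennreal (ball_density m v) \<partial>lborel)"
  proof -
   have rH: "ctranspose (root2 w) = root2 w" "ctranspose (root1 w) = root1 w" for w
    by (simp_all add: root1_def root2_def psd_hermitian[OF matrix_root_psd])
   have "root2 (ctranspose v) = root1 v" for v by (simp add: root1_def root2_def)
   then have "r ** ctranspose ((s + t ** ctranspose w) ** ctranspose v + t ** root2 w ** ctranspose \<theta> ** root2 (ctranspose v)) + s ** w ** t = \<Theta> v w \<theta>" for v \<theta>
    by (simp add: \<Theta>_def ctranspose_simps rH psd_hermitian[OF s] pos_def_hermitian[OF t] matrix_mult_simps matrix_mul_assoc add_ac)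
   then show ?thesis by (simp add: ball_density_ctranspose)
  qed
  finally show ?thesis by (simp add: k_def)
 qed (simp add: ball_density_outside)
 have "?J * ?A = (\<integral>\<^sup>+w. (\<integral>\<^sup>+v. (\<integral>\<^sup>+\<theta>. \<Phi> (\<Theta> w v \<theta>) * ennreal (ball_density n \<theta>) \<partial>lborel) * ennreal (ball_density m v) \<partial>lborel) * ennreal (ball_density m w) \<partial>lborel)"
  by (subst nn_integral_cmult[symmetric]) (simp_all add: A flip: mult.assoc)
 also have "\<dots> = (\<integral>\<^sup>+w. (\<integral>\<^sup>+v. (\<integral>\<^sup>+\<theta>. \<Phi> (\<Theta> w v \<theta>) * ennreal (ball_density n \<theta>) \<partial>lborel) * ennreal (ball_density m v) * ennreal (ball_density m w) \<partial>lborel) \<partial>lborel)"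
  by (simp add: nn_integral_multc)
 also have "\<dots> = (\<integral>\<^sup>+v. (\<integral>\<^sup>+w. (\<integral>\<^sup>+\<theta>. \<Phi> (\<Theta> w v \<theta>) * ennreal (ball_density n \<theta>) \<partial>lborel) * ennreal (ball_density m v) * ennreal (ball_density m w) \<partial>lborel) \<partial>lborel)"
  by (rule lborel_pair.Fubini') simp
 also have "\<dots> = (\<integral>\<^sup>+v. (\<integral>\<^sup>+w. (\<integral>\<^sup>+\<theta>. \<Phi> (\<Theta> w v \<theta>) * ennreal (ball_density n \<theta>) \<partial>lborel) * ennreal (ball_density m w) \<partial>lborel) * ennreal (ball_density m v) \<partial>lborel)"
  by (subst nn_integral_multc[symmetric]) (simp_all add: mult_ac)
 also have "\<dots> = ?J * ?B"
  by (subst nn_integral_cmult[symmetric]) (simp_all add: B flip: mult.assoc)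
 finally have "?J * ?A = ?J * ?B" .
 then have "?A * ?J = ?B * ?J" by (simp only: mult.commute)
 then show ?thesis
  by (rule ennreal_cancel_right) (use ball_mass_pos[of n] ball_mass_finite[OF n, where 'n = 'n] in auto)
qed

section \<open>From large exponents to all exponents\<close>

text \<open>A signed measure on a bounded interval is determined by its moments (Weierstrass); the negative
 powers are reached by truncation and dominated convergence.\<close>
lemma moments_determine_powers:
 fixes D f g :: "'a => real"
 assumes "finite_measure M"
  and [measurable]: "D \<in> borel_measurable M" "f \<in> borel_measurable M" "g \<in> borel_measurable M"
  and D: "!!x. x \<in> space M ==> 0 < D x \<and> D x <= C"
  and f: "!!x. x \<in> space M ==> 0 <= f x \<and> f x <= 1" and g: "!!x. x \<in> space M ==> 0 <= g x \<and> g x <= 1"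
  and mom: "!!n. n \<ge> N ==> (\<integral>\<^sup>+x. ennreal (f x * D x ^ n) \<partial>M) = (\<integral>\<^sup>+x. ennreal (g x * D x ^ n) \<partial>M)"
  and fin: "(\<integral>\<^sup>+x. ennreal (D x powr e) \<partial>M) < \<infinity>"
 shows "(\<integral>\<^sup>+x. ennreal (f x * D x powr e) \<partial>M) = (\<integral>\<^sup>+x. ennreal (g x * D x powr e) \<partial>M)"
proof -
 interpret finite_measure M by fact
 define K where "K = N + nat \<lceil>\<bar>e\<bar>\<rceil>"
 have K: "K \<ge> N" "e <= real K" unfolding K_def by (auto, linarith)
 define G where "G x = f x - g x" for x
 have [measurable]: "G \<in> borel_measurable M" unfolding G_def by measurable
 have G: "\<bar>G x\<bar> <= 1" if "x \<in> space M" for x using f[OF that] g[OF that] by (auto simp: G_def)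
 have Dn: "\<bar>D x ^ n\<bar> <= C ^ n" if "x \<in> space M" for x n
  using D[OF that] by (simp add: power_mono)
 have ifn: "integrable M (%x. h x * D x ^ n)" if [measurable]: "h \<in> borel_measurable M" and h: "!!x. x \<in> space M ==> \<bar>h x\<bar> <= 1" for h n
 proof (rule integrable_const_bound[of _ "C ^ n"])
  show "AE x in M. norm (h x * D x ^ n) <= C ^ n"
  proof (rule AE_I2)
   fix x assume x: "x \<in> space M"
   have "\<bar>h x\<bar> * \<bar>D x ^ n\<bar> <= 1 * C ^ n" by (intro mult_mono h[OF x] Dn[OF x]) auto
   then show "norm (h x * D x ^ n) <= C ^ n" by (simp add: abs_mult)
  qed
 qed measurable
 have eqn: "(\<integral>x. f x * D x ^ n \<partial>M) = (\<integral>x. g x * D x ^ n \<partial>M)" if "n \<ge> N" for n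
  using mom[OF that] f g D by (subst (1 2) integral_eq_nn_integral) (auto simp: less_imp_le)
 have zn: "(\<integral>x. G x * D x ^ n \<partial>M) = 0" if "n \<ge> N" for n
  unfolding G_def left_diff_distrib
  by (subst Bochner_Integration.integral_diff) (use f g in \<open>auto intro!: ifn simp: eqn[OF that]\<close>)
 have zk: "(\<integral>x. G x * D x ^ K * k (D x) \<partial>M) = 0" if k: "continuous_on {0..C} k" and [measurable]: "k \<in> borel_measurable borel" for k
 proof -
  define B where "B = measure M (space M) * C ^ K"
  have C: "0 <= C" if "space M ~= {}" using D that by fastforce
  have B: "B \<ge> 0" unfolding B_def using C by (cases "space M = {}") auto
  have "compact (k ` {0..C})" using k by (intro compact_continuous_image) auto
  then have "bounded (k ` {0..C})" by (rule compact_imp_bounded)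
  then obtain b where "\<forall>y\<in>k ` {0..C}. norm y <= b" unfolding bounded_iff by blast
  then have b: "!!x. x \<in> {0..C} ==> \<bar>k x\<bar> <= b" by auto
  have small: "\<bar>\<integral>x. G x * D x ^ K * k (D x) \<partial>M\<bar> <= \<epsilon> * B" if \<epsilon>: "\<epsilon> > 0" for \<epsilon>
  proof -
   obtain p where p: "real_polynomial_function p" "!!x. x \<in> {0..C} ==> \<bar>k x - p x\<bar> < \<epsilon>"
    using Stone_Weierstrass_real_polynomial_function[OF compact_Icc k \<epsilon>] by blast
   obtain a d where pa: "p = (%x. \<Sum>i\<le>d. a i * x ^ i)"
    using p(1) unfolding real_polynomial_function_iff_sum by blast
   have term_eq: "G x * D x ^ K * p (D x) = (\<Sum>i\<le>d. a i * (G x * D x ^ (K + i)))" for x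
    by (simp add: pa sum_distrib_left power_add mult_ac)
   have ip: "integrable M (%x. G x * D x ^ K * p (D x))"
    unfolding term_eq by (intro Bochner_Integration.integrable_sum integrable_mult_right ifn G) auto
   have p0: "(\<integral>x. G x * D x ^ K * p (D x) \<partial>M) = 0"
    unfolding term_eq
    by (subst Bochner_Integration.integral_sum) (use K(1) in \<open>auto intro!: integrable_mult_right ifn G simp: zn\<close>)
   have ik: "integrable M (%x. G x * D x ^ K * k (D x))"
   proof (rule Bochner_Integration.integrable_bound)
    show "integrable M (%x. b * (G x * D x ^ K))" by (intro integrable_mult_right ifn G) auto
    show "AE x in M. norm (G x * D x ^ K * k (D x)) <= norm (b * (G x * D x ^ K))"
    proof (rule AE_I2)
     fix x assume "x \<in> space M"
     then have "\<bar>k (D x)\<bar> <= \<bar>b\<bar>" using b[of "D x"] D by (force simp: less_imp_le)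
     then have "\<bar>G x * D x ^ K\<bar> * \<bar>k (D x)\<bar> <= \<bar>G x * D x ^ K\<bar> * \<bar>b\<bar>" by (rule mult_left_mono) simp
     then show "norm (G x * D x ^ K * k (D x)) <= norm (b * (G x * D x ^ K))" by (simp add: abs_mult mult_ac)
    qed
   qed measurable
   have "(\<integral>x. G x * D x ^ K * k (D x) \<partial>M) = (\<integral>x. G x * D x ^ K * k (D x) - G x * D x ^ K * p (D x) \<partial>M)"
    using ik ip by (subst Bochner_Integration.integral_diff) (simp_all add: p0)
   also have "\<bar>\<dots>\<bar> <= (\<integral>x. \<epsilon> * C ^ K \<partial>M)"
   proof (rule integral_abs_bound[THEN order_trans], rule integral_mono)
    show "integrable M (%x. \<bar>G x * D x ^ K * k (D x) - G x * D x ^ K * p (D x)\<bar>)" using ik ip by auto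
    fix x assume x: "x \<in> space M"
    have dx: "\<bar>k (D x) - p (D x)\<bar> <= \<epsilon>" using p(2)[of "D x"] D[OF x] by (simp add: less_imp_le)
    have "\<bar>G x\<bar> * \<bar>D x ^ K\<bar> * \<bar>k (D x) - p (D x)\<bar> <= 1 * C ^ K * \<epsilon>"
     using Dn[OF x, of K] by (intro mult_mono G[OF x] dx) (auto intro: order_trans[OF abs_ge_zero])
    then show "\<bar>G x * D x ^ K * k (D x) - G x * D x ^ K * p (D x)\<bar> <= \<epsilon> * C ^ K"
     by (simp only: right_diff_distrib[symmetric] abs_mult mult_1_left mult.commute[of "C ^ K"])
   qed auto
   also have "\<dots> = \<epsilon> * B" by (simp add: B_def)
   finally show ?thesis .
  qed
  have "\<bar>\<integral>x. G x * D x ^ K * k (D x) \<partial>M\<bar> <= 0"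
  proof (rule field_le_epsilon)
   fix \<eta> :: real assume \<eta>: "\<eta> > 0"
   have "\<bar>\<integral>x. G x * D x ^ K * k (D x) \<partial>M\<bar> <= \<eta> / (B + 1) * B"
    using B \<eta> by (intro small) (simp add: add_nonneg_pos)
   also have "\<dots> <= 0 + \<eta>" using B \<eta> by (simp add: field_simps)
   finally show "\<bar>\<integral>x. G x * D x ^ K * k (D x) \<partial>M\<bar> <= 0 + \<eta>" .
  qed
  then show ?thesis by simp
 qed
 define k where "k j d = (max d (1 / real (Suc j))) powr (e - real K)" for j :: nat and d :: real
 have kc: "continuous_on {0..C} (k j)" for j
  unfolding k_def by (intro continuous_on_powr continuous_intros) (auto simp: max_def)
 have km[measurable]: "k j \<in> borel_measurable borel" for j unfolding k_def by measurable
 have iD: "integrable M (%x. D x powr e)"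
  using fin by (intro integrableI_nonneg) auto
 have lim: "(%j. \<integral>x. G x * D x ^ K * k j (D x) \<partial>M) \<longlonglongrightarrow> (\<integral>x. G x * D x powr e \<partial>M)"
 proof (rule integral_dominated_convergence[where w = "%x. D x powr e"])
  show "AE x in M. (%j. G x * D x ^ K * k j (D x)) \<longlonglongrightarrow> G x * D x powr e"
  proof (rule AE_I2)
   fix x assume x: "x \<in> space M"
   have "eventually (%j. 1 / real (Suc j) < D x) sequentially"
    using order_tendstoD(2)[OF LIMSEQ_inverse_real_of_nat] D[OF x] by (simp add: inverse_eq_divide)
   then have "eventually (%j. G x * D x ^ K * k j (D x) = G x * D x powr e) sequentially"
   proof eventually_elim
    case (elim j)
    then have "k j (D x) = D x powr (e - real K)" by (simp add: k_def max_def)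
    moreover have "D x ^ K = D x powr real K" using D[OF x] by (simp add: powr_realpow)
    ultimately show ?case by (simp add: mult.assoc flip: powr_add)
   qed
   then show "(%j. G x * D x ^ K * k j (D x)) \<longlonglongrightarrow> G x * D x powr e" by (rule tendsto_eventually)
  qed
  show "AE x in M. norm (G x * D x ^ K * k j (D x)) <= D x powr e" for j
  proof (rule AE_I2)
   fix x assume x: "x \<in> space M"
   have "k j (D x) <= D x powr (e - real K)"
    unfolding k_def using D[OF x] K(2) by (intro powr_mono2') auto
   then have "D x ^ K * k j (D x) <= D x ^ K * D x powr (e - real K)"
    using D[OF x] by (intro mult_left_mono) auto
   also have "\<dots> = D x powr e" using D[OF x] by (simp add: powr_realpow[symmetric] flip: powr_add)
   finally have "D x ^ K * k j (D x) <= D x powr e" .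
   moreover have nn: "0 <= D x ^ K * k j (D x)" using D[OF x] by (simp add: k_def)
   ultimately have "\<bar>G x\<bar> * (D x ^ K * k j (D x)) <= 1 * D x powr e" by (intro mult_mono G[OF x]) auto
   moreover have "norm (G x * D x ^ K * k j (D x)) = \<bar>G x\<bar> * \<bar>D x ^ K * k j (D x)\<bar>"
    by (simp add: abs_mult mult.assoc)
   ultimately show "norm (G x * D x ^ K * k j (D x)) <= D x powr e"
    by (simp only: abs_of_nonneg[OF nn] mult_1_left)
  qed
 qed (use iD in measurable)
 have "(\<integral>x. G x * D x powr e \<partial>M) = 0"
  using LIMSEQ_unique[OF lim] zk[OF kc km] by simp
 moreover have ife: "integrable M (%x. h x * D x powr e)" if [measurable]: "h \<in> borel_measurable M" and h: "!!x. x \<in> space M ==> 0 <= h x \<and> h x <= 1" for h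
 proof (rule Bochner_Integration.integrable_bound[OF iD])
  show "AE x in M. norm (h x * D x powr e) <= norm (D x powr e)"
   using h by (intro AE_I2) (simp add: abs_mult mult_left_le_one_le)
 qed measurable
 ultimately have "(\<integral>x. f x * D x powr e \<partial>M) = (\<integral>x. g x * D x powr e \<partial>M)"
  unfolding G_def left_diff_distrib using f g by (subst (asm) Bochner_Integration.integral_diff) auto
 then show ?thesis
  using f g ife by (subst (1 2) nn_integral_eq_integral) auto
qed

lemma bounded_matrix_ball: "bounded (matrix_ball :: (complex^'n^'n) set)"
 using bounded_subset[OF compact_imp_bounded[OF compact_matrix_cball] matrix_ball_cball] .

text \<open>For a fixed test function, both sides integrate the \<open>e\<close>-th power of the product of the two
 determinants against measures that do not depend on \<open>e\<close>; so large exponents provide the moments.\<close>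
proposition nn_integral_associativity_all:
 fixes r s t :: "complex^'n^'n" and \<Phi> :: "complex^'n^'n => real"
 assumes r: "r \<in> pos_def" and s: "s \<in> psd" and t: "t \<in> pos_def" and e: "e > -1"
  and \<Phi>[measurable]: "\<Phi> \<in> borel_measurable borel" and \<Phi>01: "!!N. 0 <= \<Phi> N \<and> \<Phi> N <= 1"
 shows "(\<integral>\<^sup>+w. (\<integral>\<^sup>+v. ennreal (\<Phi> (r ** w ** s + matrix_root (sum_square r s w) ** v ** t)) * ennreal (ball_density e v) \<partial>lborel)
    * ennreal (ball_density e w) \<partial>lborel)
  = (\<integral>\<^sup>+w. (\<integral>\<^sup>+v. ennreal (\<Phi> (r ** v ** matrix_root (sum_square s t w) + s ** w ** t)) * ennreal (ball_density e v) \<partial>lborel)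
    * ennreal (ball_density e w) \<partial>lborel)"
proof -
 define P where "P = ((lborel \<Otimes>\<^sub>M lborel) :: ((complex^'n^'n) \<times> (complex^'n^'n)) measure)"
 define \<Omega> where "\<Omega> = (matrix_ball \<times> matrix_ball :: ((complex^'n^'n) \<times> (complex^'n^'n)) set)"
 define M where "M = restrict_space P \<Omega>"
 define F where "F p = \<Phi> (r ** fst p ** s + matrix_root (sum_square r s (fst p)) ** snd p ** t)" for p
 define G where "G p = \<Phi> (r ** snd p ** matrix_root (sum_square s t (fst p)) + s ** fst p ** t)" for p
 define D where "D p = Re (det (mat 1 - ctranspose (fst p) ** fst p)) * Re (det (mat 1 - ctranspose (snd p) ** snd p))"
  for p :: "(complex^'n^'n) \<times> (complex^'n^'n)"
 have PS[measurable_cong]: "sets P = sets (borel \<Otimes>\<^sub>M borel)" unfolding P_def by (intro sets_pair_measure_cong) simp_all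
 have [measurable]: "\<Omega> \<in> sets P" unfolding \<Omega>_def PS by measurable
 have meas[measurable]: "F \<in> borel_measurable P" "G \<in> borel_measurable P" "D \<in> borel_measurable P"
  unfolding F_def G_def D_def by measurable
 have DD: "ennreal (x * D p powr a) * indicator \<Omega> p = ennreal x * ennreal (ball_density a (snd p)) * ennreal (ball_density a (fst p))"
  if "x \<ge> 0" for x a p
 proof (cases "p \<in> \<Omega>")
  case True
  then have "fst p \<in> matrix_ball" "snd p \<in> matrix_ball" by (auto simp: \<Omega>_def)
  moreover have "Re (det (mat 1 - ctranspose (fst p) ** fst p)) > 0" "Re (det (mat 1 - ctranspose (snd p) ** snd p)) > 0"
   using calculation by (auto simp: matrix_ball_def intro!: pos_def_det(1))
  ultimately show ?thesis
   using True that by (simp add: D_def ball_density_def det_power_def matrix_ball_def powr_mult ennreal_mult mult_ac)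
 next
  case False
  then have "fst p \<notin> matrix_ball \<or> snd p \<notin> matrix_ball" by (auto simp: \<Omega>_def mem_Times_iff)
  then show ?thesis using False by (auto simp: ball_density_outside)
 qed
 have int: "(\<integral>\<^sup>+p. ennreal (H p * D p powr a) \<partial>M)
   = (\<integral>\<^sup>+w. (\<integral>\<^sup>+v. ennreal (H (w, v)) * ennreal (ball_density a v) \<partial>lborel) * ennreal (ball_density a w) \<partial>lborel)"
  if [measurable]: "H \<in> borel_measurable P" and H: "!!p. 0 <= H p" for H a
 proof -
  have "(\<integral>\<^sup>+p. ennreal (H p * D p powr a) \<partial>M) = (\<integral>\<^sup>+p. ennreal (H p) * ennreal (ball_density a (snd p)) * ennreal (ball_density a (fst p)) \<partial>P)"
   unfolding M_def by (subst nn_integral_restrict_space) (simp_all add: DD[OF H])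
  also have "\<dots> = (\<integral>\<^sup>+w. (\<integral>\<^sup>+v. ennreal (H (w, v)) * ennreal (ball_density a v) * ennreal (ball_density a w) \<partial>lborel) \<partial>lborel)"
   unfolding P_def by (subst lborel.nn_integral_fst[symmetric]) (use that(1) in \<open>simp_all add: P_def\<close>)
  also have "\<dots> = (\<integral>\<^sup>+w. (\<integral>\<^sup>+v. ennreal (H (w, v)) * ennreal (ball_density a v) \<partial>lborel) * ennreal (ball_density a w) \<partial>lborel)"
  proof (intro nn_integral_cong nn_integral_multc)
   fix w :: "complex^'n^'n"
   have "(%v. H (w, v)) \<in> borel_measurable borel"
    using measurable_compose[OF measurable_Pair1'[of w borel borel] that(1)[unfolded measurable_cong_sets[OF PS refl]]] by simp
   then show "(%v. ennreal (H (w, v)) * ennreal (ball_density a v)) \<in> borel_measurable lborel" by simp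
  qed
  finally show ?thesis .
 qed
 obtain C1 where C1: "!!w :: complex^'n^'n. w \<in> matrix_cball ==> norm (det (mat 1 - ctranspose w ** w)) <= C1"
 proof -
  have "compact ((%w. det (mat 1 - ctranspose w ** w)) ` (matrix_cball :: (complex^'n^'n) set))"
   by (intro compact_continuous_image compact_matrix_cball continuous_intros)
  then have "bounded ((%w. det (mat 1 - ctranspose w ** w)) ` (matrix_cball :: (complex^'n^'n) set))" by (rule compact_imp_bounded)
  then show ?thesis using that unfolding bounded_iff by blast
 qed
 have "(\<integral>\<^sup>+p. ennreal (F p * D p powr e) \<partial>M) = (\<integral>\<^sup>+p. ennreal (G p * D p powr e) \<partial>M)"
 proof (rule moments_determine_powers[where N = "CARD('n)" and C = "C1 * C1"])
  have "emeasure P \<Omega> < \<infinity>"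
   unfolding P_def \<Omega>_def lborel_prod by (intro emeasure_bounded_finite bounded_Times bounded_matrix_ball)
  then show "finite_measure M"
   unfolding M_def by (intro finite_measure_restrict_space finite_measureI)
    (auto simp: emeasure_restrict_space space_restrict_space intro: finite_measureI)
  show "D \<in> borel_measurable M" "F \<in> borel_measurable M" "G \<in> borel_measurable M"
   unfolding M_def by (intro measurable_restrict_space1 meas)+
  show "0 < D p \<and> D p <= C1 * C1" if "p \<in> space M" for p
  proof -
   have p: "fst p \<in> matrix_ball" "snd p \<in> matrix_ball" using that by (auto simp: M_def space_restrict_space \<Omega>_def)
   have pos: "Re (det (mat 1 - ctranspose (fst p) ** fst p)) > 0" "Re (det (mat 1 - ctranspose (snd p) ** snd p)) > 0"
    using p by (auto simp: matrix_ball_def intro!: pos_def_det(1))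
   have le: "Re (det (mat 1 - ctranspose w ** w)) <= C1" if "w \<in> matrix_ball" for w :: "complex^'n^'n"
    using C1[of w] that matrix_ball_cball complex_Re_le_cmod[of "det (mat 1 - ctranspose w ** w)"] by fastforce
   show ?thesis unfolding D_def using pos le[OF p(1)] le[OF p(2)] by (auto intro!: mult_mono)
  qed
  show "0 <= F p \<and> F p <= 1" "0 <= G p \<and> G p <= 1" for p using \<Phi>01 by (auto simp: F_def G_def)
  show "(\<integral>\<^sup>+p. ennreal (F p * D p ^ n) \<partial>M) = (\<integral>\<^sup>+p. ennreal (G p * D p ^ n) \<partial>M)" if n: "n \<ge> CARD('n)" for n
  proof -
   have pw: "D p ^ n = D p powr real n" if "p \<in> space M" for p
    using \<open>p \<in> space M ==> 0 < D p \<and> D p <= C1 * C1\<close> that by (simp add: powr_realpow)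
   have "(\<integral>\<^sup>+p. ennreal (F p * D p powr real n) \<partial>M) = (\<integral>\<^sup>+p. ennreal (G p * D p powr real n) \<partial>M)"
    using nn_integral_associativity[OF r s t, of "real (n - CARD('n))" "%N. ennreal (\<Phi> N)"] n
    by (simp add: int meas \<Phi>01 F_def G_def of_nat_diff)
   then show ?thesis by (simp add: pw cong: nn_integral_cong_simp)
  qed
  have "(\<integral>\<^sup>+p. ennreal (1 * D p powr e) \<partial>M) = ball_mass e TYPE('n) * ball_mass e TYPE('n)"
   by (subst int) (simp_all add: nn_integral_ball_density nn_integral_cmult)
  then show "(\<integral>\<^sup>+p. ennreal (D p powr e) \<partial>M) < \<infinity>"
   using ball_mass_finite[OF e, where 'n = 'n] by (simp add: ennreal_mult_less_top)
 qed
 then show ?thesis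
  by (simp add: int meas \<Phi>01 F_def G_def)
qed

section \<open>Complex measures on a closed subset of Euclidean space\<close>

lemma ennreal_add_subadditive: "ennreal (x + y) <= ennreal x + ennreal y"
proof (cases "x \<ge> 0 \<and> y \<ge> 0")
 case False
 then consider "x < 0" | "y < 0" by linarith
 then show ?thesis by cases (auto simp: ennreal_neg intro: ennreal_leI)
qed (simp add: ennreal_plus)

definition cmeasure :: "'a measure => 'a set => complex" where
 "cmeasure M = (%A. complex_of_real (measure M A))"

locale closed_subset =
 fixes S :: "'a::euclidean_space set"
 assumes closed_S: "closed S"
begin

abbreviation X :: "'a topology" where "X \<equiv> top_of_set S"

abbreviation \<Sigma> :: "'a set set" where "\<Sigma> \<equiv> sets (restrict_space borel S)"

lemma sets_S [measurable]: "S \<in> sets borel"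
 using closed_S by (rule borel_closed)

lemma Sigma_iff: "A \<in> \<Sigma> \<longleftrightarrow> A \<subseteq> S \<and> A \<in> sets borel"
 by (rule sets_restrict_space_iff) simp

lemma openin_sigma: "\<Sigma> = sigma_sets S {U. openin X U}"
proof -
 have "\<Sigma> = (\<inter>) S ` sigma_sets UNIV {U. open U}"
  by (simp add: sets_restrict_space borel_def)
 also have "\<dots> = sigma_sets S ((\<inter>) S ` {U. open U})"
  using sets_S by (intro sigma_sets_Int) (simp_all add: borel_def)
 also have "(\<inter>) S ` {U. open U} = {U. openin X U}"
  by (auto simp: openin_open)
 finally show ?thesis .
qed

lemma sets_borel_of: "sets (borel_of X) = \<Sigma>"
proof -
 have "sets (borel_of X) = sigma_sets S {U. openin X U}"
  unfolding borel_of_def by (subst sets_measure_of) (auto dest: openin_imp_subset)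
 then show ?thesis by (simp add: openin_sigma)
qed

definition finite_on :: "'a measure => bool" where
 "finite_on M \<longleftrightarrow> sets M = \<Sigma> \<and> finite_measure M"

lemma finite_onD: "finite_on M ==> sets M = \<Sigma>" "finite_on M ==> finite_measure M" "finite_on M ==> space M = S"
 by (auto simp: finite_on_def dest: sets_eq_imp_space_eq simp: space_restrict_space)

lemma S_in_Sigma: "S \<in> \<Sigma>" by (simp add: Sigma_iff)

lemma openin_Sigma: "openin X U ==> U \<in> \<Sigma>"
 by (simp add: openin_sigma)

lemma compactin_Sigma: "compactin X K ==> K \<in> \<Sigma>"
 by (auto simp: Sigma_iff compactin_subtopology intro: borel_compact)

subsection \<open>The Jordan decomposition\<close>

definition countably_additive_real :: "('a set => real) => bool" where
 "countably_additive_real \<nu> \<longleftrightarrow>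
   (\<forall>F :: nat => 'a set. range F \<subseteq> \<Sigma> \<and> disjoint_family F --> (%n. \<nu> (F n)) sums \<nu> (\<Union>n. F n))"

definition upper_variation :: "('a set => real) => 'a set => ennreal" where
 "upper_variation \<nu> A = (SUP B \<in> {B \<in> \<Sigma>. B \<subseteq> A}. ennreal (\<nu> B))"

context
 fixes \<nu> :: "'a set => real"
 assumes ca: "countably_additive_real \<nu>"
begin

lemma sums_\<nu>: "range F \<subseteq> \<Sigma> ==> disjoint_family F ==> (%n. \<nu> (F n)) sums \<nu> (\<Union>n. F n)" for F :: "nat => 'a set"
 using ca by (auto simp: countably_additive_real_def)

lemma \<nu>_empty: "\<nu> {} = 0"
proof -
 have "(%n :: nat. \<nu> {}) sums \<nu> {}"
  using sums_\<nu>[of "%_. {}"] by (simp add: disjoint_family_on_def)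
 then show ?thesis by (metis sums_summable summable_const_iff)
qed

lemma \<nu>_Un: assumes "A \<in> \<Sigma>" "B \<in> \<Sigma>" "A \<inter> B = {}" shows "\<nu> (A \<union> B) = \<nu> A + \<nu> B"
proof -
 define F where "F n = (if n = 0 then A else if n = 1 then B else {})" for n :: nat
 have "(%n. \<nu> (F n)) sums \<nu> (\<Union>n. F n)"
  using assms by (intro sums_\<nu>) (auto simp: F_def disjoint_family_on_def)
 moreover have "(\<Union>n. F n) = A \<union> B" by (auto simp: F_def split: if_splits)
 moreover have "(%n. \<nu> (F n)) sums (\<Sum>n\<in>{0, 1}. \<nu> (F n))"
  by (rule sums_finite) (auto simp: F_def \<nu>_empty)
 moreover have "(\<Sum>n\<in>{0, 1}. \<nu> (F n)) = \<nu> A + \<nu> B" by (simp add: F_def)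
 ultimately show ?thesis by (metis sums_unique2)
qed

lemma \<nu>_Diff: assumes "A \<in> \<Sigma>" "B \<in> \<Sigma>" "B \<subseteq> A" shows "\<nu> (A - B) = \<nu> A - \<nu> B"
proof -
 have "(A - B) \<inter> B = {}" by blast
 with \<nu>_Un[of "A - B" B] assms show ?thesis by (simp add: sets.Diff Un_absorb2)
qed

lemma upper_variation_mono: "A \<subseteq> B ==> upper_variation \<nu> A <= upper_variation \<nu> B"
 unfolding upper_variation_def by (intro SUP_subset_mono) auto

lemma upper_variation_ge: "B \<in> \<Sigma> ==> B \<subseteq> A ==> ennreal (\<nu> B) <= upper_variation \<nu> A"
 unfolding upper_variation_def by (intro SUP_upper) auto

lemma upper_variation_empty: "upper_variation \<nu> {} = 0"
proof -
 have "{B \<in> \<Sigma>. B \<subseteq> {}} = {{}}" by auto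
 then show ?thesis by (simp add: upper_variation_def \<nu>_empty)
qed

lemma upper_variation_Un:
 assumes A: "A \<in> \<Sigma>" and B: "B \<in> \<Sigma>" and AB: "A \<inter> B = {}"
 shows "upper_variation \<nu> (A \<union> B) = upper_variation \<nu> A + upper_variation \<nu> B"
proof (rule antisym)
 show "upper_variation \<nu> (A \<union> B) <= upper_variation \<nu> A + upper_variation \<nu> B"
  unfolding upper_variation_def[of _ "A \<union> B"]
 proof (rule SUP_least, clarify)
  fix C assume C: "C \<in> \<Sigma>" "C \<subseteq> A \<union> B"
  then have "C = (C \<inter> A) \<union> (C \<inter> B)" by auto
  then have "\<nu> C = \<nu> (C \<inter> A) + \<nu> (C \<inter> B)"
   using \<nu>_Un[of "C \<inter> A" "C \<inter> B"] A B C AB by (metis Int_assoc inf_bot_right inf_left_commute sets.Int)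
  then have "ennreal (\<nu> C) <= ennreal (\<nu> (C \<inter> A)) + ennreal (\<nu> (C \<inter> B))"
   by (simp add: ennreal_add_subadditive)
  also have "\<dots> <= upper_variation \<nu> A + upper_variation \<nu> B"
   using A B C by (intro add_mono upper_variation_ge sets.Int) auto
  finally show "ennreal (\<nu> C) <= upper_variation \<nu> A + upper_variation \<nu> B" .
 qed
next
 let ?I = "%A. {B \<in> \<Sigma>. B \<subseteq> A}"
 have ne: "?I A ~= {}" "?I B ~= {}" by blast+
 have "ennreal (\<nu> C) + ennreal (\<nu> D) <= upper_variation \<nu> (A \<union> B)" if C: "C \<in> ?I A" and D: "D \<in> ?I B" for C D
 proof -
  define C' where "C' = (if \<nu> C \<ge> 0 then C else {})"
  define D' where "D' = (if \<nu> D \<ge> 0 then D else {})"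
  have "ennreal (\<nu> C) + ennreal (\<nu> D) = ennreal (\<nu> C' + \<nu> D')"
   by (simp add: C'_def D'_def \<nu>_empty ennreal_neg)
  also have "\<nu> C' + \<nu> D' = \<nu> (C' \<union> D')"
   using C D AB by (subst \<nu>_Un) (auto simp: C'_def D'_def)
  also have "ennreal \<dots> <= upper_variation \<nu> (A \<union> B)"
   using C D by (intro upper_variation_ge) (auto simp: C'_def D'_def)
  finally show ?thesis .
 qed
 then have sup: "(SUP C\<in>?I A. ennreal (\<nu> C) + ennreal (\<nu> D)) <= upper_variation \<nu> (A \<union> B)" if "D \<in> ?I B" for D
  using that by (intro SUP_least) blast
 have "upper_variation \<nu> A + ennreal (\<nu> D) <= upper_variation \<nu> (A \<union> B)" if "D \<in> ?I B" for D
  unfolding upper_variation_def[of _ A] ennreal_SUP_add_left[OF ne(1), symmetric] by (rule sup[OF that])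
 then have "(SUP D\<in>?I B. upper_variation \<nu> A + ennreal (\<nu> D)) <= upper_variation \<nu> (A \<union> B)"
  by (intro SUP_least) blast
 then show "upper_variation \<nu> A + upper_variation \<nu> B <= upper_variation \<nu> (A \<union> B)"
  using ennreal_SUP_add_right[OF ne(2), of "upper_variation \<nu> A" "%D. ennreal (\<nu> D)"]
  unfolding upper_variation_def[of _ B] by simp
qed

text \<open>Otherwise repeated halving gives a decreasing sequence along which \<open>|\<nu>|\<close> tends to infinity,
 against countable additivity.\<close>
lemma upper_variation_finite: "upper_variation \<nu> S < \<infinity>"
proof (rule ccontr)
 assume "\<not> upper_variation \<nu> S < \<infinity>"
 then have S: "upper_variation \<nu> S = \<infinity>" by (metis infinity_ennreal_def less_top)
 define bad where "bad n E \<longleftrightarrow> E \<in> \<Sigma> \<and> upper_variation \<nu> E = \<infinity> \<and> (n > 0 --> real n <= \<bar>\<nu> E\<bar>)" for n :: nat and E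
 have "\<exists>E. \<forall>n. bad n (E n) \<and> E (Suc n) \<subseteq> E n"
 proof (rule dependent_nat_choice)
  show "\<exists>E. bad 0 E" using S S_in_Sigma by (auto simp: bad_def)
  fix E n assume E: "bad n E"
  define c where "c = real (Suc n) + \<bar>\<nu> E\<bar>"
  have "ennreal c < upper_variation \<nu> E" using E by (simp add: bad_def)
  then obtain B where B: "B \<in> \<Sigma>" "B \<subseteq> E" "ennreal c < ennreal (\<nu> B)"
   unfolding upper_variation_def less_SUP_iff by auto
  have "0 <= c" by (simp add: c_def)
  then have cB: "c < \<nu> B" using B(3) by (simp add: ennreal_less_iff)
  have "upper_variation \<nu> E = upper_variation \<nu> B + upper_variation \<nu> (E - B)"
   using upper_variation_Un[of B "E - B"] E B by (simp add: bad_def sets.Diff Un_absorb1)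
  then have "upper_variation \<nu> B = \<infinity> \<or> upper_variation \<nu> (E - B) = \<infinity>" using E by (simp add: bad_def)
  then show "\<exists>F. bad (Suc n) F \<and> F \<subseteq> E"
  proof
   assume "upper_variation \<nu> B = \<infinity>"
   then show ?thesis using B cB by (intro exI[of _ B]) (auto simp: bad_def c_def)
  next
   assume "upper_variation \<nu> (E - B) = \<infinity>"
   moreover have "real (Suc n) <= \<bar>\<nu> (E - B)\<bar>"
    using \<nu>_Diff[of E B] E B cB by (auto simp: bad_def c_def)
   ultimately show ?thesis using B E by (intro exI[of _ "E - B"]) (auto simp: bad_def)
  qed
 qed
 then obtain E where E: "!!n. bad n (E n)" "!!n. E (Suc n) \<subseteq> E n" by blast
 have Em: "E n \<in> \<Sigma>" for n using E(1) by (simp add: bad_def)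
 have dec: "E m \<subseteq> E n" if "n <= m" for n m
  using that by (induction rule: dec_induct) (use E(2) in auto)
 define D where "D n = E n - E (Suc n)" for n
 have "range D \<subseteq> \<Sigma>" using Em by (auto simp: D_def)
 moreover have "disjoint_family D"
  unfolding disjoint_family_on_def
 proof (intro ballI impI)
  fix m n :: nat assume "m ~= n"
  then consider "Suc m <= n" | "Suc n <= m" by linarith
  then show "D m \<inter> D n = {}" by cases (use dec in \<open>force simp: D_def\<close>)+
 qed
 ultimately have "summable (%n. \<nu> (D n))" using sums_\<nu> by (auto dest: sums_summable)
 then have "convergent (%n. \<Sum>k<n. \<nu> (D k))" by (simp add: summable_iff_convergent)
 moreover have "(\<Sum>k<n. \<nu> (D k)) = \<nu> (E 0) - \<nu> (E n)" for n
  by (induction n) (simp_all add: D_def \<nu>_Diff Em E(2))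
 ultimately have "convergent (%n. \<nu> (E 0) - \<nu> (E n))" by simp
 from convergent_diff[OF convergent_const[of "\<nu> (E 0)"] this]
 have "Bseq (%n. \<nu> (E n))" by (intro convergent_imp_Bseq) simp
 then obtain b where b: "!!n. norm (\<nu> (E n)) <= b" by (auto simp: Bseq_def)
 obtain n :: nat where "b < real n" using reals_Archimedean2 by blast
 with E(1)[of "Suc n"] b[of "Suc n"] show False by (simp add: bad_def)
qed

lemma upper_variation_le: "A \<in> \<Sigma> ==> upper_variation \<nu> A < \<infinity>"
 using upper_variation_mono[of A S] upper_variation_finite by (auto simp: Sigma_iff intro: le_less_trans)

lemma upper_variation_countably_additive: "countably_additive \<Sigma> (upper_variation \<nu>)"
proof (rule countably_additiveI)
 fix F :: "nat => 'a set"
 assume F: "range F \<subseteq> \<Sigma>" "disjoint_family F" "(\<Union>n. F n) \<in> \<Sigma>"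
 have part: "(\<Union>i<n. F i) \<in> \<Sigma> \<and> (\<Sum>i<n. upper_variation \<nu> (F i)) = upper_variation \<nu> (\<Union>i<n. F i)" for n
 proof (induction n)
  case (Suc n)
  have "F i \<inter> F n = {}" if "i < n" for i
   using that by (intro disjoint_family_onD[OF F(2)]) auto
  then have "(\<Union>i<n. F i) \<inter> F n = {}" by blast
  moreover have "(\<Union>i<Suc n. F i) = (\<Union>i<n. F i) \<union> F n" by (auto simp: less_Suc_eq)
  ultimately show ?case using Suc F(1) upper_variation_Un[of "\<Union>i<n. F i" "F n"] by auto
 qed (simp add: upper_variation_empty)
 show "(\<Sum>n. upper_variation \<nu> (F n)) = upper_variation \<nu> (\<Union>n. F n)"
 proof (rule antisym)
  show "(\<Sum>n. upper_variation \<nu> (F n)) <= upper_variation \<nu> (\<Union>n. F n)"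
  proof (rule suminf_le_const[OF summableI])
   fix n show "(\<Sum>i<n. upper_variation \<nu> (F i)) <= upper_variation \<nu> (\<Union>n. F n)"
    using part[of n] by (auto intro: upper_variation_mono)
  qed
  show "upper_variation \<nu> (\<Union>n. F n) <= (\<Sum>n. upper_variation \<nu> (F n))"
   unfolding upper_variation_def[of _ "\<Union>n. F n"]
  proof (rule SUP_least, clarify)
   fix C assume C: "C \<in> \<Sigma>" "C \<subseteq> (\<Union>n. F n)"
   have "(%n. \<nu> (C \<inter> F n)) sums \<nu> (\<Union>n. C \<inter> F n)"
    using F C by (intro sums_\<nu>) (auto simp: disjoint_family_on_def)
   also have "(\<Union>n. C \<inter> F n) = C" using C(2) by auto
   finally have "(%n. ennreal (\<Sum>i<n. \<nu> (C \<inter> F i))) \<longlonglongrightarrow> ennreal (\<nu> C)"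
    unfolding sums_def by (intro tendsto_ennrealI)
   moreover have "ennreal (\<Sum>i<n. \<nu> (C \<inter> F i)) <= (\<Sum>n. upper_variation \<nu> (F n))" for n
   proof -
    have "ennreal (\<Sum>i<n. \<nu> (C \<inter> F i)) <= (\<Sum>i<n. ennreal (\<nu> (C \<inter> F i)))"
    proof (induction n)
     case (Suc n)
     then show ?case
      using ennreal_add_subadditive[of "\<Sum>i<n. \<nu> (C \<inter> F i)" "\<nu> (C \<inter> F n)"]
      by (auto intro: order_trans add_mono)
    qed simp
    also have "\<dots> <= (\<Sum>i<n. upper_variation \<nu> (F i))"
     using F(1) C(1) by (intro sum_mono upper_variation_ge) auto
    also have "\<dots> <= (\<Sum>n. upper_variation \<nu> (F n))" by (intro sum_le_suminf summableI) auto
    finally show ?thesis .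
   qed
   ultimately show "ennreal (\<nu> C) <= (\<Sum>n. upper_variation \<nu> (F n))"
    by (intro LIMSEQ_le_const2) auto
  qed
 qed
qed

lemma sets_pos_part: "sets (pos_part X \<nu>) = \<Sigma>"
proof -
 have sa: "sigma_algebra S \<Sigma>" using sets.sigma_algebra_axioms[of "restrict_space borel S"] by (simp add: space_restrict_space)
 show ?thesis
  unfolding pos_part_def sets_borel_of using sigma_algebra.sets_measure_of_eq[OF sa] by simp
qed

lemma emeasure_pos_part: "A \<in> \<Sigma> ==> emeasure (pos_part X \<nu>) A = upper_variation \<nu> A"
proof -
 assume A: "A \<in> \<Sigma>"
 have eq: "pos_part X \<nu> = measure_of S \<Sigma> (upper_variation \<nu>)"
  by (simp add: pos_part_def upper_variation_def[abs_def] sets_borel_of)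
 have "sigma_algebra S \<Sigma>" using sets.sigma_algebra_axioms[of "restrict_space borel S"] by (simp add: space_restrict_space)
 then show ?thesis
  unfolding eq using upper_variation_countably_additive A
  by (intro emeasure_measure_of_sigma) (auto simp: positive_def upper_variation_empty)
qed

lemma finite_pos_part: "finite_on (pos_part X \<nu>)"
proof -
 have "space (pos_part X \<nu>) = S"
  using sets_eq_imp_space_eq[OF sets_pos_part] by (simp add: space_restrict_space)
 then have "finite_measure (pos_part X \<nu>)"
  using upper_variation_finite by (intro finite_measureI) (simp add: emeasure_pos_part S_in_Sigma less_top)
 then show ?thesis by (simp add: finite_on_def sets_pos_part)
qed

lemma ca_minus: "countably_additive_real (%A. - \<nu> A)"
 using ca by (auto simp: countably_additive_real_def intro: sums_minus)

end

lemma jordan_decomposition: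
 assumes ca: "countably_additive_real \<nu>" and A: "A \<in> \<Sigma>"
 shows "\<nu> A = measure (pos_part X \<nu>) A - measure (pos_part X (%A. - \<nu> A)) A"
proof -
 let ?P = "upper_variation \<nu>" and ?N = "upper_variation (%A. - \<nu> A)"
 note ca' = ca_minus[OF ca]
 have half: "ennreal (\<mu> A) + upper_variation (%A. - \<mu> A) A <= upper_variation \<mu> A" if \<mu>: "countably_additive_real \<mu>" "\<mu> A \<ge> 0" for \<mu>
 proof -
  have "ennreal (\<mu> A) + ennreal (- \<mu> B) <= upper_variation \<mu> A" if B: "B \<in> \<Sigma>" "B \<subseteq> A" for B
  proof (cases "\<mu> B <= 0")
   case True
   have "ennreal (\<mu> A) + ennreal (- \<mu> B) = ennreal (\<mu> (A - B))"
    using True \<mu>(2) \<nu>_Diff[OF \<mu>(1) A B] by (simp flip: ennreal_plus)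
   also have "\<dots> <= upper_variation \<mu> A" using A B by (intro upper_variation_ge[OF \<mu>(1)]) auto
   finally show ?thesis .
  next
   case False
   then show ?thesis using upper_variation_ge[OF \<mu>(1) A, of A] by (simp add: ennreal_neg)
  qed
  then have "(SUP B\<in>{B \<in> \<Sigma>. B \<subseteq> A}. ennreal (\<mu> A) + ennreal (- \<mu> B)) <= upper_variation \<mu> A"
   by (intro SUP_least) auto
  moreover have "{B \<in> \<Sigma>. B \<subseteq> A} ~= {}" by blast
  ultimately show ?thesis
   using ennreal_SUP_add_right[of "{B \<in> \<Sigma>. B \<subseteq> A}" "ennreal (\<mu> A)" "%B. ennreal (- \<mu> B)"]
   unfolding upper_variation_def[of "%A. - \<mu> A"] by simp
 qed
 have half': "upper_variation \<mu> A <= ennreal (\<mu> A) + upper_variation (%A. - \<mu> A) A" if \<mu>: "countably_additive_real \<mu>" "\<mu> A \<ge> 0" for \<mu>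
  unfolding upper_variation_def[of \<mu>]
 proof (rule SUP_least, clarify)
  fix B assume B: "B \<in> \<Sigma>" "B \<subseteq> A"
  have "\<mu> B = \<mu> A + - \<mu> (A - B)" using \<nu>_Diff[OF \<mu>(1) A B] by simp
  then have "ennreal (\<mu> B) <= ennreal (\<mu> A) + ennreal (- \<mu> (A - B))" by (metis ennreal_add_subadditive)
  also have "ennreal (- \<mu> (A - B)) <= upper_variation (%A. - \<mu> A) A"
   using A B by (intro upper_variation_ge[OF ca_minus[OF \<mu>(1)]]) auto
  finally show "ennreal (\<mu> B) <= ennreal (\<mu> A) + upper_variation (%A. - \<mu> A) A" by (simp add: add_left_mono)
 qed
 have fin: "?P A < top" "?N A < top" using upper_variation_le[OF ca A] upper_variation_le[OF ca' A] by simp_all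
 have m: "measure (pos_part X \<nu>) A = enn2real (?P A)" "measure (pos_part X (%A. - \<nu> A)) A = enn2real (?N A)"
  using A by (simp_all add: measure_def emeasure_pos_part[OF ca] emeasure_pos_part[OF ca'])
 show ?thesis
 proof (cases "\<nu> A \<ge> 0")
  case True
  have "?P A = ennreal (\<nu> A) + ?N A" using half[OF ca True] half'[OF ca True] by (rule antisym[rotated])
  then show ?thesis using fin True unfolding m by (simp add: enn2real_plus)
 next
  case False
  have "?N A = ennreal (- \<nu> A) + ?P A"
   using half[OF ca'] half'[OF ca'] False by (intro antisym) auto
  then show ?thesis using fin False unfolding m by (simp add: enn2real_plus)
 qed
qed

subsection \<open>Linear combinations of finite measures\<close>

definition lincomb :: "'i set => ('i => complex) => ('i => 'a measure) => 'a set => complex" where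
 "lincomb J c M = (%A. \<Sum>j\<in>J. c j * cmeasure (M j) A)"

lemma measure_outside: "finite_on M ==> A \<notin> \<Sigma> ==> measure M A = 0"
 by (simp add: finite_onD(1) measure_notin_sets)

lemma complex_measure_lincomb:
 assumes "finite J" "!!j. j \<in> J ==> finite_on (M j)" shows "complex_measure X (lincomb J c M)"
 unfolding complex_measure_def sets_borel_of
proof (intro conjI allI impI; (elim conjE)?)
 fix A assume "A \<notin> \<Sigma>" then show "lincomb J c M A = 0"
  using assms by (simp add: lincomb_def cmeasure_def measure_outside)
next
 fix F :: "nat => 'a set" assume F: "range F \<subseteq> \<Sigma>" "disjoint_family F"
 show "(%n. lincomb J c M (F n)) sums lincomb J c M (\<Union>n. F n)"
  unfolding lincomb_def cmeasure_def
 proof (intro sums_sum sums_mult sums_of_real)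
  fix j assume j: "j \<in> J"
  interpret finite_measure "M j" using assms(2)[OF j] by (rule finite_onD)
  show "(%n. measure (M j) (F n)) sums measure (M j) (\<Union>n. F n)"
   using F finite_onD(1)[OF assms(2)[OF j]] by (intro finite_measure_UNION) auto
 qed
qed

text \<open>Approximate the integrand by simple functions.\<close>
lemma lincomb_zero_integral:
 fixes f :: "'a => complex"
 assumes J: "finite J" and M: "!!j. j \<in> J ==> finite_on (M j)" and 0: "!!A. A \<in> \<Sigma> ==> lincomb J c M A = 0"
  and f: "f \<in> borel_measurable (restrict_space borel S)" and b: "!!x. x \<in> S ==> norm (f x) <= b"
 shows "(\<Sum>j\<in>J. c j * (\<integral>x. f x \<partial>M j)) = 0"
proof -
 define B where "B = restrict_space (borel :: 'a measure) S"
 have sp: "space B = S" by (simp add: B_def space_restrict_space)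
 obtain s where s: "!!i. simple_function B (s i)" "!!x. x \<in> S ==> (%i. s i x) \<longlonglongrightarrow> f x"
  "!!i x. x \<in> S ==> dist (s i x) 0 <= 2 * dist (f x) 0"
 proof -
  obtain s where s: "\<forall>i. simple_function B (s i)" "\<forall>x\<in>space B. (%i. s i x) \<longlonglongrightarrow> f x"
   "\<forall>i. \<forall>x\<in>space B. dist (s i x) 0 <= 2 * dist (f x) 0"
   using borel_measurable_implies_sequence_metric[OF f, of 0] unfolding B_def by blast
  show thesis by (rule that[of s]) (use s sp in blast)+
 qed
 have "(\<Sum>j\<in>J. c j * (\<integral>x. s i x \<partial>M j)) = 0" for i
 proof -
  have fin: "finite (s i ` S)" using s(1)[of i] by (simp add: simple_function_def sp)
  have int: "(\<integral>x. s i x \<partial>M j) = (\<Sum>y\<in>s i ` S. complex_of_real (measure (M j) {x \<in> S. s i x = y}) * y)" if j: "j \<in> J" for j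
  proof -
   interpret finite_measure "M j" using M[OF j] by (rule finite_onD)
   have sf: "simple_function (M j) (s i)"
    using s(1)[of i] finite_onD(1,3)[OF M[OF j]] by (simp add: simple_function_def B_def space_restrict_space)
   have "Bochner_Integration.simple_bochner_integrable (M j) (s i)"
    by (rule simple_bochner_integrable.intros[OF sf]) simp
   from simple_bochner_integrable_eq_integral[OF this]
   show ?thesis by (simp add: Bochner_Integration.simple_bochner_integral_def finite_onD(3)[OF M[OF j]] scaleR_conv_of_real)
  qed
  have lv: "{x \<in> S. s i x = y} \<in> \<Sigma>" for y
  proof -
   have "s i -` {y} \<inter> space B \<in> sets B" by (rule simple_functionD(2)[OF s(1)])
   moreover have "s i -` {y} \<inter> space B = {x \<in> S. s i x = y}" by (auto simp: sp)
   ultimately show ?thesis by (simp add: B_def)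
  qed
  have "(\<Sum>j\<in>J. c j * (\<integral>x. s i x \<partial>M j)) = (\<Sum>j\<in>J. \<Sum>y\<in>s i ` S. c j * (complex_of_real (measure (M j) {x \<in> S. s i x = y}) * y))"
   by (intro sum.cong refl) (simp add: int sum_distrib_left)
  also have "\<dots> = (\<Sum>y\<in>s i ` S. lincomb J c M {x \<in> S. s i x = y} * y)"
   by (subst sum.swap) (simp add: lincomb_def cmeasure_def sum_distrib_right mult.assoc)
  also have "\<dots> = 0" by (simp add: 0 lv)
  finally show ?thesis .
 qed
 moreover have "(%i. \<Sum>j\<in>J. c j * (\<integral>x. s i x \<partial>M j)) \<longlonglongrightarrow> (\<Sum>j\<in>J. c j * (\<integral>x. f x \<partial>M j))"
 proof (intro tendsto_sum tendsto_mult tendsto_const)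
  fix j assume j: "j \<in> J"
  interpret finite_measure "M j" using M[OF j] by (rule finite_onD)
  have cong: "measurable (M j) N = measurable B N" for N :: "complex measure"
   by (intro measurable_cong_sets) (simp_all add: finite_onD(1)[OF M[OF j]] B_def)
  show "(%i. \<integral>x. s i x \<partial>M j) \<longlonglongrightarrow> (\<integral>x. f x \<partial>M j)"
  proof (rule integral_dominated_convergence[where w = "%_. 2 * b"])
   show "AE x in M j. (%i. s i x) \<longlonglongrightarrow> f x" by (intro AE_I2 s(2)) (simp add: finite_onD(3)[OF M[OF j]])
   show "AE x in M j. norm (s i x) <= 2 * b" for i
   proof (rule AE_I2)
    fix x assume "x \<in> space (M j)"
    then have "x \<in> S" by (simp add: finite_onD(3)[OF M[OF j]])
    then show "norm (s i x) <= 2 * b" using s(3)[of x i] b[of x] by (simp add: dist_norm)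
   qed
  qed (use f borel_measurable_simple_function[OF s(1)] in \<open>auto simp: cong B_def[symmetric]\<close>)
 qed
 ultimately have "(%i. 0) \<longlonglongrightarrow> (\<Sum>j\<in>J. c j * (\<integral>x. f x \<partial>M j))" by simp
 from LIMSEQ_unique[OF this tendsto_const] show ?thesis .
qed

definition bounded_borel :: "('a => complex) => bool" where
 "bounded_borel f \<longleftrightarrow> f \<in> borel_measurable (restrict_space borel S) \<and> bounded (f ` S)"

definition jordan_coeff :: "nat => complex" where
 "jordan_coeff k = [1, -1, \<i>, -\<i>] ! k"

definition jordan_part :: "('a set => complex) => nat => 'a measure" where
 "jordan_part \<mu> k = [pos_part X (%A. Re (\<mu> A)), pos_part X (%A. - Re (\<mu> A)), pos_part X (%A. Im (\<mu> A)), pos_part X (%A. - Im (\<mu> A))] ! k"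

lemma lessThan_4: "{..<4::nat} = {0, 1, 2, 3}" by auto

lemma complex_measure_parts:
 assumes \<mu>: "complex_measure X \<mu>"
 shows "countably_additive_real (%A. Re (\<mu> A))" "countably_additive_real (%A. Im (\<mu> A))"
 using \<mu> unfolding complex_measure_def countably_additive_real_def sets_borel_of by (auto intro: sums_Re sums_Im)

lemma finite_jordan_part: "complex_measure X \<mu> ==> k \<in> {..<4} ==> finite_on (jordan_part \<mu> k)"
 unfolding lessThan_4 using complex_measure_parts[of \<mu>]
 by (auto simp: jordan_part_def intro!: finite_pos_part ca_minus)

lemma complex_measure_jordan:
 assumes \<mu>: "complex_measure X \<mu>" shows "\<mu> = lincomb {..<4} jordan_coeff (jordan_part \<mu>)"
proof
 fix A
 show "\<mu> A = lincomb {..<4} jordan_coeff (jordan_part \<mu>) A"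
 proof (cases "A \<in> \<Sigma>")
  case True
  show ?thesis
   unfolding lincomb_def lessThan_4
   using jordan_decomposition[OF complex_measure_parts(1)[OF \<mu>] True] jordan_decomposition[OF complex_measure_parts(2)[OF \<mu>] True]
   by (simp add: jordan_coeff_def jordan_part_def cmeasure_def complex_eq_iff)
 next
  case False
  then have "\<mu> A = 0" using \<mu> by (auto simp: complex_measure_def sets_borel_of)
  moreover have "lincomb {..<4} jordan_coeff (jordan_part \<mu>) A = 0"
   using False measure_outside[OF finite_jordan_part[OF \<mu>]] by (simp add: lincomb_def cmeasure_def)
  ultimately show ?thesis by simp
 qed
qed

lemma integ_jordan: "integ X \<mu> f = (\<Sum>k<4. jordan_coeff k * (\<integral>x. f x \<partial>jordan_part \<mu> k))"
 unfolding integ_def lessThan_4 by (simp add: jordan_coeff_def jordan_part_def algebra_simps)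

text \<open>The integral does not depend on the representation of the measure.\<close>
lemma integ_lincomb:
 assumes J: "finite J" and M: "!!j. j \<in> J ==> finite_on (M j)" and f: "bounded_borel f"
 shows "integ X (lincomb J c M) f = (\<Sum>j\<in>J. c j * (\<integral>x. f x \<partial>M j))"
proof -
 define \<mu> where "\<mu> = lincomb J c M"
 have \<mu>: "complex_measure X \<mu>" unfolding \<mu>_def using J M by (rule complex_measure_lincomb)
 define J' where "J' = (J <+> {..<4::nat})"
 define c' where "c' = case_sum c (%k. - jordan_coeff k)"
 define M' where "M' = case_sum M (jordan_part \<mu>)"
 have split: "(\<Sum>j\<in>J'. g j) = (\<Sum>j\<in>J. g (Inl j)) + (\<Sum>k<4. g (Inr k))" for g :: "_ => complex"
  unfolding J'_def using J by (subst sum.Plus) auto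
 obtain b where b: "!!x. x \<in> S ==> norm (f x) <= b" using f by (auto simp: bounded_borel_def bounded_iff)
 have "(\<Sum>j\<in>J'. c' j * (\<integral>x. f x \<partial>M' j)) = 0"
 proof (rule lincomb_zero_integral[OF _ _ _ _ b])
  show "finite J'" unfolding J'_def using J by simp
  show "finite_on (M' j)" if "j \<in> J'" for j
   using that M finite_jordan_part[OF \<mu>] by (auto simp: J'_def M'_def)
  show "lincomb J' c' M' A = 0" if "A \<in> \<Sigma>" for A
  proof -
   have "lincomb J' c' M' A = \<mu> A - lincomb {..<4} jordan_coeff (jordan_part \<mu>) A"
    unfolding lincomb_def[of J'] split by (simp add: c'_def M'_def sum_negf lincomb_def[of "{..<4}"]) (simp add: \<mu>_def lincomb_def)
   then show ?thesis using fun_cong[OF complex_measure_jordan[OF \<mu>], of A] by simp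
  qed
  show "f \<in> borel_measurable (restrict_space borel S)" using f by (simp add: bounded_borel_def)
 qed
 then show ?thesis unfolding split \<mu>_def[symmetric] integ_jordan by (simp add: c'_def M'_def sum_negf)
qed

lemma Cb_bounded_borel: "f \<in> Cb X ==> bounded_borel f"
 by (auto simp: Cb_def bounded_borel_def intro: borel_measurable_continuous_on_restrict)

subsection \<open>Regularity\<close>

lemma ex_sum_measure:
 assumes M: "finite_on M" and N: "finite_on N"
 shows "\<exists>V. finite_on V \<and> (\<forall>A\<in>\<Sigma>. emeasure V A = emeasure M A + emeasure N A)"
proof -
 define V where "V = measure_of S \<Sigma> (%A. emeasure M A + emeasure N A)"
 have sa: "sigma_algebra S \<Sigma>" using sets.sigma_algebra_axioms[of "restrict_space borel S"] by (simp add: space_restrict_space)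
 have "countably_additive \<Sigma> (%A. emeasure M A + emeasure N A)"
 proof (rule countably_additiveI)
  fix F :: "nat => 'a set" assume F: "range F \<subseteq> \<Sigma>" "disjoint_family F"
  show "(\<Sum>i. emeasure M (F i) + emeasure N (F i)) = emeasure M (\<Union>i. F i) + emeasure N (\<Union>i. F i)"
   using F finite_onD(1)[OF M] finite_onD(1)[OF N]
   by (subst suminf_add[symmetric]) (auto simp: summableI suminf_emeasure)
 qed
 then have V: "emeasure V A = emeasure M A + emeasure N A" if "A \<in> \<Sigma>" for A
  unfolding V_def using that by (intro emeasure_measure_of_sigma[OF sa]) (auto simp: positive_def)
 have sV: "sets V = \<Sigma>" unfolding V_def using sa by (simp add: sigma_algebra.sets_measure_of_eq)
 then have "space V = S" using sets_eq_imp_space_eq[OF sV] by (simp add: space_restrict_space)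
 moreover have "emeasure M S < top" "emeasure N S < top"
  using finite_measure.emeasure_finite[OF finite_onD(2)[OF M], of S] finite_measure.emeasure_finite[OF finite_onD(2)[OF N], of S]
  by (simp_all add: less_top)
 ultimately have "finite_measure V" by (intro finite_measureI) (simp add: V S_in_Sigma less_top[symmetric])
 then show ?thesis using sV V by (auto simp: finite_on_def)
qed

lemma finite_on_regular:
 assumes V: "finite_on V" and A: "A \<in> \<Sigma>" and e: "(e::real) > 0"
 shows "\<exists>U. openin X U \<and> A \<subseteq> U \<and> emeasure V (U - A) < ennreal e"
  and "\<exists>K. compactin X K \<and> K \<subseteq> A \<and> emeasure V (A - K) < ennreal e"
proof -
 interpret V: finite_measure V using V by (rule finite_onD)
 have sV: "sets V = \<Sigma>" "space V = S" using V by (simp_all add: finite_onD)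
 define V' where "V' = distr V borel (%x. x)"
 have [measurable]: "(%x. x) \<in> measurable V borel"
  unfolding measurable_cong_sets[OF sV(1) refl] by (rule measurable_restrict_space1) simp
 have em: "emeasure V' B = emeasure V (B \<inter> S)" if "B \<in> sets borel" for B
  unfolding V'_def using that by (simp add: emeasure_distr sV vimage_def Int_def)
 have A': "A \<in> sets borel" "A \<subseteq> S" using A by (auto simp: Sigma_iff)
 have V'A: "emeasure V' A = emeasure V A" using em[OF A'(1)] A'(2) by (simp add: Int_absorb2)
 have fin: "emeasure V' (space V') ~= \<infinity>" unfolding V'_def by (simp add: emeasure_distr V.emeasure_finite)
 have less: "emeasure V' A < emeasure V' A + ennreal e"
  using e V.emeasure_finite[of A] V'A by (cases "emeasure V A") (auto simp: ennreal_less_iff simp flip: ennreal_plus)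
 have "(INF U\<in>{U. A \<subseteq> U \<and> open U}. emeasure V' U) < emeasure V' A + ennreal e"
  using outer_regular[of V' A] fin A'(1) less by (simp add: V'_def)
 then obtain U where U: "A \<subseteq> U" "open U" "emeasure V' U < emeasure V' A + ennreal e"
  unfolding INF_less_iff by blast
 have "emeasure V (U \<inter> S - A) < ennreal e"
 proof -
  have "emeasure V (U \<inter> S) = emeasure V A + emeasure V (U \<inter> S - A)"
   using U(1,2) A A'(2) by (subst plus_emeasure) (auto simp: sV Sigma_iff Un_absorb1)
  with U(3) show ?thesis
   using V.emeasure_finite[of A] em[OF borel_open[OF U(2)]] by (simp add: V'A ennreal_add_left_cancel_less)
 qed
 then show "\<exists>U. openin X U \<and> A \<subseteq> U \<and> emeasure V (U - A) < ennreal e"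
  using U(1,2) A'(2) by (intro exI[of _ "U \<inter> S"]) (auto simp: openin_open)
 have "\<exists>K. K \<subseteq> A \<and> compact K \<and> emeasure V A < emeasure V K + ennreal e"
 proof (cases "emeasure V A = 0")
  case True then show ?thesis using e by (intro exI[of _ "{}"]) auto
 next
  case False
  define a where "a = measure V A"
  have a: "emeasure V A = ennreal a" "a > 0"
   using False V.emeasure_eq_measure[of A] by (auto simp: a_def zero_less_measure_iff)
  have "ennreal (a - e) < emeasure V' A" using a e unfolding V'A by (simp add: ennreal_less_iff ennreal_lessI)
  also have "emeasure V' A = (SUP K\<in>{K. K \<subseteq> A \<and> compact K}. emeasure V' K)"
   using inner_regular[of V' A] fin A'(1) by (simp add: V'_def)
  finally obtain K where K: "K \<subseteq> A" "compact K" "ennreal (a - e) < emeasure V' K"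
   unfolding less_SUP_iff by blast
  have VK: "emeasure V' K = ennreal (measure V K)"
   using em[OF borel_compact[OF K(2)]] K(1) A'(2) V.emeasure_eq_measure[of K] by (simp add: Int_absorb2 subset_trans)
  have "a < measure V K + e"
  proof (cases "a - e \<ge> 0")
   case True
   then have "a - e < measure V K" using K(3) unfolding VK by (simp add: ennreal_less_iff)
   then show ?thesis by simp
  next
   case False
   then show ?thesis using measure_nonneg[of V K] by linarith
  qed
  then have "emeasure V A < ennreal (measure V K + e)" using a by (simp add: ennreal_less_iff)
  then show ?thesis using K V.emeasure_eq_measure[of K] e by (intro exI[of _ K]) (simp add: ennreal_plus)
 qed
 then obtain K where K: "K \<subseteq> A" "compact K" "emeasure V A < emeasure V K + ennreal e" by blast
 have KS: "K \<in> \<Sigma>" using K A'(2) by (auto simp: Sigma_iff borel_compact)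
 have "emeasure V (A - K) < ennreal e"
 proof -
  have "emeasure V A = emeasure V K + emeasure V (A - K)"
   using K(1) A KS by (subst plus_emeasure) (auto simp: sV Un_absorb1)
  with K(3) show ?thesis using V.emeasure_finite[of K] by (simp add: ennreal_add_left_cancel_less)
 qed
 then show "\<exists>K. compactin X K \<and> K \<subseteq> A \<and> emeasure V (A - K) < ennreal e"
  using K A'(2) by (intro exI[of _ K]) (auto simp: compactin_subtopology)
qed

lemma total_variation_le:
 assumes V: "finite_on V" and \<mu>V: "!!A. A \<in> \<Sigma> ==> ennreal (norm (\<mu> A)) <= emeasure V A"
 shows "total_variation X \<mu> A <= emeasure V A"
 unfolding total_variation_def sets_borel_of
proof (rule SUP_least, clarify)
 fix F :: "nat => 'a set" assume F: "range F \<subseteq> \<Sigma>" "disjoint_family F"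
 have "(\<Sum>n. ennreal (norm (\<mu> (F n)))) <= (\<Sum>n. emeasure V (F n))"
  using F(1) by (intro suminf_le summableI \<mu>V) auto
 also have "\<dots> = emeasure V (\<Union>n. F n)"
  using F finite_onD(1)[OF V] by (intro suminf_emeasure) auto
 finally show "(\<Sum>n. ennreal (norm (\<mu> (F n)))) <= emeasure V (\<Union>n. F n)" .
qed

lemma total_variation_Un:
 assumes \<mu>: "\<mu> {} = 0" and A: "A \<in> \<Sigma>" and B: "B \<in> \<Sigma>" and AB: "A \<inter> B = {}"
  and add: "!!A B. A \<in> \<Sigma> ==> B \<in> \<Sigma> ==> A \<inter> B = {} ==> \<mu> (A \<union> B) = \<mu> A + \<mu> B"
 shows "total_variation X \<mu> (A \<union> B) <= total_variation X \<mu> A + total_variation X \<mu> B"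
 unfolding total_variation_def[of _ _ "A \<union> B"] sets_borel_of
proof (rule SUP_least, clarify)
 fix F :: "nat => 'a set" assume F: "range F \<subseteq> \<Sigma>" "disjoint_family F" "(\<Union>n. F n) = A \<union> B"
 have tv: "(\<Sum>n. ennreal (norm (\<mu> (F n \<inter> C)))) <= total_variation X \<mu> C" if "C \<in> \<Sigma>" "C \<subseteq> A \<union> B" for C
  unfolding total_variation_def sets_borel_of
  using F that by (intro SUP_upper2[of "%n. F n \<inter> C"]) (auto simp: disjoint_family_on_def)
 have "ennreal (norm (\<mu> (F n))) <= ennreal (norm (\<mu> (F n \<inter> A))) + ennreal (norm (\<mu> (F n \<inter> B)))" for n
 proof -
  have "(F n \<inter> A) \<inter> (F n \<inter> B) = {}" using AB by blast
  then have "\<mu> ((F n \<inter> A) \<union> (F n \<inter> B)) = \<mu> (F n \<inter> A) + \<mu> (F n \<inter> B)"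
   using F(1) A B by (intro add) auto
  moreover have "(F n \<inter> A) \<union> (F n \<inter> B) = F n" using F(3) by auto
  ultimately have "\<mu> (F n) = \<mu> (F n \<inter> A) + \<mu> (F n \<inter> B)" by simp
  then show ?thesis using norm_triangle_ineq[of "\<mu> (F n \<inter> A)" "\<mu> (F n \<inter> B)"]
   by (simp add: ennreal_leI flip: ennreal_plus)
 qed
 then have "(\<Sum>n. ennreal (norm (\<mu> (F n)))) <= (\<Sum>n. ennreal (norm (\<mu> (F n \<inter> A))) + ennreal (norm (\<mu> (F n \<inter> B))))"
  by (intro suminf_le summableI)
 also have "\<dots> = (\<Sum>n. ennreal (norm (\<mu> (F n \<inter> A)))) + (\<Sum>n. ennreal (norm (\<mu> (F n \<inter> B))))"
  by (intro suminf_add[symmetric] summableI)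
 also have "\<dots> <= total_variation X \<mu> A + total_variation X \<mu> B" by (intro add_mono tv A B) auto
 finally show "(\<Sum>n. ennreal (norm (\<mu> (F n)))) <= total_variation X \<mu> A + total_variation X \<mu> B" .
qed

lemma total_variation_mono:
 assumes A: "A \<in> \<Sigma>" and B: "B \<in> \<Sigma>" and AB: "A \<subseteq> B"
 shows "total_variation X \<mu> A <= total_variation X \<mu> B"
 unfolding total_variation_def[of _ _ A] sets_borel_of
proof (rule SUP_least)
 fix F :: "nat => 'a set" assume "F \<in> {F. range F \<subseteq> \<Sigma> \<and> disjoint_family F \<and> (\<Union>n. F n) = A}"
 then have F: "range F \<subseteq> \<Sigma>" "disjoint_family F" "(\<Union>n. F n) = A" by auto
 define G where "G n = (case n of 0 => B - A | Suc n => F n)" for n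
 have "range G \<subseteq> \<Sigma>" using F A B by (auto simp: G_def split: nat.splits)
 moreover have "disjoint_family G"
  using F(2,3) unfolding disjoint_family_on_def G_def by (auto split: nat.splits)
 moreover have "(\<Union>n. G n) = B"
 proof -
  have "(\<Union>n. G n) = G 0 \<union> (\<Union>n. G (Suc n))" by auto (metis not0_implies_Suc)
  then show ?thesis using F(3) AB by (auto simp: G_def)
 qed
 ultimately have "(\<Sum>n. ennreal (norm (\<mu> (G n)))) <= total_variation X \<mu> B"
  unfolding total_variation_def sets_borel_of by (intro SUP_upper) auto
 moreover have "(\<Sum>n. ennreal (norm (\<mu> (F n)))) <= (\<Sum>n. ennreal (norm (\<mu> (G n))))"
 proof (rule suminf_le_const[OF summableI])
  fix n
  have "(\<Sum>i<n. ennreal (norm (\<mu> (F i)))) <= (\<Sum>i<Suc n. ennreal (norm (\<mu> (G i))))"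
   by (subst sum.lessThan_Suc_shift) (simp add: G_def)
  also have "\<dots> <= (\<Sum>n. ennreal (norm (\<mu> (G n))))" by (rule sum_le_suminf[OF summableI]) auto
  finally show "(\<Sum>i<n. ennreal (norm (\<mu> (F i)))) <= (\<Sum>n. ennreal (norm (\<mu> (G n))))" .
 qed
 ultimately show "(\<Sum>n. ennreal (norm (\<mu> (F n)))) <= total_variation X \<mu> B" by simp
qed

lemma total_variation_cmeasure:
 assumes M: "finite_on M" and A: "A \<in> \<Sigma>"
 shows "total_variation X (cmeasure M) A = emeasure M A"
proof (rule antisym)
 interpret finite_measure M using M by (rule finite_onD)
 have n: "ennreal (norm (cmeasure M A)) = emeasure M A" for A
  by (simp add: cmeasure_def emeasure_eq_measure)
 show "total_variation X (cmeasure M) A <= emeasure M A"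
  by (rule total_variation_le[OF M]) (simp add: n)
 define F where "F n = (if n = 0 then A else {})" for n :: nat
 have "(\<Sum>n. ennreal (norm (cmeasure M (F n)))) <= total_variation X (cmeasure M) A"
  unfolding total_variation_def sets_borel_of
  using A by (intro SUP_upper) (auto simp: F_def disjoint_family_on_def split: if_splits)
 moreover have "(\<Sum>n. ennreal (norm (cmeasure M (F n)))) = (\<Sum>n\<in>{0}. ennreal (norm (cmeasure M (F n))))"
  by (rule suminf_finite) (auto simp: F_def cmeasure_def)
 ultimately show "emeasure M A <= total_variation X (cmeasure M) A" by (simp add: n F_def)
qed

lemma complex_measure_dominated:
 assumes J: "finite J" and M: "!!j. j \<in> J ==> finite_on (M j)" and c: "!!j. j \<in> J ==> norm (c j) <= 1"
 shows "\<exists>V. finite_on V \<and> (\<forall>A\<in>\<Sigma>. ennreal (norm (lincomb J c M A)) <= emeasure V A)"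
 using J M c
proof (induction J rule: finite_induct)
 case empty
 have "finite_on (null_measure (restrict_space borel S))"
  by (auto simp: finite_on_def intro!: finite_measureI)
 then show ?case by (intro exI[of _ "null_measure (restrict_space borel S)"]) (simp add: lincomb_def)
next
 case (insert j J)
 then obtain V where V: "finite_on V" "!!A. A \<in> \<Sigma> ==> ennreal (norm (lincomb J c M A)) <= emeasure V A" by auto
 obtain W where W: "finite_on W" "!!A. A \<in> \<Sigma> ==> emeasure W A = emeasure (M j) A + emeasure V A"
  using ex_sum_measure[OF insert.prems(1)[of j] V(1)] by auto
 have "ennreal (norm (lincomb (insert j J) c M A)) <= emeasure W A" if A: "A \<in> \<Sigma>" for A
 proof -
  interpret finite_measure "M j" using insert.prems(1)[of j] by (simp add: finite_onD)
  have "norm (c j * cmeasure (M j) A) <= 1 * measure (M j) A"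
   using insert.prems(2)[of j] by (simp add: norm_mult cmeasure_def mult_left_le_one_le)
  then have "norm (lincomb (insert j J) c M A) <= measure (M j) A + norm (lincomb J c M A)"
   using insert.hyps norm_triangle_ineq[of "c j * cmeasure (M j) A" "lincomb J c M A"]
   by (simp add: lincomb_def)
  then have "ennreal (norm (lincomb (insert j J) c M A)) <= ennreal (measure (M j) A) + ennreal (norm (lincomb J c M A))"
   by (simp add: ennreal_leI flip: ennreal_plus)
  also have "\<dots> <= emeasure W A" using V(2)[OF A] by (simp add: W(2)[OF A] emeasure_eq_measure add_left_mono)
  finally show ?thesis .
 qed
 with W(1) show ?case by blast
qed

text \<open>The total variation is dominated by a finite measure, whose regularity it inherits.\<close>
proposition complex_measure_regular:
 assumes \<mu>: "complex_measure X \<mu>" shows "regular_measure X \<mu>"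
proof -
 obtain V where V: "finite_on V" "!!A. A \<in> \<Sigma> ==> ennreal (norm (\<mu> A)) <= emeasure V A"
 proof -
  have "\<exists>V. finite_on V \<and> (\<forall>A\<in>\<Sigma>. ennreal (norm (lincomb {..<4} jordan_coeff (jordan_part \<mu>) A)) <= emeasure V A)"
   by (rule complex_measure_dominated)
    (auto simp: finite_jordan_part[OF \<mu>] lessThan_4 jordan_coeff_def intro: finite_jordan_part[OF \<mu>, unfolded lessThan_4])
  then show ?thesis using that by (auto simp: complex_measure_jordan[OF \<mu>, symmetric])
 qed
 have TV: "total_variation X \<mu> A <= emeasure V A" for A using V by (rule total_variation_le)
 have ca: "countably_additive_real (%A. Re (\<mu> A))" "countably_additive_real (%A. Im (\<mu> A))"
  using complex_measure_parts[OF \<mu>] by auto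
 have add: "\<mu> (A \<union> B) = \<mu> A + \<mu> B" if "A \<in> \<Sigma>" "B \<in> \<Sigma>" "A \<inter> B = {}" for A B
  using \<nu>_Un[OF ca(1) that] \<nu>_Un[OF ca(2) that] by (simp add: complex_eq_iff)
 have 0: "\<mu> {} = 0" using \<nu>_empty[OF ca(1)] \<nu>_empty[OF ca(2)] by (simp add: complex_eq_iff)
 have tot: "total_variation X \<mu> B <= total_variation X \<mu> A + emeasure V (B - A)" if "A \<in> \<Sigma>" "B \<in> \<Sigma>" "A \<subseteq> B" for A B
 proof -
  have "total_variation X \<mu> (A \<union> (B - A)) <= total_variation X \<mu> A + total_variation X \<mu> (B - A)"
   using that by (intro total_variation_Un[where \<mu> = \<mu>, OF 0] add) auto
  also have "A \<union> (B - A) = B" using that by auto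
  finally show ?thesis using TV[of "B - A"] by (meson add_left_mono order_trans)
 qed
 show ?thesis
  unfolding regular_measure_def sets_borel_of
 proof (intro ballI conjI)
  fix A assume A: "A \<in> \<Sigma>"
  show "total_variation X \<mu> A = (INF U\<in>{U. openin X U \<and> A \<subseteq> U}. total_variation X \<mu> U)"
  proof (rule antisym)
   show "total_variation X \<mu> A <= (INF U\<in>{U. openin X U \<and> A \<subseteq> U}. total_variation X \<mu> U)"
    using A openin_Sigma by (intro INF_greatest total_variation_mono) auto
   show "(INF U\<in>{U. openin X U \<and> A \<subseteq> U}. total_variation X \<mu> U) <= total_variation X \<mu> A"
   proof (rule ennreal_le_epsilon)
    fix e :: real assume "e > 0"
    then obtain U where U: "openin X U" "A \<subseteq> U" "emeasure V (U - A) < ennreal e"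
     using finite_on_regular(1)[OF V(1) A] by blast
    have "(INF U\<in>{U. openin X U \<and> A \<subseteq> U}. total_variation X \<mu> U) <= total_variation X \<mu> U"
     using U by (intro INF_lower) auto
    also have "\<dots> <= total_variation X \<mu> A + emeasure V (U - A)" using U A openin_Sigma by (intro tot) auto
    also have "\<dots> <= total_variation X \<mu> A + ennreal e" using U(3) by (intro add_left_mono) simp
    finally show "(INF U\<in>{U. openin X U \<and> A \<subseteq> U}. total_variation X \<mu> U) <= total_variation X \<mu> A + ennreal e" .
   qed
  qed
  show "total_variation X \<mu> A = (SUP K\<in>{K. compactin X K \<and> K \<subseteq> A}. total_variation X \<mu> K)"
  proof (rule antisym)
   show "(SUP K\<in>{K. compactin X K \<and> K \<subseteq> A}. total_variation X \<mu> K) <= total_variation X \<mu> A"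
    using A compactin_Sigma by (intro SUP_least total_variation_mono) auto
   show "total_variation X \<mu> A <= (SUP K\<in>{K. compactin X K \<and> K \<subseteq> A}. total_variation X \<mu> K)"
   proof (rule ennreal_le_epsilon)
    fix e :: real assume "e > 0"
    then obtain K where K: "compactin X K" "K \<subseteq> A" "emeasure V (A - K) < ennreal e"
     using finite_on_regular(2)[OF V(1) A] by blast
    have "total_variation X \<mu> A <= total_variation X \<mu> K + emeasure V (A - K)"
     using K A compactin_Sigma by (intro tot) auto
    also have "\<dots> <= (SUP K\<in>{K. compactin X K \<and> K \<subseteq> A}. total_variation X \<mu> K) + ennreal e"
     using K by (intro add_mono SUP_upper) auto
    finally show "total_variation X \<mu> A <= (SUP K\<in>{K. compactin X K \<and> K \<subseteq> A}. total_variation X \<mu> K) + ennreal e" .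
   qed
  qed
 qed
qed

lemma Mb_eq: "Mb X = {\<mu>. complex_measure X \<mu>}"
 using complex_measure_regular by (auto simp: Mb_def)

lemma lincomb_Mb: "finite J ==> (!!j. j \<in> J ==> finite_on (M j)) ==> lincomb J c M \<in> Mb X"
 by (simp add: Mb_eq complex_measure_lincomb)

lemma supp_cmeasure:
 assumes M: "finite_on M"
 shows "supp X (cmeasure M) = {x \<in> S. \<forall>U. openin X U \<and> x \<in> U --> emeasure M U > 0}"
 using openin_Sigma by (auto simp: supp_def total_variation_cmeasure[OF M])

end

lemma measurable_continuous_on_compose:
 assumes f: "continuous_on C f" and g: "g \<in> borel_measurable M" and C: "!!x. x \<in> space M ==> g x \<in> C"
 shows "(%x. f (g x)) \<in> borel_measurable M"
proof -
 have "g \<in> measurable M (restrict_space borel C)" using C g by (intro measurable_restrict_space2) auto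
 from measurable_compose[OF this borel_measurable_continuous_on_restrict[OF f]] show ?thesis .
qed

context closed_subset
begin

lemma finite_on_id: "finite_on M ==> (%x. x) \<in> borel_measurable M"
 by (subst measurable_cong_sets[OF finite_onD(1) refl]) (auto intro: measurable_restrict_space1)

lemma finite_on_measurable_cong: "finite_on M ==> measurable M N = measurable (restrict_space borel S) N"
 by (intro measurable_cong_sets) (auto simp: finite_onD)

lemma finite_on_integrable:
 assumes M: "finite_on M" and f: "bounded_borel f" shows "integrable M f"
proof -
 interpret finite_measure M using M by (rule finite_onD)
 obtain b where "!!x. x \<in> S ==> norm (f x) <= b" using f by (auto simp: bounded_borel_def bounded_iff)
 then show ?thesis using f
  by (intro integrable_const_bound[of _ b] AE_I2) (auto simp: bounded_borel_def finite_onD(3)[OF M] finite_on_measurable_cong[OF M])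
qed

section \<open>The weak topology\<close>

text \<open>The indicator of an open set is a limit of continuous functions of the distance to its complement,
 and the open sets are a generator that is stable under intersection.\<close>
lemma lincomb_zero_if_Cb:
 assumes J: "finite J" and M: "!!j. j \<in> J ==> finite_on (M j)"
  and 0: "!!f. f \<in> Cb X ==> (\<Sum>j\<in>J. c j * (\<integral>x. f x \<partial>M j)) = 0" and A: "A \<in> \<Sigma>"
 shows "lincomb J c M A = 0"
proof -
 have S0: "lincomb J c M S = 0"
 proof -
  have "(\<Sum>j\<in>J. c j * (\<integral>x. 1 \<partial>M j)) = 0" by (rule 0) (auto simp: Cb_def image_constant_conv)
  then show ?thesis by (simp add: lincomb_def cmeasure_def finite_onD(3)[OF M] scaleR_conv_of_real cong: sum.cong)
 qed
 have open0: "lincomb J c M U = 0" if U: "openin X U" for U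
 proof (cases "S - U = {}")
  case True
  then have "U = S" using openin_imp_subset[OF U] by auto
  then show ?thesis using S0 by simp
 next
  case False
  have cl: "closed (S - U)"
   using U closed_S by (metis closedin_closed_trans closedin_diff closedin_topspace topspace_euclidean_subtopology)
  define f where "f k x = complex_of_real (min 1 (real k * infdist x (S - U)))" for k :: nat and x
  have fCb: "f k \<in> Cb X" for k
  proof -
   have "continuous_on S (f k)" unfolding f_def by (intro continuous_intros)
   moreover have "norm (f k x) <= 1" for x by (auto simp: f_def min_def infdist_nonneg)
   ultimately show ?thesis by (auto simp: Cb_def bounded_iff)
  qed
  have lim: "(%k. \<integral>x. f k x \<partial>M j) \<longlonglongrightarrow> (\<integral>x. indicator U x \<partial>M j)" if j: "j \<in> J" for j
  proof -
   interpret finite_measure "M j" using M[OF j] by (rule finite_onD)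
   show ?thesis
   proof (rule integral_dominated_convergence[where w = "%_. 1"])
    show "AE x in M j. (%k. f k x) \<longlonglongrightarrow> indicator U x"
    proof (rule AE_I2)
     fix x assume "x \<in> space (M j)"
     then have x: "x \<in> S" by (simp add: finite_onD(3)[OF M[OF j]])
     show "(%k. f k x) \<longlonglongrightarrow> indicator U x"
     proof (cases "x \<in> U")
      case True
      then have "infdist x (S - U) > 0" using cl False by (metis Diff_iff infdist_pos_not_in_closed)
      then obtain N where N: "1 < real N * infdist x (S - U)" using reals_Archimedean3 by blast
      have "1 <= real k * infdist x (S - U)" if "k \<ge> N" for k
       using N mult_right_mono[of "real N" "real k" "infdist x (S - U)"] that infdist_nonneg[of x "S - U"] by linarith
      then have "eventually (%k. 1 <= real k * infdist x (S - U)) sequentially"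
       unfolding eventually_sequentially by blast
      then have "eventually (%k. f k x = indicator U x) sequentially"
       by eventually_elim (use True in \<open>simp add: f_def\<close>)
      then show ?thesis by (rule tendsto_eventually)
     next
      case False
      then show ?thesis using x by (simp add: f_def)
     qed
    qed
    show "AE x in M j. norm (f k x) <= 1" for k
     by (rule AE_I2) (auto simp: f_def min_def infdist_nonneg)
    show "f k \<in> borel_measurable (M j)" for k
     using Cb_bounded_borel[OF fCb] by (simp add: bounded_borel_def finite_on_measurable_cong[OF M[OF j]])
    show "indicator U \<in> borel_measurable (M j)"
     unfolding finite_on_measurable_cong[OF M[OF j]] using openin_Sigma[OF U] by (rule borel_measurable_indicator)
   qed simp
  qed
  have "(%k. \<Sum>j\<in>J. c j * (\<integral>x. f k x \<partial>M j)) \<longlonglongrightarrow> (\<Sum>j\<in>J. c j * (\<integral>x. indicator U x \<partial>M j))"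
   by (intro tendsto_sum tendsto_mult tendsto_const lim)
  then have "(%k. 0) \<longlonglongrightarrow> (\<Sum>j\<in>J. c j * (\<integral>x. indicator U x \<partial>M j))" by (simp add: 0[OF fCb])
  then have "(\<Sum>j\<in>J. c j * (\<integral>x. indicator U x \<partial>M j)) = 0" by (rule LIMSEQ_unique[OF _ tendsto_const])
  moreover have "(\<integral>x. indicator U x \<partial>M j) = complex_of_real (measure (M j) U)" if j: "j \<in> J" for j
  proof -
   interpret finite_measure "M j" using M[OF j] by (rule finite_onD)
   have "(\<integral>x. indicator U x *\<^sub>R (1 :: complex) \<partial>M j) = measure (M j) U *\<^sub>R 1"
    using openin_Sigma[OF U]
    by (intro has_bochner_integral_integral_eq has_bochner_integral_indicator)
     (simp_all add: finite_onD(1)[OF M[OF j]] emeasure_finite less_top[symmetric])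
   moreover have "(%x. indicator U x *\<^sub>R (1 :: complex)) = indicator U" by (auto simp: indicator_def)
   ultimately show ?thesis by (simp only: scaleR_conv_of_real mult_1_right)
  qed
  ultimately show ?thesis by (simp add: lincomb_def cmeasure_def cong: sum.cong)
 qed
 have cm: "complex_measure X (lincomb J c M)" using J M by (rule complex_measure_lincomb)
 note ca = complex_measure_parts[OF cm]
 have stable: "Int_stable {U. openin X U}" by (auto simp: Int_stable_def)
 have pow: "{U. openin X U} \<subseteq> Pow S" by (auto dest: openin_imp_subset)
 have "A \<in> sigma_sets S {U. openin X U}" using A by (simp add: openin_sigma)
 with stable pow show ?thesis
 proof (induction rule: sigma_sets_induct_disjoint)
  case (basic A) then show ?case using open0 by simp
 next
  case empty show ?case by (simp add: lincomb_def cmeasure_def)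
 next
  case (compl A)
  then have "A \<in> \<Sigma>" "A \<subseteq> S" by (auto simp: openin_sigma[symmetric] Sigma_iff)
  then show ?case
   using \<nu>_Diff[OF ca(1) S_in_Sigma, of A] \<nu>_Diff[OF ca(2) S_in_Sigma, of A] S0 compl.IH by (simp add: complex_eq_iff)
 next
  case (union F)
  then have "range F \<subseteq> \<Sigma>" by (simp add: openin_sigma)
  with union(1) cm have "(%n. lincomb J c M (F n)) sums lincomb J c M (\<Union>n. F n)"
   by (simp add: complex_measure_def sets_borel_of)
  then have "(%n::nat. 0) sums lincomb J c M (\<Union>n. F n)" using union.IH by simp
  then show ?case using sums_unique2[OF _ sums_zero] by blast
 qed
qed

proposition Cb_separates:
 assumes \<mu>: "\<mu> \<in> Mb X" and \<nu>: "\<nu> \<in> Mb X" and eq: "!!f. f \<in> Cb X ==> integ X \<mu> f = integ X \<nu> f"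
 shows "\<mu> = \<nu>"
proof -
 have cm: "complex_measure X \<mu>" "complex_measure X \<nu>" using \<mu> \<nu> by (simp_all add: Mb_eq)
 define J where "J = ({..<4::nat} <+> {..<4::nat})"
 define c where "c = case_sum jordan_coeff (%k. - jordan_coeff k)"
 define M where "M = case_sum (jordan_part \<mu>) (jordan_part \<nu>)"
 have split: "(\<Sum>j\<in>J. g j) = (\<Sum>k<4. g (Inl k)) + (\<Sum>k<4. g (Inr k))" for g :: "_ => complex"
  unfolding J_def by (subst sum.Plus) auto
 have lc: "lincomb J c M A = \<mu> A - \<nu> A" for A
 proof -
  have "lincomb J c M A = lincomb {..<4} jordan_coeff (jordan_part \<mu>) A - lincomb {..<4} jordan_coeff (jordan_part \<nu>) A"
   unfolding lincomb_def split by (simp add: c_def M_def sum_negf)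
  then show ?thesis using complex_measure_jordan[OF cm(1)] complex_measure_jordan[OF cm(2)] by simp
 qed
 have "lincomb J c M A = 0" if A: "A \<in> \<Sigma>" for A
 proof (rule lincomb_zero_if_Cb[OF _ _ _ A])
  show "finite J" by (simp add: J_def)
  show "finite_on (M j)" if "j \<in> J" for j
   using that finite_jordan_part[OF cm(1)] finite_jordan_part[OF cm(2)] by (auto simp: J_def M_def)
  show "(\<Sum>j\<in>J. c j * (\<integral>x. f x \<partial>M j)) = 0" if "f \<in> Cb X" for f
   using eq[OF that] unfolding split integ_jordan by (simp add: c_def M_def sum_negf)
 qed
 then have "\<mu> A = \<nu> A" if "A \<in> \<Sigma>" for A using that lc by simp
 moreover have "\<mu> A = \<nu> A" if "A \<notin> \<Sigma>" for A using that cm by (simp add: complex_measure_def sets_borel_of)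
 ultimately show ?thesis by blast
qed

lemma cmeasure_lincomb: "cmeasure M = lincomb {()} (%_. 1) (%_. M)"
 by (simp add: lincomb_def)

lemma cmeasure_Mb: "finite_on M ==> cmeasure M \<in> Mb X"
 unfolding cmeasure_lincomb by (rule lincomb_Mb) auto

lemma cmeasure_Mb_pos: "finite_on M ==> cmeasure M \<in> Mb_pos X"
 using cmeasure_Mb by (simp add: Mb_pos_def cmeasure_def)

lemma integ_cmeasure: "finite_on M ==> bounded_borel f ==> integ X (cmeasure M) f = (\<integral>x. f x \<partial>M)"
 unfolding cmeasure_lincomb by (subst integ_lincomb) auto

lemma Mb_posE:
 assumes "\<mu> \<in> Mb_pos X" obtains M where "finite_on M" "\<mu> = cmeasure M"
proof -
 have cm: "complex_measure X \<mu>" and pos: "!!A. Im (\<mu> A) = 0" "!!A. 0 <= Re (\<mu> A)"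
  using assms by (auto simp: Mb_pos_def Mb_eq)
 note ca = complex_measure_parts(1)[OF cm]
 let ?M = "pos_part X (%A. Re (\<mu> A))"
 have "\<mu> A = cmeasure ?M A" for A
 proof (cases "A \<in> \<Sigma>")
  case True
  have "upper_variation (%A. - Re (\<mu> A)) A = 0"
   unfolding upper_variation_def using pos(2) by (intro antisym SUP_least) (auto simp: ennreal_neg)
  then have "measure (pos_part X (%A. - Re (\<mu> A))) A = 0"
   using True by (simp add: measure_def emeasure_pos_part[OF ca_minus[OF ca]])
  then show ?thesis using jordan_decomposition[OF ca True] pos(1) by (simp add: complex_eq_iff cmeasure_def)
 next
  case False
  then show ?thesis
   using cm measure_outside[OF finite_pos_part[OF ca]] by (simp add: complex_measure_def sets_borel_of cmeasure_def)
 qed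
 then show ?thesis using that finite_pos_part[OF ca] by blast
qed

lemma topspace_weak: "topspace (weak_topology X) = Mb X"
proof -
 have "(%_. 0) \<in> Cb X" by (auto simp: Cb_def image_constant_conv)
 then have "{\<mu> \<in> Mb X. integ X \<mu> (%_. 0) \<in> UNIV} \<in> {{\<mu> \<in> Mb X. integ X \<mu> f \<in> W} | f W. f \<in> Cb X \<and> open W}"
  using open_UNIV by blast
 then have "Mb X \<subseteq> \<Union>{{\<mu> \<in> Mb X. integ X \<mu> f \<in> W} | f W. f \<in> Cb X \<and> open W}" by auto
 moreover have "\<Union>{{\<mu> \<in> Mb X. integ X \<mu> f \<in> W} | f W. f \<in> Cb X \<and> open W} \<subseteq> Mb X" by auto
 ultimately show ?thesis unfolding weak_topology_def topology_generated_by_topspace by (rule antisym[rotated])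
qed

lemma continuous_integ: "f \<in> Cb X ==> continuous_map (weak_topology X) euclidean (%\<mu>. integ X \<mu> f)"
 unfolding continuous_map_def topspace_weak
proof (intro conjI allI impI)
 fix U :: "complex set" assume f: "f \<in> Cb X" and "openin euclidean U"
 then show "openin (weak_topology X) {\<mu> \<in> Mb X. integ X \<mu> f \<in> U}"
  unfolding weak_topology_def by (intro topology_generated_by_Basis) auto
qed simp

lemma continuous_map_weak:
 assumes "!!x. x \<in> topspace T ==> h x \<in> Mb X"
  and "!!f. f \<in> Cb X ==> continuous_map T euclidean (%x. integ X (h x) f)"
 shows "continuous_map T (weak_topology X) h"
 unfolding weak_topology_def
proof (rule continuous_on_generated_topo)
 fix U assume "U \<in> {{\<mu> \<in> Mb X. integ X \<mu> f \<in> W} | f W. f \<in> Cb X \<and> open W}"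
 then obtain f W where U: "U = {\<mu> \<in> Mb X. integ X \<mu> f \<in> W}" "f \<in> Cb X" "open W" by blast
 have "h -` U \<inter> topspace T = {x \<in> topspace T. integ X (h x) f \<in> W}" using assms(1) by (auto simp: U(1))
 then show "openin T (h -` U \<inter> topspace T)"
  using assms(2)[OF U(2)] U(3) by (simp add: continuous_map_def)
next
 have "\<Union>{{\<mu> \<in> Mb X. integ X \<mu> f \<in> W} | f W. f \<in> Cb X \<and> open W} = Mb X"
  using topspace_weak unfolding weak_topology_def topology_generated_by_topspace .
 then show "h ` topspace T \<subseteq> \<Union>{{\<mu> \<in> Mb X. integ X \<mu> f \<in> W} | f W. f \<in> Cb X \<and> open W}"
  using assms(1) by auto
qed

lemma weak_neighbourhood:
 assumes "openin (weak_topology X) T" "\<mu> \<in> T"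
 shows "\<exists>F e. finite F \<and> F \<subseteq> Cb X \<and> e > 0 \<and> (\<forall>\<nu>\<in>Mb X. (\<forall>f\<in>F. dist (integ X \<nu> f) (integ X \<mu> f) < e) --> \<nu> \<in> T)"
proof -
 let ?P = "%T. \<forall>\<mu>\<in>T. \<exists>F e. finite F \<and> F \<subseteq> Cb X \<and> e > (0::real) \<and> (\<forall>\<nu>\<in>Mb X. (\<forall>f\<in>F. dist (integ X \<nu> f) (integ X \<mu> f) < e) --> \<nu> \<in> T)"
 have "generate_topology_on {{\<mu> \<in> Mb X. integ X \<mu> f \<in> W} | f W. f \<in> Cb X \<and> open W} T"
  using assms(1) unfolding weak_topology_def by (rule openin_topology_generated_by)
 then have "?P T"
 proof induction
  case Empty show ?case by simp
 next
  case (Int a b)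
  show ?case
  proof
   fix \<mu> assume "\<mu> \<in> a \<inter> b"
   then have \<mu>: "\<mu> \<in> a" "\<mu> \<in> b" by auto
   from bspec[OF Int.IH(1) \<mu>(1)] bspec[OF Int.IH(2) \<mu>(2)]
   show "\<exists>F e. finite F \<and> F \<subseteq> Cb X \<and> e > 0 \<and> (\<forall>\<nu>\<in>Mb X. (\<forall>f\<in>F. dist (integ X \<nu> f) (integ X \<mu> f) < e) --> \<nu> \<in> a \<inter> b)"
   proof (elim exE conjE)
    fix F e F' e'
    assume "finite F" "F \<subseteq> Cb X" "(0::real) < e" "finite F'" "F' \<subseteq> Cb X" "(0::real) < e'"
     and "\<forall>\<nu>\<in>Mb X. (\<forall>f\<in>F. dist (integ X \<nu> f) (integ X \<mu> f) < e) --> \<nu> \<in> a"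
      "\<forall>\<nu>\<in>Mb X. (\<forall>f\<in>F'. dist (integ X \<nu> f) (integ X \<mu> f) < e') --> \<nu> \<in> b"
    then show ?thesis by (intro exI[of _ "F \<union> F'"] exI[of _ "min e e'"]) simp
   qed
  qed
 next
  case (UN K)
  show ?case
  proof
   fix \<mu> assume "\<mu> \<in> \<Union>K"
   then obtain k where k: "k \<in> K" "\<mu> \<in> k" by blast
   have "k \<subseteq> \<Union>K" using k(1) by blast
   with bspec[OF UN.IH[OF k(1)] k(2)]
   show "\<exists>F e. finite F \<and> F \<subseteq> Cb X \<and> e > 0 \<and> (\<forall>\<nu>\<in>Mb X. (\<forall>f\<in>F. dist (integ X \<nu> f) (integ X \<mu> f) < e) --> \<nu> \<in> \<Union>K)"
   proof (elim exE conjE)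
    fix F e
    assume "k \<subseteq> \<Union>K" "finite F" "F \<subseteq> Cb X" "(0::real) < e"
     and *: "\<forall>\<nu>\<in>Mb X. (\<forall>f\<in>F. dist (integ X \<nu> f) (integ X \<mu> f) < e) --> \<nu> \<in> k"
    moreover have "\<forall>\<nu>\<in>Mb X. (\<forall>f\<in>F. dist (integ X \<nu> f) (integ X \<mu> f) < e) --> \<nu> \<in> \<Union>K"
     using * subsetD[OF \<open>k \<subseteq> \<Union>K\<close>] by simp
    ultimately show ?thesis by (intro exI[of _ F] exI[of _ e]) simp
   qed
  qed
 next
  case (Basis s)
  then obtain f W where s: "s = {\<mu> \<in> Mb X. integ X \<mu> f \<in> W}" "f \<in> Cb X" "open W" by blast
  show ?case
  proof
   fix \<mu> assume "\<mu> \<in> s"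
   then obtain e where "e > 0" "!!z. dist z (integ X \<mu> f) < e ==> z \<in> W"
    using s(1,3) by (auto simp: open_dist)
   then show "\<exists>F e. finite F \<and> F \<subseteq> Cb X \<and> e > 0 \<and> (\<forall>\<nu>\<in>Mb X. (\<forall>f\<in>F. dist (integ X \<nu> f) (integ X \<mu> f) < e) --> \<nu> \<in> s)"
    using s by (intro exI[of _ "{f}"] exI[of _ e]) auto
  qed
 qed
 then show ?thesis using assms(2) by blast
qed

subsection \<open>Density of the discrete measures and uniqueness of extensions\<close>

definition point_mass :: "'a => 'a measure" where
 "point_mass x = distr (count_space (UNIV :: unit set)) (restrict_space borel S) (%_. x)"

lemma
 assumes x: "x \<in> S"
 shows finite_point_mass: "finite_on (point_mass x)"
  and dirac_eq: "dirac X x = cmeasure (point_mass x)"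
  and integral_point_mass: "bounded_borel f ==> (\<integral>y. f y \<partial>point_mass x) = f x"
proof -
 have m: "(%_. x) \<in> measurable (count_space (UNIV :: unit set)) (restrict_space borel S)"
  using x by (simp add: space_restrict_space)
 have em: "emeasure (point_mass x) A = indicator A x" if "A \<in> \<Sigma>" for A
  using that unfolding point_mass_def by (subst emeasure_distr[OF m]) (auto simp: indicator_def vimage_def)
 show fin: "finite_on (point_mass x)"
  unfolding finite_on_def
  by (auto intro!: finite_measureI simp: em S_in_Sigma) (use x in \<open>simp_all add: point_mass_def space_restrict_space em[unfolded point_mass_def] S_in_Sigma indicator_def\<close>)
 show "dirac X x = cmeasure (point_mass x)"
 proof
  fix A show "dirac X x A = cmeasure (point_mass x) A"
   using measure_outside[OF fin, of A]
   by (cases "A \<in> \<Sigma>") (auto simp: dirac_def cmeasure_def sets_borel_of measure_def em indicator_def)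
 qed
 assume "bounded_borel f"
 then have "(\<integral>y. f y \<partial>point_mass x) = (\<integral>u. f x \<partial>count_space (UNIV :: unit set))"
  unfolding point_mass_def by (subst integral_distr[OF m]) (auto simp: bounded_borel_def)
 then show "(\<integral>y. f y \<partial>point_mass x) = f x" by (simp add: lebesgue_integral_count_space_finite)
qed

lemma dirac_Mb: "x \<in> S ==> dirac X x \<in> Mb X"
 by (simp add: dirac_eq cmeasure_Mb finite_point_mass)

lemma integ_dirac: "x \<in> S ==> bounded_borel f ==> integ X (dirac X x) f = f x"
 by (simp add: dirac_eq integ_cmeasure finite_point_mass integral_point_mass)

text \<open>Cut the bounded range of \<open>(f)\<^sub>f\<^sub>\<in>\<^sub>F\<close> into finitely many small cubes and concentrate the
 measure of the preimage of a cube at one of its points.\<close>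
lemma discrete_dense:
 assumes M: "finite_on M" and F: "finite F" "F \<subseteq> Cb X" and e: "e > 0"
 shows "\<exists>P c. finite P \<and> P \<subseteq> S \<and> (\<forall>x. 0 <= c x) \<and>
  (\<forall>f\<in>F. dist (integ X (lincomb P (%x. complex_of_real (c x)) point_mass) f) (\<integral>x. f x \<partial>M) < e)"
proof -
 interpret finite_measure M using M by (rule finite_onD)
 have sp: "space M = S" "sets M = \<Sigma>" using M by (simp_all add: finite_onD)
 define \<eta> where "\<eta> = e / (4 * (measure M S + 1))"
 have \<eta>: "\<eta> > 0" using e by (simp add: \<eta>_def add_nonneg_pos)
 define h where "h x = (\<lambda>f\<in>F. (\<lfloor>Re (f x) / \<eta>\<rfloor>, \<lfloor>Im (f x) / \<eta>\<rfloor>))" for x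
 have bb: "bounded_borel f" if "f \<in> F" for f using F(2) that by (intro Cb_bounded_borel) auto
 have fm[measurable]: "f \<in> borel_measurable M" if "f \<in> F" for f
  using bb[OF that] by (simp add: bounded_borel_def finite_on_measurable_cong[OF M])
 have "\<exists>b. \<forall>f\<in>F. \<forall>x\<in>S. norm (f x) <= b"
 proof -
  have "\<forall>f\<in>F. \<exists>b. \<forall>x\<in>S. norm (f x) <= b" using bb by (auto simp: bounded_borel_def bounded_iff)
  then obtain b where b: "!!f x. f \<in> F ==> x \<in> S ==> norm (f x) <= b f" by metis
  have "norm (f x) <= (\<Sum>f\<in>F. \<bar>b f\<bar>)" if "f \<in> F" "x \<in> S" for f x
   using b[OF that] member_le_sum[of f F "%f. \<bar>b f\<bar>"] F(1) that(1) by simp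
  then show ?thesis by blast
 qed
 then obtain b where b: "!!f x. f \<in> F ==> x \<in> S ==> norm (f x) <= b" by blast
 define K where "K = {- \<lceil>b / \<eta>\<rceil> - 1 .. \<lceil>b / \<eta>\<rceil> + 1}"
 have fl: "\<lfloor>r / \<eta>\<rfloor> \<in> K" if "\<bar>r\<bar> <= b" for r
 proof -
  have "r / \<eta> <= b / \<eta>" "- (b / \<eta>) <= r / \<eta>" using that \<eta> by (auto simp: field_simps)
  then show ?thesis unfolding K_def by simp linarith
 qed
 have "h ` S \<subseteq> (\<Pi>\<^sub>E f\<in>F. K \<times> K)"
 proof (intro image_subsetI PiE_I)
  fix z f assume z: "z \<in> S" and f: "f \<in> F"
  show "h z f \<in> K \<times> K"
   using f fl[OF order_trans[OF abs_Re_le_cmod b[OF f z]]] fl[OF order_trans[OF abs_Im_le_cmod b[OF f z]]] by (simp add: h_def)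
 qed (simp add: h_def)
 moreover have "finite (\<Pi>\<^sub>E f\<in>F. K \<times> K)" using F(1) by (intro finite_PiE) (auto simp: K_def)
 ultimately have fin: "finite (h ` S)" by (rule finite_subset)
 define x where "x i = (SOME x. x \<in> S \<and> h x = i)" for i
 have x: "x i \<in> S \<and> h (x i) = i" if "i \<in> h ` S" for i
  unfolding x_def by (rule someI_ex) (use that in blast)
 define A where "A y = {z \<in> S. h z = h y}" for y
 define P where "P = x ` h ` S"
 have PS: "P \<subseteq> S" using x by (auto simp: P_def)
 have finP: "finite P" unfolding P_def using fin by simp
 have xh: "x (h y) \<in> P" if "y \<in> S" for y using that by (auto simp: P_def)
 have Pinj: "y = z" if "y \<in> P" "z \<in> P" "h y = h z" for y z using that x by (auto simp: P_def)
 have AS: "A y \<in> \<Sigma>" for y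
 proof -
  have "A y = {z \<in> space M. \<forall>f\<in>F. \<lfloor>Re (f z) / \<eta>\<rfloor> = \<lfloor>Re (f y) / \<eta>\<rfloor> \<and> \<lfloor>Im (f z) / \<eta>\<rfloor> = \<lfloor>Im (f y) / \<eta>\<rfloor>}"
   by (auto simp: A_def h_def sp fun_eq_iff restrict_def)
  moreover have "\<dots> \<in> sets M"
  proof (rule sets.sets_Collect_finite_All[OF _ F(1)])
   fix f assume "f \<in> F"
   note [measurable] = fm[OF this]
   show "{z \<in> space M. \<lfloor>Re (f z) / \<eta>\<rfloor> = \<lfloor>Re (f y) / \<eta>\<rfloor> \<and> \<lfloor>Im (f z) / \<eta>\<rfloor> = \<lfloor>Im (f y) / \<eta>\<rfloor>} \<in> sets M"
    by measurable
  qed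
  ultimately show ?thesis by (simp add: sp)
 qed
 define c where "c y = measure M (A y)" for y
 have "dist (integ X (lincomb P (%x. complex_of_real (c x)) point_mass) f) (\<integral>x. f x \<partial>M) < e" if f: "f \<in> F" for f
 proof -
  define s where "s z = (\<Sum>y\<in>P. indicator (A y) z *\<^sub>R f y)" for z
  have s: "s z = f (x (h z))" if z: "z \<in> S" for z
  proof -
   have "s z = (\<Sum>y\<in>P. if y = x (h z) then f y else 0)"
    unfolding s_def
   proof (intro sum.cong refl)
    fix y assume y: "y \<in> P"
    have "z \<in> A y \<longleftrightarrow> h z = h y" using z by (simp add: A_def)
    also have "\<dots> \<longleftrightarrow> y = x (h z)" using Pinj[OF y xh[OF z]] x[of "h z"] z by auto
    finally show "indicator (A y) z *\<^sub>R f y = (if y = x (h z) then f y else 0)" by (cases "y = x (h z)") simp_all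
   qed
   then show ?thesis using xh[OF z] finP by simp
  qed
  have close: "norm (f z - s z) <= 2 * \<eta>" if z: "z \<in> S" for z
  proof -
   have hf: "h y f = (\<lfloor>Re (f y) / \<eta>\<rfloor>, \<lfloor>Im (f y) / \<eta>\<rfloor>)" for y using f by (simp add: h_def)
   have "h (x (h z)) = h z" using x[of "h z"] z by blast
   then have "h (x (h z)) f = h z f" by simp
   then have "\<lfloor>Re (f z) / \<eta>\<rfloor> = \<lfloor>Re (s z) / \<eta>\<rfloor>" "\<lfloor>Im (f z) / \<eta>\<rfloor> = \<lfloor>Im (s z) / \<eta>\<rfloor>"
    unfolding hf[of z] hf[of "x (h z)"] s[OF z] by simp_all
   then have "\<bar>Re (f z) / \<eta> - Re (s z) / \<eta>\<bar> <= 1" "\<bar>Im (f z) / \<eta> - Im (s z) / \<eta>\<bar> <= 1" by linarith+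
   then have "\<bar>Re (f z - s z)\<bar> <= \<eta>" "\<bar>Im (f z - s z)\<bar> <= \<eta>"
    using \<eta> by (simp_all add: abs_le_iff field_simps)
   then show ?thesis using cmod_le[of "f z - s z"] by linarith
  qed
  have int_ind: "integrable M (%z. indicator (A y) z *\<^sub>R f y)" for y
   using AS by (intro integrable_indicator) (simp_all add: sp emeasure_finite less_top[symmetric])
  have if': "integrable M f" by (rule finite_on_integrable[OF M bb[OF f]])
  have "(\<integral>z. s z \<partial>M) = (\<Sum>y\<in>P. complex_of_real (c y) * f y)"
  proof -
   have val: "(\<integral>z. indicator (A y) z *\<^sub>R f y \<partial>M) = c y *\<^sub>R f y" for y
    unfolding c_def using AS[of y]
    by (intro has_bochner_integral_integral_eq has_bochner_integral_indicator) (simp_all add: sp emeasure_finite less_top[symmetric])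
   show ?thesis
    unfolding s_def Bochner_Integration.integral_sum[OF int_ind] val by (simp only: scaleR_conv_of_real)
  qed
  also have "\<dots> = integ X (lincomb P (%x. complex_of_real (c x)) point_mass) f"
   using finP PS bb[OF f] by (subst integ_lincomb) (auto simp: finite_point_mass integral_point_mass subset_iff intro!: sum.cong)
  finally have eq: "integ X (lincomb P (%x. complex_of_real (c x)) point_mass) f = (\<integral>z. s z \<partial>M)" ..
  have ints: "integrable M s" unfolding s_def by (intro Bochner_Integration.integrable_sum int_ind)
  have "norm ((\<integral>z. f z \<partial>M) - (\<integral>z. s z \<partial>M)) = norm (\<integral>z. f z - s z \<partial>M)"
   using if' ints by simp
  also have "\<dots> <= (\<integral>z. norm (f z - s z) \<partial>M)" by (rule integral_norm_bound)
  also have "\<dots> <= (\<integral>z. 2 * \<eta> \<partial>M)"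
   using if' ints close by (intro integral_mono) (auto simp: sp)
  also have "\<dots> = 2 * \<eta> * measure M S" by (simp add: sp)
  also have "\<dots> <= 2 * \<eta> * (measure M S + 1)" using \<eta> by (intro mult_left_mono) auto
  also have "\<dots> = e / 2"
  proof -
   define m where "m = measure M S + 1"
   have "m ~= 0" using measure_nonneg[of M S] unfolding m_def by linarith
   then show ?thesis unfolding \<eta>_def m_def[symmetric] by (simp add: field_simps)
  qed
  also have "\<dots> < e" using e by simp
  finally show ?thesis unfolding eq by (simp add: dist_norm norm_minus_commute)
 qed
 then show ?thesis using finP PS by (intro exI[of _ P] exI[of _ c]) (auto simp: c_def)
qed

lemma lincomb_insert:
 "finite J ==> j \<notin> J ==> lincomb (insert j J) c M = (%A. c j * cmeasure (M j) A + 1 * lincomb J c M A)"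
 by (simp add: lincomb_def)

lemma lincomb_empty: "lincomb {} c M = (%A. 0 * cmeasure N A + 0 * cmeasure N A)"
 by (simp add: lincomb_def)

lemma bilinear_agree:
 assumes b: "bilinear_convolution X cv" "bilinear_convolution X cv'"
  and J: "finite J" and M: "!!j. j \<in> J ==> finite_on (M j)" and \<nu>: "\<nu> \<in> Mb X"
 shows "(!!j. j \<in> J ==> cv (cmeasure (M j)) \<nu> = cv' (cmeasure (M j)) \<nu>)
   ==> cv (lincomb J c M) \<nu> = cv' (lincomb J c M) \<nu>"
  and "(!!j. j \<in> J ==> cv \<nu> (cmeasure (M j)) = cv' \<nu> (cmeasure (M j)))
   ==> cv \<nu> (lincomb J c M) = cv' \<nu> (lincomb J c M)"
proof -
 have lin: "cv (%A. c * \<mu> A + d * \<mu>' A) \<nu> = (%A. c * cv \<mu> \<nu> A + d * cv \<mu>' \<nu> A)"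
  "cv' (%A. c * \<mu> A + d * \<mu>' A) \<nu> = (%A. c * cv' \<mu> \<nu> A + d * cv' \<mu>' \<nu> A)"
  "cv \<nu> (%A. c * \<mu> A + d * \<mu>' A) = (%A. c * cv \<nu> \<mu> A + d * cv \<nu> \<mu>' A)"
  "cv' \<nu> (%A. c * \<mu> A + d * \<mu>' A) = (%A. c * cv' \<nu> \<mu> A + d * cv' \<nu> \<mu>' A)"
  if "\<mu> \<in> Mb X" "\<mu>' \<in> Mb X" for c d \<mu> \<mu>'
  using b \<nu> that unfolding bilinear_convolution_def by blast+
 have z: "cmeasure (null_measure (restrict_space borel S)) \<in> Mb X"
  by (intro cmeasure_Mb) (auto simp: finite_on_def intro!: finite_measureI)
 show "cv (lincomb J c M) \<nu> = cv' (lincomb J c M) \<nu>"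
  if "!!j. j \<in> J ==> cv (cmeasure (M j)) \<nu> = cv' (cmeasure (M j)) \<nu>"
  using J M that
 proof (induction J rule: finite_induct)
  case empty
  show ?case unfolding lincomb_empty[of _ _ "null_measure (restrict_space borel S)"] lin[OF z z] by simp
 next
  case (insert j J)
  have m: "cmeasure (M j) \<in> Mb X" "lincomb J c M \<in> Mb X"
   using insert.prems(1) insert.hyps by (auto intro!: cmeasure_Mb lincomb_Mb)
  show ?case
   unfolding lincomb_insert[OF insert.hyps] lin[OF m] using insert.IH insert.prems by simp
 qed
 show "cv \<nu> (lincomb J c M) = cv' \<nu> (lincomb J c M)"
  if "!!j. j \<in> J ==> cv \<nu> (cmeasure (M j)) = cv' \<nu> (cmeasure (M j))"
  using J M that
 proof (induction J rule: finite_induct)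
  case empty
  show ?case unfolding lincomb_empty[of _ _ "null_measure (restrict_space borel S)"] lin[OF z z] by simp
 next
  case (insert j J)
  have m: "cmeasure (M j) \<in> Mb X" "lincomb J c M \<in> Mb X"
   using insert.prems(1) insert.hyps by (auto intro!: cmeasure_Mb lincomb_Mb)
  show ?case
   unfolding lincomb_insert[OF insert.hyps] lin[OF m] using insert.IH insert.prems by simp
 qed
qed

lemma lincomb_Mb_pos:
 assumes "finite J" "!!j. j \<in> J ==> finite_on (M j)" "!!j. 0 <= c j"
 shows "lincomb J (%j. complex_of_real (c j)) M \<in> Mb_pos X"
 using lincomb_Mb[of J M] assms by (auto simp: Mb_pos_def lincomb_def cmeasure_def intro!: sum_nonneg)

text \<open>Bilinearity carries the agreement from points to discrete measures, weak density to positive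
 measures, and the Jordan decomposition to all measures.\<close>
proposition convolution_unique:
 assumes b: "bilinear_convolution X cv" "bilinear_convolution X cv'"
  and w: "weakly_continuous X cv" "weakly_continuous X cv'"
  and dirac: "!!x y. x \<in> S ==> y \<in> S ==> cv (dirac X x) (dirac X y) = cv' (dirac X x) (dirac X y)"
  and \<mu>: "\<mu> \<in> Mb X" and \<nu>: "\<nu> \<in> Mb X"
 shows "cv \<mu> \<nu> = cv' \<mu> \<nu>"
proof -
 let ?W = "subtopology (weak_topology X) (Mb_pos X)"
 have cl: "cv \<mu> \<nu> \<in> Mb X" "cv' \<mu> \<nu> \<in> Mb X" if "\<mu> \<in> Mb X" "\<nu> \<in> Mb X" for \<mu> \<nu>
  using b that unfolding bilinear_convolution_def by blast+
 have pos_sub: "Mb_pos X \<subseteq> Mb X" by (auto simp: Mb_pos_def)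
 have disc: "cv (lincomb P c point_mass) (lincomb Q d point_mass) = cv' (lincomb P c point_mass) (lincomb Q d point_mass)"
  if P: "finite P" "P \<subseteq> S" and Q: "finite Q" "Q \<subseteq> S" for P Q c d
 proof (rule bilinear_agree(1)[OF b])
  show "lincomb Q d point_mass \<in> Mb X" using Q by (intro lincomb_Mb finite_point_mass) auto
  fix x assume x: "x \<in> P"
  show "cv (cmeasure (point_mass x)) (lincomb Q d point_mass) = cv' (cmeasure (point_mass x)) (lincomb Q d point_mass)"
  proof (rule bilinear_agree(2)[OF b])
   show "cmeasure (point_mass x) \<in> Mb X" using x P by (intro cmeasure_Mb finite_point_mass) auto
   show "cv (cmeasure (point_mass x)) (cmeasure (point_mass y)) = cv' (cmeasure (point_mass x)) (cmeasure (point_mass y))"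
    if "y \<in> Q" for y
    using dirac[of x y] x that P Q by (auto simp: dirac_eq subset_iff)
  qed (use Q in \<open>auto intro: finite_point_mass\<close>)
 qed (use P in \<open>auto intro: finite_point_mass\<close>)
 have dense: "\<exists>P c. finite P \<and> P \<subseteq> S \<and> lincomb P c point_mass \<in> U" if U: "openin ?W U" "\<mu> \<in> U" for U \<mu>
 proof -
  obtain T where T: "openin (weak_topology X) T" "U = T \<inter> Mb_pos X" using U(1) by (auto simp: openin_subtopology)
  obtain F e where F: "finite F" "F \<subseteq> Cb X" "e > 0"
   "!!\<nu>. \<nu> \<in> Mb X ==> (\<forall>f\<in>F. dist (integ X \<nu> f) (integ X \<mu> f) < e) ==> \<nu> \<in> T"
   using weak_neighbourhood[OF T(1), of \<mu>] U(2) T(2) by blast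
  obtain M where M: "finite_on M" "\<mu> = cmeasure M" using Mb_posE[of \<mu>] U(2) T(2) by blast
  obtain P c where P: "finite P" "P \<subseteq> S" "\<forall>x. 0 <= c x"
   "\<forall>f\<in>F. dist (integ X (lincomb P (%x. complex_of_real (c x)) point_mass) f) (\<integral>x. f x \<partial>M) < e"
   using discrete_dense[OF M(1) F(1,2,3)] by blast
  have pos: "lincomb P (%x. complex_of_real (c x)) point_mass \<in> Mb_pos X"
   using P by (intro lincomb_Mb_pos) (auto intro: finite_point_mass)
  have "(\<integral>x. f x \<partial>M) = integ X \<mu> f" if "f \<in> F" for f
   using that F(2) by (simp add: M integ_cmeasure Cb_bounded_borel subset_iff)
  then have "lincomb P (%x. complex_of_real (c x)) point_mass \<in> T"
   using pos pos_sub P(4) by (intro F(4)) auto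
  then show ?thesis using P(1,2) pos T(2) by blast
 qed
 have posit: "cv \<mu> \<nu> = cv' \<mu> \<nu>" if \<mu>: "\<mu> \<in> Mb_pos X" and \<nu>: "\<nu> \<in> Mb_pos X" for \<mu> \<nu>
 proof (rule Cb_separates)
  have "\<mu> \<in> Mb X" "\<nu> \<in> Mb X" using pos_sub \<mu> \<nu> by auto
  then show "cv \<mu> \<nu> \<in> Mb X" "cv' \<mu> \<nu> \<in> Mb X" by (rule cl)+
  fix f assume f: "f \<in> Cb X"
  define \<phi> where "\<phi> p = integ X (case p of (\<mu>, \<nu>) => cv \<mu> \<nu>) f - integ X (case p of (\<mu>, \<nu>) => cv' \<mu> \<nu>) f" for p
  have c1: "continuous_map (prod_topology ?W ?W) euclidean (%p. integ X (case p of (\<mu>, \<nu>) => cv \<mu> \<nu>) f)"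
   using continuous_map_compose[OF w(1)[unfolded weakly_continuous_def] continuous_integ[OF f]] by (simp add: o_def)
  have c2: "continuous_map (prod_topology ?W ?W) euclidean (%p. integ X (case p of (\<mu>, \<nu>) => cv' \<mu> \<nu>) f)"
   using continuous_map_compose[OF w(2)[unfolded weakly_continuous_def] continuous_integ[OF f]] by (simp add: o_def)
  have c: "continuous_map (prod_topology ?W ?W) euclidean \<phi>"
   unfolding \<phi>_def by (intro continuous_map_diff c1 c2)
  have tW: "topspace ?W = Mb_pos X" using pos_sub by (auto simp: topspace_weak)
  show "integ X (cv \<mu> \<nu>) f = integ X (cv' \<mu> \<nu>) f"
  proof (rule ccontr)
   assume "integ X (cv \<mu> \<nu>) f ~= integ X (cv' \<mu> \<nu>) f"
   then have nz: "\<phi> (\<mu>, \<nu>) ~= 0" by (simp add: \<phi>_def)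
   define G where "G = {p \<in> topspace (prod_topology ?W ?W). \<phi> p \<in> - {0}}"
   have "openin (prod_topology ?W ?W) G"
    unfolding G_def by (rule openin_continuous_map_preimage[OF c]) auto
   then have op: "\<forall>x y. (x, y) \<in> G --> (\<exists>U V. openin ?W U \<and> openin ?W V \<and> x \<in> U \<and> y \<in> V \<and> U \<times> V \<subseteq> G)"
    by (simp only: openin_prod_topology_alt)
   have "(\<mu>, \<nu>) \<in> G" using nz \<mu> \<nu> tW by (simp add: G_def)
   from op[rule_format, OF this]
   obtain U V where UV: "openin ?W U" "openin ?W V" "\<mu> \<in> U" "\<nu> \<in> V" "U \<times> V \<subseteq> G" by (elim exE conjE)
   obtain P c Q d where P: "finite P" "P \<subseteq> S" "lincomb P c point_mass \<in> U" and Q: "finite Q" "Q \<subseteq> S" "lincomb Q d point_mass \<in> V"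
    using dense[OF UV(1,3)] dense[OF UV(2,4)] by blast
   then have "(lincomb P c point_mass, lincomb Q d point_mass) \<in> G" using UV(5) by blast
   then show False using disc[OF P(1,2) Q(1,2), of c d] by (simp add: G_def \<phi>_def)
  qed
 qed
 have cm: "complex_measure X \<mu>" "complex_measure X \<nu>" using \<mu> \<nu> by (simp_all add: Mb_eq)
 have jp: "cmeasure (jordan_part \<mu> k) \<in> Mb_pos X" "cmeasure (jordan_part \<nu> k) \<in> Mb_pos X" if "k \<in> {..<4}" for k
  using finite_jordan_part[OF cm(1) that] finite_jordan_part[OF cm(2) that] by (auto intro: cmeasure_Mb_pos)
 have "cv (lincomb {..<4} jordan_coeff (jordan_part \<mu>)) \<nu> = cv' (lincomb {..<4} jordan_coeff (jordan_part \<mu>)) \<nu>"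
 proof (rule bilinear_agree(1)[OF b _ _ \<nu>])
  fix k assume k: "k \<in> {..<4::nat}"
  have "cv (cmeasure (jordan_part \<mu> k)) (lincomb {..<4} jordan_coeff (jordan_part \<nu>))
    = cv' (cmeasure (jordan_part \<mu> k)) (lincomb {..<4} jordan_coeff (jordan_part \<nu>))"
   using jp k pos_sub by (intro bilinear_agree(2)[OF b] posit finite_jordan_part[OF cm(2)]) auto
  then show "cv (cmeasure (jordan_part \<mu> k)) \<nu> = cv' (cmeasure (jordan_part \<mu> k)) \<nu>"
   by (simp only: complex_measure_jordan[OF cm(2), symmetric])
 qed (use finite_jordan_part[OF cm(1)] in auto)
 then show ?thesis by (simp only: complex_measure_jordan[OF cm(1), symmetric])
qed

end

lemma continuous_on_parametric_integral:
 fixes F :: "'p::metric_space \<times> 'q::metric_space => complex"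
 assumes F: "continuous_on (P \<times> Q) F" and b: "!!x y. x \<in> P ==> y \<in> Q ==> norm (F (x, y)) <= b"
  and N: "finite_measure N" "space N = Q" "(%y. y) \<in> borel_measurable N"
 shows "continuous_on P (%x. \<integral>y. F (x, y) \<partial>N)"
 unfolding continuous_on_sequentially
proof (intro allI ballI impI; elim conjE)
 interpret finite_measure N by (rule N)
 have m: "(%y. F (x, y)) \<in> borel_measurable N" if "x \<in> P" for x
 proof (rule measurable_continuous_on_compose[OF _ N(3)])
  show "continuous_on Q (%y. F (x, y))" by (rule continuous_on_compose2[OF F]) (use that in \<open>auto intro!: continuous_intros\<close>)
 qed (simp add: N)
 fix s a assume a: "a \<in> P" and s: "\<forall>n. s n \<in> P" "s \<longlonglongrightarrow> a"
 have "(%n. \<integral>y. F (s n, y) \<partial>N) \<longlonglongrightarrow> (\<integral>y. F (a, y) \<partial>N)"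
 proof (rule integral_dominated_convergence[where w = "%_. b"])
  show "AE y in N. (%n. F (s n, y)) \<longlonglongrightarrow> F (a, y)"
  proof (rule AE_I2)
   fix y assume "y \<in> space N"
   then have y: "y \<in> Q" by (simp add: N)
   show "(%n. F (s n, y)) \<longlonglongrightarrow> F (a, y)"
    by (rule continuous_on_tendsto_compose[OF F]) (use a s y in \<open>auto intro: tendsto_Pair\<close>)
  qed
  show "AE y in N. norm (F (s n, y)) <= b" for n
   using b s by (intro AE_I2) (simp add: N)
  show "(%y. F (a, y)) \<in> borel_measurable N" by (rule m[OF a])
  show "(%y. F (s n, y)) \<in> borel_measurable N" for n using m s by blast
 qed simp
 then show "((%x. \<integral>y. F (x, y) \<partial>N) \<circ> s) \<longlonglongrightarrow> (\<integral>y. F (a, y) \<partial>N)" by (simp add: o_def)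
qed

context closed_subset begin

subsection \<open>Joint weak continuity\<close>

lemma integral_close:
 fixes f g :: "'a => complex" and h :: "'a => real"
 assumes M: "finite_on M" and f: "bounded_borel f" and g: "bounded_borel g"
  and h: "bounded_borel (%x. complex_of_real (h x))" and le: "!!x. x \<in> S ==> norm (f x - g x) <= h x"
 shows "norm ((\<integral>x. f x \<partial>M) - (\<integral>x. g x \<partial>M)) <= (\<integral>x. h x \<partial>M)"
proof -
 note int = finite_on_integrable[OF M]
 have "norm ((\<integral>x. f x \<partial>M) - (\<integral>x. g x \<partial>M)) = norm (\<integral>x. f x - g x \<partial>M)"
  using int[OF f] int[OF g] by simp
 also have "\<dots> <= (\<integral>x. norm (f x - g x) \<partial>M)" by (rule integral_norm_bound)
 also have "\<dots> <= (\<integral>x. h x \<partial>M)"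
  using int[OF f] int[OF g] integrable_Re[OF int[OF h]] le by (intro integral_mono) (auto simp: finite_onD(3)[OF M])
 finally show ?thesis .
qed

lemma Cb_I: "continuous_on S f ==> (!!x. x \<in> S ==> norm (f x) <= b) ==> f \<in> Cb X"
 by (auto simp: Cb_def bounded_iff)

lemma Cb_integral_slice:
 fixes F :: "'a \<times> 'a => complex"
 assumes F: "continuous_on (S \<times> S) F" and b: "!!x y. x \<in> S ==> y \<in> S ==> norm (F (x, y)) <= b" and N: "finite_on N"
 shows "(%x. \<integral>y. F (x, y) \<partial>N) \<in> Cb X"
proof (rule Cb_I)
 interpret finite_measure N using N by (rule finite_onD)
 have slice: "(%y. F (x, y)) \<in> Cb X" if "x \<in> S" for x
  using that b by (intro Cb_I[of _ b] continuous_on_compose2[OF F] continuous_intros) auto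
 show "continuous_on S (%x. \<integral>y. F (x, y) \<partial>N)"
  by (rule continuous_on_parametric_integral[OF F b finite_onD(2)[OF N] finite_onD(3)[OF N] finite_on_id[OF N]])
 show "norm (\<integral>y. F (x, y) \<partial>N) <= (\<integral>y. b \<partial>N)" if "x \<in> S" for x
  by (rule order_trans[OF integral_norm_bound integral_mono])
   (use that b finite_on_integrable[OF N Cb_bounded_borel[OF slice[OF that]]] in \<open>auto simp: finite_onD(3)[OF N]\<close>)
qed

lemma space_jordan_part: "\<mu> \<in> Mb X ==> k < 4 ==> finite_on (jordan_part \<mu> k)"
 by (simp add: Mb_eq finite_jordan_part)

lemma integ_cong: "\<mu> \<in> Mb X ==> (!!x. x \<in> S ==> f x = g x) ==> integ X \<mu> f = integ X \<mu> g"
 unfolding integ_jordan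
 by (intro sum.cong refl arg_cong2[where f = times] Bochner_Integration.integral_cong)
  (simp_all add: finite_onD(3)[OF space_jordan_part])

lemma continuous_map_mult:
 fixes f g :: "'p => 'b :: real_normed_algebra"
 shows "continuous_map T euclidean f ==> continuous_map T euclidean g ==> continuous_map T euclidean (%x. f x * g x)"
 by (simp add: continuous_map_atin tendsto_mult)

text \<open>Since the error bound \<open>E\<close> is itself continuous, one approximant serves on a whole neighbourhood.\<close>
lemma continuous_map_approx:
 fixes \<Phi> :: "'p => complex"
 assumes "!!p0 \<epsilon>. p0 \<in> topspace T ==> \<epsilon> > 0 ==> \<exists>\<Psi> E. continuous_map T euclidean \<Psi> \<and> continuous_map T euclidean E \<and>
  (\<forall>p\<in>topspace T. norm (\<Phi> p - \<Psi> p) <= E p) \<and> E p0 < (\<epsilon> :: real)"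
 shows "continuous_map T euclidean \<Phi>"
proof -
 have "\<exists>U. openin T U \<and> p0 \<in> U \<and> (\<forall>p\<in>U. \<Phi> p \<in> ball (\<Phi> p0) \<epsilon>)" if p0: "p0 \<in> topspace T" and \<epsilon>: "\<epsilon> > 0" for p0 \<epsilon>
 proof -
  obtain \<Psi> E where *: "continuous_map T euclidean \<Psi>" "continuous_map T euclidean E"
   "\<forall>p\<in>topspace T. norm (\<Phi> p - \<Psi> p) <= E p" "E p0 < \<epsilon> / 3"
   using assms[OF p0, of "\<epsilon> / 3"] \<epsilon> by auto
  define U where "U = {p \<in> topspace T. \<Psi> p \<in> ball (\<Psi> p0) (\<epsilon> / 3)} \<inter> {p \<in> topspace T. E p \<in> {..<\<epsilon> / 3}}"
  have U: "openin T U"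
   unfolding U_def by (intro openin_Int openin_continuous_map_preimage[OF *(1)] openin_continuous_map_preimage[OF *(2)]) auto
  have "\<Phi> p \<in> ball (\<Phi> p0) \<epsilon>" if "p \<in> U" for p
  proof -
   have p: "p \<in> topspace T" "dist (\<Psi> p0) (\<Psi> p) < \<epsilon> / 3" "E p < \<epsilon> / 3" using that by (auto simp: U_def)
   have "dist (\<Phi> p0) (\<Psi> p0) <= E p0" "dist (\<Phi> p) (\<Psi> p) <= E p" using *(3) p p0 by (auto simp: dist_norm)
   then show ?thesis
    using p *(4) dist_triangle[of "\<Phi> p0" "\<Phi> p" "\<Psi> p0"] dist_triangle[of "\<Psi> p0" "\<Phi> p" "\<Psi> p"]
    by (simp add: dist_commute)
  qed
  moreover have "p0 \<in> U" using p0 \<epsilon> *(4) by (simp add: U_def)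
  ultimately show ?thesis using U by blast
 qed
 then have "continuous_map T (Met_TC.mtopology) \<Phi>"
  by (subst Met_TC.continuous_map_to_metric) auto
 then show ?thesis by simp
qed

text \<open>The kernel is approximated, up to an error that is small for all measures near the given
 ones, by finite sums of products: choose a compact set that carries most of the mass of both
 measures, and a fine partition of unity \<open>(g\<^sub>a)\<^sub>a\<^sub>\<in>\<^sub>A\<close> there; then \<open>F (x, y)\<close> is close to
 \<open>\<Sum>a\<in>A. g\<^sub>a x * F (a, y)\<close>.\<close>
lemma product_approximation:
 fixes F :: "'a \<times> 'a => complex"
 assumes F: "continuous_on (S \<times> S) F" and b: "!!x y. x \<in> S ==> y \<in> S ==> norm (F (x, y)) <= b"
  and \<eta>: "\<eta> > 0" and R: "R \<ge> 0"
 shows "\<exists>A g. finite A \<and> A \<subseteq> S \<and> (\<forall>a\<in>A. g a \<in> Cb X) \<and> (\<forall>x\<in>S. \<forall>y\<in>S.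
  norm (F (x, y) - (\<Sum>a\<in>A. g a x * F (a, y))) <= \<eta> + 2 * b * (min 1 (max 0 (norm x - R)) + min 1 (max 0 (norm y - R))))"
proof (cases "S = {}")
 case True then show ?thesis by (intro exI[of _ "{}"]) auto
next
 case False
 then obtain x0 where "x0 \<in> S" by blast
 then have b0: "b \<ge> 0" using b[of x0 x0] norm_ge_zero[of "F (x0, x0)"] by linarith
 define K where "K = S \<inter> cball 0 (R + 1)"
 have K: "compact K" unfolding K_def using closed_S by (intro closed_Int_compact) auto
 have uc: "uniformly_continuous_on (K \<times> K) F"
  using K by (intro compact_uniformly_continuous compact_Times continuous_on_subset[OF F]) (auto simp: K_def)
 from mp[OF spec[OF uc[unfolded uniformly_continuous_on_def], of \<eta>] \<eta>] obtain \<delta>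
  where "\<delta> > 0" and unif: "\<forall>p\<in>K \<times> K. \<forall>q\<in>K \<times> K. dist q p < \<delta> --> dist (F q) (F p) < \<eta>"
  by (elim exE conjE) rule
 note \<delta> = \<open>\<delta> > 0\<close> unif[rule_format]
 obtain A where A: "finite A" "A \<subseteq> K" "K \<subseteq> (\<Union>a\<in>A. ball a \<delta>)"
  using compactE_image[OF K, of K "%a. ball a \<delta>"] \<delta>(1) by (metis (no_types, lifting) UN_I centre_in_ball open_ball subsetI)
 define h where "h a x = max 0 (\<delta> - dist a x)" for a x :: 'a
 define D where "D x = (\<Sum>a\<in>A. h a x) + max 0 (norm x - (R + 1))" for x
 define g where "g a x = h a x / D x" for a x
 have h0: "h a x \<ge> 0" for a x by (simp add: h_def)
 have D: "D x > 0" if "x \<in> S" for x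
 proof (cases "x \<in> K")
  case True
  then obtain a where a: "a \<in> A" "dist a x < \<delta>" using A(3) by auto
  then have "0 < h a x" by (simp add: h_def)
  also have "\<dots> <= (\<Sum>a\<in>A. h a x)" using A(1) a(1) h0 by (intro member_le_sum) auto
  finally show ?thesis by (simp add: D_def add_pos_nonneg)
 next
  case False
  then have "norm x - (R + 1) > 0" using that by (simp add: K_def)
  then show ?thesis by (simp add: D_def h0 sum_nonneg add_nonneg_pos)
 qed
 have g0: "g a x \<ge> 0" if "x \<in> S" for a x using h0 D[OF that] by (simp add: g_def)
 have gD: "(\<Sum>a\<in>A. g a x) = (\<Sum>a\<in>A. h a x) / D x" for x by (simp add: g_def sum_divide_distrib)
 have g1: "(\<Sum>a\<in>A. g a x) <= 1" if "x \<in> S" for x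
  using D[OF that] by (simp add: gD divide_le_eq) (simp add: D_def)
 have gK: "(\<Sum>a\<in>A. g a x) = 1" if "x \<in> K" for x
  using D[of x] that by (simp add: gD K_def) (simp add: D_def)
 have gCb: "(%x. complex_of_real (g a x)) \<in> Cb X" if a: "a \<in> A" for a
 proof (rule Cb_I)
  show "continuous_on S (%x. complex_of_real (g a x))"
   unfolding g_def D_def h_def using D unfolding D_def h_def by (intro continuous_intros) (metis less_irrefl)
  show "norm (complex_of_real (g a x)) <= 1" if "x \<in> S" for x
   using member_le_sum[of a A "%a. g a x"] g1[OF that] g0[OF that] A(1) a by simp
 qed
 have "norm (F (x, y) - (\<Sum>a\<in>A. complex_of_real (g a x) * F (a, y)))
   <= \<eta> + 2 * b * (min 1 (max 0 (norm x - R)) + min 1 (max 0 (norm y - R)))" if x: "x \<in> S" and y: "y \<in> S" for x y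
 proof (cases "x \<in> K \<and> y \<in> K")
  case True
  have "F (x, y) = (\<Sum>a\<in>A. complex_of_real (g a x)) * F (x, y)"
   using gK[of x] True by (simp flip: of_real_sum)
  then have "norm (F (x, y) - (\<Sum>a\<in>A. complex_of_real (g a x) * F (a, y))) = norm (\<Sum>a\<in>A. complex_of_real (g a x) * (F (x, y) - F (a, y)))"
   by (simp add: sum_distrib_right sum_subtractf right_diff_distrib)
  also have "\<dots> <= (\<Sum>a\<in>A. g a x * \<eta>)"
  proof (rule sum_norm_le)
   fix a assume a: "a \<in> A"
   show "norm (complex_of_real (g a x) * (F (x, y) - F (a, y))) <= g a x * \<eta>"
   proof (cases "dist a x < \<delta>")
    case *: True
    then have "dist (F (x, y)) (F (a, y)) < \<eta>"
     using True a A(2) by (intro \<delta>(2)) (auto simp: dist_Pair_Pair dist_commute)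
    then show ?thesis using g0[OF x, of a] by (simp add: norm_mult dist_norm mult_left_mono)
   next
    case False then show ?thesis by (simp add: g_def h_def)
   qed
  qed
  also have "\<dots> = \<eta>" using gK[of x] True by (simp flip: sum_distrib_right)
  also have "\<dots> <= \<eta> + 2 * b * (min 1 (max 0 (norm x - R)) + min 1 (max 0 (norm y - R)))" using b0 by simp
  finally show ?thesis .
 next
  case False
  have "norm (\<Sum>a\<in>A. complex_of_real (g a x) * F (a, y)) <= (\<Sum>a\<in>A. g a x * b)"
   using g0[OF x] b y A(2) by (intro sum_norm_le) (auto simp: norm_mult K_def intro!: mult_left_mono)
  also have "\<dots> <= b" using g1[OF x] b0 by (simp add: mult_left_le_one_le sum_nonneg g0[OF x] flip: sum_distrib_right)
  finally have "norm (F (x, y) - (\<Sum>a\<in>A. complex_of_real (g a x) * F (a, y))) <= 2 * b"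
   using b[OF x y] norm_triangle_ineq4[of "F (x, y)" "\<Sum>a\<in>A. complex_of_real (g a x) * F (a, y)"] by linarith
  moreover have "1 <= min 1 (max 0 (norm x - R)) + min 1 (max 0 (norm y - R))"
   using False x y by (auto simp: K_def)
  then have "2 * b * 1 <= 2 * b * (min 1 (max 0 (norm x - R)) + min 1 (max 0 (norm y - R)))"
   using b0 by (intro mult_left_mono) auto
  ultimately show ?thesis using \<eta> by linarith
 qed
 then show ?thesis using A gCb by (intro exI[of _ A] exI[of _ "%a x. complex_of_real (g a x)"]) (auto simp: K_def)
qed

lemma tail_tendsto_0:
 assumes M: "finite_on M" shows "(%n::nat. \<integral>x. min 1 (max 0 (norm x - real n)) \<partial>M) \<longlonglongrightarrow> 0"
proof -
 interpret finite_measure M using M by (rule finite_onD)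
 have [measurable]: "(%x. x) \<in> borel_measurable M" by (rule finite_on_id[OF M])
 have "(%n::nat. \<integral>x. min 1 (max 0 (norm x - real n)) \<partial>M) \<longlonglongrightarrow> (\<integral>x. 0 \<partial>M)"
 proof (rule integral_dominated_convergence[where w = "%_. 1"])
  show "AE x in M. (%n. min 1 (max 0 (norm x - real n))) \<longlonglongrightarrow> 0"
  proof (rule AE_I2)
   fix x :: 'a
   obtain N where N: "norm x <= real N" using real_arch_simple by blast
   have "\<forall>n\<ge>N. min 1 (max 0 (norm x - real n)) = 0"
   proof (intro allI impI)
    fix n assume "N <= n"
    then have "real N <= real n" by simp
    then show "min 1 (max 0 (norm x - real n)) = 0" using N by simp
   qed
   then show "(%n. min 1 (max 0 (norm x - real n))) \<longlonglongrightarrow> 0"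
    by (intro tendsto_eventually) (auto simp: eventually_sequentially)
  qed
 qed auto
 then show ?thesis by simp
qed

proposition continuous_map_double_integral:
 fixes F :: "'a \<times> 'a => complex"
 assumes F: "continuous_on (S \<times> S) F" and b: "!!x y. x \<in> S ==> y \<in> S ==> norm (F (x, y)) <= b"
 defines "W \<equiv> subtopology (weak_topology X) (Mb_pos X)"
 shows "continuous_map (prod_topology W W) euclidean (%(\<mu>, \<nu>). integ X \<mu> (%x. integ X \<nu> (%y. F (x, y))))"
proof -
 define \<Phi> where "\<Phi> = (%(\<mu>, \<nu>). integ X \<mu> (%x. integ X \<nu> (%y. F (x, y))))"
 define B where "B = max b 0"
 have B: "!!x y. x \<in> S ==> y \<in> S ==> norm (F (x, y)) <= B" "B \<ge> 0" using b by (auto simp: B_def le_max_iff_disj)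
 have tW: "topspace W = Mb_pos X" by (auto simp: W_def topspace_weak Mb_pos_def)
 define \<zeta> where "\<zeta> n x = min 1 (max 0 (norm x - real n))" for n and x :: 'a
 have \<zeta>Cb: "(%x. complex_of_real (\<zeta> n x)) \<in> Cb X" for n
  unfolding \<zeta>_def by (rule Cb_I[of _ 1]) (auto intro!: continuous_intros)
 have \<zeta>01: "0 <= \<zeta> k x" "\<zeta> k x <= 1" for k x by (simp_all add: \<zeta>_def)
 have oneCb: "(%x. 1) \<in> Cb X" by (rule Cb_I[of _ 1]) auto
 have c1: "continuous_map (prod_topology W W) euclidean (%p. integ X (fst p) f)" if "f \<in> Cb X" for f
  using continuous_map_compose[OF continuous_map_fst[of W W] continuous_map_from_subtopology[OF continuous_integ[OF that], of "Mb_pos X", folded W_def]]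
  by (simp add: o_def)
 have c2: "continuous_map (prod_topology W W) euclidean (%p. integ X (snd p) f)" if "f \<in> Cb X" for f
  using continuous_map_compose[OF continuous_map_snd[of W W] continuous_map_from_subtopology[OF continuous_integ[OF that], of "Mb_pos X", folded W_def]]
  by (simp add: o_def)
 have FCb: "(%y. F (x, y)) \<in> Cb X" if "x \<in> S" for x
  using that B by (intro Cb_I[of _ B] continuous_on_compose2[OF F] continuous_intros) auto
 have "continuous_map (prod_topology W W) euclidean \<Phi>"
 proof (rule continuous_map_approx)
  fix p0 and \<epsilon> :: real assume p0: "p0 \<in> topspace (prod_topology W W)" and \<epsilon>: "\<epsilon> > 0"
  define m where "m = Re (integ X (fst p0) (%_. 1))"
  define n where "n = Re (integ X (snd p0) (%_. 1))"
  define tm where "tm k = Re (integ X (fst p0) (%x. complex_of_real (\<zeta> k x)))" for k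
  define tn where "tn k = Re (integ X (snd p0) (%x. complex_of_real (\<zeta> k x)))" for k
  have tail: "(%k. Re (integ X \<mu> (%x. complex_of_real (\<zeta> k x)))) \<longlonglongrightarrow> 0" if \<mu>: "\<mu> \<in> Mb_pos X" for \<mu>
  proof -
   obtain M where M: "finite_on M" "\<mu> = cmeasure M" using Mb_posE[OF \<mu>] by blast
   show ?thesis
    using tail_tendsto_0[OF M(1)] by (simp add: M integ_cmeasure[OF M(1) Cb_bounded_borel[OF \<zeta>Cb]] \<zeta>_def[symmetric])
  qed
  have "fst p0 \<in> Mb_pos X" "snd p0 \<in> Mb_pos X" using p0 by (simp_all add: tW mem_Times_iff)
  from tail[OF this(1)] tail[OF this(2)] have "tm \<longlonglongrightarrow> 0" "tn \<longlonglongrightarrow> 0" unfolding tm_def tn_def by auto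
  then have "(%k. 2 * B * (tm k * n + m * tn k)) \<longlonglongrightarrow> 2 * B * (0 * n + m * 0)" by (intro tendsto_intros)
  then have "(%k. 2 * B * (tm k * n + m * tn k)) \<longlonglongrightarrow> 0" by simp
  from order_tendstoD(2)[OF this, of "\<epsilon> / 2"] \<epsilon> have "eventually (%k. 2 * B * (tm k * n + m * tn k) < \<epsilon> / 2) sequentially" by simp
  then obtain k where k: "2 * B * (tm k * n + m * tn k) < \<epsilon> / 2" unfolding eventually_sequentially by blast
  define \<eta> where "\<eta> = \<epsilon> / (2 * (\<bar>m * n\<bar> + 1))"
  have \<eta>: "\<eta> > 0" using \<epsilon> by (simp add: \<eta>_def add_nonneg_pos)
  have "\<eta> * (m * n) <= \<eta> * \<bar>m * n\<bar>" using \<eta> by (intro mult_left_mono) auto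
  also have "\<dots> < \<eta> * (\<bar>m * n\<bar> + 1)" using \<eta> by (intro mult_strict_left_mono) auto
  also have "\<dots> = \<epsilon> / 2" by (simp add: \<eta>_def field_simps)
  finally have \<eta>mn: "\<eta> * (m * n) < \<epsilon> / 2" .
  have "\<exists>A g. finite A \<and> A \<subseteq> S \<and> (\<forall>a\<in>A. g a \<in> Cb X) \<and>
   (\<forall>x\<in>S. \<forall>y\<in>S. norm (F (x, y) - (\<Sum>a\<in>A. g a x * F (a, y))) <= \<eta> + 2 * B * (\<zeta> k x + \<zeta> k y))"
   by (rule product_approximation[OF F B(1) \<eta> of_nat_0_le_iff[of k], folded \<zeta>_def])
  then obtain A g where A: "finite A" "A \<subseteq> S" and gA: "\<forall>a\<in>A. g a \<in> Cb X"
   and approx: "\<forall>x\<in>S. \<forall>y\<in>S. norm (F (x, y) - (\<Sum>a\<in>A. g a x * F (a, y))) <= \<eta> + 2 * B * (\<zeta> k x + \<zeta> k y)"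
   by (elim exE conjE) rule
  note A = A gA[rule_format] approx[rule_format]
  define \<Psi> where "\<Psi> p = (\<Sum>a\<in>A. integ X (fst p) (g a) * integ X (snd p) (%y. F (a, y)))" for p
  define E where "E p = \<eta> * (Re (integ X (fst p) (%_. 1)) * Re (integ X (snd p) (%_. 1)))
   + 2 * B * (Re (integ X (fst p) (%x. complex_of_real (\<zeta> k x))) * Re (integ X (snd p) (%_. 1))
    + Re (integ X (fst p) (%_. 1)) * Re (integ X (snd p) (%x. complex_of_real (\<zeta> k x))))" for p
  have ReC: "continuous_map (prod_topology W W) euclidean (%p. Re (h p))" if "continuous_map (prod_topology W W) euclidean h" for h
   using continuous_map_compose[OF that, of euclidean Re] by (simp add: o_def continuous_on_Re continuous_on_id)
  have "continuous_map (prod_topology W W) euclidean \<Psi>"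
   unfolding \<Psi>_def using A FCb by (intro continuous_map_sum continuous_map_mult c1 c2) auto
  moreover have "continuous_map (prod_topology W W) euclidean E"
   unfolding E_def by (intro continuous_map_add continuous_map_real_mult ReC c1 c2 oneCb \<zeta>Cb) simp_all
  moreover have "E p0 < \<epsilon>" using k \<eta>mn unfolding E_def m_def n_def tm_def tn_def by linarith
  moreover have "norm (\<Phi> p - \<Psi> p) <= E p" if "p \<in> topspace (prod_topology W W)" for p
  proof -
   obtain \<mu> \<nu> where "p = (\<mu>, \<nu>)" by (cases p)
   with that have p: "p = (\<mu>, \<nu>)" "\<mu> \<in> Mb_pos X" "\<nu> \<in> Mb_pos X" by (simp_all add: tW)
   obtain M where M: "finite_on M" "\<mu> = cmeasure M" using Mb_posE[OF p(2)] by blast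
   obtain N where N: "finite_on N" "\<nu> = cmeasure N" using Mb_posE[OF p(3)] by blast
   interpret M: finite_measure M using M(1) by (rule finite_onD)
   interpret N: finite_measure N using N(1) by (rule finite_onD)
   have sp: "space M = S" "space N = S" using M(1) N(1) by (simp_all add: finite_onD)
   define G where "G x = (\<integral>y. F (x, y) \<partial>N)" for x
   have GCb: "G \<in> Cb X" unfolding G_def by (rule Cb_integral_slice[OF F B(1) N(1)])
   have i\<nu>: "integ X \<nu> f = (\<integral>y. f y \<partial>N)" "integ X \<mu> f = (\<integral>y. f y \<partial>M)" if "f \<in> Cb X" for f
    using M N that by (simp_all add: integ_cmeasure Cb_bounded_borel)
   have in_N: "integrable N f" "integrable M f" if "f \<in> Cb X" for f
    using that by (auto intro: finite_on_integrable M N Cb_bounded_borel)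
   have in_\<zeta>: "integrable N (\<zeta> k)" "integrable M (\<zeta> k)" using integrable_Re[OF in_N(1)[OF \<zeta>Cb]] integrable_Re[OF in_N(2)[OF \<zeta>Cb]] by simp_all
   have H: "norm (G x - (\<Sum>a\<in>A. g a x * G a)) <= (\<eta> + 2 * B * \<zeta> k x) * measure N S + 2 * B * (\<integral>y. \<zeta> k y \<partial>N)" if x: "x \<in> S" for x
   proof -
    have s: "(\<integral>y. (\<Sum>a\<in>A. g a x * F (a, y)) \<partial>N) = (\<Sum>a\<in>A. g a x * G a)"
     unfolding G_def using A(2) in_N(1)[OF FCb]
     by (subst Bochner_Integration.integral_sum) (auto intro!: Bochner_Integration.integrable_mult_right)
    have "norm (G x - (\<Sum>a\<in>A. g a x * G a)) <= (\<integral>y. \<eta> + 2 * B * (\<zeta> k x + \<zeta> k y) \<partial>N)"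
     unfolding s[symmetric] unfolding G_def
    proof (rule integral_close[OF N(1)])
     show "bounded_borel (%y. F (x, y))" by (rule Cb_bounded_borel[OF FCb[OF x]])
     show "bounded_borel (%y. \<Sum>a\<in>A. g a x * F (a, y))"
     proof (rule Cb_bounded_borel[OF Cb_I])
      show "continuous_on S (%y. \<Sum>a\<in>A. g a x * F (a, y))"
       using FCb A(2) by (intro continuous_intros) (auto simp: Cb_def)
      show "norm (\<Sum>a\<in>A. g a x * F (a, y)) <= (\<Sum>a\<in>A. norm (g a x) * B)" if "y \<in> S" for y
       using B A(2) that by (intro sum_norm_le) (auto simp: norm_mult intro!: mult_left_mono)
     qed
     show "bounded_borel (%y. complex_of_real (\<eta> + 2 * B * (\<zeta> k x + \<zeta> k y)))"
     proof (rule Cb_bounded_borel[OF Cb_I])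
      show "continuous_on S (%y. complex_of_real (\<eta> + 2 * B * (\<zeta> k x + \<zeta> k y)))"
       unfolding \<zeta>_def by (intro continuous_intros)
      show "norm (complex_of_real (\<eta> + 2 * B * (\<zeta> k x + \<zeta> k y))) <= \<eta> + 2 * B * (1 + 1)" for y
      proof -
       have "0 <= 2 * B * (\<zeta> k x + \<zeta> k y)" using B(2) \<zeta>01 by (simp add: add_nonneg_nonneg)
       moreover have "2 * B * (\<zeta> k x + \<zeta> k y) <= 2 * B * (1 + 1)"
        by (rule mult_left_mono[OF add_mono[OF \<zeta>01(2) \<zeta>01(2)]]) (use B(2) in simp)
       ultimately show ?thesis unfolding norm_of_real using \<eta> by linarith
      qed
     qed
     show "norm (F (x, y) - (\<Sum>a\<in>A. g a x * F (a, y))) <= \<eta> + 2 * B * (\<zeta> k x + \<zeta> k y)" if "y \<in> S" for y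
      by (rule A(4)[OF x that])
    qed
    also have "\<dots> = (\<eta> + 2 * B * \<zeta> k x) * measure N S + 2 * B * (\<integral>y. \<zeta> k y \<partial>N)"
     using in_\<zeta>(1) by (simp add: sp algebra_simps)
    finally show ?thesis .
   qed
   have "\<forall>a\<in>A. \<exists>c. \<forall>x\<in>S. norm (g a x) <= c" using A(3) by (auto simp: Cb_def bounded_iff)
   then obtain c where c: "\<forall>a\<in>A. \<forall>x\<in>S. norm (g a x) <= c a" by metis
   have gC: "(%x. \<Sum>a\<in>A. g a x * G a) \<in> Cb X"
   proof (rule Cb_I)
    show "norm (\<Sum>a\<in>A. g a x * G a) <= (\<Sum>a\<in>A. c a * norm (G a))" if "x \<in> S" for x
     using that c by (intro sum_norm_le) (auto simp: norm_mult intro!: mult_right_mono)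
    show "continuous_on S (%x. \<Sum>a\<in>A. g a x * G a)" using A(3) by (intro continuous_intros) (auto simp: Cb_def)
   qed
   have "norm ((\<integral>x. G x \<partial>M) - (\<integral>x. (\<Sum>a\<in>A. g a x * G a) \<partial>M)) <= (\<integral>x. (\<eta> + 2 * B * \<zeta> k x) * measure N S + 2 * B * (\<integral>y. \<zeta> k y \<partial>N) \<partial>M)"
   proof (rule integral_close[OF M(1) Cb_bounded_borel[OF GCb] Cb_bounded_borel[OF gC]])
    show "bounded_borel (%x. complex_of_real ((\<eta> + 2 * B * \<zeta> k x) * measure N S + 2 * B * (\<integral>y. \<zeta> k y \<partial>N)))"
    proof (rule Cb_bounded_borel[OF Cb_I])
     show "continuous_on S (%x. complex_of_real ((\<eta> + 2 * B * \<zeta> k x) * measure N S + 2 * B * (\<integral>y. \<zeta> k y \<partial>N)))"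
      unfolding \<zeta>_def by (intro continuous_intros)
     have "0 <= (\<integral>y. \<zeta> k y \<partial>N)" by (rule Bochner_Integration.integral_nonneg) (rule \<zeta>01)
     then show "norm (complex_of_real ((\<eta> + 2 * B * \<zeta> k x) * measure N S + 2 * B * (\<integral>y. \<zeta> k y \<partial>N)))
       <= (\<eta> + 2 * B * 1) * measure N S + 2 * B * (\<integral>y. \<zeta> k y \<partial>N)" for x
      unfolding norm_of_real using \<eta> B(2) \<zeta>01
      by (subst abs_of_nonneg) (auto intro!: mult_right_mono add_mono mult_left_mono add_nonneg_nonneg mult_nonneg_nonneg mult_left_le)
    qed
   qed (rule H)
   also have "\<dots> = E p"
    using in_\<zeta>(2) by (simp add: E_def p(1) i\<nu> oneCb \<zeta>Cb sp algebra_simps)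
   finally have le: "norm ((\<integral>x. G x \<partial>M) - (\<integral>x. (\<Sum>a\<in>A. g a x * G a) \<partial>M)) <= E p" .
   have "(\<integral>x. (\<Sum>a\<in>A. g a x * G a) \<partial>M) = (\<Sum>a\<in>A. \<integral>x. g a x * G a \<partial>M)"
    by (rule Bochner_Integration.integral_sum) (rule Bochner_Integration.integrable_mult_left[OF in_N(2)[OF A(3)]])
   also have "\<dots> = \<Psi> p"
    unfolding \<Psi>_def p(1) fst_conv snd_conv
   proof (rule sum.cong[OF refl])
    fix a assume a: "a \<in> A"
    then have "a \<in> S" using A(2) by blast
    then have "integ X \<nu> (%y. F (a, y)) = G a" unfolding G_def by (intro i\<nu>(1) FCb)
    then show "(\<integral>x. g a x * G a \<partial>M) = integ X \<mu> (g a) * integ X \<nu> (%y. F (a, y))" by (simp add: i\<nu>(2)[OF A(3)[OF a]])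
   qed
   finally have "(\<integral>x. (\<Sum>a\<in>A. g a x * G a) \<partial>M) = \<Psi> p" .
   moreover have "(\<integral>x. G x \<partial>M) = \<Phi> p"
   proof -
    have "(\<integral>x. G x \<partial>M) = integ X \<mu> G" using i\<nu>(2)[OF GCb] by simp
    also have "\<dots> = integ X \<mu> (%x. integ X \<nu> (%y. F (x, y)))"
     using p(2) i\<nu>(1)[OF FCb] by (intro integ_cong) (auto simp: Mb_pos_def G_def)
    finally show ?thesis by (simp add: \<Phi>_def p(1))
   qed
   ultimately show ?thesis using le by simp
  qed
  ultimately show "\<exists>\<Psi> E. continuous_map (prod_topology W W) euclidean \<Psi> \<and> continuous_map (prod_topology W W) euclidean E \<and>
    (\<forall>p\<in>topspace (prod_topology W W). norm (\<Phi> p - \<Psi> p) <= E p) \<and> E p0 < \<epsilon>" by blast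
 qed
 then show ?thesis by (simp add: \<Phi>_def)
qed

end

section \<open>Convolutions given by an integral over a compact parameter space\<close>

lemma borel_measurable_continuous_pair:
 fixes F :: "'p::euclidean_space \<times> 'q::euclidean_space => 'b::topological_space"
 assumes F: "continuous_on (space M \<times> space N) F"
  and M: "(%x. x) \<in> borel_measurable M" and N: "(%x. x) \<in> borel_measurable N"
 shows "F \<in> borel_measurable (M \<Otimes>\<^sub>M N)"
proof -
 have "(%z. (fst z, snd z)) \<in> borel_measurable (M \<Otimes>\<^sub>M N)"
  using measurable_compose[OF measurable_fst M] measurable_compose[OF measurable_snd N] by (rule borel_measurable_Pair)
 from measurable_continuous_on_compose[OF F this] show ?thesis by (simp add: space_pair_measure mem_Times_iff)
qed

lemma finite_measure_pair:
 assumes "finite_measure M" "finite_measure N" shows "finite_measure (M \<Otimes>\<^sub>M N)"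
proof -
 interpret M: finite_measure M by fact
 interpret N: finite_measure N by fact
 show ?thesis
  by (rule finite_measureI)
   (simp add: space_pair_measure N.emeasure_pair_measure_Times M.emeasure_finite N.emeasure_finite ennreal_mult_eq_top_iff)
qed

lemma double_integral:
 fixes F :: "'p::euclidean_space \<times> 'q::euclidean_space => complex"
 assumes F: "continuous_on (space M \<times> space N) F" and b: "!!x y. x \<in> space M ==> y \<in> space N ==> norm (F (x, y)) <= b"
  and M: "finite_measure M" "(%x. x) \<in> borel_measurable M" and N: "finite_measure N" "(%x. x) \<in> borel_measurable N"
 shows integral_pair_continuous: "(\<integral>z. F z \<partial>(M \<Otimes>\<^sub>M N)) = (\<integral>x. (\<integral>y. F (x, y) \<partial>N) \<partial>M)"
  and integral_swap_continuous: "(\<integral>x. (\<integral>y. F (x, y) \<partial>N) \<partial>M) = (\<integral>y. (\<integral>x. F (x, y) \<partial>M) \<partial>N)"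
proof -
 interpret M: finite_measure M by (rule M)
 interpret N: finite_measure N by (rule N)
 interpret P: pair_sigma_finite M N by unfold_locales
 interpret MN: finite_measure "M \<Otimes>\<^sub>M N" by (rule finite_measure_pair[OF M(1) N(1)])
 have int: "integrable (M \<Otimes>\<^sub>M N) F"
  using borel_measurable_continuous_pair[OF F M(2) N(2)] b
  by (intro MN.integrable_const_bound[of _ b] AE_I2) (auto simp: space_pair_measure)
 show "(\<integral>z. F z \<partial>(M \<Otimes>\<^sub>M N)) = (\<integral>x. (\<integral>y. F (x, y) \<partial>N) \<partial>M)" by (rule P.integral_fst'[OF int, symmetric])
 show "(\<integral>x. (\<integral>y. F (x, y) \<partial>N) \<partial>M) = (\<integral>y. (\<integral>x. F (x, y) \<partial>M) \<partial>N)"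
  using P.Fubini_integral[of "%x y. F (x, y)"] int by (simp add: case_prod_beta')
qed

context closed_subset
begin

lemma Cb_D: "f \<in> Cb X ==> continuous_on S f"
 by (simp add: Cb_def)

lemma Cb_boundE:
 assumes "f \<in> Cb X" obtains b where "!!x. x \<in> S ==> norm (f x) <= b"
 using assms by (auto simp: Cb_def bounded_iff)

lemma integ_linear_measure:
 assumes \<mu>: "\<mu> \<in> Mb X" "\<mu>' \<in> Mb X" and f: "bounded_borel f"
 shows "integ X (%A. c * \<mu> A + d * \<mu>' A) f = c * integ X \<mu> f + d * integ X \<mu>' f"
proof -
 have cm: "complex_measure X \<mu>" "complex_measure X \<mu>'" using \<mu> by (simp_all add: Mb_eq)
 define J where "J = ({..<4::nat} <+> {..<4::nat})"
 define k where "k = case_sum (%i. c * jordan_coeff i) (%i. d * jordan_coeff i)"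
 define M where "M = case_sum (jordan_part \<mu>) (jordan_part \<mu>')"
 have split: "(\<Sum>j\<in>J. g j) = (\<Sum>k<4. g (Inl k)) + (\<Sum>k<4. g (Inr k))" for g :: "_ => complex"
  unfolding J_def by (subst sum.Plus) auto
 have fin: "finite_on (M j)" if "j \<in> J" for j
  using that space_jordan_part[OF \<mu>(1)] space_jordan_part[OF \<mu>(2)] by (auto simp: J_def M_def)
 have "lincomb J k M A = c * lincomb {..<4} jordan_coeff (jordan_part \<mu>) A + d * lincomb {..<4} jordan_coeff (jordan_part \<mu>') A" for A
  unfolding lincomb_def split by (simp add: k_def M_def sum_distrib_left mult.assoc)
 then have eq: "(%A. c * \<mu> A + d * \<mu>' A) = lincomb J k M"
  by (simp add: fun_eq_iff complex_measure_jordan[OF cm(1), symmetric] complex_measure_jordan[OF cm(2), symmetric])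
 have "finite J" by (simp add: J_def)
 from integ_lincomb[OF this fin f] show ?thesis
  unfolding eq integ_jordan[of \<mu>] integ_jordan[of \<mu>'] split by (simp add: k_def M_def sum_distrib_left mult.assoc)
qed

lemma linear_combination_Mb:
 assumes \<mu>: "\<mu> \<in> Mb X" "\<mu>' \<in> Mb X" shows "(%A. c * \<mu> A + d * \<mu>' A) \<in> Mb X"
 using \<mu> unfolding Mb_eq complex_measure_def by (auto intro!: sums_add sums_mult)

lemma integ_linear_integrand:
 assumes \<mu>: "\<mu> \<in> Mb X" and f: "f \<in> Cb X" and g: "g \<in> Cb X"
 shows "integ X \<mu> (%x. c * f x + d * g x) = c * integ X \<mu> f + d * integ X \<mu> g"
proof -
 have int: "integrable (jordan_part \<mu> k) h" if "k < 4" "h \<in> Cb X" for k h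
  using that by (intro finite_on_integrable space_jordan_part \<mu> Cb_bounded_borel)
 have "(\<integral>x. c * f x + d * g x \<partial>jordan_part \<mu> k) = c * (\<integral>x. f x \<partial>jordan_part \<mu> k) + d * (\<integral>x. g x \<partial>jordan_part \<mu> k)" if "k < 4" for k
  using int[OF that f] int[OF that g] by simp
 then show ?thesis
  unfolding integ_jordan sum_distrib_left sum.distrib[symmetric] by (intro sum.cong) (simp_all add: algebra_simps)
qed

lemma Cb_integ_slice:
 fixes F :: "'a \<times> 'a => complex"
 assumes F: "continuous_on (S \<times> S) F" and b: "!!x y. x \<in> S ==> y \<in> S ==> norm (F (x, y)) <= b" and \<nu>: "\<nu> \<in> Mb X"
 shows "(%x. integ X \<nu> (%y. F (x, y))) \<in> Cb X"
proof -
 have *: "(%x. \<integral>y. F (x, y) \<partial>jordan_part \<nu> k) \<in> Cb X" if "k < 4" for k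
  by (rule Cb_integral_slice[OF F b space_jordan_part[OF \<nu> that]])
 have "\<forall>k<4. \<exists>c. \<forall>x\<in>S. norm (\<integral>y. F (x, y) \<partial>jordan_part \<nu> k) <= c" using * by (auto simp: Cb_def bounded_iff)
 then obtain c where c: "!!k x. k < 4 ==> x \<in> S ==> norm (\<integral>y. F (x, y) \<partial>jordan_part \<nu> k) <= c k" by metis
 show ?thesis
  unfolding integ_jordan
 proof (rule Cb_I)
  show "continuous_on S (%x. \<Sum>k<4. jordan_coeff k * (\<integral>y. F (x, y) \<partial>jordan_part \<nu> k))"
   using Cb_D[OF *] by (intro continuous_intros) auto
  show "norm (\<Sum>k<4. jordan_coeff k * (\<integral>y. F (x, y) \<partial>jordan_part \<nu> k)) <= (\<Sum>k<4. norm (jordan_coeff k) * c k)" if "x \<in> S" for x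
   using c that by (intro sum_norm_le) (auto simp: norm_mult intro!: mult_left_mono)
 qed
qed

end

locale convolution_kernel = closed_subset S for S :: "'a::euclidean_space set" +
 fixes m :: "'w::euclidean_space measure" and W :: "'w set" and \<phi> :: "'a => 'a => 'w => 'a"
 assumes finite_m: "finite_measure m" and mass_m: "measure m W = 1" and sets_m: "sets m = sets (restrict_space borel W)" and compact_W: "compact W"
  and \<phi>_S: "!!x y w. x \<in> S ==> y \<in> S ==> w \<in> W ==> \<phi> x y w \<in> S"
  and \<phi>_cont: "continuous_on ((S \<times> S) \<times> W) (%q. \<phi> (fst (fst q)) (snd (fst q)) (snd q))"
begin

lemma space_m: "space m = W"
 using sets_eq_imp_space_eq[OF sets_m] by (simp add: space_restrict_space)


lemma measurable_m: "measurable m N = measurable (restrict_space borel W) N"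
 by (rule measurable_cong_sets[OF sets_m refl])

lemma id_m: "(%w. w) \<in> borel_measurable m"
 unfolding measurable_m by (rule measurable_restrict_space1) simp

lemma W_nonempty: "W ~= {}"
 using mass_m by auto

lemma \<phi>_slice:
 assumes "x \<in> S" "y \<in> S" shows "continuous_on W (\<phi> x y)"
proof -
 have "continuous_on W (%w. ((x, y), w))" by (intro continuous_intros)
 from continuous_on_compose2[OF \<phi>_cont this] show ?thesis using assms by (simp add: image_subset_iff)
qed

definition T :: "('a => complex) => 'a => 'a => complex" where
 "T f x y = (\<integral>w. f (\<phi> x y w) \<partial>m)"

lemma f\<phi>_cont: "f \<in> Cb X ==> continuous_on ((S \<times> S) \<times> W) (%q. f (\<phi> (fst (fst q)) (snd (fst q)) (snd q)))"
 by (rule continuous_on_compose2[OF Cb_D \<phi>_cont]) (auto intro: \<phi>_S)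

lemma T_cont:
 assumes f: "f \<in> Cb X" shows "continuous_on (S \<times> S) (%p. T f (fst p) (snd p))"
proof -
 obtain b where b: "!!x. x \<in> S ==> norm (f x) <= b" using Cb_boundE[OF f] by blast
 have "norm (f (\<phi> (fst p) (snd p) w)) <= b" if "p \<in> S \<times> S" "w \<in> W" for p w
  using that b \<phi>_S by (simp add: mem_Times_iff)
 then show ?thesis
  unfolding T_def
  using continuous_on_parametric_integral[OF f\<phi>_cont[OF f] _ finite_m space_m id_m, of b] by simp
qed

lemma T_bound:
 assumes b: "!!x. x \<in> S ==> norm (f x) <= b" and f: "f \<in> Cb X" and xy: "x \<in> S" "y \<in> S"
 shows "norm (T f x y) <= b"
proof -
 interpret finite_measure m by (rule finite_m)
 have int: "integrable m (%w. f (\<phi> x y w))"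
 proof (rule integrable_const_bound)
  show "(%w. f (\<phi> x y w)) \<in> borel_measurable m"
   using continuous_on_compose2[OF Cb_D[OF f] \<phi>_slice[OF xy]] \<phi>_S[OF xy] unfolding measurable_m
   by (intro borel_measurable_continuous_on_restrict) auto
  show "AE w in m. norm (f (\<phi> x y w)) <= b" using b \<phi>_S[OF xy] by (intro AE_I2) (simp add: space_m)
 qed
 have "norm (T f x y) <= (\<integral>w. norm (f (\<phi> x y w)) \<partial>m)" unfolding T_def by (rule integral_norm_bound)
 also have "\<dots> <= (\<integral>w. b \<partial>m)" using int b \<phi>_S[OF xy] by (intro integral_mono) (auto simp: space_m)
 finally show ?thesis by (simp add: space_m mass_m)
qed

lemma T_Cb: "f \<in> Cb X ==> x \<in> S ==> T f x \<in> Cb X"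
proof -
 assume f: "f \<in> Cb X" and x: "x \<in> S"
 obtain b where b: "!!x. x \<in> S ==> norm (f x) <= b" using Cb_boundE[OF f] by blast
 have "continuous_on S (%y. (x, y))" by (intro continuous_intros)
 from continuous_on_compose2[OF T_cont[OF f] this] have "continuous_on S (T f x)" using x by (simp add: image_subset_iff)
 then show ?thesis using T_bound[OF b f x] by (rule Cb_I)
qed

lemma T_integ_Cb:
 assumes f: "f \<in> Cb X" and \<nu>: "\<nu> \<in> Mb X" shows "(%x. integ X \<nu> (%y. T f x y)) \<in> Cb X"
proof -
 obtain b where b: "!!x. x \<in> S ==> norm (f x) <= b" using Cb_boundE[OF f] by blast
 show ?thesis using Cb_integ_slice[OF T_cont[OF f] _ \<nu>, of b] T_bound[OF b f] by simp
qed

definition push :: "'a measure => 'a measure => 'a measure" where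
 "push M N = distr ((M \<Otimes>\<^sub>M N) \<Otimes>\<^sub>M m) (restrict_space borel S) (%q. \<phi> (fst (fst q)) (snd (fst q)) (snd q))"

lemma
 assumes M: "finite_on M" and N: "finite_on N"
 shows finite_push: "finite_on (push M N)"
  and integral_push: "f \<in> Cb X ==> (\<integral>x. f x \<partial>push M N) = (\<integral>x. (\<integral>y. T f x y \<partial>N) \<partial>M)"
proof -
 interpret fm: finite_measure "(M \<Otimes>\<^sub>M N) \<Otimes>\<^sub>M m"
  by (intro finite_measure_pair finite_m finite_onD(2)[OF M] finite_onD(2)[OF N])
 have idMN: "(%z. z) \<in> borel_measurable (M \<Otimes>\<^sub>M N)"
  by (rule borel_measurable_continuous_pair) (auto intro: finite_on_id M N)
 have sp: "space (M \<Otimes>\<^sub>M N) = S \<times> S" "space M = S" "space N = S" by (simp_all add: space_pair_measure finite_onD(3)[OF M] finite_onD(3)[OF N])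
 have meas: "(%q. \<phi> (fst (fst q)) (snd (fst q)) (snd q)) \<in> measurable ((M \<Otimes>\<^sub>M N) \<Otimes>\<^sub>M m) (restrict_space borel S)"
 proof (rule measurable_restrict_space2)
  show "(%q. \<phi> (fst (fst q)) (snd (fst q)) (snd q)) \<in> borel_measurable ((M \<Otimes>\<^sub>M N) \<Otimes>\<^sub>M m)"
   by (rule borel_measurable_continuous_pair[OF _ idMN id_m]) (simp add: sp space_m \<phi>_cont)
 qed (auto simp: space_pair_measure[of "M \<Otimes>\<^sub>M N"] sp space_m intro: \<phi>_S)
 show "finite_on (push M N)"
  unfolding finite_on_def push_def by (simp add: fm.finite_measure_distr[OF meas])
 assume f: "f \<in> Cb X"
 obtain b where b: "!!x. x \<in> S ==> norm (f x) <= b" using Cb_boundE[OF f] by blast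
 have "(\<integral>x. f x \<partial>push M N) = (\<integral>q. f (\<phi> (fst (fst q)) (snd (fst q)) (snd q)) \<partial>((M \<Otimes>\<^sub>M N) \<Otimes>\<^sub>M m))"
  unfolding push_def using Cb_bounded_borel[OF f] by (intro integral_distr[OF meas]) (simp add: bounded_borel_def)
 also have "\<dots> = (\<integral>p. T f (fst p) (snd p) \<partial>(M \<Otimes>\<^sub>M N))"
  unfolding T_def
  by (subst integral_pair_continuous[where b = b, OF _ _ finite_measure_pair[OF finite_onD(2)[OF M] finite_onD(2)[OF N]] idMN finite_m id_m])
   (auto simp: sp space_m intro!: f\<phi>_cont[OF f] b \<phi>_S)
 also have "\<dots> = (\<integral>x. (\<integral>y. T f x y \<partial>N) \<partial>M)"
  by (subst integral_pair_continuous[where b = b, OF _ _ finite_onD(2)[OF M] finite_on_id[OF M] finite_onD(2)[OF N] finite_on_id[OF N]])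
   (auto simp: sp intro: T_cont[OF f] T_bound[OF b f])
 finally show "(\<integral>x. f x \<partial>push M N) = (\<integral>x. (\<integral>y. T f x y \<partial>N) \<partial>M)" .
qed

text \<open>Through the Jordan parts, only images of positive product measures are needed.\<close>
definition cv :: "('a set => complex) => ('a set => complex) => 'a set => complex" where
 "cv \<mu> \<nu> = lincomb ({..<4} \<times> {..<4}) (%(i, j). jordan_coeff i * jordan_coeff j) (%(i, j). push (jordan_part \<mu> i) (jordan_part \<nu> j))"

lemma cv_Mb: "\<mu> \<in> Mb X ==> \<nu> \<in> Mb X ==> cv \<mu> \<nu> \<in> Mb X"
 unfolding cv_def by (rule lincomb_Mb) (auto intro: finite_push space_jordan_part)

lemma integ_cv:
 assumes \<mu>: "\<mu> \<in> Mb X" and \<nu>: "\<nu> \<in> Mb X" and f: "f \<in> Cb X"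
 shows "integ X (cv \<mu> \<nu>) f = integ X \<mu> (%x. integ X \<nu> (%y. T f x y))"
proof -
 obtain b where b: "!!x. x \<in> S ==> norm (f x) <= b" using Cb_boundE[OF f] by blast
 have int: "integrable (jordan_part \<mu> i) (%x. \<integral>y. T f x y \<partial>jordan_part \<nu> j)" if "i < 4" "j < 4" for i j
  using Cb_integral_slice[OF T_cont[OF f] _ space_jordan_part[OF \<nu> that(2)], of b] T_bound[OF b f]
  by (intro finite_on_integrable[OF space_jordan_part[OF \<mu> that(1)] Cb_bounded_borel]) simp
 have "integ X (cv \<mu> \<nu>) f = (\<Sum>(i, j)\<in>{..<4} \<times> {..<4}. jordan_coeff i * jordan_coeff j * (\<integral>x. (\<integral>y. T f x y \<partial>jordan_part \<nu> j) \<partial>jordan_part \<mu> i))"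
  unfolding cv_def
  by (subst integ_lincomb[OF _ _ Cb_bounded_borel[OF f]])
   (auto intro!: finite_push space_jordan_part[OF \<mu>] space_jordan_part[OF \<nu>] sum.cong simp: integral_push[OF space_jordan_part[OF \<mu>] space_jordan_part[OF \<nu>] f])
 also have "\<dots> = (\<Sum>i<4. jordan_coeff i * (\<Sum>j<4. jordan_coeff j * (\<integral>x. (\<integral>y. T f x y \<partial>jordan_part \<nu> j) \<partial>jordan_part \<mu> i)))"
  by (simp add: sum.cartesian_product[symmetric] sum_distrib_left mult.assoc)
 also have "\<dots> = (\<Sum>i<4. jordan_coeff i * (\<integral>x. (\<Sum>j<4. jordan_coeff j * (\<integral>y. T f x y \<partial>jordan_part \<nu> j)) \<partial>jordan_part \<mu> i))"
 proof (intro sum.cong refl arg_cong2[where f = times])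
  fix i :: nat assume i: "i \<in> {..<4}"
  show "(\<Sum>j<4. jordan_coeff j * (\<integral>x. (\<integral>y. T f x y \<partial>jordan_part \<nu> j) \<partial>jordan_part \<mu> i))
   = (\<integral>x. (\<Sum>j<4. jordan_coeff j * (\<integral>y. T f x y \<partial>jordan_part \<nu> j)) \<partial>jordan_part \<mu> i)"
   using int i by (subst Bochner_Integration.integral_sum) (auto intro!: Bochner_Integration.integrable_mult_right)
 qed
 finally show ?thesis unfolding integ_jordan .
qed

lemma bilinear_cv: "bilinear_convolution X cv"
 unfolding bilinear_convolution_def
proof (intro conjI ballI allI)
 fix \<mu> \<mu>' \<nu> and c d :: complex assume \<mu>: "\<mu> \<in> Mb X" "\<mu>' \<in> Mb X" and \<nu>: "\<nu> \<in> Mb X"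
 note lc = linear_combination_Mb
 show "cv (%A. c * \<mu> A + d * \<mu>' A) \<nu> = (%A. c * cv \<mu> \<nu> A + d * cv \<mu>' \<nu> A)"
 proof (rule Cb_separates)
  fix f assume f: "f \<in> Cb X"
  note bb = Cb_bounded_borel[OF f] Cb_bounded_borel[OF T_integ_Cb[OF f \<nu>]]
  show "integ X (cv (%A. c * \<mu> A + d * \<mu>' A) \<nu>) f = integ X (%A. c * cv \<mu> \<nu> A + d * cv \<mu>' \<nu> A) f"
   by (simp only: integ_cv[OF lc[OF \<mu>] \<nu> f] integ_linear_measure[OF cv_Mb[OF \<mu>(1) \<nu>] cv_Mb[OF \<mu>(2) \<nu>] bb(1)]
     integ_linear_measure[OF \<mu> bb(2)] integ_cv[OF \<mu>(1) \<nu> f] integ_cv[OF \<mu>(2) \<nu> f])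
 qed (intro cv_Mb lc \<mu> \<nu>)+
 show "cv \<nu> (%A. c * \<mu> A + d * \<mu>' A) = (%A. c * cv \<nu> \<mu> A + d * cv \<nu> \<mu>' A)"
 proof (rule Cb_separates)
  fix f assume f: "f \<in> Cb X"
  have "integ X (cv \<nu> (%A. c * \<mu> A + d * \<mu>' A)) f = integ X \<nu> (%x. c * integ X \<mu> (T f x) + d * integ X \<mu>' (T f x))"
   unfolding integ_cv[OF \<nu> lc[OF \<mu>] f]
   by (rule integ_cong[OF \<nu>]) (simp add: integ_linear_measure[OF \<mu> Cb_bounded_borel[OF T_Cb[OF f]]])
  also have "\<dots> = integ X (%A. c * cv \<nu> \<mu> A + d * cv \<nu> \<mu>' A) f"
   by (simp only: integ_linear_integrand[OF \<nu> T_integ_Cb[OF f \<mu>(1)] T_integ_Cb[OF f \<mu>(2)]]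
     integ_linear_measure[OF cv_Mb[OF \<nu> \<mu>(1)] cv_Mb[OF \<nu> \<mu>(2)] Cb_bounded_borel[OF f]] integ_cv[OF \<nu> \<mu>(1) f] integ_cv[OF \<nu> \<mu>(2) f])
  finally show "integ X (cv \<nu> (%A. c * \<mu> A + d * \<mu>' A)) f = integ X (%A. c * cv \<nu> \<mu> A + d * cv \<nu> \<mu>' A) f" .
 qed (intro cv_Mb lc \<mu> \<nu>)+
qed (rule cv_Mb)

lemma weakly_continuous_cv: "weakly_continuous X cv"
 unfolding weakly_continuous_def
proof (rule continuous_map_weak)
 let ?Z = "subtopology (weak_topology X) (Mb_pos X)"
 have top: "topspace (prod_topology ?Z ?Z) = Mb_pos X \<times> Mb_pos X" "Mb_pos X \<subseteq> Mb X" by (auto simp: topspace_weak Mb_pos_def)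
 show "(case p of (\<mu>, \<nu>) => cv \<mu> \<nu>) \<in> Mb X" if "p \<in> topspace (prod_topology ?Z ?Z)" for p
  using that top by (auto intro!: cv_Mb simp del: topspace_prod_topology topspace_subtopology)
 fix f assume f: "f \<in> Cb X"
 obtain b where b: "!!x. x \<in> S ==> norm (f x) <= b" using Cb_boundE[OF f] by blast
 have "continuous_map (prod_topology ?Z ?Z) euclidean (%(\<mu>, \<nu>). integ X \<mu> (%x. integ X \<nu> (%y. T f (fst (x, y)) (snd (x, y)))))"
  by (rule continuous_map_double_integral[OF T_cont[OF f], of b]) (simp add: T_bound[OF b f])
 then show "continuous_map (prod_topology ?Z ?Z) euclidean (%p. integ X (case p of (\<mu>, \<nu>) => cv \<mu> \<nu>) f)"
 proof (rule continuous_map_eq)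
  fix p assume "p \<in> topspace (prod_topology ?Z ?Z)"
  then obtain \<mu> \<nu> where "p = (\<mu>, \<nu>)" "\<mu> \<in> Mb X" "\<nu> \<in> Mb X" using top by blast
  then show "(case p of (\<mu>, \<nu>) => integ X \<mu> (%x. integ X \<nu> (%y. T f (fst (x, y)) (snd (x, y))))) = integ X (case p of (\<mu>, \<nu>) => cv \<mu> \<nu>) f"
   by (simp add: integ_cv[OF _ _ f])
 qed
qed

definition law :: "'a => 'a => 'a measure" where
 "law x y = distr m (restrict_space borel S) (\<phi> x y)"

lemma
 assumes xy: "x \<in> S" "y \<in> S"
 shows measurable_\<phi>: "\<phi> x y \<in> measurable m (restrict_space borel S)"
  and finite_law: "finite_on (law x y)"
  and cv_dirac: "cv (dirac X x) (dirac X y) = cmeasure (law x y)"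
  and integ_cv_dirac: "f \<in> Cb X ==> integ X (cv (dirac X x) (dirac X y)) f = T f x y"
proof -
 interpret finite_measure m by (rule finite_m)
 show meas: "\<phi> x y \<in> measurable m (restrict_space borel S)"
  unfolding measurable_m using borel_measurable_continuous_on_restrict[OF \<phi>_slice[OF xy]] \<phi>_S[OF xy]
  by (intro measurable_restrict_space2) (auto simp: space_restrict_space)
 show fin: "finite_on (law x y)"
  unfolding finite_on_def law_def by (simp add: finite_measure_distr[OF meas])
 show *: "integ X (cv (dirac X x) (dirac X y)) f = T f x y" if f: "f \<in> Cb X" for f
 proof -
  have "integ X (cv (dirac X x) (dirac X y)) f = integ X (dirac X x) (%x. integ X (dirac X y) (%y. T f x y))"
   by (rule integ_cv[OF dirac_Mb[OF xy(1)] dirac_Mb[OF xy(2)] f])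
  also have "\<dots> = integ X (dirac X y) (%y. T f x y)"
   by (rule integ_dirac[OF xy(1) Cb_bounded_borel[OF T_integ_Cb[OF f dirac_Mb[OF xy(2)]]]])
  also have "\<dots> = T f x y" by (rule integ_dirac[OF xy(2) Cb_bounded_borel[OF T_Cb[OF f xy(1)]]])
  finally show ?thesis .
 qed
 show "cv (dirac X x) (dirac X y) = cmeasure (law x y)"
 proof (rule Cb_separates[OF cv_Mb[OF dirac_Mb[OF xy(1)] dirac_Mb[OF xy(2)]] cmeasure_Mb[OF fin]])
  fix f assume f: "f \<in> Cb X"
  have "integ X (cmeasure (law x y)) f = (\<integral>z. f z \<partial>law x y)" by (rule integ_cmeasure[OF fin Cb_bounded_borel[OF f]])
  also have "\<dots> = T f x y"
   unfolding law_def T_def using Cb_bounded_borel[OF f] by (intro integral_distr[OF meas]) (simp add: bounded_borel_def)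
  finally show "integ X (cv (dirac X x) (dirac X y)) f = integ X (cmeasure (law x y)) f" using *[OF f] by simp
 qed
qed

lemma emeasure_law: "x \<in> S ==> y \<in> S ==> A \<in> \<Sigma> ==> emeasure (law x y) A = emeasure m {w \<in> W. \<phi> x y w \<in> A}"
 unfolding law_def by (subst emeasure_distr[OF measurable_\<phi>]) (auto simp: space_m intro!: arg_cong[where f = "emeasure m"])

lemma cv_unique:
 assumes b: "bilinear_convolution X cv'" and w: "weakly_continuous X cv'"
  and e: "!!x y f. x \<in> S ==> y \<in> S ==> f \<in> Cb X ==> integ X (cv' (dirac X x) (dirac X y)) f = T f x y"
  and \<mu>: "\<mu> \<in> Mb X" and \<nu>: "\<nu> \<in> Mb X"
 shows "cv' \<mu> \<nu> = cv \<mu> \<nu>"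
proof (rule convolution_unique[OF b bilinear_cv w weakly_continuous_cv _ \<mu> \<nu>])
 fix x y assume xy: "x \<in> S" "y \<in> S"
 have "cv' (dirac X x) (dirac X y) \<in> Mb X" using b dirac_Mb[OF xy(1)] dirac_Mb[OF xy(2)] by (simp add: bilinear_convolution_def)
 then show "cv' (dirac X x) (dirac X y) = cv (dirac X x) (dirac X y)"
  by (rule Cb_separates) (use xy in \<open>simp_all add: cv_Mb dirac_Mb e integ_cv_dirac\<close>)
qed

lemma integ_swap:
 assumes F: "continuous_on (W \<times> S) F" and b: "!!w z. w \<in> W ==> z \<in> S ==> norm (F (w, z)) <= b" and \<rho>: "\<rho> \<in> Mb X"
 shows "(\<integral>w. integ X \<rho> (%z. F (w, z)) \<partial>m) = integ X \<rho> (%z. \<integral>w. F (w, z) \<partial>m)"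
proof -
 interpret finite_measure m by (rule finite_m)
 have bb: "norm (\<integral>z. F (w, z) \<partial>N) <= (\<integral>z. b \<partial>N)" if N: "finite_on N" and w: "w \<in> W" for N w
 proof -
  have "(%z. F (w, z)) \<in> Cb X"
   using w b by (intro Cb_I[of _ b] continuous_on_compose2[OF F] continuous_intros) auto
  from finite_on_integrable[OF N Cb_bounded_borel[OF this]] finite_onD(2)[OF N] show ?thesis
   by (intro order_trans[OF integral_norm_bound integral_mono]) (use w b in \<open>auto simp: finite_onD(3)[OF N] finite_measure.integrable_const\<close>)
 qed
 have int: "integrable m (%w. \<integral>z. F (w, z) \<partial>N)" if N: "finite_on N" for N
 proof (rule integrable_const_bound)
  show "(%w. \<integral>z. F (w, z) \<partial>N) \<in> borel_measurable m"
   unfolding measurable_m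
   by (intro borel_measurable_continuous_on_restrict continuous_on_parametric_integral[OF F b finite_onD(2)[OF N] finite_onD(3)[OF N] finite_on_id[OF N]]) auto
  show "AE w in m. norm (\<integral>z. F (w, z) \<partial>N) <= (\<integral>z. b \<partial>N)" using bb[OF N] by (intro AE_I2) (simp add: space_m)
 qed
 have sw: "(\<integral>w. (\<integral>z. F (w, z) \<partial>N) \<partial>m) = (\<integral>z. (\<integral>w. F (w, z) \<partial>m) \<partial>N)" if N: "finite_on N" for N
  by (rule integral_swap_continuous[where b = b, OF _ _ finite_m id_m finite_onD(2)[OF N] finite_on_id[OF N]])
   (auto simp: space_m finite_onD(3)[OF N] F b)
 have "(\<integral>w. integ X \<rho> (%z. F (w, z)) \<partial>m) = (\<Sum>k<4. jordan_coeff k * (\<integral>w. (\<integral>z. F (w, z) \<partial>jordan_part \<rho> k) \<partial>m))"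
  unfolding integ_jordan using int[OF space_jordan_part[OF \<rho>]]
  by (subst Bochner_Integration.integral_sum) (auto intro!: Bochner_Integration.integrable_mult_right)
 also have "\<dots> = (\<Sum>k<4. jordan_coeff k * (\<integral>z. (\<integral>w. F (w, z) \<partial>m) \<partial>jordan_part \<rho> k))"
  by (intro sum.cong refl arg_cong2[where f = times] sw space_jordan_part[OF \<rho>]) simp
 finally show ?thesis unfolding integ_jordan .
qed

end

locale hypergroup_kernel = convolution_kernel S m W \<phi>
 for S :: "'a::euclidean_space set" and m :: "'w::euclidean_space measure" and W and \<phi> +
 fixes e :: 'a and bar :: "'a => 'a" and flip :: "'w => 'w"
 assumes full_support: "!!U. open U ==> U \<inter> W ~= {} ==> emeasure m (U \<inter> W) > 0"
  and associative_kernel: "!!f x y z. f \<in> Cb (top_of_set S) ==> x \<in> S ==> y \<in> S ==> z \<in> S ==>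
   (\<integral>w. (\<integral>v. f (\<phi> (\<phi> x y w) z v) \<partial>m) \<partial>m) = (\<integral>w. (\<integral>v. f (\<phi> x (\<phi> y z w) v) \<partial>m) \<partial>m)"
  and e_S: "e \<in> S" and \<phi>_e: "!!x w. x \<in> S ==> w \<in> W ==> \<phi> e x w = x" "!!x w. x \<in> S ==> w \<in> W ==> \<phi> x e w = x"
  and bar_S: "!!x. x \<in> S ==> bar x \<in> S" and bar_bar: "!!x. x \<in> S ==> bar (bar x) = x" and bar_cont: "continuous_on S bar"
  and flip_meas: "flip \<in> measurable m m" and flip_distr: "distr m m flip = m"
  and bar_\<phi>: "!!x y w. x \<in> S ==> y \<in> S ==> w \<in> W ==> bar (\<phi> x y w) = \<phi> (bar y) (bar x) (flip w)"
  and e_range: "!!x y. x \<in> S ==> y \<in> S ==> e \<in> \<phi> x y ` W \<longleftrightarrow> y = bar x"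
begin

text \<open>The range of \<open>\<phi> x y\<close> is closed, and an open set that meets it has a nonempty relatively open
 preimage in \<open>W\<close>, which is charged.\<close>
lemma supp_cv:
 assumes xy: "x \<in> S" "y \<in> S" shows "supp X (cv (dirac X x) (dirac X y)) = \<phi> x y ` W"
proof -
 have cpt: "compact (\<phi> x y ` W)" by (rule compact_continuous_image[OF \<phi>_slice[OF xy] compact_W])
 have "(\<forall>U. openin X U \<and> z \<in> U --> emeasure (law x y) U > 0) \<longleftrightarrow> z \<in> \<phi> x y ` W" if z: "z \<in> S" for z
 proof
  assume *: "\<forall>U. openin X U \<and> z \<in> U --> emeasure (law x y) U > 0"
  show "z \<in> \<phi> x y ` W"
  proof (rule ccontr)
   assume nz: "z \<notin> \<phi> x y ` W"
   have op: "openin X (S \<inter> - \<phi> x y ` W)" using cpt by (intro openin_open_Int open_Compl compact_imp_closed)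
   have no: "{w \<in> W. \<phi> x y w \<in> S \<inter> - \<phi> x y ` W} = {}" by auto
   have "emeasure (law x y) (S \<inter> - \<phi> x y ` W) = 0" unfolding emeasure_law[OF xy openin_Sigma[OF op]] no by simp
   then show False using * op nz z by fastforce
  qed
 next
  assume "z \<in> \<phi> x y ` W"
  then obtain w where w: "w \<in> W" "z = \<phi> x y w" by blast
  show "\<forall>U. openin X U \<and> z \<in> U --> emeasure (law x y) U > 0"
  proof (intro allI impI; elim conjE)
   fix U assume U: "openin X U" "z \<in> U"
   have "openin (top_of_set W) (W \<inter> \<phi> x y -` U)"
    by (rule continuous_openin_preimage[OF \<phi>_slice[OF xy] _ U(1)]) (use \<phi>_S[OF xy] in auto)
   then obtain V where V: "open V" "W \<inter> \<phi> x y -` U = W \<inter> V" unfolding openin_open by blast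
   then have "{w \<in> W. \<phi> x y w \<in> U} = V \<inter> W" by auto
   moreover have "V \<inter> W ~= {}" using V(2) w U(2) by auto
   ultimately show "emeasure (law x y) U > 0" using emeasure_law[OF xy openin_Sigma[OF U(1)]] full_support[OF V(1)] by simp
  qed
 qed
 moreover have "\<phi> x y ` W \<subseteq> S" using \<phi>_S[OF xy] by blast
 ultimately show ?thesis unfolding cv_dirac[OF xy] supp_cmeasure[OF finite_law[OF xy]] by blast
qed

lemma compact_range: "x \<in> S ==> y \<in> S ==> compactin X (\<phi> x y ` W)"
 using compact_continuous_image[OF \<phi>_slice compact_W] \<phi>_S by (auto simp: compactin_subtopology)

text \<open>Meeting \<open>U\<close> and leaving \<open>V\<close> are conditions on a projection along \<open>W\<close>; projections are open maps, and
 closed maps because \<open>W\<close> is compact.\<close>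
lemma continuous_range: "continuous_map (prod_topology X X) (michael_topology X) (%(x, y). \<phi> x y ` W)"
 unfolding michael_topology_def
proof (rule continuous_on_generated_topo)
 have ne: "\<phi> x y ` W ~= {}" for x y using W_nonempty by simp
 fix Q assume "Q \<in> {{C. compactin X C \<and> C ~= {} \<and> C \<inter> U ~= {} \<and> C \<subseteq> V} | U V. openin X U \<and> openin X V}"
 then obtain U V where Q: "Q = {C. compactin X C \<and> C ~= {} \<and> C \<inter> U ~= {} \<and> C \<subseteq> V}" and U: "openin X U" and V: "openin X V" by blast
 let ?\<Phi> = "%q. \<phi> (fst (fst q)) (snd (fst q)) (snd q)"
 let ?P = "prod_topology (prod_topology X X) (top_of_set W)"
 have P: "?P = top_of_set ((S \<times> S) \<times> W)" by (simp add: prod_topology_subtopology_eu)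
 have cm: "continuous_map ?P X ?\<Phi>"
  unfolding P using \<phi>_cont by (auto simp: continuous_map_in_subtopology \<phi>_S)
 have o: "openin (prod_topology X X) (fst ` {q \<in> topspace ?P. ?\<Phi> q \<in> U})"
  using open_map_fst openin_continuous_map_preimage[OF cm U] unfolding open_map_def by blast
 have "compact_space (top_of_set W)" using compact_W by (simp add: compact_space_subtopology compactin_euclidean_iff)
 then have "closed_map ?P (prod_topology X X) fst" by (rule closed_map_fst)
 moreover have "closedin ?P {q \<in> topspace ?P. ?\<Phi> q \<in> topspace X - V}"
  by (rule closedin_continuous_map_preimage[OF cm closedin_diff[OF closedin_topspace V]])
 ultimately have c: "closedin (prod_topology X X) (fst ` {q \<in> topspace ?P. ?\<Phi> q \<in> topspace X - V})"
  unfolding closed_map_def by blast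
 have "(%(x, y). \<phi> x y ` W) -` Q \<inter> topspace (prod_topology X X) =
  fst ` {q \<in> topspace ?P. ?\<Phi> q \<in> U} - fst ` {q \<in> topspace ?P. ?\<Phi> q \<in> topspace X - V}" (is "?L = ?R")
 proof (intro set_eqI)
  fix p
  show "p \<in> ?L \<longleftrightarrow> p \<in> ?R"
  proof (cases "p \<in> S \<times> S")
   case False then show ?thesis by auto
  next
   case True
   then obtain x y where p: "p = (x, y)" and xy: "x \<in> S" "y \<in> S" by blast
   have L: "p \<in> ?L \<longleftrightarrow> (\<exists>w\<in>W. \<phi> x y w \<in> U) \<and> (\<forall>w\<in>W. \<phi> x y w \<in> V)"
    using compact_range[OF xy] ne[of x y] xy by (auto simp: p Q)
   have R: "p \<in> fst ` {q \<in> topspace ?P. ?\<Phi> q \<in> Z} \<longleftrightarrow> (\<exists>w\<in>W. \<phi> x y w \<in> Z)" for Z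
    using xy by (force simp: p image_iff)
   have D: "p \<in> A - B \<longleftrightarrow> p \<in> A \<and> \<not> p \<in> B" for A B :: "('a \<times> 'a) set" by simp
   show ?thesis unfolding L D R using \<phi>_S[OF xy] by auto
  qed
 qed
 then show "openin (prod_topology X X) ((%(x, y). \<phi> x y ` W) -` Q \<inter> topspace (prod_topology X X))"
  using openin_diff[OF o c] by simp
next
 let ?B = "{{C. compactin X C \<and> C ~= {} \<and> C \<inter> U ~= {} \<and> C \<subseteq> V} | U V. openin X U \<and> openin X V}"
 have all: "{C. compactin X C \<and> C ~= {} \<and> C \<inter> S ~= {} \<and> C \<subseteq> S} \<in> ?B"
  using openin_subtopology_self[of S] by blast
 show "(%(x, y). \<phi> x y ` W) ` topspace (prod_topology X X) \<subseteq> \<Union>?B"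
 proof (rule image_subsetI)
  fix p assume "p \<in> topspace (prod_topology X X)"
  then obtain x y where p: "p = (x, y)" and xy: "x \<in> S" "y \<in> S" by auto
  have "\<phi> x y ` W \<in> {C. compactin X C \<and> C ~= {} \<and> C \<inter> S ~= {} \<and> C \<subseteq> S}"
   using compact_range[OF xy] W_nonempty \<phi>_S[OF xy] by auto
  then show "(case p of (x, y) => \<phi> x y ` W) \<in> \<Union>?B" unfolding p prod.case by (rule UnionI[OF all])
 qed
qed

lemma associative_cv:
 assumes \<mu>: "\<mu> \<in> Mb X" and \<nu>: "\<nu> \<in> Mb X" and \<rho>: "\<rho> \<in> Mb X"
 shows "cv (cv \<mu> \<nu>) \<rho> = cv \<mu> (cv \<nu> \<rho>)"
proof (rule Cb_separates[OF cv_Mb[OF cv_Mb[OF \<mu> \<nu>] \<rho>] cv_Mb[OF \<mu> cv_Mb[OF \<nu> \<rho>]]])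
 fix f assume f: "f \<in> Cb X"
 obtain b where b: "!!x. x \<in> S ==> norm (f x) <= b" using Cb_boundE[OF f] by blast
 define g where "g u = integ X \<rho> (%z. T f u z)" for u
 have g: "g \<in> Cb X" unfolding g_def by (rule T_integ_Cb[OF f \<rho>])
 have "T g x y = integ X \<rho> (%z. T (T f x) y z)" if xy: "x \<in> S" "y \<in> S" for x y
 proof -
  have c: "continuous_on (W \<times> S) (%q. T f (\<phi> x y (fst q)) (snd q))"
   by (rule continuous_on_compose2[OF T_cont[OF f], of _ "%q. (\<phi> x y (fst q), snd q)", simplified])
    (use \<phi>_S[OF xy] in \<open>auto intro!: continuous_intros continuous_on_compose2[OF \<phi>_slice[OF xy]]\<close>)
  have "T g x y = integ X \<rho> (%z. \<integral>w. T f (\<phi> x y w) z \<partial>m)"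
   unfolding T_def[of g] g_def using integ_swap[OF c _ \<rho>, of b] T_bound[OF b f \<phi>_S[OF xy]] by simp
  also have "\<dots> = integ X \<rho> (%z. T (T f x) y z)"
   by (rule integ_cong[OF \<rho>]) (simp add: T_def associative_kernel[OF f xy])
  finally show ?thesis .
 qed
 moreover have "integ X (cv \<nu> \<rho>) (T f x) = integ X \<nu> (%y. integ X \<rho> (%z. T (T f x) y z))" if "x \<in> S" for x
  by (rule integ_cv[OF \<nu> \<rho> T_Cb[OF f that]])
 ultimately have "integ X \<nu> (%y. T g x y) = integ X (cv \<nu> \<rho>) (T f x)" if "x \<in> S" for x
  using that by (simp cong: integ_cong[OF \<nu>])
 then have "integ X \<mu> (%x. integ X \<nu> (%y. T g x y)) = integ X \<mu> (%x. integ X (cv \<nu> \<rho>) (T f x))"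
  by (rule integ_cong[OF \<mu>])
 then show "integ X (cv (cv \<mu> \<nu>) \<rho>) f = integ X (cv \<mu> (cv \<nu> \<rho>)) f"
  unfolding integ_cv[OF cv_Mb[OF \<mu> \<nu>] \<rho> f] integ_cv[OF \<mu> cv_Mb[OF \<nu> \<rho>] f] g_def[symmetric] integ_cv[OF \<mu> \<nu> g] .
qed

theorem hypergroup_cv: "hypergroup X cv e bar"
proof
 interpret finite_measure m by (rule finite_m)
 show "locally_compact_space X"
  using closed_S by (intro locally_compact_space_closed_subset locally_compact_space_euclidean) simp
 show "Hausdorff_space X" by (intro Hausdorff_space_subtopology) simp
 show "bilinear_convolution X cv" by (rule bilinear_cv)
 show "cv (cv \<mu> \<nu>) \<rho> = cv \<mu> (cv \<nu> \<rho>)" if "\<mu> \<in> Mb X" "\<nu> \<in> Mb X" "\<rho> \<in> Mb X" for \<mu> \<nu> \<rho>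
  using that by (rule associative_cv)
 show "weakly_continuous X cv" by (rule weakly_continuous_cv)
 show "continuous_map (prod_topology X X) (michael_topology X) (%(x, y). supp X (cv (dirac X x) (dirac X y)))"
  by (rule continuous_map_eq[OF continuous_range]) (auto simp: supp_cv)
 show "e \<in> topspace X" using e_S by simp
 show "homeomorphic_maps X X bar bar"
  using bar_S bar_bar bar_cont by (auto simp: homeomorphic_maps_def continuous_map_in_subtopology)
 fix x assume "x \<in> topspace X"
 then have x: "x \<in> S" by simp
 have const: "(\<integral>w. g w \<partial>m) = c" if "!!w. w \<in> W ==> g w = c" for g :: "'w => complex" and c
 proof -
  have "(\<integral>w. g w \<partial>m) = (\<integral>w. c \<partial>m)" using that by (intro Bochner_Integration.integral_cong) (simp_all add: space_m)
  then show ?thesis by (simp add: space_m mass_m)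
 qed
 have "cv (dirac X e) (dirac X x) = dirac X x"
  by (rule Cb_separates[OF cv_Mb[OF dirac_Mb[OF e_S] dirac_Mb[OF x]] dirac_Mb[OF x]])
   (simp add: integ_cv_dirac[OF e_S x] integ_dirac[OF x Cb_bounded_borel] T_def const \<phi>_e(1)[OF x])
 moreover have "cv (dirac X x) (dirac X e) = dirac X x"
  by (rule Cb_separates[OF cv_Mb[OF dirac_Mb[OF x] dirac_Mb[OF e_S]] dirac_Mb[OF x]])
   (simp add: integ_cv_dirac[OF x e_S] integ_dirac[OF x Cb_bounded_borel] T_def const \<phi>_e(2)[OF x])
 ultimately show "cv (dirac X e) (dirac X x) = dirac X x \<and> cv (dirac X x) (dirac X e) = dirac X x" by blast
 fix y assume "y \<in> topspace X"
 then have y: "y \<in> S" by simp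
 have "emeasure (law x y) S = 1"
  using \<phi>_S[OF x y] mass_m by (simp add: emeasure_law[OF x y S_in_Sigma] emeasure_eq_measure cong: conj_cong)
 then show "cv (dirac X x) (dirac X y) \<in> Mb_pos X \<and> cv (dirac X x) (dirac X y) (topspace X) = 1"
  using cmeasure_Mb_pos[OF finite_law[OF x y]] by (simp add: cv_dirac[OF x y] cmeasure_def measure_def)
 show "compactin X (supp X (cv (dirac X x) (dirac X y)))" by (simp add: supp_cv[OF x y] compact_range[OF x y])
 show "e \<in> supp X (cv (dirac X x) (dirac X y)) \<longleftrightarrow> y = bar x" by (simp add: supp_cv[OF x y] e_range[OF x y])
 show "image_measure X bar (cv (dirac X x) (dirac X y)) = cv (dirac X (bar y)) (dirac X (bar x))"
 proof
  fix A
  show "image_measure X bar (cv (dirac X x) (dirac X y)) A = cv (dirac X (bar y)) (dirac X (bar x)) A"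
  proof (cases "A \<in> \<Sigma>")
   case False
   then show ?thesis
    using measure_outside[OF finite_law[OF bar_S[OF y] bar_S[OF x]]]
    by (simp add: cv_dirac[OF bar_S[OF y] bar_S[OF x]] cmeasure_def image_measure_def sets_borel_of)
  next
   case A: True
   have "bar \<in> measurable (restrict_space borel S) (restrict_space borel S)"
    using borel_measurable_continuous_on_restrict[OF bar_cont] bar_S by (intro measurable_restrict_space2) (auto simp: space_restrict_space)
   from measurable_sets[OF this A] have A': "bar -` A \<inter> S \<in> \<Sigma>" by (simp add: space_restrict_space)
   have "{w \<in> W. \<phi> (bar y) (bar x) w \<in> A} \<in> sets m"
    using measurable_sets[OF measurable_\<phi>[OF bar_S[OF y] bar_S[OF x]] A] by (simp add: space_m vimage_def Int_def conj_commute)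
   from emeasure_distr[OF flip_meas this]
   have "emeasure m {w \<in> W. \<phi> (bar y) (bar x) w \<in> A} = emeasure m (flip -` {w \<in> W. \<phi> (bar y) (bar x) w \<in> A} \<inter> W)"
    by (simp add: flip_distr space_m)
   also have "flip -` {w \<in> W. \<phi> (bar y) (bar x) w \<in> A} \<inter> W = {w \<in> W. \<phi> x y w \<in> bar -` A \<inter> S}"
    using measurable_space[OF flip_meas] \<phi>_S[OF x y] by (auto simp: space_m bar_\<phi>[OF x y])
   finally show ?thesis
    using A by (simp add: cv_dirac[OF x y] cv_dirac[OF bar_S[OF y] bar_S[OF x]] cmeasure_def image_measure_def sets_borel_of measure_def
      emeasure_law[OF bar_S[OF y] bar_S[OF x] A] emeasure_law[OF x y A'])
  qed
 qed
qed

end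

section \<open>Invariant measures\<close>

context closed_subset
begin

text \<open>On a bounded piece of \<open>S\<close> the measure is finite, hence regular. Open sets that approximate \<open>A\<close> on the
 \<open>n\<close>-th piece up to \<open>\<epsilon> / 2 ^ (n + 1)\<close> are united for outer regularity.\<close>
lemma radon_measureI:
 assumes sets: "sets \<omega> = \<Sigma>" and fin: "!!K. compactin X K ==> emeasure \<omega> K < \<infinity>"
 shows "radon_measure X \<omega>"
proof -
 have space: "space \<omega> = S" using sets_eq_imp_space_eq[OF sets] by (simp add: space_restrict_space)
 define B where "B n = S \<inter> ball 0 (real n)" for n
 have BS: "B n \<in> \<Sigma>" for n by (simp add: B_def Sigma_iff)
 have Bop: "openin X (B n)" for n unfolding B_def by (rule openin_open_Int) simp
 have "emeasure \<omega> (B n) < \<infinity>" for n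
 proof -
  have "compactin X (S \<inter> cball 0 (real n))" using closed_S by (auto simp: compactin_subtopology intro: closed_Int_compact)
  then have "emeasure \<omega> (S \<inter> cball 0 (real n)) < \<infinity>" "S \<inter> cball 0 (real n) \<in> \<Sigma>"
   by (rule fin, rule compactin_Sigma)
  moreover have "emeasure \<omega> (B n) <= emeasure \<omega> (S \<inter> cball 0 (real n))"
   using calculation(2) by (intro emeasure_mono) (auto simp: B_def sets)
  ultimately show ?thesis by (simp add: le_less_trans)
 qed
 note Bfin = this
 define M where "M n = density \<omega> (indicator (B n))" for n
 have eM: "emeasure (M n) A = emeasure \<omega> (B n \<inter> A)" if "A \<in> \<Sigma>" for n A
  unfolding M_def using that BS by (intro emeasure_restricted) (simp_all add: sets)
 have finM: "finite_on (M n)" for n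
 proof -
  have "emeasure (M n) S = emeasure \<omega> (B n)" using eM[OF S_in_Sigma] by (simp add: B_def Int_absorb2 Int_commute)
  moreover have "space (M n) = S" by (simp add: M_def space)
  ultimately show ?thesis using Bfin[of n] unfolding finite_on_def by (auto simp: M_def sets intro!: finite_measureI)
 qed
 have UNB: "S = (\<Union>n. B n)"
 proof -
  have "\<exists>n. norm x < real n" for x :: 'a by (rule reals_Archimedean2)
  then show ?thesis by (auto simp: B_def)
 qed
 have inner: "emeasure \<omega> A <= (SUP K\<in>{K. compactin X K \<and> K \<subseteq> A}. emeasure \<omega> K)" if A: "A \<in> \<Sigma>" for A
 proof -
  have "incseq (%n. B n \<inter> A)" by (auto simp: incseq_def B_def)
  moreover have "range (%n. B n \<inter> A) \<subseteq> sets \<omega>" using BS A by (auto simp: sets)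
  moreover have "(\<Union>n. B n \<inter> A) = A"
  proof -
   have "(\<Union>n. B n \<inter> A) = (\<Union>n. B n) \<inter> A" by blast
   also have "\<dots> = A" unfolding UNB[symmetric] using A by (auto simp: Sigma_iff)
   finally show ?thesis .
  qed
  ultimately have "emeasure \<omega> A = (SUP n. emeasure \<omega> (B n \<inter> A))" using SUP_emeasure_incseq[of "%n. B n \<inter> A" \<omega>] by simp
  also have "\<dots> <= (SUP K\<in>{K. compactin X K \<and> K \<subseteq> A}. emeasure \<omega> K)"
  proof (rule SUP_least)
   fix n
   let ?sup = "SUP K\<in>{K. compactin X K \<and> K \<subseteq> A}. emeasure \<omega> K"
   have "emeasure (M n) A <= ?sup"
   proof (rule ennreal_le_epsilon)
    fix \<epsilon> :: real assume "0 < \<epsilon>"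
    from finite_on_regular(2)[OF finM A this, of n]
    obtain K where K: "compactin X K" "K \<subseteq> A" "emeasure (M n) (A - K) < ennreal \<epsilon>" by blast
    have K': "K \<in> \<Sigma>" by (rule compactin_Sigma[OF K(1)])
    have "emeasure (M n) A = emeasure (M n) K + emeasure (M n) (A - K)"
     using K(2) A K' by (subst plus_emeasure) (auto simp: M_def sets intro!: arg_cong[where f = "emeasure _"])
    moreover have "emeasure (M n) K <= emeasure \<omega> K" unfolding eM[OF K'] using K' by (intro emeasure_mono) (auto simp: sets)
    moreover have "emeasure \<omega> K <= ?sup" using K(1,2) by (intro SUP_upper) auto
    ultimately show "emeasure (M n) A <= ?sup + ennreal \<epsilon>"
     using add_mono[OF order_trans less_imp_le[OF K(3)]] by simp
   qed
   then show "emeasure \<omega> (B n \<inter> A) <= ?sup" using eM[OF A] by simp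
  qed
  finally show ?thesis .
 qed
 have outer: "(INF U\<in>{U. openin X U \<and> A \<subseteq> U}. emeasure \<omega> U) <= emeasure \<omega> A" if A: "A \<in> \<Sigma>" for A
 proof (rule ennreal_le_epsilon)
  fix \<epsilon> :: real assume \<epsilon>: "0 < \<epsilon>" and finA: "emeasure \<omega> A < top"
  have "\<exists>U. openin X U \<and> A \<inter> B n \<subseteq> U \<and> emeasure \<omega> (U - A) <= ennreal (\<epsilon> * (1 / 2) ^ Suc n)" for n
  proof -
   have pos: "0 < \<epsilon> * (1 / 2) ^ Suc n" using \<epsilon> by simp
   from finite_on_regular(1)[OF finM A pos, of n]
   obtain U where U: "openin X U" "A \<subseteq> U" "emeasure (M n) (U - A) < ennreal (\<epsilon> * (1 / 2) ^ Suc n)" by blast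
   have US: "U \<in> \<Sigma>" by (rule openin_Sigma[OF U(1)])
   have "emeasure (M n) (U - A) <= ennreal (\<epsilon> * (1 / 2) ^ Suc n)" using U(3) by (rule less_imp_le)
   moreover have "emeasure (M n) (U - A) = emeasure \<omega> (B n \<inter> U - A)" using US A by (subst eM) (auto simp: Int_Diff)
   ultimately have "emeasure \<omega> (B n \<inter> U - A) <= ennreal (\<epsilon> * (1 / 2) ^ Suc n)" by simp
   moreover have "openin X (B n \<inter> U)" by (rule openin_Int[OF Bop U(1)])
   moreover have "A \<inter> B n \<subseteq> B n \<inter> U" using U(2) by blast
   ultimately show ?thesis by blast
  qed
  then obtain U where U: "!!n. openin X (U n)" "!!n. A \<inter> B n \<subseteq> U n" "!!n. emeasure \<omega> (U n - A) <= ennreal (\<epsilon> * (1 / 2) ^ Suc n)"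
   by metis
  have AU: "A \<subseteq> (\<Union>n. U n)"
  proof
   fix x assume x: "x \<in> A"
   then have "x \<in> S" using A by (auto simp: Sigma_iff)
   then have "x \<in> (\<Union>n. B n)" by (simp only: UNB[symmetric])
   then obtain n where "x \<in> B n" by blast
   then show "x \<in> (\<Union>n. U n)" using U(2)[of n] x by blast
  qed
  have US: "U n \<in> sets \<omega>" for n using openin_Sigma[OF U(1)] by (simp add: sets)
  have "emeasure \<omega> ((\<Union>n. U n) - A) <= (\<Sum>n. emeasure \<omega> (U n - A))"
   unfolding UN_extend_simps(6) using US A by (intro emeasure_subadditive_countably) (auto simp: sets)
  also have "\<dots> <= (\<Sum>n. ennreal (\<epsilon> * (1 / 2) ^ Suc n))" using U(3) by (intro suminf_le) auto
  also have "\<dots> = ennreal \<epsilon>"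
  proof -
   have "(%n. \<epsilon> * (1 / 2) ^ Suc n) sums (\<epsilon> * 1)" by (rule sums_mult[OF power_half_series])
   then show ?thesis using \<epsilon> by (subst suminf_ennreal_eq[of _ \<epsilon>]) auto
  qed
  finally have *: "emeasure \<omega> ((\<Union>n. U n) - A) <= ennreal \<epsilon>" .
  have "(INF U\<in>{U. openin X U \<and> A \<subseteq> U}. emeasure \<omega> U) <= emeasure \<omega> (\<Union>n. U n)"
   using AU U(1) by (intro INF_lower) auto
  also have "\<dots> = emeasure \<omega> A + emeasure \<omega> ((\<Union>n. U n) - A)"
   using AU US A by (subst plus_emeasure) (auto simp: sets intro!: arg_cong[where f = "emeasure _"])
  also have "\<dots> <= emeasure \<omega> A + ennreal \<epsilon>" using * by (rule add_left_mono)
  finally show "(INF U\<in>{U. openin X U \<and> A \<subseteq> U}. emeasure \<omega> U) <= emeasure \<omega> A + ennreal \<epsilon>" .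
 qed
 show ?thesis
  unfolding radon_measure_def
 proof (intro conjI ballI allI impI)
  show "sets \<omega> = sets (borel_of X)" by (simp add: sets sets_borel_of)
  show "emeasure \<omega> K < \<infinity>" if "compactin X K" for K by (rule fin[OF that])
  show "emeasure \<omega> A = (INF U\<in>{U. openin X U \<and> A \<subseteq> U}. emeasure \<omega> U)" if "A \<in> sets \<omega>" for A
   using outer[of A] that openin_Sigma by (intro antisym INF_greatest) (auto simp: sets intro!: emeasure_mono)
  show "emeasure \<omega> U = (SUP K\<in>{K. compactin X K \<and> K \<subseteq> U}. emeasure \<omega> K)" if "openin X U" for U
   using inner[OF openin_Sigma[OF that]] openin_Sigma[OF that] by (intro antisym SUP_least) (auto simp: sets intro!: emeasure_mono)
 qed
qed

lemma radon_sigma_finite: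
 assumes \<omega>: "radon_measure X \<omega>" shows "sigma_finite_measure \<omega>"
proof
 have sets: "sets \<omega> = \<Sigma>" using \<omega> by (simp add: radon_measure_def sets_borel_of)
 have space: "space \<omega> = S" using sets_eq_imp_space_eq[OF sets] by (simp add: space_restrict_space)
 have cpt: "compactin X (S \<inter> cball 0 (real n))" for n
  using closed_S by (auto simp: compactin_subtopology intro: closed_Int_compact)
 have "\<exists>n. norm x <= real n" for x :: 'a by (rule real_arch_simple)
 then have "(\<Union>n. S \<inter> cball 0 (real n)) = space \<omega>" by (auto simp: space)
 moreover have "S \<inter> cball 0 (real n) \<in> sets \<omega>" "emeasure \<omega> (S \<inter> cball 0 (real n)) ~= \<infinity>" for n
 proof -
  show "S \<inter> cball 0 (real n) \<in> sets \<omega>" unfolding sets by (rule compactin_Sigma[OF cpt])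
  have "emeasure \<omega> (S \<inter> cball 0 (real n)) < \<infinity>" using \<omega> cpt unfolding radon_measure_def by blast
  then show "emeasure \<omega> (S \<inter> cball 0 (real n)) ~= \<infinity>" by simp
 qed
 ultimately show "\<exists>A. countable A \<and> A \<subseteq> sets \<omega> \<and> \<Union> A = space \<omega> \<and> (\<forall>a\<in>A. emeasure \<omega> a ~= \<infinity>)"
  by (intro exI[of _ "range (%n. S \<inter> cball 0 (real n))"] conjI ballI image_subsetI) (simp, assumption, simp, blast)
qed

lemma Cc_integrable:
 assumes \<omega>: "radon_measure X \<omega>" and f: "f \<in> Cc X" shows "integrable \<omega> f" and "f \<in> Cb X"
proof -
 have sets: "sets \<omega> = \<Sigma>" using \<omega> by (simp add: radon_measure_def sets_borel_of)
 have space: "space \<omega> = S" using sets_eq_imp_space_eq[OF sets] by (simp add: space_restrict_space)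
 define K where "K = X closure_of {x \<in> S. f x ~= 0}"
 have K: "compactin X K" and c: "continuous_on S f" using f by (simp_all add: Cc_def K_def)
 have sub: "{x \<in> S. f x ~= 0} \<subseteq> K" unfolding K_def by (rule closure_of_subset) simp
 have KS: "K \<subseteq> S" "compact K" using K by (simp_all add: compactin_subtopology)
 then obtain b where b: "!!x. x \<in> K ==> norm (f x) <= b"
  using compact_imp_bounded[OF compact_continuous_image[OF continuous_on_subset[OF c] KS(2)]] by (auto simp: bounded_iff)
 have b': "norm (f x) <= max b 0" if "x \<in> S" for x
  using b[of x] sub that by (cases "f x = 0") (auto simp: le_max_iff_disj)
 show "f \<in> Cb X" by (rule Cb_I[OF c b'])
 then have meas: "f \<in> borel_measurable \<omega>"
  using Cb_bounded_borel by (simp add: bounded_borel_def measurable_cong_sets[OF sets refl])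
 have "integrable \<omega> (%x. indicator K x *\<^sub>R f x)"
  using \<omega> K b by (intro integrableI_bounded_set_indicator[of K \<omega> f b] meas AE_I2) (auto simp: sets compactin_Sigma radon_measure_def)
 moreover have "integrable \<omega> f \<longleftrightarrow> integrable \<omega> (%x. indicator K x *\<^sub>R f x)"
 proof (rule Bochner_Integration.integrable_cong[OF refl])
  fix x assume "x \<in> space \<omega>"
  then show "f x = indicator K x *\<^sub>R f x" using sub by (cases "f x = 0") (auto simp: space)
 qed
 ultimately show "integrable \<omega> f" by simp
qed

end

context convolution_kernel
begin

text \<open>Invariance on sets says that \<open>\<omega>\<close> is the image of \<open>\<omega> \<Otimes>\<^sub>M m\<close> under \<open>\<psi>\<close>.\<close>
lemma invariant_integral:
 assumes \<omega>: "sigma_finite_measure \<omega>" "sets \<omega> = \<Sigma>"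
  and \<psi>: "continuous_on (S \<times> W) (%q. \<psi> (fst q) (snd q))" "!!y w. y \<in> S ==> w \<in> W ==> \<psi> y w \<in> S"
  and inv: "!!A. A \<in> \<Sigma> ==> (\<integral>\<^sup>+y. emeasure m {w \<in> W. \<psi> y w \<in> A} \<partial>\<omega>) = emeasure \<omega> A"
  and f: "integrable \<omega> (f :: 'a => complex)"
 shows "has_bochner_integral \<omega> (%y. \<integral>w. f (\<psi> y w) \<partial>m) (\<integral>y. f y \<partial>\<omega>)"
proof -
 interpret \<omega>: sigma_finite_measure \<omega> by (rule \<omega>)
 interpret m: finite_measure m by (rule finite_m)
 interpret P: pair_sigma_finite \<omega> m by unfold_locales
 have space: "space \<omega> = S" using sets_eq_imp_space_eq[OF \<omega>(2)] by (simp add: space_restrict_space)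
 have id: "(%x. x) \<in> borel_measurable \<omega>"
  unfolding measurable_cong_sets[OF \<omega>(2) refl] by (rule measurable_restrict_space1) simp
 let ?g = "%q. \<psi> (fst q) (snd q)"
 have meas: "?g \<in> measurable (\<omega> \<Otimes>\<^sub>M m) (restrict_space borel S)"
  using borel_measurable_continuous_pair[OF _ id id_m, of ?g] \<psi>
  by (intro measurable_restrict_space2) (auto simp: space_pair_measure space space_m)
 have eq: "distr (\<omega> \<Otimes>\<^sub>M m) \<omega> ?g = \<omega>"
 proof (rule measure_eqI)
  fix A assume "A \<in> sets (distr (\<omega> \<Otimes>\<^sub>M m) \<omega> ?g)"
  then have A: "A \<in> \<Sigma>" by (simp add: \<omega>(2))
  have meas': "?g \<in> measurable (\<omega> \<Otimes>\<^sub>M m) \<omega>" using meas by (simp add: measurable_cong_sets[OF refl \<omega>(2)])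
  have "emeasure (distr (\<omega> \<Otimes>\<^sub>M m) \<omega> ?g) A = emeasure (\<omega> \<Otimes>\<^sub>M m) (?g -` A \<inter> space (\<omega> \<Otimes>\<^sub>M m))"
   using A by (intro emeasure_distr[OF meas']) (simp add: \<omega>(2))
  also have "\<dots> = (\<integral>\<^sup>+y. emeasure m (Pair y -` (?g -` A \<inter> space (\<omega> \<Otimes>\<^sub>M m))) \<partial>\<omega>)"
   by (rule m.emeasure_pair_measure_alt[OF measurable_sets[OF meas A]])
  also have "\<dots> = (\<integral>\<^sup>+y. emeasure m {w \<in> W. \<psi> y w \<in> A} \<partial>\<omega>)"
   by (intro nn_integral_cong arg_cong[where f = "emeasure m"]) (auto simp: space_pair_measure space space_m)
  finally show "emeasure (distr (\<omega> \<Otimes>\<^sub>M m) \<omega> ?g) A = emeasure \<omega> A" using inv[OF A] by simp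
 qed simp
 have meas': "?g \<in> measurable (\<omega> \<Otimes>\<^sub>M m) \<omega>" using meas by (simp add: measurable_cong_sets[OF refl \<omega>(2)])
 have fm: "f \<in> borel_measurable \<omega>" using f by simp
 have int: "integrable (\<omega> \<Otimes>\<^sub>M m) (%q. f (?g q))"
  using f integrable_distr_eq[OF meas' fm] by (simp add: eq)
 have "(\<integral>y. f y \<partial>\<omega>) = (\<integral>q. f (?g q) \<partial>(\<omega> \<Otimes>\<^sub>M m))" using integral_distr[OF meas' fm] by (simp add: eq)
 also have "\<dots> = (\<integral>y. (\<integral>w. f (\<psi> y w) \<partial>m) \<partial>\<omega>)" using P.integral_fst'[OF int] by simp
 finally show ?thesis using P.integrable_fst'[OF int] by (simp add: has_bochner_integral_iff)
qed

lemma left_haar_measureI: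
 assumes \<omega>: "radon_measure X \<omega>" "emeasure \<omega> S ~= 0"
  and inv: "!!x A. x \<in> S ==> A \<in> \<Sigma> ==> (\<integral>\<^sup>+y. emeasure m {w \<in> W. \<phi> x y w \<in> A} \<partial>\<omega>) = emeasure \<omega> A"
 shows "left_haar_measure X cv \<omega>"
proof -
 have sets: "sets \<omega> = \<Sigma>" using \<omega> by (simp add: radon_measure_def sets_borel_of)
 have space: "space \<omega> = S" using sets_eq_imp_space_eq[OF sets] by (simp add: space_restrict_space)
 have "has_bochner_integral \<omega> (%y. integ X (cv (dirac X x) (dirac X y)) f) (\<integral>y. f y \<partial>\<omega>)" if x: "x \<in> S" and f: "f \<in> Cc X" for x f
 proof -
  have "continuous_on (S \<times> W) (%q. ((x, fst q), snd q))" by (intro continuous_intros)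
  from continuous_on_compose2[OF \<phi>_cont this] have c: "continuous_on (S \<times> W) (%q. \<phi> x (fst q) (snd q))" using x by (simp add: image_subset_iff)
  have "has_bochner_integral \<omega> (%y. \<integral>w. f (\<phi> x y w) \<partial>m) (\<integral>y. f y \<partial>\<omega>)"
   by (rule invariant_integral[OF radon_sigma_finite[OF \<omega>(1)] sets c \<phi>_S[OF x] inv[OF x] Cc_integrable(1)[OF \<omega>(1) f]])
  moreover have "has_bochner_integral \<omega> (%y. integ X (cv (dirac X x) (dirac X y)) f) (\<integral>y. f y \<partial>\<omega>)
   \<longleftrightarrow> has_bochner_integral \<omega> (%y. \<integral>w. f (\<phi> x y w) \<partial>m) (\<integral>y. f y \<partial>\<omega>)"
   by (rule has_bochner_integral_cong[OF refl _ refl])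
    (simp add: space integ_cv_dirac[OF x _ Cc_integrable(2)[OF \<omega>(1) f]] T_def)
  ultimately show ?thesis by simp
 qed
 then show ?thesis using \<omega> by (simp add: left_haar_measure_def)
qed

lemma right_haar_measureI:
 assumes \<omega>: "radon_measure X \<omega>" "emeasure \<omega> S ~= 0"
  and inv: "!!x A. x \<in> S ==> A \<in> \<Sigma> ==> (\<integral>\<^sup>+y. emeasure m {w \<in> W. \<phi> y x w \<in> A} \<partial>\<omega>) = emeasure \<omega> A"
 shows "right_haar_measure X cv \<omega>"
proof -
 have sets: "sets \<omega> = \<Sigma>" using \<omega> by (simp add: radon_measure_def sets_borel_of)
 have space: "space \<omega> = S" using sets_eq_imp_space_eq[OF sets] by (simp add: space_restrict_space)
 have "has_bochner_integral \<omega> (%y. integ X (cv (dirac X y) (dirac X x)) f) (\<integral>y. f y \<partial>\<omega>)" if x: "x \<in> S" and f: "f \<in> Cc X" for x f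
 proof -
  have "continuous_on (S \<times> W) (%q. ((fst q, x), snd q))" by (intro continuous_intros)
  from continuous_on_compose2[OF \<phi>_cont this] have c: "continuous_on (S \<times> W) (%q. \<phi> (fst q) x (snd q))" using x by (simp add: image_subset_iff)
  have "has_bochner_integral \<omega> (%y. \<integral>w. f (\<phi> y x w) \<partial>m) (\<integral>y. f y \<partial>\<omega>)"
   by (rule invariant_integral[OF radon_sigma_finite[OF \<omega>(1)] sets c \<phi>_S[OF _ x] inv[OF x] Cc_integrable(1)[OF \<omega>(1) f]])
  moreover have "has_bochner_integral \<omega> (%y. integ X (cv (dirac X y) (dirac X x)) f) (\<integral>y. f y \<partial>\<omega>)
   \<longleftrightarrow> has_bochner_integral \<omega> (%y. \<integral>w. f (\<phi> y x w) \<partial>m) (\<integral>y. f y \<partial>\<omega>)"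
   by (rule has_bochner_integral_cong[OF refl _ refl])
    (simp add: space integ_cv_dirac[OF _ x Cc_integrable(2)[OF \<omega>(1) f]] T_def)
  ultimately show ?thesis by simp
 qed
 then show ?thesis using \<omega> by (simp add: right_haar_measure_def)
qed

lemma iterated_cont:
 assumes f: "f \<in> Cb X" and y: "y \<in> S"
 shows "continuous_on (S \<times> S) (%p. \<integral>w. (\<integral>v. f (\<phi> (\<phi> (fst p) y w) (snd p) v) \<partial>m) \<partial>m)"
  and "continuous_on (S \<times> S) (%p. \<integral>w. (\<integral>v. f (\<phi> (fst p) (\<phi> y (snd p) w) v) \<partial>m) \<partial>m)"
proof -
 obtain b where b: "!!x. x \<in> S ==> norm (f x) <= b" using Cb_boundE[OF f] by blast
 have c1: "continuous_on ((S \<times> S) \<times> W) (%q. \<phi> (fst (fst q)) y (snd q))"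
 proof -
  have "continuous_on ((S \<times> S) \<times> W) (%q. ((fst (fst q), y), snd q))" by (intro continuous_intros)
  from continuous_on_compose2[OF \<phi>_cont this] show ?thesis using y by (simp add: image_subset_iff mem_Times_iff)
 qed
 have c2: "continuous_on ((S \<times> S) \<times> W) (%q. \<phi> y (snd (fst q)) (snd q))"
 proof -
  have "continuous_on ((S \<times> S) \<times> W) (%q. ((y, snd (fst q)), snd q))" by (intro continuous_intros)
  from continuous_on_compose2[OF \<phi>_cont this] show ?thesis using y by (simp add: image_subset_iff mem_Times_iff)
 qed
 have "continuous_on ((S \<times> S) \<times> W) (%q. (\<phi> (fst (fst q)) y (snd q), snd (fst q)))" by (intro continuous_intros c1)
 from continuous_on_compose2[OF T_cont[OF f] this]
 have d1: "continuous_on ((S \<times> S) \<times> W) (%q. T f (\<phi> (fst (fst q)) y (snd q)) (snd (fst q)))"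
  using y \<phi>_S by (simp add: image_subset_iff mem_Times_iff)
 have "continuous_on ((S \<times> S) \<times> W) (%q. (fst (fst q), \<phi> y (snd (fst q)) (snd q)))" by (intro continuous_intros c2)
 from continuous_on_compose2[OF T_cont[OF f] this]
 have d2: "continuous_on ((S \<times> S) \<times> W) (%q. T f (fst (fst q)) (\<phi> y (snd (fst q)) (snd q)))"
  using y \<phi>_S by (simp add: image_subset_iff mem_Times_iff)
 have "norm (T f (\<phi> (fst p) y w) (snd p)) <= b" "norm (T f (fst p) (\<phi> y (snd p) w)) <= b" if "p \<in> S \<times> S" "w \<in> W" for p w
  using that y by (simp_all add: mem_Times_iff T_bound[OF b f] \<phi>_S)
 then show "continuous_on (S \<times> S) (%p. \<integral>w. (\<integral>v. f (\<phi> (\<phi> (fst p) y w) (snd p) v) \<partial>m) \<partial>m)"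
  "continuous_on (S \<times> S) (%p. \<integral>w. (\<integral>v. f (\<phi> (fst p) (\<phi> y (snd p) w) v) \<partial>m) \<partial>m)"
  using continuous_on_parametric_integral[OF d1 _ finite_m space_m id_m, of b]
   continuous_on_parametric_integral[OF d2 _ finite_m space_m id_m, of b] by (simp_all add: T_def)
qed

text \<open>This reduces associativity on the cone to invertible outer factors.\<close>
lemma associative_limit:
 assumes f: "f \<in> Cb X" and y: "y \<in> S" and xz: "x \<in> S" "z \<in> S" "x' \<longlonglongrightarrow> x" "z' \<longlonglongrightarrow> z"
  and k: "!!k. x' k \<in> S" "!!k. z' k \<in> S"
   "!!k. (\<integral>w. (\<integral>v. f (\<phi> (\<phi> (x' k) y w) (z' k) v) \<partial>m) \<partial>m) = (\<integral>w. (\<integral>v. f (\<phi> (x' k) (\<phi> y (z' k) w) v) \<partial>m) \<partial>m)"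
 shows "(\<integral>w. (\<integral>v. f (\<phi> (\<phi> x y w) z v) \<partial>m) \<partial>m) = (\<integral>w. (\<integral>v. f (\<phi> x (\<phi> y z w) v) \<partial>m) \<partial>m)"
proof -
 have l: "(%k. (x' k, z' k)) \<longlonglongrightarrow> (x, z)" by (intro tendsto_Pair xz)
 have e: "eventually (%k. (x' k, z' k) \<in> S \<times> S) sequentially" using k by simp
 have "(%k. \<integral>w. (\<integral>v. f (\<phi> (\<phi> (x' k) y w) (z' k) v) \<partial>m) \<partial>m) \<longlonglongrightarrow> (\<integral>w. (\<integral>v. f (\<phi> (\<phi> x y w) z v) \<partial>m) \<partial>m)"
  using continuous_on_tendsto_compose[OF iterated_cont(1)[OF f y] l _ e] xz by simp
 moreover have "(%k. \<integral>w. (\<integral>v. f (\<phi> (\<phi> (x' k) y w) (z' k) v) \<partial>m) \<partial>m) \<longlonglongrightarrow> (\<integral>w. (\<integral>v. f (\<phi> x (\<phi> y z w) v) \<partial>m) \<partial>m)"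
  unfolding k(3) using continuous_on_tendsto_compose[OF iterated_cont(2)[OF f y] l _ e] xz by simp
 ultimately show ?thesis by (rule LIMSEQ_unique)
qed

lemma iterated_integral_pair:
 assumes f: "f \<in> Cb X" and x: "x \<in> S" and y: "y \<in> S" and z: "z \<in> S"
 shows "(\<integral>w. (\<integral>v. f (\<phi> (\<phi> x y w) z v) \<partial>m) \<partial>m) = (\<integral>q. f (\<phi> (\<phi> x y (fst q)) z (snd q)) \<partial>(m \<Otimes>\<^sub>M m))"
  and "(\<integral>w. (\<integral>v. f (\<phi> x (\<phi> y z w) v) \<partial>m) \<partial>m) = (\<integral>q. f (\<phi> x (\<phi> y z (fst q)) (snd q)) \<partial>(m \<Otimes>\<^sub>M m))"
proof -
 obtain b where b: "!!x. x \<in> S ==> norm (f x) <= b" using Cb_boundE[OF f] by blast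
 have c: "continuous_on (W \<times> W) (%q. \<phi> x y (fst q))" "continuous_on (W \<times> W) (%q. \<phi> y z (fst q))"
  by (rule continuous_on_compose2[OF \<phi>_slice], (rule x y z)+, auto intro!: continuous_intros)+
 have "continuous_on (W \<times> W) (%q. ((\<phi> x y (fst q), z), snd q))" by (intro continuous_intros c)
 from continuous_on_compose2[OF f\<phi>_cont[OF f] this]
 have d1: "continuous_on (W \<times> W) (%q. f (\<phi> (\<phi> x y (fst q)) z (snd q)))" using \<phi>_S[OF x y] z by (simp add: image_subset_iff mem_Times_iff)
 have "continuous_on (W \<times> W) (%q. ((x, \<phi> y z (fst q)), snd q))" by (intro continuous_intros c)
 from continuous_on_compose2[OF f\<phi>_cont[OF f] this]
 have d2: "continuous_on (W \<times> W) (%q. f (\<phi> x (\<phi> y z (fst q)) (snd q)))" using \<phi>_S[OF y z] x by (simp add: image_subset_iff mem_Times_iff)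
 show "(\<integral>w. (\<integral>v. f (\<phi> (\<phi> x y w) z v) \<partial>m) \<partial>m) = (\<integral>q. f (\<phi> (\<phi> x y (fst q)) z (snd q)) \<partial>(m \<Otimes>\<^sub>M m))"
  using integral_pair_continuous[where b = b, OF _ _ finite_m id_m finite_m id_m, unfolded space_m, OF d1] b \<phi>_S x y z by simp
 show "(\<integral>w. (\<integral>v. f (\<phi> x (\<phi> y z w) v) \<partial>m) \<partial>m) = (\<integral>q. f (\<phi> x (\<phi> y z (fst q)) (snd q)) \<partial>(m \<Otimes>\<^sub>M m))"
  using integral_pair_continuous[where b = b, OF _ _ finite_m id_m finite_m id_m, unfolded space_m, OF d2] b \<phi>_S x y z by simp
qed

end

section \<open>The hypergroup structure\<close>

abbreviation (input) cone_points :: "'n::finite itself => ((complex^'n^'n) \<times> real) set" where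
 "cone_points t \<equiv> psd \<times> UNIV"

lemma Im_trace_hermitian: "ctranspose A = A ==> Im (trace (A :: complex^'n^'n)) = 0"
 using trace_ctranspose[of A] by (simp add: complex_eq_iff)

lemma matrix_cball_ctranspose:
 assumes w: "(w :: complex^'n^'n) \<in> matrix_cball" shows "ctranspose w \<in> matrix_cball"
proof -
 have "norm (ctranspose w *v x) <= norm x" for x
 proof -
  have "0 <= x \<bullet> ((mat 1 - ctranspose (ctranspose w) ** ctranspose w) *v x)"
   using psd_nonneg[OF matrix_cball_ctranspose_psd[OF w], of x] by simp
  then have "(norm (ctranspose w *v x))\<^sup>2 <= (norm x)\<^sup>2" unfolding inner_one_minus_gram by simp
  then show ?thesis by (rule power2_le_imp_le) simp
 qed
 then show ?thesis by (simp add: matrix_cball_def)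
qed

text \<open>The sum is that of two semidefinite matrices, \<open>(s + r w) (s + r w)\<^sup>*\<close> and \<open>r (1 - w w\<^sup>* ) r\<close>; both
 vanish because their traces do.\<close>
lemma sum_square_zero:
 assumes r: "r \<in> psd" and s: "s \<in> psd" and w: "(w :: complex^'n^'n) \<in> matrix_cball" and 0: "sum_square r s w = 0"
 shows "r = s" and "r ** w = - s"
proof -
 define C where "C = s + r ** w"
 define D where "D = r ** (mat 1 - w ** ctranspose w) ** r"
 have D: "D \<in> psd"
  using psd_congruence[OF matrix_cball_ctranspose_psd[OF w], of r] by (simp add: D_def psd_hermitian[OF r])
 have CD: "C ** ctranspose C + D = 0" using 0 unfolding sum_square_eq[OF r s] C_def D_def .
 have "Re (trace (C ** ctranspose C)) + Re (trace D) = 0"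
 proof -
  have "trace (0 :: complex^'n^'n) = 0" by (simp add: trace_def)
  then show ?thesis using arg_cong[OF CD, of "%A. Re (trace A)"] by (simp add: trace_add)
 qed
 moreover have "Re (trace (C ** ctranspose C)) = (norm C)\<^sup>2" using Re_trace_gram[of "ctranspose C"] by simp
 ultimately have "(norm C)\<^sup>2 = 0" using Re_trace_nonneg[OF D] zero_le_power2[of "norm C"] by linarith
 then have C: "C = 0" by simp
 then show rw: "r ** w = - s" unfolding C_def by (simp add: add_eq_0_iff)
 have "D = 0" using CD C by simp
 then have "r ** r = (r ** w) ** ctranspose (r ** w)"
  by (simp add: D_def matrix_mult_simps ctranspose_mult psd_hermitian[OF r] matrix_mul_assoc)
 also have "\<dots> = s ** s" unfolding rw by (simp add: ctranspose_simps psd_hermitian[OF s] matrix_mult_simps)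
 finally show "r = s" by (rule psd_square_inject[OF r s])
qed

lemma point_arg_eq:
 "point_arg x y w = (psd_sqrt (sum_square (fst x) (fst y) w), snd x + snd y - Im (trace (fst x ** w ** fst y)))"
 by (cases x; cases y) (simp add: point_arg_def sum_square_def)

definition ball_measure :: "real => (complex^'n^'n) measure" where
 "ball_measure e = density (restrict_space lborel matrix_cball)
   (%w. ennreal (ball_density e w / enn2real (ball_mass e TYPE('n))))"

lemma sets_matrix_cball [measurable]: "(matrix_cball :: (complex^'n^'n) set) \<in> sets borel"
 by (intro borel_closed compact_imp_closed compact_matrix_cball)

lemma ball_density_outside_cball: "w \<notin> matrix_cball ==> ball_density e w = 0"
 using ball_density_outside[of w e] matrix_ball_cball by auto

lemma sets_ball_measure: "sets (ball_measure e) = sets (restrict_space borel (matrix_cball :: (complex^'n^'n) set))"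
 unfolding ball_measure_def sets_density by (intro sets_restrict_space_cong) simp

lemma space_ball_measure: "space (ball_measure e) = (matrix_cball :: (complex^'n^'n) set)"
 by (simp add: ball_measure_def space_restrict_space)

lemma enn2real_ball_mass:
 assumes "e > -1" shows "0 < enn2real (ball_mass e TYPE('n::finite))" "ennreal (enn2real (ball_mass e TYPE('n))) = ball_mass e TYPE('n)"
 using ball_mass_finite[OF assms, where 'n = 'n] ball_mass_pos[of e, where 'n = 'n]
 by (auto simp: enn2real_positive_iff zero_less_iff_neq_zero)

lemma nn_integral_ball_measure:
 fixes g :: "complex^'n^'n => ennreal"
 assumes e: "e > -1" and g[measurable]: "g \<in> borel_measurable borel"
 shows "ball_mass e TYPE('n) * (\<integral>\<^sup>+w. g w \<partial>ball_measure e) = (\<integral>\<^sup>+w. g w * ennreal (ball_density e w) \<partial>lborel)"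
proof -
 define M where "M = enn2real (ball_mass e TYPE('n))"
 have M: "M > 0" "ennreal M = ball_mass e TYPE('n)" using enn2real_ball_mass[OF e, where 'n = 'n] by (simp_all add: M_def)
 have m: "(%w. ennreal (ball_density e w / M)) \<in> borel_measurable (restrict_space lborel matrix_cball)"
  "g \<in> borel_measurable (restrict_space lborel matrix_cball)"
  by (intro measurable_restrict_space1; simp)+
 have "(\<integral>\<^sup>+w. g w \<partial>ball_measure e) = (\<integral>\<^sup>+w. ennreal (ball_density e w / M) * g w \<partial>restrict_space lborel matrix_cball)"
  unfolding ball_measure_def M_def[symmetric] by (rule nn_integral_density[OF m])
 also have "\<dots> = (\<integral>\<^sup>+w. ennreal (ball_density e w / M) * g w * indicator matrix_cball w \<partial>lborel)"
  by (rule nn_integral_restrict_space) simp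
 also have "\<dots> = (\<integral>\<^sup>+w. ennreal (ball_density e w / M) * g w \<partial>lborel)"
  by (intro nn_integral_cong) (simp add: indicator_def ball_density_outside_cball)
 finally have "ball_mass e TYPE('n) * (\<integral>\<^sup>+w. g w \<partial>ball_measure e) = (\<integral>\<^sup>+w. ennreal M * (ennreal (ball_density e w / M) * g w) \<partial>lborel)"
  unfolding M(2)[symmetric] by (simp add: nn_integral_cmult)
 also have "\<dots> = (\<integral>\<^sup>+w. g w * ennreal (ball_density e w) \<partial>lborel)"
 proof (rule nn_integral_cong)
  fix w :: "complex^'n^'n"
  have "ennreal M * ennreal (ball_density e w / M) = ennreal (ball_density e w)"
   using M(1) by (subst ennreal_mult[symmetric]) (simp_all add: ball_density_nonneg)
  then show "ennreal M * (ennreal (ball_density e w / M) * g w) = g w * ennreal (ball_density e w)"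
   unfolding mult.assoc[of "ennreal M", symmetric] by (simp only: mult.commute)
 qed
 finally show ?thesis .
qed

lemma emeasure_ball_measure:
 assumes e: "e > -1" and A: "A \<in> sets borel" "A \<subseteq> (matrix_cball :: (complex^'n^'n) set)"
 shows "ball_mass e TYPE('n) * emeasure (ball_measure e) A = (\<integral>\<^sup>+w. indicator A w * ennreal (ball_density e w) \<partial>lborel)"
proof -
 have "A \<in> sets (ball_measure e)" unfolding sets_ball_measure using A by (simp add: sets_restrict_space_iff)
 then have "emeasure (ball_measure e) A = (\<integral>\<^sup>+w. indicator A w \<partial>ball_measure e)" by simp
 then show ?thesis using nn_integral_ball_measure[OF e, of "indicator A"] A(1) by simp
qed

lemma ball_measure_prob:
 assumes e: "e > -1"
 shows "finite_measure (ball_measure e :: (complex^'n^'n) measure)" "measure (ball_measure e) (matrix_cball :: (complex^'n^'n) set) = 1"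
proof -
 note M = enn2real_ball_mass[OF e, where 'n = 'n]
 have "(\<integral>\<^sup>+w. indicator matrix_cball w * ennreal (ball_density e (w :: complex^'n^'n)) \<partial>lborel) = (\<integral>\<^sup>+w. ennreal (ball_density e (w :: complex^'n^'n)) \<partial>lborel)"
  by (intro nn_integral_cong) (simp add: indicator_def ball_density_outside_cball)
 then have "ball_mass e TYPE('n) * emeasure (ball_measure e) (matrix_cball :: (complex^'n^'n) set) = ball_mass e TYPE('n) * 1"
  using emeasure_ball_measure[OF e sets_matrix_cball[where 'n = 'n] order_refl] by (simp add: nn_integral_ball_density)
 then have 1: "emeasure (ball_measure e) (matrix_cball :: (complex^'n^'n) set) = 1"
  using ball_mass_pos[of e, where 'n = 'n] ball_mass_finite[OF e, where 'n = 'n] by (subst (asm) ennreal_mult_cancel_left) auto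
 then show "measure (ball_measure e) (matrix_cball :: (complex^'n^'n) set) = 1" by (simp add: measure_def)
 show "finite_measure (ball_measure e :: (complex^'n^'n) measure)" by (rule finite_measureI) (simp add: space_ball_measure 1)
qed

lemma integral_ball_measure:
 fixes f :: "complex^'n^'n => complex"
 assumes p: "p > 2 * real CARD('n) - 1" and f: "f \<in> borel_measurable (restrict_space borel matrix_cball)"
 shows "(\<integral>w. f w \<partial>ball_measure (p - 2 * real CARD('n))) = kappa p TYPE('n) *\<^sub>R (LINT w : matrix_ball | lborel. ball_weight p w *\<^sub>R f w)"
proof -
 define e where "e = p - 2 * real CARD('n)"
 have e: "e > -1" using p by (simp add: e_def)
 define M where "M = enn2real (ball_mass e TYPE('n))"
 have bd: "indicator matrix_ball w *\<^sub>R ball_weight p w = ball_density e w" for w :: "complex^'n^'n"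
  by (simp add: ball_density_def ball_weight_def det_power_def e_def matrix_ball_def indicator_def)
 have "(LINT w : (matrix_ball :: (complex^'n^'n) set) | lborel. ball_weight p w) = (\<integral>w. ball_density e (w :: complex^'n^'n) \<partial>lborel)"
  unfolding set_lebesgue_integral_def bd ..
 also have "\<dots> = M"
  unfolding M_def nn_integral_ball_density[symmetric] by (rule integral_eq_nn_integral) (simp_all add: ball_density_nonneg)
 finally have kappa: "kappa p TYPE('n) = inverse M" by (simp add: kappa_def)
 have M0: "0 <= M" by (simp add: M_def)
 have f': "f \<in> borel_measurable (restrict_space lborel matrix_cball)"
  using f by (simp add: measurable_cong_sets[OF sets_restrict_space_cong[OF sets_lborel] refl])
 have "(\<integral>w. f w \<partial>ball_measure e) = (\<integral>w. (ball_density e w / M) *\<^sub>R f w \<partial>restrict_space lborel matrix_cball)"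
  unfolding ball_measure_def M_def[symmetric]
  by (rule integral_density[OF f']) (auto intro!: measurable_restrict_space1 AE_I2 simp: ball_density_nonneg M0)
 also have "\<dots> = (\<integral>w. indicator matrix_cball w *\<^sub>R (ball_density e w / M) *\<^sub>R f w \<partial>lborel)"
  by (rule integral_restrict_space) simp
 also have "\<dots> = (\<integral>w. inverse M *\<^sub>R (indicator matrix_ball w *\<^sub>R (ball_weight p w *\<^sub>R f w)) \<partial>lborel)"
 proof (rule Bochner_Integration.integral_cong[OF refl])
  fix w :: "complex^'n^'n"
  have 1: "indicator matrix_ball w *\<^sub>R (ball_weight p w *\<^sub>R f w) = ball_density e w *\<^sub>R f w"
   using bd[of w] by (simp add: scaleR_scaleR)
  have 2: "indicator matrix_cball w *\<^sub>R (ball_density e w / M) *\<^sub>R f w = inverse M *\<^sub>R (ball_density e w *\<^sub>R f w)"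
   by (cases "w \<in> matrix_cball") (simp_all add: ball_density_outside_cball divide_inverse mult.commute)
  show "indicator matrix_cball w *\<^sub>R (ball_density e w / M) *\<^sub>R f w = inverse M *\<^sub>R (indicator matrix_ball w *\<^sub>R (ball_weight p w *\<^sub>R f w))"
   unfolding 1 2 ..
 qed
 also have "\<dots> = inverse M *\<^sub>R (LINT w : matrix_ball | lborel. ball_weight p w *\<^sub>R f w)"
  unfolding set_lebesgue_integral_def by (rule integral_scaleR_right)
 finally show ?thesis by (simp add: kappa e_def)
qed

text \<open>A contraction is a limit of its multiples by factors below \<open>1\<close>, at which the density is positive.\<close>
lemma ball_measure_full_support:
 assumes e: "e > -1" and U: "open U" "U \<inter> (matrix_cball :: (complex^'n^'n) set) ~= {}"
 shows "0 < emeasure (ball_measure e) (U \<inter> matrix_cball)"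
proof -
 obtain w where w: "w \<in> U" "w \<in> matrix_cball" using U(2) by blast
 have "((%c. c *\<^sub>R w) \<longlongrightarrow> 1 *\<^sub>R w) (at_left 1)" by (intro tendsto_intros)
 then have "eventually (%c. c *\<^sub>R w \<in> U) (at_left 1)" using U(1) w(1) by (intro topological_tendstoD) auto
 moreover have "eventually (%c::real. c \<in> {0<..<1}) (at_left 1)" by (rule eventually_at_left_real) simp
 ultimately have "eventually (%c. c *\<^sub>R w \<in> U \<and> c \<in> {0<..<1}) (at_left 1)" by (rule eventually_conj)
 then obtain c where c: "c *\<^sub>R w \<in> U" "c \<in> {0<..<1}" using eventually_happens'[OF trivial_limit_at_left_real] by blast
 define V where "V = U \<inter> (matrix_ball :: (complex^'n^'n) set)"
 have V: "open V" "V ~= {}"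
  using U(1) open_matrix_ball matrix_cball_limit[OF w(2), of c] c by (auto simp: V_def)
 have VW: "V \<subseteq> U \<inter> matrix_cball" using matrix_ball_cball by (auto simp: V_def)
 have Vs: "V \<in> sets borel" "U \<inter> matrix_cball \<in> sets borel" using V(1) U(1) by auto
 show ?thesis
 proof (rule ccontr)
  assume "\<not> 0 < emeasure (ball_measure e) (U \<inter> matrix_cball)"
  then have "(\<integral>\<^sup>+w. indicator (U \<inter> matrix_cball) w * ennreal (ball_density e (w :: complex^'n^'n)) \<partial>lborel) = 0"
   using emeasure_ball_measure[OF e Vs(2)] by simp
  then have "AE w in lborel. indicator (U \<inter> matrix_cball) w * ennreal (ball_density e (w :: complex^'n^'n)) = 0"
   using Vs(2) by (subst (asm) nn_integral_0_iff_AE) auto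
  then have "AE w in lborel. w \<notin> V"
  proof eventually_elim
   case (elim w)
   then show ?case using VW ball_density_pos[of w e] by (auto simp: V_def indicator_def split: if_splits)
  qed
  then have "emeasure lborel V = 0" using Vs(1) by (subst (asm) AE_iff_measurable[of V]) auto
  then show False using lborel_open_pos[OF V] by simp
 qed
qed

lemma closed_cone: "closed (cone_points TYPE('n::finite))"
 by (intro closed_Times closed_psd closed_UNIV)

interpretation cone: closed_subset "cone_points TYPE('n::finite)"
 by unfold_locales (rule closed_cone)

lemma continuous_on_point_arg:
 "continuous_on (((psd \<times> UNIV) \<times> (psd \<times> UNIV)) \<times> matrix_cball)
   (%q. point_arg (fst (fst q)) (snd (fst q)) (snd q) :: (complex^'n^'n) \<times> real)"
 unfolding point_arg_eq
proof (intro continuous_intros)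
 show "continuous_on (((psd \<times> UNIV) \<times> (psd \<times> UNIV)) \<times> matrix_cball)
   (%q. psd_sqrt (sum_square (fst (fst (fst q))) (fst (snd (fst q))) (snd q)) :: complex^'n^'n)"
  unfolding sum_square_def
  by (rule continuous_on_compose2[OF continuous_on_psd_sqrt])
   (auto intro!: continuous_intros simp: sum_square_psd[unfolded sum_square_def])
qed

lemma convolution_kernel_cone:
 assumes e: "e > -1"
 shows "convolution_kernel (cone_points TYPE('n::finite)) (ball_measure e) matrix_cball point_arg"
proof (intro convolution_kernel.intro convolution_kernel_axioms.intro)
 show "closed_subset (cone_points TYPE('n::finite))" by unfold_locales
 show "finite_measure (ball_measure e :: (complex^'n^'n) measure)" "measure (ball_measure e) (matrix_cball :: (complex^'n^'n) set) = 1"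
  by (rule ball_measure_prob[OF e])+
 show "sets (ball_measure e) = sets (restrict_space borel (matrix_cball :: (complex^'n^'n) set))" by (rule sets_ball_measure)
 fix x y :: "(complex^'n^'n) \<times> real" and w :: "complex^'n^'n"
 assume "x \<in> psd \<times> UNIV" "y \<in> psd \<times> UNIV" "w \<in> matrix_cball"
 then show "point_arg x y w \<in> psd \<times> UNIV" by (auto simp: point_arg_eq intro!: psd_sqrt_psd sum_square_psd)
qed (rule compact_matrix_cball continuous_on_point_arg)+

lemma distr_ball_measure_ctranspose:
 assumes e: "e > -1"
 shows "ctranspose \<in> measurable (ball_measure e) (ball_measure e :: (complex^'n^'n) measure)"
  and "distr (ball_measure e) (ball_measure e) ctranspose = (ball_measure e :: (complex^'n^'n) measure)"
proof -
 show meas: "ctranspose \<in> measurable (ball_measure e) (ball_measure e :: (complex^'n^'n) measure)"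
  unfolding measurable_cong_sets[OF sets_ball_measure sets_ball_measure]
  by (intro measurable_restrict_space2 measurable_restrict_space1) (auto simp: space_restrict_space matrix_cball_ctranspose)
 show "distr (ball_measure e) (ball_measure e) ctranspose = (ball_measure e :: (complex^'n^'n) measure)"
 proof (rule measure_eqI)
  fix A assume "A \<in> sets (distr (ball_measure e) (ball_measure e) (ctranspose :: complex^'n^'n => complex^'n^'n))"
  then have A: "A \<in> sets (ball_measure e)" by simp
  then have A': "A \<in> sets borel" "A \<subseteq> matrix_cball" unfolding sets_ball_measure by (simp_all add: sets_restrict_space_iff)
  note [measurable] = A'(1)
  define B where "B = ctranspose -` A \<inter> matrix_cball"
  have B: "B \<in> sets (ball_measure e)" using measurable_sets[OF meas A] by (simp add: B_def space_ball_measure)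
  then have B': "B \<in> sets borel" "B \<subseteq> matrix_cball" unfolding sets_ball_measure by (simp_all add: sets_restrict_space_iff)
  have "indicator A (ctranspose w) = (indicator B w :: ennreal)" for w
   using A'(2) matrix_cball_ctranspose[of "ctranspose w"] by (auto simp: B_def indicator_def)
  then have "(\<integral>\<^sup>+w. indicator B w * ennreal (ball_density e w) \<partial>lborel) = (\<integral>\<^sup>+w. indicator A (ctranspose w) * ennreal (ball_density e (ctranspose w)) \<partial>lborel)"
   by (simp add: ball_density_ctranspose)
  also have "\<dots> = (\<integral>\<^sup>+w. indicator A w * ennreal (ball_density e w) \<partial>lborel)"
   by (rule nn_integral_ctranspose[of "%w. indicator A w * ennreal (ball_density e w)"]) measurable
  finally have "ball_mass e TYPE('n) * emeasure (ball_measure e) B = ball_mass e TYPE('n) * emeasure (ball_measure e) A"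
   by (simp add: emeasure_ball_measure[OF e A'] emeasure_ball_measure[OF e B'])
  then have "emeasure (ball_measure e) B = emeasure (ball_measure e) A"
   using ball_mass_pos[of e, where 'n = 'n] ball_mass_finite[OF e, where 'n = 'n] by (subst (asm) ennreal_mult_cancel_left) auto
  then show "emeasure (distr (ball_measure e) (ball_measure e) ctranspose) A = emeasure (ball_measure e) A"
   using A by (simp add: emeasure_distr[OF meas] B_def space_ball_measure)
 qed simp
qed

text \<open>Both iterated convolutions are images of the same measure, the law of the matrix
 \<open>N = r ** w ** s + k ** v ** t\<close> of \<open>nn_integral_associativity_all\<close>, under one and the same map.\<close>
lemma associative_pos_def:
 fixes r s t :: "complex^'n^'n" and a b c :: real
 assumes e: "e > -1" and r: "r \<in> pos_def" and s: "s \<in> psd" and t: "t \<in> pos_def"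
  and f: "f \<in> Cb (top_of_set (psd \<times> UNIV))"
 shows "(\<integral>w. (\<integral>v. f (point_arg (point_arg (r, a) (s, b) w) (t, c) v) \<partial>ball_measure e) \<partial>ball_measure e)
  = (\<integral>w. (\<integral>v. f (point_arg (r, a) (point_arg (s, b) (t, c) w) v) \<partial>ball_measure e) \<partial>ball_measure e)"
proof -
 interpret convolution_kernel "cone_points TYPE('n::finite)" "ball_measure e" matrix_cball point_arg
  by (rule convolution_kernel_cone[OF e])
 interpret m: finite_measure "ball_measure e :: (complex^'n^'n) measure" by (rule finite_m)
 let ?P = "(ball_measure e :: (complex^'n^'n) measure) \<Otimes>\<^sub>M (ball_measure e :: (complex^'n^'n) measure)"
 have r': "r \<in> psd" and t': "t \<in> psd" using r t by (auto intro: pos_def_psd)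
 define \<Theta> where "\<Theta> N = (matrix_root (r ** r + s ** s + t ** t + N + ctranspose N), a + b + c - Im (trace N))" for N :: "complex^'n^'n"
 define N1 where "N1 q = r ** fst q ** s + matrix_root (sum_square r s (fst q)) ** snd q ** t" for q
 define N2 where "N2 q = r ** snd q ** matrix_root (sum_square s t (fst q)) + s ** fst q ** t" for q
 have idP: "(%q. q) \<in> borel_measurable ?P"
  by (rule borel_measurable_continuous_pair[OF _ id_m id_m]) (rule continuous_on_id)
 have [measurable]: "fst \<in> borel_measurable ?P" "snd \<in> borel_measurable ?P"
  using measurable_compose[OF idP, of fst borel] measurable_compose[OF idP, of snd borel] by (simp_all add: borel_measurable_continuous_onI continuous_on_fst continuous_on_snd)
 have N_meas [measurable]: "N1 \<in> borel_measurable ?P" "N2 \<in> borel_measurable ?P" unfolding N1_def N2_def by measurable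
 have \<Theta>_meas: "\<Theta> \<in> measurable borel (restrict_space borel (psd \<times> UNIV))"
  unfolding \<Theta>_def by (intro measurable_restrict_space2) (auto simp: matrix_root_psd)
 have f\<Theta>: "(%N. f (\<Theta> N)) \<in> borel_measurable borel"
  using cone.Cb_bounded_borel[OF f] by (intro measurable_compose[OF \<Theta>_meas]) (simp add: cone.bounded_borel_def)
 have law: "distr ?P borel N1 = distr ?P borel N2"
 proof (rule measure_eqI)
  fix A :: "(complex^'n^'n) set" assume "A \<in> sets (distr ?P borel N1)"
  then have [measurable]: "A \<in> sets borel" by simp
  have dist: "ball_mass e TYPE('n) * (ball_mass e TYPE('n) * emeasure (distr ?P borel N) A)
   = (\<integral>\<^sup>+w. (\<integral>\<^sup>+v. ennreal (indicator A (N (w, v))) * ennreal (ball_density e v) \<partial>lborel) * ennreal (ball_density e w) \<partial>lborel)"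
   if N: "N \<in> borel_measurable ?P" and N': "N \<in> borel_measurable borel" for N
  proof -
   have [measurable]: "N \<in> borel_measurable (borel \<Otimes>\<^sub>M borel)" using N' by (simp add: borel_prod)
   have [measurable]: "(%v. N (w, v)) \<in> borel_measurable borel" for w by measurable
   have "emeasure (distr ?P borel N) A = (\<integral>\<^sup>+q. indicator A (N q) \<partial>?P)"
    using N by (subst nn_integral_indicator[symmetric], simp, subst nn_integral_distr) auto
   also have "\<dots> = (\<integral>\<^sup>+w. (\<integral>\<^sup>+v. indicator A (N (w, v)) \<partial>ball_measure e) \<partial>ball_measure e)"
    using N by (subst m.nn_integral_fst[symmetric]) auto
   finally have em: "emeasure (distr ?P borel N) A = (\<integral>\<^sup>+w. (\<integral>\<^sup>+v. indicator A (N (w, v)) \<partial>ball_measure e) \<partial>ball_measure e)" .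
   have "ball_mass e TYPE('n) * (ball_mass e TYPE('n) * emeasure (distr ?P borel N) A)
    = ball_mass e TYPE('n) * (\<integral>\<^sup>+w. (\<integral>\<^sup>+v. indicator A (N (w, v)) * ennreal (ball_density e v) \<partial>lborel) \<partial>ball_measure e)"
   proof -
    have "ball_mass e TYPE('n) * (\<integral>\<^sup>+w. (\<integral>\<^sup>+v. indicator A (N (w, v)) \<partial>ball_measure e) \<partial>ball_measure e)
     = (\<integral>\<^sup>+w. ball_mass e TYPE('n) * (\<integral>\<^sup>+v. indicator A (N (w, v)) \<partial>ball_measure e) \<partial>ball_measure e)"
    proof (rule nn_integral_cmult[symmetric])
     have "(%q. indicator A (N q) :: ennreal) \<in> borel_measurable ?P" using N by measurable
     from m.borel_measurable_nn_integral_fst[OF this]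
     show "(%w. \<integral>\<^sup>+v. indicator A (N (w, v)) \<partial>ball_measure e) \<in> borel_measurable (ball_measure e)" .
    qed
    also have "\<dots> = (\<integral>\<^sup>+w. (\<integral>\<^sup>+v. indicator A (N (w, v)) * ennreal (ball_density e v) \<partial>lborel) \<partial>ball_measure e)"
     by (intro nn_integral_cong nn_integral_ball_measure[OF e]) measurable
    finally show ?thesis unfolding em by (rule arg_cong)
   qed
   also have "\<dots> = (\<integral>\<^sup>+w. (\<integral>\<^sup>+v. indicator A (N (w, v)) * ennreal (ball_density e v) \<partial>lborel) * ennreal (ball_density e w) \<partial>lborel)"
    by (rule nn_integral_ball_measure[OF e]) measurable
   finally show ?thesis by (simp add: ennreal_indicator)
  qed
  have "N1 \<in> borel_measurable (borel \<Otimes>\<^sub>M borel)" "N2 \<in> borel_measurable (borel \<Otimes>\<^sub>M borel)" unfolding N1_def N2_def by measurable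
  then have "N1 \<in> borel_measurable borel" "N2 \<in> borel_measurable borel" by (simp_all add: borel_prod)
  note * = dist[OF N_meas(1) this(1)] dist[OF N_meas(2) this(2)]
  have "ball_mass e TYPE('n) * (ball_mass e TYPE('n) * emeasure (distr ?P borel N1) A)
   = ball_mass e TYPE('n) * (ball_mass e TYPE('n) * emeasure (distr ?P borel N2) A)"
   unfolding * unfolding N1_def N2_def fst_conv snd_conv
   by (rule nn_integral_associativity_all[OF r s t e]) (auto simp: indicator_def)
  then show "emeasure (distr ?P borel N1) A = emeasure (distr ?P borel N2) A"
   using ball_mass_pos[of e, where 'n = 'n] ball_mass_finite[OF e, where 'n = 'n]
   by (auto simp: ennreal_mult_cancel_left)
 qed simp
 have spP: "space ?P = matrix_cball \<times> matrix_cball" by (simp add: space_pair_measure space_ball_measure)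
 have eq1: "point_arg (point_arg (r, a) (s, b) w) (t, c) v = \<Theta> (N1 (w, v))" and eq2: "point_arg (r, a) (point_arg (s, b) (t, c) w) v = \<Theta> (N2 (w, v))"
  if w: "w \<in> matrix_cball" and v: "v \<in> matrix_cball" for w v
 proof -
  have k: "sum_square r s w \<in> psd" "sum_square s t w \<in> psd" using r' s t' w by (auto intro: sum_square_psd)
  have ss: "sum_square (psd_sqrt (sum_square r s w)) t v = r ** r + s ** s + t ** t + N1 (w, v) + ctranspose (N1 (w, v))"
   "sum_square r (psd_sqrt (sum_square s t w)) v = r ** r + s ** s + t ** t + N2 (w, v) + ctranspose (N2 (w, v))"
   using k unfolding sum_square_def[of "psd_sqrt _"] sum_square_def[of r "psd_sqrt _"]
   by (simp_all add: psd_sqrt_square matrix_root_def N1_def N2_def ctranspose_add) (simp_all add: sum_square_def algebra_simps)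
  have "sum_square (psd_sqrt (sum_square r s w)) t v \<in> psd" "sum_square r (psd_sqrt (sum_square s t w)) v \<in> psd"
   using k r' t' v by (auto intro!: sum_square_psd psd_sqrt_psd)
  then show "point_arg (point_arg (r, a) (s, b) w) (t, c) v = \<Theta> (N1 (w, v))" "point_arg (r, a) (point_arg (s, b) (t, c) w) v = \<Theta> (N2 (w, v))"
   using k unfolding point_arg_eq \<Theta>_def fst_conv snd_conv ss
   by (simp_all add: matrix_root_def) (simp_all add: N1_def N2_def matrix_root_def trace_add algebra_simps)
 qed
 have S: "(r, a) \<in> psd \<times> UNIV" "(s, b) \<in> psd \<times> UNIV" "(t, c) \<in> psd \<times> UNIV" using r' s t' by auto
 have "(\<integral>w. (\<integral>v. f (point_arg (point_arg (r, a) (s, b) w) (t, c) v) \<partial>ball_measure e) \<partial>ball_measure e) = (\<integral>q. f (\<Theta> (N1 q)) \<partial>?P)"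
  unfolding iterated_integral_pair(1)[OF f S] by (intro Bochner_Integration.integral_cong) (auto simp: spP eq1)
 also have "\<dots> = (\<integral>N. f (\<Theta> N) \<partial>distr ?P borel N1)" by (rule integral_distr[OF N_meas(1) f\<Theta>, symmetric])
 also have "\<dots> = (\<integral>q. f (\<Theta> (N2 q)) \<partial>?P)" unfolding law by (rule integral_distr[OF N_meas(2) f\<Theta>])
 also have "\<dots> = (\<integral>w. (\<integral>v. f (point_arg (r, a) (point_arg (s, b) (t, c) w) v) \<partial>ball_measure e) \<partial>ball_measure e)"
  unfolding iterated_integral_pair(2)[OF f S] by (intro Bochner_Integration.integral_cong) (auto simp: spP eq2)
 finally show ?thesis .
qed

lemma hypergroup_kernel_cone:
 assumes e: "e > -1"
 shows "hypergroup_kernel (cone_points TYPE('n::finite)) (ball_measure e) matrix_cball point_arg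
  (0, 0) (%(r, a). (r, - a)) ctranspose"
proof -
 interpret convolution_kernel "cone_points TYPE('n::finite)" "ball_measure e" matrix_cball point_arg
  by (rule convolution_kernel_cone[OF e])
 show ?thesis
 proof
  show "0 < emeasure (ball_measure e) (U \<inter> matrix_cball)" if "open U" "U \<inter> matrix_cball ~= {}" for U :: "(complex^'n^'n) set"
   by (rule ball_measure_full_support[OF e that])
  show "ctranspose \<in> measurable (ball_measure e) (ball_measure e :: (complex^'n^'n) measure)"
   "distr (ball_measure e) (ball_measure e) ctranspose = (ball_measure e :: (complex^'n^'n) measure)"
   by (rule distr_ball_measure_ctranspose[OF e])+
  show "(0, 0) \<in> cone_points TYPE('n::finite)" by (simp add: zero_psd)
  show "continuous_on (cone_points TYPE('n::finite)) (%(r, a). (r, - a))"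
   unfolding case_prod_beta by (intro continuous_intros)
 next
  fix x :: "(complex^'n^'n) \<times> real" and w :: "complex^'n^'n"
  assume "x \<in> psd \<times> UNIV"
  then have x: "fst x \<in> psd" by auto
  have sq: "psd_sqrt (fst x ** fst x) = fst x" by (rule psd_sqrt_eq[OF x refl])
  show "point_arg (0, 0) x w = x" "point_arg x (0, 0) w = x"
   by (simp_all add: point_arg_eq sum_square_def sq trace_def)
  show "(case x of (r, a) => (r, - a)) \<in> psd \<times> UNIV" "(case (case x of (r, a) => (r, - a)) of (r, a) => (r, - a)) = x"
   using x by (auto simp: case_prod_beta)
 next
  fix x y :: "(complex^'n^'n) \<times> real" and w :: "complex^'n^'n"
  assume "x \<in> psd \<times> UNIV" "y \<in> psd \<times> UNIV"
  then have x: "fst x \<in> psd" and y: "fst y \<in> psd" by auto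
  note h = psd_hermitian[OF x] psd_hermitian[OF y]
  have ct: "ctranspose (fst x ** w ** fst y) = fst y ** ctranspose w ** fst x" by (simp add: ctranspose_mult h matrix_mul_assoc)
  have "sum_square (fst y) (fst x) (ctranspose w) = sum_square (fst x) (fst y) w"
   unfolding sum_square_def ct[symmetric] by simp
  moreover have "Im (trace (fst y ** ctranspose w ** fst x)) = - Im (trace (fst x ** w ** fst y))"
   unfolding ct[symmetric] trace_ctranspose by simp
  ultimately show "(case point_arg x y w of (r, a) => (r, - a)) = point_arg (case y of (r, a) => (r, - a)) (case x of (r, a) => (r, - a)) (ctranspose w)"
   by (simp add: point_arg_eq case_prod_beta)
 next
  fix x y :: "(complex^'n^'n) \<times> real"
  assume "x \<in> psd \<times> UNIV" "y \<in> psd \<times> UNIV"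
  then obtain r a s b where xy: "x = (r, a)" "y = (s, b)" and r: "r \<in> psd" and s: "s \<in> psd" by auto
  have sr: "Im (trace (s ** s)) = 0" by (rule Im_trace_hermitian) (simp add: ctranspose_mult psd_hermitian[OF s])
  show "(0, 0) \<in> point_arg x y ` matrix_cball \<longleftrightarrow> y = (case x of (r, a) => (r, - a))"
  proof
   assume "(0, 0) \<in> point_arg x y ` matrix_cball"
   then obtain w where w: "w \<in> matrix_cball" "psd_sqrt (sum_square r s w) = 0" "a + b - Im (trace (r ** w ** s)) = 0"
    by (auto simp: point_arg_eq xy)
   have "sum_square r s w = 0" using psd_sqrt_square[OF sum_square_psd[OF r s w(1)]] w(2) by simp
   from sum_square_zero[OF r s w(1) this] have "r = s" "r ** w ** s = - (s ** s)" by (simp_all add: matrix_mult_simps)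
   then have "r = s" "Im (trace (r ** w ** s)) = 0" using sr by (simp_all add: trace_def sum_negf)
   then show "y = (case x of (r, a) => (r, - a))" using w(3) by (simp add: xy)
  next
   assume "y = (case x of (r, a) => (r, - a))"
   then have y: "r = s" "b = - a" by (simp_all add: xy)
   have "- mat 1 \<in> (matrix_cball :: (complex^'n^'n) set)"
    using scaleR_matrix_vector[of "-1" "mat 1 :: complex^'n^'n"] by (simp add: matrix_cball_def)
   moreover have "s ** (- mat 1) ** s = - (s ** s)" by (simp add: matrix_mult_simps)
   then have "point_arg x y (- mat 1) = (0, 0)"
    using psd_sqrt_eq[OF zero_psd, of 0] sr
    by (simp add: point_arg_eq xy y sum_square_def ctranspose_simps psd_hermitian[OF s] trace_def sum_negf)
   ultimately show "(0, 0) \<in> point_arg x y ` matrix_cball" by (metis image_eqI)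
  qed
 next
  fix f and x y z :: "(complex^'n^'n) \<times> real"
  assume f: "f \<in> Cb (top_of_set (cone_points TYPE('n::finite)))"
   and S: "x \<in> psd \<times> UNIV" "y \<in> psd \<times> UNIV" "z \<in> psd \<times> UNIV"
  obtain r a s b t c where xyz: "x = (r, a)" "y = (s, b)" "z = (t, c)" and rst: "r \<in> psd" "s \<in> psd" "t \<in> psd" using S by auto
  define \<epsilon> where "\<epsilon> k = 1 / real (Suc k)" for k
  have lim: "(%k. (A + \<epsilon> k *\<^sub>R mat 1, d)) \<longlonglongrightarrow> (A, d)" for A :: "complex^'n^'n" and d :: real
  proof -
   have "(%k. (A + \<epsilon> k *\<^sub>R mat 1, d)) \<longlonglongrightarrow> (A + 0 *\<^sub>R mat 1, d)"
    unfolding \<epsilon>_def using LIMSEQ_inverse_real_of_nat by (intro tendsto_intros) (simp add: divide_inverse)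
   then show ?thesis by simp
  qed
  have pd: "A + \<epsilon> k *\<^sub>R mat 1 \<in> pos_def" if "A \<in> psd" for A :: "complex^'n^'n" and k
   using pos_def_add_psd[OF pos_def_scaleR[OF _ mat_1_pos_def] that, of "\<epsilon> k"] by (simp add: \<epsilon>_def add.commute)
  show "(\<integral>w. (\<integral>v. f (point_arg (point_arg x y w) z v) \<partial>ball_measure e) \<partial>ball_measure e)
    = (\<integral>w. (\<integral>v. f (point_arg x (point_arg y z w) v) \<partial>ball_measure e) \<partial>ball_measure e)"
   unfolding xyz
   by (rule associative_limit[OF f _ _ _ lim[of r a] lim[of t c]])
    (use rst in \<open>auto intro!: associative_pos_def[OF e _ _ _ f] pd pos_def_psd[OF pd]\<close>)
 qed
qed

section \<open>Haar measure\<close>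

text \<open>The density vanishes off the positive definite matrices, where the default value of
 \<^const>\<open>matrix_root\<close> lies.\<close>
definition cone_haar :: "real => ((complex^'n^'n) \<times> real) measure" where
 "cone_haar e = distr (density (hermitian_lebesgue \<Otimes>\<^sub>M lborel) (%z. ennreal (det_power e (fst z))))
   (restrict_space borel (psd \<times> UNIV)) (%z. (matrix_root (fst z), snd z))"

lemma sets_cone_haar: "sets (cone_haar e) = sets (restrict_space borel ((psd :: (complex^'n^'n) set) \<times> UNIV))"
 by (simp add: cone_haar_def)

lemma measurable_haar_map:
 "(%z. (matrix_root (fst z), snd z)) \<in> measurable (hermitian_lebesgue \<Otimes>\<^sub>M lborel) (restrict_space borel (cone_points TYPE('n::finite)))"
proof (rule measurable_restrict_space2)
 show "(%z. (matrix_root (fst z), snd z)) \<in> borel_measurable (hermitian_lebesgue \<Otimes>\<^sub>M (lborel :: real measure))"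
  unfolding borel_prod[symmetric] by measurable
qed (auto simp: matrix_root_psd)

lemma nn_integral_cone_haar:
 fixes g :: "(complex^'n^'n) \<times> real => ennreal"
 assumes [measurable]: "g \<in> borel_measurable (borel \<Otimes>\<^sub>M borel)"
 shows "(\<integral>\<^sup>+x. g x \<partial>cone_haar e) = (\<integral>\<^sup>+r. (\<integral>\<^sup>+a. g (matrix_root r, a) \<partial>lborel) * ennreal (det_power e r) \<partial>hermitian_lebesgue)"
proof -
 have g: "g \<in> borel_measurable (restrict_space borel (cone_points TYPE('n::finite)))"
  using assms by (intro measurable_restrict_space1) (simp add: borel_prod)
 have m: "(%z. ennreal (det_power e (fst z))) \<in> borel_measurable (hermitian_lebesgue \<Otimes>\<^sub>M (lborel :: real measure))"
  "(%z. g (matrix_root (fst z), snd z)) \<in> borel_measurable (hermitian_lebesgue \<Otimes>\<^sub>M (lborel :: real measure))"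
  by measurable
 have "(\<integral>\<^sup>+x. g x \<partial>cone_haar e) = (\<integral>\<^sup>+z. g (matrix_root (fst z), snd z) \<partial>density (hermitian_lebesgue \<Otimes>\<^sub>M lborel) (%z. ennreal (det_power e (fst z))))"
  unfolding cone_haar_def
  by (rule nn_integral_distr) (use measurable_haar_map g in \<open>simp_all\<close>)
 also have "\<dots> = (\<integral>\<^sup>+z. ennreal (det_power e (fst z)) * g (matrix_root (fst z), snd z) \<partial>(hermitian_lebesgue \<Otimes>\<^sub>M lborel))"
  by (rule nn_integral_density[OF m])
 also have "\<dots> = (\<integral>\<^sup>+r. (\<integral>\<^sup>+a. ennreal (det_power e r) * g (matrix_root r, a) \<partial>lborel) \<partial>hermitian_lebesgue)"
 proof -
  have "(%z. ennreal (det_power e (fst z)) * g (matrix_root (fst z), snd z)) \<in> borel_measurable (hermitian_lebesgue \<Otimes>\<^sub>M (lborel :: real measure))"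
   by measurable
  from lborel.nn_integral_fst[OF this] show ?thesis by simp
 qed
 also have "\<dots> = (\<integral>\<^sup>+r. (\<integral>\<^sup>+a. g (matrix_root r, a) \<partial>lborel) * ennreal (det_power e r) \<partial>hermitian_lebesgue)"
  by (intro nn_integral_cong) (subst nn_integral_cmult, measurable, simp add: mult.commute)
 finally show ?thesis .
qed

lemma emeasure_cone_haar:
 assumes A: "A \<in> sets (restrict_space borel (cone_points TYPE('n::finite)))"
 shows "emeasure (cone_haar e) A = (\<integral>\<^sup>+r. (\<integral>\<^sup>+a. indicator A (matrix_root r, a) \<partial>lborel) * ennreal (det_power e r) \<partial>hermitian_lebesgue)"
proof -
 have "A \<in> sets (borel \<Otimes>\<^sub>M borel)" using A unfolding cone.Sigma_iff borel_prod by blast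
 then have "(indicator A :: _ => ennreal) \<in> borel_measurable (borel \<Otimes>\<^sub>M borel)" by simp
 from nn_integral_cone_haar[OF this, of e] show ?thesis using A by (simp add: sets_cone_haar)
qed

lemma radon_cone_haar:
 assumes e: "e > -1"
 shows "radon_measure (top_of_set (cone_points TYPE('n::finite))) (cone_haar e)"
proof (rule cone.radon_measureI[OF sets_cone_haar])
 fix K assume K: "compactin (top_of_set (cone_points TYPE('n::finite))) K"
 then have "bounded K" by (simp add: compactin_subtopology compact_imp_bounded)
 then obtain R where R: "!!x. x \<in> K ==> norm x <= R" by (auto simp: bounded_iff)
 have "(\<integral>\<^sup>+a. indicator K (matrix_root r, a) \<partial>lborel) * ennreal (det_power e r)
   <= ennreal (2 * \<bar>R\<bar>) * (indicator (cball 0 (R\<^sup>2)) r * ennreal (det_power e r))" for r :: "complex^'n^'n"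
 proof (cases "r \<in> pos_def")
  case False then show ?thesis by (simp add: det_power_def)
 next
  case True
  then have r: "r \<in> psd" by (rule pos_def_psd)
  have "indicator K (matrix_root r, a) <= (indicator (cball 0 (R\<^sup>2)) r * indicator {- \<bar>R\<bar>..\<bar>R\<bar>} a :: ennreal)" for a
  proof (cases "(matrix_root r, a) \<in> K")
   case *: True
   have n: "norm (matrix_root r) <= R" "norm a <= R"
    using R[OF *] norm_fst_le[of "matrix_root r" a] norm_snd_le[of a "matrix_root r"] by linarith+
   have "norm r <= norm (matrix_root r) * norm (matrix_root r)"
    using norm_matrix_mult_le[of "matrix_root r" "matrix_root r"] by (simp add: matrix_root_square[OF r])
   also have "\<dots> <= R\<^sup>2" unfolding power2_eq_square using n(1) order_trans[OF norm_ge_zero n(1)] by (intro mult_mono) auto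
   finally show ?thesis using n(2) by (simp add: indicator_def abs_le_iff)
  qed simp
  then have "(\<integral>\<^sup>+a. indicator K (matrix_root r, a) \<partial>lborel) <= (\<integral>\<^sup>+a. indicator (cball 0 (R\<^sup>2)) r * indicator {- \<bar>R\<bar>..\<bar>R\<bar>} a \<partial>lborel)"
   by (intro nn_integral_mono)
  also have "\<dots> = indicator (cball 0 (R\<^sup>2)) r * emeasure lborel {- \<bar>R\<bar>..\<bar>R\<bar>}"
   by (rule nn_integral_cmult_indicator) simp
  also have "\<dots> = ennreal (2 * \<bar>R\<bar>) * indicator (cball 0 (R\<^sup>2)) r" by (simp add: mult.commute)
  finally show ?thesis by (simp add: mult_right_mono mult.assoc[symmetric])
 qed
 then have "emeasure (cone_haar e) K <= (\<integral>\<^sup>+r. ennreal (2 * \<bar>R\<bar>) * (indicator (cball 0 (R\<^sup>2)) r * ennreal (det_power e (r :: complex^'n^'n))) \<partial>hermitian_lebesgue)"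
  unfolding emeasure_cone_haar[OF cone.compactin_Sigma[OF K]] by (intro nn_integral_mono)
 also have "\<dots> = ennreal (2 * \<bar>R\<bar>) * (\<integral>\<^sup>+r. indicator (cball 0 (R\<^sup>2)) r * ennreal (det_power e (r :: complex^'n^'n)) \<partial>hermitian_lebesgue)"
  by (rule nn_integral_cmult) measurable
 also have "\<dots> < \<infinity>" using nn_integral_det_power_finite[OF e, of "R\<^sup>2", where 'n = 'n] by (simp add: ennreal_mult_less_top)
 finally show "emeasure (cone_haar e) K < \<infinity>" .
qed

lemma cone_haar_nonzero: "emeasure (cone_haar e) (cone_points TYPE('n::finite)) ~= 0"
proof
 assume "emeasure (cone_haar e) (cone_points TYPE('n::finite)) = 0"
 then have "(\<integral>\<^sup>+r. (\<integral>\<^sup>+a. indicator (psd \<times> UNIV) (matrix_root r, a :: real) \<partial>lborel) * ennreal (det_power e (r :: complex^'n^'n)) \<partial>hermitian_lebesgue) = 0"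
  by (simp only: emeasure_cone_haar[OF cone.S_in_Sigma])
 then have "(\<integral>\<^sup>+r. top * ennreal (det_power e (r :: complex^'n^'n)) \<partial>hermitian_lebesgue) = 0"
  by (simp add: matrix_root_psd)
 then have "(\<integral>\<^sup>+A. top * ennreal (det_power e (hermitian_of A :: complex^'n^'n)) \<partial>lborel) = 0"
  by (subst (asm) nn_integral_hermitian_lebesgue) measurable
 moreover have "(%A. top * ennreal (det_power e (hermitian_of A :: complex^'n^'n))) \<in> borel_measurable lborel" by measurable
 ultimately have ae: "AE A in lborel. top * ennreal (det_power e (hermitian_of A :: complex^'n^'n)) = 0"
  by (simp only: nn_integral_0_iff_AE)
 obtain V where V: "open V" "(pos_def :: (complex^'n^'n) set) = hermitian \<inter> V"
  using openin_pos_def[where 'n = 'n] by (auto simp: openin_open)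
 define U where "U = (hermitian_of :: real^'n^'n => complex^'n^'n) -` V"
 have "open U"
  unfolding U_def by (intro open_vimage V linear_continuous_on linear_hermitian_of[THEN linear_conv_bounded_linear[THEN iffD1]])
 have one: "(mat 1 :: complex^'n^'n) \<in> hermitian" "(mat 1 :: complex^'n^'n) \<in> V" using mat_1_pos_def V(2) by auto
 have "(\<chi> i j. Re ((mat 1 :: complex^'n^'n) $ i $ j) + Im ((mat 1 :: complex^'n^'n) $ i $ j)) \<in> U"
  unfolding U_def vimage_def mem_Collect_eq hermitian_of_surj[OF one(1)] by (rule one(2))
 then have "U ~= {}" by blast
 have pd: "hermitian_of A \<in> (pos_def :: (complex^'n^'n) set)" if "A \<in> U" for A
  using that hermitian_of_hermitian[of A] V(2) by (auto simp: U_def)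
 from ae have "AE A in lborel. A \<notin> U"
 proof eventually_elim
  case (elim A)
  show ?case
  proof
   assume "A \<in> U"
   from pos_def_det(1)[OF pd[OF this]] pd[OF this] have "0 < det_power e (hermitian_of A :: complex^'n^'n)" by (simp add: det_power_def)
   then show False using elim by simp
  qed
 qed
 then have "emeasure lborel U = 0" using \<open>open U\<close> by (subst (asm) AE_iff_measurable[of U]) auto
 then show False using lborel_open_pos[OF \<open>open U\<close> \<open>U ~= {}\<close>] by simp
qed

text \<open>Integrating out the central coordinate turns invariance into a statement on the cone. There,
 the polar decomposition rewrites the ball integral so that the shift by \<open>r\<close> becomes a translation
 \<open>y \<mapsto> y + r\<close> of the matrix variable: \<open>r\<^sup>2 + (y\<^sup>*y + t) + ry + (ry)\<^sup>* = (y + r)\<^sup>*(y + r) + t\<close>.\<close>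
lemma nn_integral_cone_invariance:
 fixes G :: "complex^'n^'n => ennreal"
 assumes r: "r \<in> psd" and [measurable]: "G \<in> borel_measurable borel"
 shows "(\<integral>\<^sup>+s. (\<integral>\<^sup>+w. G (sum_square r (matrix_root s) w) * ennreal (ball_density e w) \<partial>lborel) * ennreal (det_power (e + real CARD('n)) s) \<partial>hermitian_lebesgue)
  = ball_mass e TYPE('n) * (\<integral>\<^sup>+s. G s * ennreal (det_power (e + real CARD('n)) s) \<partial>hermitian_lebesgue)"
proof -
 let ?d = "%s :: complex^'n^'n. ennreal (det_power (e + real CARD('n)) s)"
 define \<Psi> where "\<Psi> q = G (r ** r + fst q + r ** snd q + ctranspose (r ** snd q))" for q
 have [measurable]: "\<Psi> \<in> borel_measurable (borel \<Otimes>\<^sub>M borel)" unfolding \<Psi>_def by measurable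
 have "(\<integral>\<^sup>+s. (\<integral>\<^sup>+w. G (sum_square r (matrix_root s) w) * ennreal (ball_density e w) \<partial>lborel) * ?d s \<partial>hermitian_lebesgue)
  = (\<integral>\<^sup>+s. (\<integral>\<^sup>+w. \<Psi> (s, w ** matrix_root s) * ennreal (ball_density e w) \<partial>lborel) * ?d s \<partial>hermitian_lebesgue)"
 proof (rule nn_integral_cong)
  fix s :: "complex^'n^'n"
  show "(\<integral>\<^sup>+w. G (sum_square r (matrix_root s) w) * ennreal (ball_density e w) \<partial>lborel) * ?d s
   = (\<integral>\<^sup>+w. \<Psi> (s, w ** matrix_root s) * ennreal (ball_density e w) \<partial>lborel) * ?d s"
  proof (cases "s \<in> psd")
   case True then show ?thesis by (simp add: \<Psi>_def sum_square_def matrix_root_square matrix_mul_assoc)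
  next
   case False then have "s \<notin> pos_def" using pos_def_psd by blast
   then show ?thesis by (simp add: det_power_def)
  qed
 qed
 also have "\<dots> = (\<integral>\<^sup>+y. (\<integral>\<^sup>+t. \<Psi> (ctranspose y ** y + t, y) * ennreal (det_power e t) \<partial>hermitian_lebesgue) \<partial>lborel)"
  unfolding ball_density_def by (rule nn_integral_polar_shift) measurable
 also have "\<dots> = (\<integral>\<^sup>+y. (\<integral>\<^sup>+t. G (ctranspose (r + y) ** (r + y) + t) * ennreal (det_power e t) \<partial>hermitian_lebesgue) \<partial>lborel)"
  by (simp add: \<Psi>_def ctranspose_simps matrix_mult_simps psd_hermitian[OF r] algebra_simps)
 also have "\<dots> = (\<integral>\<^sup>+y. (\<integral>\<^sup>+t. G (ctranspose y ** (y :: complex^'n^'n) + t) * ennreal (det_power e t) \<partial>hermitian_lebesgue) \<partial>lborel)"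
 proof (rule nn_integral_lborel_translate[where c = r and g = "%y :: complex^'n^'n. \<integral>\<^sup>+t. G (ctranspose y ** y + t) * ennreal (det_power e t) \<partial>hermitian_lebesgue"])
  interpret sigma_finite_measure "hermitian_lebesgue :: (complex^'n^'n) measure" by (rule sigma_finite_hermitian_lebesgue)
  show "(%y. \<integral>\<^sup>+t. G (ctranspose y ** y + t) * ennreal (det_power e t) \<partial>hermitian_lebesgue) \<in> borel_measurable borel" by measurable
 qed
 also have "\<dots> = (\<integral>\<^sup>+s. (\<integral>\<^sup>+w. G (fst (s, w ** matrix_root s)) * ennreal (det_power e (mat 1 - ctranspose w ** (w :: complex^'n^'n))) \<partial>lborel) * ?d s \<partial>hermitian_lebesgue)"
 proof -
  have "(%q :: (complex^'n^'n) \<times> (complex^'n^'n). G (fst q)) \<in> borel_measurable (borel \<Otimes>\<^sub>M borel)" by measurable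
  from nn_integral_polar_shift[OF this, of e] show ?thesis by simp
 qed
 also have "\<dots> = (\<integral>\<^sup>+s. ball_mass e TYPE('n) * (G s * ?d s) \<partial>hermitian_lebesgue)"
 proof (rule nn_integral_cong)
  fix s :: "complex^'n^'n"
  have "(\<integral>\<^sup>+w. G s * ennreal (ball_density e (w :: complex^'n^'n)) \<partial>lborel) = G s * ball_mass e TYPE('n)"
   by (subst nn_integral_cmult) (simp_all add: nn_integral_ball_density)
  then show "(\<integral>\<^sup>+w. G (fst (s, w ** matrix_root s)) * ennreal (det_power e (mat 1 - ctranspose w ** (w :: complex^'n^'n))) \<partial>lborel) * ?d s = ball_mass e TYPE('n) * (G s * ?d s)"
   unfolding ball_density_def fst_conv by (simp only: mult_ac)
 qed
 also have "\<dots> = ball_mass e TYPE('n) * (\<integral>\<^sup>+s. G s * ?d s \<partial>hermitian_lebesgue)" by (rule nn_integral_cmult) measurable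
 finally show ?thesis .
qed

text \<open>The integral over the central coordinate removes the shift \<open>c s w\<close> by translation invariance. Leaving
 \<open>c\<close> free covers the left and the right translations.\<close>
lemma cone_haar_invariant:
 fixes x :: "(complex^'n^'n) \<times> real" and c :: "complex^'n^'n => complex^'n^'n => real"
 assumes e: "e > -1" and x: "x \<in> psd \<times> UNIV"
  and A: "A \<in> sets (restrict_space borel (cone_points TYPE('n::finite)))"
  and \<psi>: "!!s b w. s \<in> psd ==> \<psi> (s, b) w = (psd_sqrt (sum_square (fst x) s w), b + c s w)"
  and c[measurable]: "(%q. c (fst q) (snd q)) \<in> borel_measurable (borel \<Otimes>\<^sub>M borel)"
  and \<psi>_sets: "!!s b. s \<in> psd ==> {w \<in> matrix_cball. \<psi> (s, b) w \<in> A} \<in> sets borel"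
 shows "(\<integral>\<^sup>+y. emeasure (ball_measure e) {w \<in> matrix_cball. \<psi> y w \<in> A} \<partial>cone_haar (e + real CARD('n))) = emeasure (cone_haar (e + real CARD('n))) A"
proof -
 let ?d = "%s :: complex^'n^'n. ennreal (det_power (e + real CARD('n)) s)"
 have r: "fst x \<in> psd" using x by auto
 have [measurable]: "A \<in> sets (borel \<Otimes>\<^sub>M borel)" using A unfolding cone.Sigma_iff borel_prod by blast
 define G where "G z = (\<integral>\<^sup>+b. indicator A (matrix_root z, b) \<partial>lborel)" for z :: "complex^'n^'n"
 have [measurable]: "G \<in> borel_measurable borel" unfolding G_def by measurable
 define M where "M = ball_mass e TYPE('n)"
 define H where "H q = (\<integral>\<^sup>+w. indicator A (matrix_root (sum_square (fst x) (fst q) w), snd q + c (fst q) w) * ennreal (ball_density e w) \<partial>lborel)" for q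
 have H_meas [measurable]: "H \<in> borel_measurable (borel \<Otimes>\<^sub>M borel)"
 proof -
  have "(%x. (fst (fst x), snd x)) \<in> measurable (((borel :: (complex^'n^'n) measure) \<Otimes>\<^sub>M (borel :: real measure)) \<Otimes>\<^sub>M (lborel :: (complex^'n^'n) measure)) (borel \<Otimes>\<^sub>M borel)"
   by measurable
  from measurable_compose[OF this c]
  have [measurable]: "(%x. c (fst (fst x)) (snd x)) \<in> borel_measurable (((borel :: (complex^'n^'n) measure) \<Otimes>\<^sub>M (borel :: real measure)) \<Otimes>\<^sub>M (lborel :: (complex^'n^'n) measure))"
   by simp
  show ?thesis unfolding H_def by measurable
 qed
 have space: "y \<in> psd \<times> UNIV" if "y \<in> space (cone_haar e')" for y :: "(complex^'n^'n) \<times> real" and e'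
  using that by (simp add: cone_haar_def space_restrict_space)
 have pt: "M * emeasure (ball_measure e) {w \<in> matrix_cball. \<psi> y w \<in> A} = H y" if y: "y \<in> psd \<times> UNIV" for y
 proof -
  obtain s b where sb: "y = (s, b)" "s \<in> psd" using y by auto
  have "M * emeasure (ball_measure e) {w \<in> matrix_cball. \<psi> y w \<in> A} = (\<integral>\<^sup>+w. indicator {w \<in> matrix_cball. \<psi> y w \<in> A} w * ennreal (ball_density e w) \<partial>lborel)"
   unfolding M_def sb(1) using \<psi>_sets[OF sb(2)] by (intro emeasure_ball_measure[OF e]) auto
  also have "\<dots> = H y"
   unfolding H_def
  proof (rule nn_integral_cong)
   fix w :: "complex^'n^'n"
   show "indicator {w \<in> matrix_cball. \<psi> y w \<in> A} w * ennreal (ball_density e w)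
    = indicator A (matrix_root (sum_square (fst x) (fst y) w), snd y + c (fst y) w) * ennreal (ball_density e w)"
   proof (cases "w \<in> matrix_cball")
    case False then show ?thesis by (simp add: ball_density_outside_cball)
   next
    case True
    then show ?thesis using sum_square_psd[OF r sb(2) True] by (simp add: sb \<psi>[OF sb(2)] matrix_root_def indicator_def)
   qed
  qed
  finally show ?thesis .
 qed
 have "M * (\<integral>\<^sup>+y. emeasure (ball_measure e) {w \<in> matrix_cball. \<psi> y w \<in> A} \<partial>cone_haar (e + real CARD('n)))
   = M * (\<integral>\<^sup>+y. H y / M \<partial>cone_haar (e + real CARD('n)))"
 proof (intro arg_cong2[where f = times] refl nn_integral_cong)
  fix y assume "y \<in> space (cone_haar (e + real CARD('n)) :: ((complex^'n^'n) \<times> real) measure)"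
  from pt[OF space[OF this]] have "H y = emeasure (ball_measure e) {w \<in> matrix_cball. \<psi> y w \<in> A} * M" by (simp add: mult.commute)
  then show "emeasure (ball_measure e) {w \<in> matrix_cball. \<psi> y w \<in> A} = H y / M"
   using ball_mass_pos[of e, where 'n = 'n] ball_mass_finite[OF e, where 'n = 'n]
   by (simp add: M_def[symmetric] ennreal_mult_divide_eq)
 qed
 also have "\<dots> = (\<integral>\<^sup>+y. H y \<partial>cone_haar (e + real CARD('n)))"
 proof -
  have "H \<in> borel_measurable (restrict_space borel (cone_points TYPE('n::finite)))"
   using H_meas by (intro measurable_restrict_space1) (simp add: borel_prod)
  then have "H \<in> borel_measurable (cone_haar (e + real CARD('n)))" by (simp add: measurable_cong_sets[OF sets_cone_haar refl])
  then have "M * (\<integral>\<^sup>+y. H y / M \<partial>cone_haar (e + real CARD('n))) = M * ((\<integral>\<^sup>+y. H y \<partial>cone_haar (e + real CARD('n))) / M)"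
   by (subst nn_integral_divide) auto
  then show ?thesis
   using ball_mass_pos[of e, where 'n = 'n] ball_mass_finite[OF e, where 'n = 'n]
   by (simp add: M_def[symmetric] ennreal_times_divide mult.commute[of M] ennreal_mult_divide_eq)
 qed
 also have "\<dots> = (\<integral>\<^sup>+s. (\<integral>\<^sup>+b. H (matrix_root s, b) \<partial>lborel) * ?d s \<partial>hermitian_lebesgue)"
  by (rule nn_integral_cone_haar[OF H_meas])
 also have "\<dots> = (\<integral>\<^sup>+s. (\<integral>\<^sup>+w. G (sum_square (fst x) (matrix_root s) w) * ennreal (ball_density e w) \<partial>lborel) * ?d s \<partial>hermitian_lebesgue)"
 proof (intro nn_integral_cong arg_cong2[where f = times] refl)
  fix s :: "complex^'n^'n"
  have cw [measurable]: "(%w. c (matrix_root s) w) \<in> borel_measurable borel"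
   using measurable_compose[OF measurable_Pair[OF measurable_const measurable_ident] c, of "matrix_root s"] by simp
  have "(\<integral>\<^sup>+b. H (matrix_root s, b) \<partial>lborel)
   = (\<integral>\<^sup>+w. (\<integral>\<^sup>+b. indicator A (matrix_root (sum_square (fst x) (matrix_root s) w), b + c (matrix_root s) w) * ennreal (ball_density e w) \<partial>lborel) \<partial>lborel)"
   unfolding H_def fst_conv snd_conv by (rule lborel_pair.Fubini') measurable
  also have "\<dots> = (\<integral>\<^sup>+w. G (sum_square (fst x) (matrix_root s) w) * ennreal (ball_density e w) \<partial>lborel)"
  proof (rule nn_integral_cong)
   fix w :: "complex^'n^'n"
   have "(\<integral>\<^sup>+b. indicator A (matrix_root (sum_square (fst x) (matrix_root s) w), c (matrix_root s) w + b) \<partial>lborel) = G (sum_square (fst x) (matrix_root s) w)"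
    unfolding G_def by (rule nn_integral_lborel_translate[of "%b. indicator A (matrix_root (sum_square (fst x) (matrix_root s) w), b)"]) measurable
   then show "(\<integral>\<^sup>+b. indicator A (matrix_root (sum_square (fst x) (matrix_root s) w), b + c (matrix_root s) w) * ennreal (ball_density e w) \<partial>lborel)
    = G (sum_square (fst x) (matrix_root s) w) * ennreal (ball_density e w)"
    by (subst nn_integral_multc) (measurable, simp add: add.commute)
  qed
  finally show "(\<integral>\<^sup>+b. H (matrix_root s, b) \<partial>lborel) = (\<integral>\<^sup>+w. G (sum_square (fst x) (matrix_root s) w) * ennreal (ball_density e w) \<partial>lborel)" .
 qed
 also have "\<dots> = M * (\<integral>\<^sup>+s. G s * ?d s \<partial>hermitian_lebesgue)" unfolding M_def by (rule nn_integral_cone_invariance[OF r]) measurable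
 also have "(\<integral>\<^sup>+s. G s * ?d s \<partial>hermitian_lebesgue) = emeasure (cone_haar (e + real CARD('n))) A"
  unfolding emeasure_cone_haar[OF A] G_def ..
 finally show ?thesis
  using ball_mass_pos[of e, where 'n = 'n] ball_mass_finite[OF e, where 'n = 'n] by (auto simp: M_def ennreal_mult_cancel_left)
qed

text \<open>A singular semidefinite matrix has determinant \<open>0\<close>, and \<open>0 powr e = 0\<close>; so restricting the density to
 positive definite matrices changes nothing.\<close>
lemma cone_haar_integral:
 fixes f :: "(complex^'n^'n) \<times> real => complex"
 assumes f: "integrable (cone_haar e) f"
 shows "has_bochner_integral (hermitian_lebesgue \<Otimes>\<^sub>M lborel)
  (%(r, a). indicator psd r *\<^sub>R (Re (det r) powr e *\<^sub>R f (psd_sqrt r, a))) (\<integral>x. f x \<partial>cone_haar e)"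
proof -
 let ?P = "(hermitian_lebesgue :: (complex^'n^'n) measure) \<Otimes>\<^sub>M (lborel :: real measure)"
 let ?h = "%z. (matrix_root (fst z), snd z) :: (complex^'n^'n) \<times> real"
 have fm: "f \<in> borel_measurable (restrict_space borel (psd \<times> UNIV))"
  using borel_measurable_integrable[OF f] unfolding measurable_cong_sets[OF sets_cone_haar refl] .
 have h: "?h \<in> measurable (density ?P (%z. ennreal (det_power e (fst z)))) (restrict_space borel (psd \<times> UNIV))"
  using measurable_haar_map by simp
 have fh: "(%z. f (?h z)) \<in> borel_measurable ?P" by (rule measurable_compose[OF measurable_haar_map fm])
 have d: "(%z. det_power e (fst z)) \<in> borel_measurable ?P" "AE z in ?P. 0 <= det_power e (fst z)"
  by (measurable, simp add: det_power_nonneg)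
 have "integrable ?P (%z. det_power e (fst z) *\<^sub>R f (?h z))"
  using f unfolding cone_haar_def integrable_distr_eq[OF h fm] integrable_density[OF fh d] .
 moreover have "(\<integral>x. f x \<partial>cone_haar e) = (\<integral>z. det_power e (fst z) *\<^sub>R f (?h z) \<partial>?P)"
  unfolding cone_haar_def integral_distr[OF h fm] integral_density[OF fh d] ..
 moreover have "det_power e (fst z) *\<^sub>R f (?h z) = (case z of (r, a) => indicator psd r *\<^sub>R (Re (det r) powr e *\<^sub>R f (psd_sqrt r, a)))"
  for z
 proof (cases z)
  case (Pair r a)
  consider "r \<in> pos_def" | "r \<in> psd" "r \<notin> pos_def" | "r \<notin> psd" by blast
  then show ?thesis
  proof cases
   case 2
   then have "det r = 0" using psd_invertible_pos_def invertible_det_nz by blast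
   then show ?thesis using 2 by (simp add: Pair det_power_def)
  next
   case 3
   then have "r \<notin> pos_def" using pos_def_psd by blast
   then show ?thesis using 3 by (simp add: Pair det_power_def)
  qed (use pos_def_psd in \<open>auto simp: Pair det_power_def matrix_root_def\<close>)
 qed
 ultimately show ?thesis by (simp add: has_bochner_integral_iff)
qed

theorem theorem1p1:
  fixes p :: real
  assumes "p > 2 * real CARD('n::finite) - 1"
  defines "X \<equiv> (cone_space :: ((complex ^ 'n ^ 'n) \<times> real) topology)"
  shows "\<exists>cv.
    bilinear_convolution X cv \<and> weakly_continuous X cv \<and> extends_point_convolution p cv \<and>
    (\<forall>cv'. bilinear_convolution X cv' \<and> weakly_continuous X cv' \<and> extends_point_convolution p cv' \<longrightarrow>
       (\<forall>\<mu> \<in> Mb X. \<forall>\<nu> \<in> Mb X. cv' \<mu> \<nu> = cv \<mu> \<nu>)) \<and>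
    hypergroup X cv (0, 0) (\<lambda>(r, a). (r, - a)) \<and>
    (\<exists>\<omega>. (\<forall>f \<in> Cc X.
            integrable \<omega> f \<and>
            has_bochner_integral (hermitian_lebesgue \<Otimes>\<^sub>M lborel)
              (\<lambda>(r, a). indicator psd r *\<^sub>R
                 (Re (det r) powr (p - real CARD('n)) *\<^sub>R f (psd_sqrt r, a)))
              (\<integral>x. f x \<partial>\<omega>)) \<and>
         left_haar_measure X cv \<omega> \<and> right_haar_measure X cv \<omega>)"
proof -
 define e where "e = p - 2 * real CARD('n)"
 have e: "e > -1" using assms(1) by (simp add: e_def)
 have pe: "p - real CARD('n) = e + real CARD('n)" by (simp add: e_def)
 let ?S = "cone_points TYPE('n::finite)"
 interpret K: hypergroup_kernel ?S "ball_measure e" matrix_cball point_arg "(0, 0)" "%(r, a). (r, - a)" ctranspose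
  by (rule hypergroup_kernel_cone[OF e])
 have X: "X = top_of_set ?S" by (simp add: X_def cone_space_def)
 have T: "kappa p TYPE('n) *\<^sub>R (LINT w : matrix_ball | lborel. ball_weight p w *\<^sub>R f (point_arg x y w)) = K.T f x y"
  if "x \<in> ?S" "y \<in> ?S" "f \<in> Cb (top_of_set ?S)" for x y f
 proof -
  have "continuous_on matrix_cball (%w. f (point_arg x y w))"
   by (rule continuous_on_compose2[OF cone.Cb_D[OF that(3)] K.\<phi>_slice[OF that(1,2)]], rule image_subsetI, erule K.\<phi>_S[OF that(1,2)])
  from integral_ball_measure[OF assms(1) borel_measurable_continuous_on_restrict[OF this]]
  show ?thesis unfolding K.T_def by (simp add: e_def)
 qed
 have ext: "extends_point_convolution p K.cv"
  unfolding extends_point_convolution_def cone_space_def using K.integ_cv_dirac T by simp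
 have unique: "cv' \<mu> \<nu> = K.cv \<mu> \<nu>"
  if "bilinear_convolution X cv'" "weakly_continuous X cv'" "extends_point_convolution p cv'" "\<mu> \<in> Mb X" "\<nu> \<in> Mb X" for cv' \<mu> \<nu>
 proof (rule K.cv_unique)
  show "bilinear_convolution (top_of_set ?S) cv'" "weakly_continuous (top_of_set ?S) cv'" "\<mu> \<in> Mb (top_of_set ?S)" "\<nu> \<in> Mb (top_of_set ?S)"
   using that(1,2,4,5) by (simp_all only: X)
  show "integ (top_of_set ?S) (cv' (dirac (top_of_set ?S) x) (dirac (top_of_set ?S) y)) f = K.T f x y"
   if "x \<in> ?S" "y \<in> ?S" "f \<in> Cb (top_of_set ?S)" for x y f
   using \<open>extends_point_convolution p cv'\<close>[unfolded extends_point_convolution_def cone_space_def topspace_euclidean_subtopology, rule_format, OF that]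
    T[OF that] by simp
 qed
 let ?\<omega> = "cone_haar (e + real CARD('n)) :: ((complex^'n^'n) \<times> real) measure"
 have "e + real CARD('n) > -1" using e by simp
 note radon = radon_cone_haar[OF this]
 have sets: "{w \<in> matrix_cball. point_arg x y w \<in> A} \<in> sets borel"
  if "x \<in> ?S" "y \<in> ?S" "A \<in> sets (restrict_space borel ?S)" for x y A
  using measurable_sets[OF K.measurable_\<phi>[OF that(1,2)] that(3)]
  by (simp add: space_ball_measure sets_ball_measure sets_restrict_space_iff vimage_def Int_def conj_commute)
 have left: "left_haar_measure X K.cv ?\<omega>"
  unfolding X
 proof (rule K.left_haar_measureI[OF radon cone_haar_nonzero])
  fix x A assume x: "x \<in> ?S" and A: "A \<in> sets (restrict_space borel ?S)"
  show "(\<integral>\<^sup>+y. emeasure (ball_measure e) {w \<in> matrix_cball. point_arg x y w \<in> A} \<partial>?\<omega>) = emeasure ?\<omega> A"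
  proof (rule cone_haar_invariant[OF e x A, where c = "%s w. snd x - Im (trace (fst x ** w ** s))"])
   show "{w \<in> matrix_cball. point_arg x (s, b) w \<in> A} \<in> sets borel" if "s \<in> psd" for s b
    using that by (intro sets[OF x _ A]) simp
  qed (simp_all add: point_arg_eq)
 qed
 have right: "right_haar_measure X K.cv ?\<omega>"
  unfolding X
 proof (rule K.right_haar_measureI[OF radon cone_haar_nonzero])
  fix x A assume x: "x \<in> ?S" and A: "A \<in> sets (restrict_space borel ?S)"
  define \<psi> where "\<psi> y w = point_arg y x (ctranspose w)" for y w
  have flip: "emeasure (ball_measure e) {w \<in> matrix_cball. point_arg y x w \<in> A} = emeasure (ball_measure e) {w \<in> matrix_cball. \<psi> y w \<in> A}"
   if y: "y \<in> ?S" for y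
  proof -
   have m: "{w \<in> matrix_cball. point_arg y x w \<in> A} \<in> sets (ball_measure e)"
    using sets[OF y x A] by (auto simp: sets_ball_measure sets_restrict_space_iff)
   have "ctranspose -` {w \<in> matrix_cball. point_arg y x w \<in> A} \<inter> matrix_cball = {w \<in> matrix_cball. \<psi> y w \<in> A}"
    by (auto simp: \<psi>_def matrix_cball_ctranspose)
   then show ?thesis using emeasure_distr[OF K.flip_meas m] by (simp add: K.flip_distr space_ball_measure)
  qed
  have "(\<integral>\<^sup>+y. emeasure (ball_measure e) {w \<in> matrix_cball. point_arg y x w \<in> A} \<partial>?\<omega>)
    = (\<integral>\<^sup>+y. emeasure (ball_measure e) {w \<in> matrix_cball. \<psi> y w \<in> A} \<partial>?\<omega>)"
   by (rule nn_integral_cong) (simp add: flip cone_haar_def space_restrict_space)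
  also have "\<dots> = emeasure ?\<omega> A"
  proof (rule cone_haar_invariant[OF e x A, where c = "%s w. snd x - Im (trace (s ** ctranspose w ** fst x))"])
   fix s :: "complex^'n^'n" and b :: real and w :: "complex^'n^'n"
   assume s: "s \<in> psd"
   have "ctranspose (fst x ** w ** s) = s ** ctranspose w ** fst x"
    using x s by (auto simp: ctranspose_mult psd_hermitian matrix_mul_assoc)
   note ct = this
   have "sum_square s (fst x) (ctranspose w) = sum_square (fst x) s w"
    unfolding sum_square_def ct[symmetric] by simp
   then show "\<psi> (s, b) w = (psd_sqrt (sum_square (fst x) s w), b + (snd x - Im (trace (s ** ctranspose w ** fst x))))"
    by (simp add: \<psi>_def point_arg_eq)
  next
   fix s :: "complex^'n^'n" and b :: real assume s: "s \<in> psd"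
   have [measurable]: "{w \<in> matrix_cball. point_arg (s, b) x w \<in> A} \<in> sets borel" using s by (intro sets[OF _ x A]) simp
   have "(ctranspose :: complex^'n^'n => _) -` {w \<in> matrix_cball. point_arg (s, b) x w \<in> A} \<inter> space borel \<in> sets borel"
    by (rule measurable_sets[of ctranspose borel borel]) measurable
   moreover have "ctranspose -` {w \<in> matrix_cball. point_arg (s, b) x w \<in> A} = {w \<in> matrix_cball. \<psi> (s, b) w \<in> A}"
   proof (intro set_eqI)
    fix w :: "complex^'n^'n"
    have "ctranspose w \<in> matrix_cball \<longleftrightarrow> w \<in> matrix_cball"
     using matrix_cball_ctranspose[of w] matrix_cball_ctranspose[of "ctranspose w"] by auto
    then show "w \<in> ctranspose -` {w \<in> matrix_cball. point_arg (s, b) x w \<in> A} \<longleftrightarrow> w \<in> {w \<in> matrix_cball. \<psi> (s, b) w \<in> A}"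
     by (simp add: \<psi>_def)
   qed
   ultimately show "{w \<in> matrix_cball. \<psi> (s, b) w \<in> A} \<in> sets borel" by simp
  qed measurable
  finally show "(\<integral>\<^sup>+y. emeasure (ball_measure e) {w \<in> matrix_cball. point_arg y x w \<in> A} \<partial>?\<omega>) = emeasure ?\<omega> A" .
 qed
 have int: "integrable ?\<omega> f \<and> has_bochner_integral (hermitian_lebesgue \<Otimes>\<^sub>M lborel)
   (%(r, a). indicator psd r *\<^sub>R (Re (det r) powr (p - real CARD('n)) *\<^sub>R f (psd_sqrt r, a))) (\<integral>x. f x \<partial>?\<omega>)" if "f \<in> Cc X" for f
  using cone.Cc_integrable(1)[OF radon that[unfolded X]] cone_haar_integral unfolding pe by blast
 show ?thesis
 proof (intro exI[of _ K.cv] conjI allI impI ballI; (elim conjE)?)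
  show "bilinear_convolution X K.cv" "weakly_continuous X K.cv" "hypergroup X K.cv (0, 0) (%(r, a). (r, - a))"
   unfolding X by (rule K.bilinear_cv K.weakly_continuous_cv K.hypergroup_cv)+
  show "extends_point_convolution p K.cv" by (rule ext)
  show "cv' \<mu> \<nu> = K.cv \<mu> \<nu>"
   if "\<mu> \<in> Mb X" "\<nu> \<in> Mb X" "bilinear_convolution X cv'" "weakly_continuous X cv'" "extends_point_convolution p cv'" for cv' \<mu> \<nu>
   using that(3,4,5,1,2) by (rule unique)
  show "\<exists>\<omega>. (\<forall>f \<in> Cc X. integrable \<omega> f \<and>
      has_bochner_integral (hermitian_lebesgue \<Otimes>\<^sub>M lborel)
       (%(r, a). indicator psd r *\<^sub>R (Re (det r) powr (p - real CARD('n)) *\<^sub>R f (psd_sqrt r, a))) (\<integral>x. f x \<partial>\<omega>)) \<and>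
     left_haar_measure X K.cv \<omega> \<and> right_haar_measure X K.cv \<omega>"
   by (rule exI[of _ ?\<omega>], rule conjI, rule ballI, erule int, rule conjI, rule left, rule right)
 qed
qed

end
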